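(* Let $(X,E,\theta)$ be a holomorphic-Higgs pair with $X$ compact, and let $K$ be a hermitian metric on $E$. Let $L^i:=\bigoplus_{p+q=i}A^{p,q}(\mathrm{End}(E))\oplus A^{0,i}(TX)$ and $L:=\bigoplus_iL^i$. For $(A,\phi)\in L^i$ and $(B,\psi)\in L^j$ set $$[(A,\phi),(B,\psi)]_{T(E)}:=\Big((-1)^i\{\partial_K^{\mathrm{End}(E)},\phi\lrcorner\}B-(-1)^{(i+1)j}\{\partial_K^{\mathrm{End}(E)},\psi\lrcorner\}A-[A,B],\ [\phi,\psi]_{SN}\Big).$$ For $v\in A^{0,p}(TX)$ set $\mathcal B(v):=(-1)^pv\lrcorner F_{d_K}$ and $\mathcal C(v):=\{\partial_K^{\mathrm{End}(E)},v\lrcorner\}\theta$, and define $d_{T(E)}:L\to L$ by $$d_{T(E)}:=\begin{pmatrix}\overline\partial_{\mathrm{End}(E)}&\mathcal B\\0&\overline\partial_{TX}\end{pmatrix}+\begin{pmatrix}\theta&\mathcal C\\0&0\end{pmatrix},$$ that is, $d_{T(E)}(A,\phi)=\big(\overline\partial_{\mathrm{End}(E)}A+\mathcal B(\phi)+[\theta,A]+\mathcal C(\phi),\ \overline\partial_{TX}\phi\big)$. Then $(L,d_{T(E)},[\cdot,\cdot]_{T(E)})$ is a differential graded Lie algebra.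
   Context: A holomorphic-Higgs pair $(X,E,\theta)$ consists of a compact complex manifold $X$, a holomorphic vector bundle $(E,\overline\partial_E)$ on $X$, and a Higgs field $\theta\in A^{1,0}(\mathrm{End}(E))$, i.e. $\overline\partial_{\mathrm{End}(E)}\theta=0$ and $\theta\wedge\theta=0$. Notation: $A^{p,q}(V)$, $A^i(V)$ are the smooth $V$-valued forms of type $(p,q)$, resp. total degree $i$. $TX$ is the holomorphic tangent bundle, $\overline\partial_{TX}$ its Dolbeault operator. $\partial_K$ is the $(1,0)$-part of the Chern connection $d_K$ of $(E,\overline\partial_E,K)$, $F_{d_K}\in A^{1,1}(\mathrm{End}(E))$ its curvature, $\partial_K^{\mathrm{End}(E)}$ the operator induced by $\partial_K$ on $\mathrm{End}(E)$-valued forms. $[\cdot,\cdot]$ on $A^*(\mathrm{End}(E))$ is the graded commutator $[A,B]=A\wedge B-(-1)^{ij}B\wedge A$ for $A,B$ of degrees $i,j$. For $\phi\in A^{0,i}(TX)$, contraction is $(d\overline z_J\otimes v)\lrcorner\omega=d\overline z_J\wedge(\iota_v\omega)$, and $\{\partial_K^{\mathrm{End}(E)},\phi\lrcorner\}:=\partial_K^{\mathrm{End}(E)}(\phi\lrcorner)+(-1)^i\phi\lrcorner\partial_K^{\mathrm{End}(E)}$. $[\cdot,\cdot]_{SN}$ is the standard Schouten–Nijenhuis bracket on $A^{0,*}(TX)$: locally $[d\overline z_I\otimes u,d\overline z_J\otimes v]_{SN}=d\overline z_I\wedge d\overline z_J\otimes[u,v]$, where for $u=\sum_a u_a\partial/\partial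 z_a$, $v=\sum_b v_b\partial/\partial z_b$ with smooth coefficients $[u,v]=\sum_{a,b}(u_a\tfrac{\partial v_b}{\partial z_a}-v_a\tfrac{\partial u_b}{\partial z_a})\tfrac{\partial}{\partial z_b}$. A differential graded Lie algebra is a $\mathbb{Z}$-graded vector space $L=\bigoplus L^i$ with a bilinear bracket $[\cdot,\cdot]$, $[L^i,L^j]\subset L^{i+j}$, and a linear map $d$ such that for $a\in L^i,b\in L^j,c\in L^k$: (1) $[a,b]+(-1)^{ij}[b,a]=0$; (2) $[a,[b,c]]=[[a,b],c]+(-1)^{ij}[b,[a,c]]$; (3) $d(L^i)\subset L^{i+1}$, $d\circ d=0$, $d[a,b]=[da,b]+(-1)^i[a,db]$. *)

theory Defs
  imports "HOL-Analysis.Analysis" "HOL-Library.Function_Algebras"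
begin

text \<open>
  Function_Algebras and Product_Plus make functions and pairs into additive groups
  (functions even into rings) pointwise.  Sums of forms and products such as
  \<open>(- 1) ^ i * A\<close> below are meant in this sense: the left factor is the constant function.
\<close>

section \<open>Differential graded Lie algebras\<close>

text \<open>\<open>L i\<close> is the degree \<open>i\<close> part; the underlying space of the algebra is the internal direct sum
  \<open>span (\<Union>i. L i)\<close> inside an ambient vector space.\<close>

locale dg_lie_algebra = vector_space scale
  for scale :: "'k::field \<Rightarrow> 'v::ab_group_add \<Rightarrow> 'v" +
  fixes L :: "int \<Rightarrow> 'v set"
    and br :: "'v \<Rightarrow> 'v \<Rightarrow> 'v"
    and d :: "'v \<Rightarrow> 'v"
  assumes subspace_L: "subspace (L i)"
    and direct_L: "\<lbrakk>finite I; \<And>i. i \<in> I \<Longrightarrow> x i \<in> L i; (\<Sum>i\<in>I. x i) = 0; i \<in> I\<rbrakk> \<Longrightarrow> x i = 0"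
    and br_add_left: "\<lbrakk>a \<in> span (\<Union>i. L i); b \<in> span (\<Union>i. L i); c \<in> span (\<Union>i. L i)\<rbrakk>
          \<Longrightarrow> br (a + b) c = br a c + br b c"
    and br_add_right: "\<lbrakk>a \<in> span (\<Union>i. L i); b \<in> span (\<Union>i. L i); c \<in> span (\<Union>i. L i)\<rbrakk>
          \<Longrightarrow> br a (b + c) = br a b + br a c"
    and br_scale_left: "\<lbrakk>a \<in> span (\<Union>i. L i); b \<in> span (\<Union>i. L i)\<rbrakk>
          \<Longrightarrow> br (scale r a) b = scale r (br a b)"
    and br_scale_right: "\<lbrakk>a \<in> span (\<Union>i. L i); b \<in> span (\<Union>i. L i)\<rbrakk>
          \<Longrightarrow> br a (scale r b) = scale r (br a b)"
    and br_degree: "\<lbrakk>a \<in> L i; b \<in> L j\<rbrakk> \<Longrightarrow> br a b \<in> L (i + j)"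
    and d_add: "\<lbrakk>a \<in> span (\<Union>i. L i); b \<in> span (\<Union>i. L i)\<rbrakk> \<Longrightarrow> d (a + b) = d a + d b"
    and d_scale: "a \<in> span (\<Union>i. L i) \<Longrightarrow> d (scale r a) = scale r (d a)"
    and br_antisym: "\<lbrakk>a \<in> L i; b \<in> L j\<rbrakk> \<Longrightarrow> br a b + scale ((- 1) powi (i * j)) (br b a) = 0"
    and br_Jacobi: "\<lbrakk>a \<in> L i; b \<in> L j; c \<in> L k\<rbrakk>
          \<Longrightarrow> br a (br b c) = br (br a b) c + scale ((- 1) powi (i * j)) (br b (br a c))"
    and d_degree: "a \<in> L i \<Longrightarrow> d a \<in> L (i + 1)"
    and d_square: "a \<in> L i \<Longrightarrow> d (d a) = 0"
    and d_Leibniz: "\<lbrakk>a \<in> L i; b \<in> L j\<rbrakk>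
          \<Longrightarrow> d (br a b) = br (d a) b + scale ((- 1) powi i) (br a (d b))"

section \<open>Smooth and holomorphic functions on open subsets of complex n-space\<close>

fun Ck_on :: "nat \<Rightarrow> 'a::real_normed_vector set \<Rightarrow> ('a \<Rightarrow> 'b::real_normed_vector) \<Rightarrow> bool" where
  "Ck_on 0 S f \<longleftrightarrow> continuous_on S f"
| "Ck_on (Suc k) S f \<longleftrightarrow> (\<forall>x\<in>S. f differentiable (at x)) \<and>
     (\<forall>v. Ck_on k S (\<lambda>x. frechet_derivative f (at x) v))"

definition smooth_on :: "'a::real_normed_vector set \<Rightarrow> ('a \<Rightarrow> 'b::real_normed_vector) \<Rightarrow> bool" where
  "smooth_on S f \<longleftrightarrow> (\<forall>k. Ck_on k S f)"

text \<open>\<open>\<partial>f/\<partial>z\<^sub>a\<close> and its conjugate.\<close>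

definition pdz :: "'n::finite \<Rightarrow> (complex^'n \<Rightarrow> complex) \<Rightarrow> complex^'n \<Rightarrow> complex" where
  "pdz a f y = (frechet_derivative f (at y) (axis a 1) - \<i> * frechet_derivative f (at y) (axis a \<i>)) / 2"

definition pdzbar :: "'n::finite \<Rightarrow> (complex^'n \<Rightarrow> complex) \<Rightarrow> complex^'n \<Rightarrow> complex" where
  "pdzbar a f y = (frechet_derivative f (at y) (axis a 1) + \<i> * frechet_derivative f (at y) (axis a \<i>)) / 2"

definition holo_on :: "(complex^'n::finite) set \<Rightarrow> (complex^'n \<Rightarrow> complex) \<Rightarrow> bool" where
  "holo_on S f \<longleftrightarrow> smooth_on S f \<and> (\<forall>y\<in>S. \<forall>a. pdzbar a f y = 0)"

section \<open>Complex-valued differential forms in a coordinate domain\<close>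

text \<open>
  A form is given at the point \<open>y\<close> by its values on lists of (real) tangent vectors, the
  real tangent space being identified with complex n-space.  A form of degree \<open>k\<close> vanishes on all
  lists whose length is not \<open>k\<close>.
\<close>

type_synonym 'n form = "complex^'n \<Rightarrow> (complex^'n) list \<Rightarrow> complex"

definition shuffle_sign :: "nat \<Rightarrow> nat set \<Rightarrow> complex" where
  "shuffle_sign m S = (- 1) ^ card {(i, j). i \<in> S \<and> j \<in> {..<m} - S \<and> j < i}"

text \<open>The sum over all shuffles, normalised so that
  \<open>(\<alpha>\<^sub>1 \<and> \<dots> \<and> \<alpha>\<^sub>k)(v\<^sub>1, \<dots>, v\<^sub>k) = det (\<alpha>\<^sub>i(v\<^sub>j))\<close> for 1-forms.\<close>

definition wedge :: "'n::finite form \<Rightarrow> 'n form \<Rightarrow> 'n form" where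
  "wedge \<alpha> \<beta> y vs = (\<Sum>S\<in>Pow {..<length vs}.
     shuffle_sign (length vs) S * \<alpha> y (nths vs S) * \<beta> y (nths vs (- S)))"

definition one_form :: "'n::finite form" where
  "one_form y vs = (if vs = [] then 1 else 0)"

definition dz :: "'n::finite \<Rightarrow> 'n form" where
  "dz a y vs = (case vs of [v] \<Rightarrow> v $ a | _ \<Rightarrow> 0)"

definition dzbar :: "'n::finite \<Rightarrow> 'n form" where
  "dzbar a y vs = (case vs of [v] \<Rightarrow> cnj (v $ a) | _ \<Rightarrow> 0)"

definition dz_dzbar :: "'n::finite list \<Rightarrow> 'n list \<Rightarrow> 'n form" where
  "dz_dzbar I J = foldr wedge (map dz I @ map dzbar J) one_form"

text \<open>Smooth forms of type \<open>(p, q)\<close> on \<open>D\<close>: \<open>\<Sum> f\<^sub>I\<^sub>J dz\<^sub>I \<and> dzbar\<^sub>J\<close> with smooth \<open>f\<^sub>I\<^sub>J\<close>.  The sum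
  is over all multi-indices, which gives the same forms as summing over increasing ones.\<close>

definition pq_form_on :: "(complex^'n::finite) set \<Rightarrow> nat \<Rightarrow> nat \<Rightarrow> 'n form \<Rightarrow> bool" where
  "pq_form_on D p q \<omega> \<longleftrightarrow> (\<exists>f. (\<forall>I J. smooth_on D (f I J)) \<and>
     (\<forall>y\<in>D. \<forall>vs. \<omega> y vs =
        (\<Sum>I | length I = p. \<Sum>J | length J = q. f I J y * dz_dzbar I J y vs)))"

text \<open>Coefficientwise derivatives, constant on all \<open>dz\<^sub>b\<close> and \<open>dzbar\<^sub>b\<close>.\<close>

definition coeff_dz :: "'n::finite \<Rightarrow> 'n form \<Rightarrow> 'n form" where
  "coeff_dz a \<omega> y vs = pdz a (\<lambda>u. \<omega> u vs) y"

definition coeff_dzbar :: "'n::finite \<Rightarrow> 'n form \<Rightarrow> 'n form" where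
  "coeff_dzbar a \<omega> y vs = pdzbar a (\<lambda>u. \<omega> u vs) y"

definition del :: "'n::finite form \<Rightarrow> 'n form" where
  "del \<omega> = (\<Sum>a\<in>UNIV. wedge (dz a) (coeff_dz a \<omega>))"

definition delbar :: "'n::finite form \<Rightarrow> 'n form" where
  "delbar \<omega> = (\<Sum>a\<in>UNIV. wedge (dzbar a) (coeff_dzbar a \<omega>))"

text \<open>Insertion of the complexified tangent vector
  \<open>\<partial>/\<partial>z\<^sub>a = (\<partial>/\<partial>x\<^sub>a - \<i> \<partial>/\<partial>y\<^sub>a) / 2\<close> into the first slot.\<close>

definition iota :: "'n::finite \<Rightarrow> 'n form \<Rightarrow> 'n form" where
  "iota a \<omega> y vs = (\<omega> y (axis a 1 # vs) - \<i> * \<omega> y (axis a \<i> # vs)) / 2"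

section \<open>Bundle-valued forms in a holomorphic frame\<close>

text \<open>\<open>TX\<close>-valued forms \<open>\<Sum>\<^sub>a \<phi> a \<otimes> \<partial>/\<partial>z\<^sub>a\<close> and endomorphism-valued forms \<open>(A i j)\<^sub>i\<^sub>j\<close>,
  acting on column vectors of coefficients with respect to the frame.\<close>

type_synonym 'n vform = "'n \<Rightarrow> 'n form"
type_synonym ('n, 'r) mform = "'r \<Rightarrow> 'r \<Rightarrow> 'n form"

definition mwedge :: "('n::finite, 'r::finite) mform \<Rightarrow> ('n, 'r) mform \<Rightarrow> ('n, 'r) mform" where
  "mwedge A B i j = (\<Sum>k\<in>UNIV. wedge (A i k) (B k j))"

definition gcomm :: "nat \<Rightarrow> nat \<Rightarrow> ('n::finite, 'r::finite) mform \<Rightarrow> ('n, 'r) mform \<Rightarrow> ('n, 'r) mform" where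
  "gcomm p q A B = mwedge A B - (- 1) ^ (p * q) * mwedge B A"

definition mdel :: "('n::finite, 'r::finite) mform \<Rightarrow> ('n, 'r) mform" where
  "mdel A i j = del (A i j)"

definition mdelbar :: "('n::finite, 'r::finite) mform \<Rightarrow> ('n, 'r) mform" where
  "mdelbar A i j = delbar (A i j)"

text \<open>The operator induced by \<open>\<partial> + W\<close> on endomorphism-valued forms of degree \<open>m\<close>.\<close>

definition cov_del :: "('n::finite, 'r::finite) mform \<Rightarrow> nat \<Rightarrow> ('n, 'r) mform \<Rightarrow> ('n, 'r) mform" where
  "cov_del W m A = mdel A + gcomm 1 m W A"

definition curv :: "('n::finite, 'r::finite) mform \<Rightarrow> ('n, 'r) mform" where
  "curv W = (mdel W + mdelbar W) + mwedge W W"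

definition contr :: "'n::finite vform \<Rightarrow> ('n, 'r::finite) mform \<Rightarrow> ('n, 'r) mform" where
  "contr \<phi> A i j = (\<Sum>a\<in>UNIV. wedge (\<phi> a) (iota a (A i j)))"

text \<open>\<open>{\<partial>\<^sub>K, \<phi>\<lrcorner>} A\<close> for \<open>\<phi>\<close> of degree \<open>i\<close> and \<open>A\<close> of degree \<open>j\<close>.  The truncated subtraction is
  harmless: \<open>contr \<phi> A\<close> vanishes if \<open>j = 0\<close>.\<close>

definition brace :: "('n::finite, 'r::finite) mform \<Rightarrow> nat \<Rightarrow> nat \<Rightarrow> 'n vform \<Rightarrow> ('n, 'r) mform \<Rightarrow> ('n, 'r) mform" where
  "brace W i j \<phi> A = cov_del W (i + j - 1) (contr \<phi> A) + (- 1) ^ i * contr \<phi> (cov_del W j A)"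

definition vdelbar :: "'n::finite vform \<Rightarrow> 'n vform" where
  "vdelbar \<phi> b = delbar (\<phi> b)"

text \<open>Bilinear extension of \<open>[dzbar\<^sub>I \<otimes> u, dzbar\<^sub>J \<otimes> v] = dzbar\<^sub>I \<and> dzbar\<^sub>J \<otimes> [u, v]\<close>; keeping the
  factor from \<open>\<phi>\<close> on the left in both terms makes further signs unnecessary.\<close>

definition SN_bracket :: "'n::finite vform \<Rightarrow> 'n vform \<Rightarrow> 'n vform" where
  "SN_bracket \<phi> \<psi> b = (\<Sum>a\<in>UNIV. wedge (\<phi> a) (coeff_dz a (\<psi> b)) - wedge (coeff_dz a (\<phi> b)) (\<psi> a))"

section \<open>Complex manifolds and holomorphic vector bundles\<close>

type_synonym ('x, 'n) chart = "'x set \<times> ('x \<Rightarrow> complex^'n)"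

record ('x, 'n) cmanifold =
  space_of :: "'x topology"
  charts :: "('x, 'n) chart set"

definition inv_chart :: "('x, 'n::finite) chart \<Rightarrow> complex^'n \<Rightarrow> 'x" where
  "inv_chart c = inv_into (fst c) (snd c)"

definition coord_change :: "('x, 'n::finite) chart \<Rightarrow> ('x, 'n) chart \<Rightarrow> complex^'n \<Rightarrow> complex^'n" where
  "coord_change c c' y = snd c' (inv_chart c y)"

definition complex_manifold :: "('x, 'n::finite) cmanifold \<Rightarrow> bool" where
  "complex_manifold M \<longleftrightarrow>
     Hausdorff_space (space_of M) \<and> second_countable (space_of M) \<and>
     (\<Union>c\<in>charts M. fst c) = topspace (space_of M) \<and>
     (\<forall>c\<in>charts M. openin (space_of M) (fst c) \<and> open (snd c ` fst c) \<and>
        homeomorphic_map (subtopology (space_of M) (fst c)) (top_of_set (snd c ` fst c)) (snd c)) \<and>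
     (\<forall>c\<in>charts M. \<forall>c'\<in>charts M. \<forall>a.
        holo_on (snd c ` (fst c \<inter> fst c')) (\<lambda>y. coord_change c c' y $ a))"

text \<open>A holomorphic vector bundle of rank \<open>CARD('r)\<close> is given by an open cover with holomorphic
  frames: \<open>tmap E t s\<close> turns the coefficients of a section in the frame \<open>s\<close> into those in the
  frame \<open>t\<close>.  The cover need not be related to the atlas.\<close>

record ('x, 't, 'r) vbundle =
  frames :: "'t set"
  fdom :: "'t \<Rightarrow> 'x set"
  tmap :: "'t \<Rightarrow> 't \<Rightarrow> 'x \<Rightarrow> complex^'r^'r"

definition holomorphic_vector_bundle :: "('x, 'n::finite) cmanifold \<Rightarrow> ('x, 't, 'r::finite) vbundle \<Rightarrow> bool" where
  "holomorphic_vector_bundle M E \<longleftrightarrow>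
     (\<forall>t\<in>frames E. openin (space_of M) (fdom E t)) \<and>
     (\<Union>t\<in>frames E. fdom E t) = topspace (space_of M) \<and>
     (\<forall>t\<in>frames E. \<forall>x\<in>fdom E t. tmap E t t x = mat 1) \<and>
     (\<forall>t\<in>frames E. \<forall>s\<in>frames E. \<forall>u\<in>frames E. \<forall>x\<in>fdom E t \<inter> fdom E s \<inter> fdom E u.
        tmap E t s x ** tmap E s u x = tmap E t u x) \<and>
     (\<forall>c\<in>charts M. \<forall>t\<in>frames E. \<forall>s\<in>frames E. \<forall>i j.
        holo_on (snd c ` (fst c \<inter> fdom E t \<inter> fdom E s)) (\<lambda>y. tmap E t s (inv_chart c y) $ i $ j))"

text \<open>The coordinate domains on which the local representatives of global forms live; they are
  empty for indices that do not belong to the manifold or the bundle.\<close>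

definition vdom :: "('x, 'n::finite) cmanifold \<Rightarrow> ('x, 'n) chart \<Rightarrow> (complex^'n) set" where
  "vdom M c = (if c \<in> charts M then snd c ` fst c else {})"

definition edom :: "('x, 'n::finite) cmanifold \<Rightarrow> ('x, 't, 'r::finite) vbundle \<Rightarrow> ('x, 'n) chart \<Rightarrow> 't \<Rightarrow> (complex^'n) set" where
  "edom M E c t = (if c \<in> charts M \<and> t \<in> frames E then snd c ` (fst c \<inter> fdom E t) else {})"

section \<open>Global forms\<close>

text \<open>A global form is the family of its local representatives, one for each chart (and frame),
  extended by 0 outside the coordinate domain so that equality of forms is equality of families.\<close>

type_synonym ('x, 'n) tan_form = "('x, 'n) chart \<Rightarrow> 'n vform"
type_synonym ('x, 't, 'n, 'r) end_form = "('x, 'n) chart \<Rightarrow> 't \<Rightarrow> ('n, 'r) mform"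

definition tan_forms :: "('x, 'n::finite) cmanifold \<Rightarrow> nat \<Rightarrow> ('x, 'n) tan_form set" where
  "tan_forms M q = {\<phi>.
     (\<forall>c a. pq_form_on (vdom M c) 0 q (\<phi> c a)) \<and>
     (\<forall>c a y vs. y \<notin> vdom M c \<longrightarrow> \<phi> c a y vs = 0) \<and>
     (\<forall>c\<in>charts M. \<forall>c'\<in>charts M. \<forall>y\<in>snd c ` (fst c \<inter> fst c'). \<forall>b vs.
        \<phi> c' b (coord_change c c' y) (map (frechet_derivative (coord_change c c') (at y)) vs) =
        (\<Sum>a\<in>UNIV. pdz a (\<lambda>u. coord_change c c' u $ b) y * \<phi> c a y vs))}"

definition end_forms :: "('x, 'n::finite) cmanifold \<Rightarrow> ('x, 't, 'r::finite) vbundle \<Rightarrow> nat \<Rightarrow> nat \<Rightarrow>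
    ('x, 't, 'n, 'r) end_form set" where
  "end_forms M E p q = {A.
     (\<forall>c t i j. pq_form_on (edom M E c t) p q (A c t i j)) \<and>
     (\<forall>c t i j y vs. y \<notin> edom M E c t \<longrightarrow> A c t i j y vs = 0) \<and>
     (\<forall>c\<in>charts M. \<forall>c'\<in>charts M. \<forall>t\<in>frames E. \<forall>s\<in>frames E.
        \<forall>y\<in>snd c ` (fst c \<inter> fst c' \<inter> fdom E t \<inter> fdom E s). \<forall>i j vs.
        A c t i j y vs =
        (\<Sum>k\<in>UNIV. \<Sum>l\<in>UNIV. tmap E t s (inv_chart c y) $ i $ k *
           A c' s k l (coord_change c c' y) (map (frechet_derivative (coord_change c c') (at y)) vs) *
           tmap E s t (inv_chart c y) $ l $ j))}"

definition restrict_end :: "('x, 'n::finite) cmanifold \<Rightarrow> ('x, 't, 'r::finite) vbundle \<Rightarrow>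
    ('x, 't, 'n, 'r) end_form \<Rightarrow> ('x, 't, 'n, 'r) end_form" where
  "restrict_end M E A c t i j y vs = (if y \<in> edom M E c t then A c t i j y vs else 0)"

definition restrict_tan :: "('x, 'n::finite) cmanifold \<Rightarrow> ('x, 'n) tan_form \<Rightarrow> ('x, 'n) tan_form" where
  "restrict_tan M \<phi> c a y vs = (if y \<in> vdom M c then \<phi> c a y vs else 0)"

section \<open>Hermitian metrics and the Chern connection\<close>

definition herm :: "complex^'r^'r::finite \<Rightarrow> complex^'r \<Rightarrow> complex^'r \<Rightarrow> complex" where
  "herm h v w = (\<Sum>i\<in>UNIV. \<Sum>j\<in>UNIV. cnj (w $ i) * h $ i $ j * v $ j)"

text \<open>In the frame \<open>t\<close> the metric at \<open>x\<close> is \<open>K(v, w) = herm (K t x) v w\<close>, linear in \<open>v\<close>.\<close>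

definition hermitian_metric :: "('x, 'n::finite) cmanifold \<Rightarrow> ('x, 't, 'r::finite) vbundle \<Rightarrow>
    ('t \<Rightarrow> 'x \<Rightarrow> complex^'r^'r) \<Rightarrow> bool" where
  "hermitian_metric M E K \<longleftrightarrow>
     (\<forall>c\<in>charts M. \<forall>t\<in>frames E. \<forall>i j. smooth_on (edom M E c t) (\<lambda>y. K t (inv_chart c y) $ i $ j)) \<and>
     (\<forall>t\<in>frames E. \<forall>x\<in>fdom E t.
        (\<forall>v w. herm (K t x) w v = cnj (herm (K t x) v w)) \<and>
        (\<forall>v. v \<noteq> 0 \<longrightarrow> Re (herm (K t x) v v) > 0)) \<and>
     (\<forall>t\<in>frames E. \<forall>s\<in>frames E. \<forall>x\<in>fdom E t \<inter> fdom E s. \<forall>v w.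
        herm (K t x) (tmap E t s x *v v) (tmap E t s x *v w) = herm (K s x) v w)"

text \<open>A connection on \<open>E\<close> is given by its connection matrices \<open>W\<close>: in a frame, it is
  \<open>s \<mapsto> ds + W s\<close>.\<close>

definition connection :: "('x, 'n::finite) cmanifold \<Rightarrow> ('x, 't, 'r::finite) vbundle \<Rightarrow>
    ('x, 't, 'n, 'r) end_form \<Rightarrow> bool" where
  "connection M E W \<longleftrightarrow>
     (\<forall>c t i j. \<exists>\<alpha> \<beta>. pq_form_on (edom M E c t) 1 0 \<alpha> \<and> pq_form_on (edom M E c t) 0 1 \<beta> \<and>
        W c t i j = \<alpha> + \<beta>) \<and>
     (\<forall>c t i j y vs. y \<notin> edom M E c t \<longrightarrow> W c t i j y vs = 0) \<and>
     (\<forall>c\<in>charts M. \<forall>c'\<in>charts M. \<forall>t\<in>frames E. \<forall>s\<in>frames E.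
        \<forall>y\<in>snd c ` (fst c \<inter> fst c' \<inter> fdom E t \<inter> fdom E s). \<forall>i j v.
        (\<Sum>k\<in>UNIV. W c t i k y [v] * tmap E t s (inv_chart c y) $ k $ j) =
        (\<Sum>k\<in>UNIV. tmap E t s (inv_chart c y) $ i $ k *
           W c' s k j (coord_change c c' y) [frechet_derivative (coord_change c c') (at y) v]) -
        frechet_derivative (\<lambda>u. tmap E t s (inv_chart c u) $ i $ j) (at y) v)"

definition nabla :: "('n::finite, 'r::finite) mform \<Rightarrow> (complex^'n \<Rightarrow> complex^'r) \<Rightarrow> complex^'n \<Rightarrow>
    complex^'n \<Rightarrow> complex^'r" where
  "nabla W s y v = frechet_derivative s (at y) v + (\<chi> i. \<Sum>j\<in>UNIV. W i j y [v] * s y $ j)"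

text \<open>The Chern connection of \<open>(E, K)\<close>: its \<open>(0,1)\<close>-part is the Dolbeault operator of \<open>E\<close>, which in
  holomorphic frames means that the connection matrices are of type \<open>(1,0)\<close>, and it is metric.\<close>

definition chern_connection :: "('x, 'n::finite) cmanifold \<Rightarrow> ('x, 't, 'r::finite) vbundle \<Rightarrow>
    ('t \<Rightarrow> 'x \<Rightarrow> complex^'r^'r) \<Rightarrow> ('x, 't, 'n, 'r) end_form \<Rightarrow> bool" where
  "chern_connection M E K W \<longleftrightarrow> connection M E W \<and>
     (\<forall>c t i j. pq_form_on (edom M E c t) 1 0 (W c t i j)) \<and>
     (\<forall>c t s1 s2. smooth_on (edom M E c t) s1 \<longrightarrow> smooth_on (edom M E c t) s2 \<longrightarrow>
        (\<forall>y\<in>edom M E c t. \<forall>v.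
           frechet_derivative (\<lambda>u. herm (K t (inv_chart c u)) (s1 u) (s2 u)) (at y) v =
           herm (K t (inv_chart c y)) (nabla (W c t) s1 y v) (s2 y) +
           herm (K t (inv_chart c y)) (s1 y) (nabla (W c t) s2 y v)))"

section \<open>Holomorphic-Higgs pairs and the algebra L\<close>

definition higgs_field :: "('x, 'n::finite) cmanifold \<Rightarrow> ('x, 't, 'r::finite) vbundle \<Rightarrow>
    ('x, 't, 'n, 'r) end_form \<Rightarrow> bool" where
  "higgs_field M E \<theta> \<longleftrightarrow> \<theta> \<in> end_forms M E 1 0 \<and>
     restrict_end M E (\<lambda>c t. mdelbar (\<theta> c t)) = 0 \<and>
     restrict_end M E (\<lambda>c t. mwedge (\<theta> c t) (\<theta> c t)) = 0"

definition holomorphic_higgs_pair :: "('x, 'n::finite) cmanifold \<Rightarrow> ('x, 't, 'r::finite) vbundle \<Rightarrow>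
    ('x, 't, 'n, 'r) end_form \<Rightarrow> bool" where
  "holomorphic_higgs_pair M E \<theta> \<longleftrightarrow>
     complex_manifold M \<and> compact_space (space_of M) \<and> holomorphic_vector_bundle M E \<and> higgs_field M E \<theta>"

type_synonym ('x, 't, 'n, 'r) pair_form = "('x, 't, 'n, 'r) end_form \<times> ('x, 'n) tan_form"

definition TE_scale :: "complex \<Rightarrow> ('x, 't, 'n, 'r) pair_form \<Rightarrow> ('x, 't, 'n, 'r) pair_form" where
  "TE_scale r = (\<lambda>(A, \<phi>). (\<lambda>c t i j y vs. r * A c t i j y vs, \<lambda>c a y vs. r * \<phi> c a y vs))"

definition TE_space :: "('x, 'n::finite) cmanifold \<Rightarrow> ('x, 't, 'r::finite) vbundle \<Rightarrow> int \<Rightarrow>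
    ('x, 't, 'n, 'r) pair_form set" where
  "TE_space M E k = (if k < 0 then {0} else
     {(\<Sum>p\<le>nat k. \<alpha> p, \<phi>) |\<alpha> \<phi>. (\<forall>p\<le>nat k. \<alpha> p \<in> end_forms M E p (nat k - p)) \<and> \<phi> \<in> tan_forms M (nat k)})"

definition degree_part :: "nat \<Rightarrow> ('x, 't, 'n, 'r) pair_form \<Rightarrow> ('x, 't, 'n, 'r) pair_form" where
  "degree_part k = (\<lambda>(A, \<phi>). (\<lambda>c t i j y vs. if length vs = k then A c t i j y vs else 0,
     \<lambda>c a y vs. if length vs = k then \<phi> c a y vs else 0))"

text \<open>The bracket of homogeneous elements of degrees \<open>i\<close> and \<open>j\<close>, where \<open>W\<close> is the Chern connection,
  and its biadditive extension.  Forms of degree greater than the real dimension \<open>2 * CARD('n)\<close>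
  vanish.\<close>

definition TE_bracket_hom :: "('x, 'n::finite) cmanifold \<Rightarrow> ('x, 't, 'r::finite) vbundle \<Rightarrow>
    ('x, 't, 'n, 'r) end_form \<Rightarrow> nat \<Rightarrow> nat \<Rightarrow>
    ('x, 't, 'n, 'r) pair_form \<Rightarrow> ('x, 't, 'n, 'r) pair_form \<Rightarrow> ('x, 't, 'n, 'r) pair_form" where
  "TE_bracket_hom M E W i j = (\<lambda>(A, \<phi>) (B, \<psi>).
     (restrict_end M E (\<lambda>c t.
        (- 1) ^ i * brace (W c t) i j (\<phi> c) (B c t)
        - (- 1) ^ ((i + 1) * j) * brace (W c t) j i (\<psi> c) (A c t)
        - gcomm i j (A c t) (B c t)),
      restrict_tan M (\<lambda>c. SN_bracket (\<phi> c) (\<psi> c))))"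

definition TE_bracket :: "('x, 'n::finite) cmanifold \<Rightarrow> ('x, 't, 'r::finite) vbundle \<Rightarrow>
    ('x, 't, 'n, 'r) end_form \<Rightarrow>
    ('x, 't, 'n, 'r) pair_form \<Rightarrow> ('x, 't, 'n, 'r) pair_form \<Rightarrow> ('x, 't, 'n, 'r) pair_form" where
  "TE_bracket M E W a b = (\<Sum>i\<le>2 * CARD('n). \<Sum>j\<le>2 * CARD('n).
     TE_bracket_hom M E W i j (degree_part i a) (degree_part j b))"

definition B_op :: "('n::finite, 'r::finite) mform \<Rightarrow> nat \<Rightarrow> 'n vform \<Rightarrow> ('n, 'r) mform" where
  "B_op W p v = (- 1) ^ p * contr v (curv W)"

definition C_op :: "('n::finite, 'r::finite) mform \<Rightarrow> ('n, 'r) mform \<Rightarrow> nat \<Rightarrow> 'n vform \<Rightarrow> ('n, 'r) mform" where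
  "C_op W \<theta> p v = brace W p 1 v \<theta>"

definition TE_diff_hom :: "('x, 'n::finite) cmanifold \<Rightarrow> ('x, 't, 'r::finite) vbundle \<Rightarrow>
    ('x, 't, 'n, 'r) end_form \<Rightarrow> ('x, 't, 'n, 'r) end_form \<Rightarrow> nat \<Rightarrow>
    ('x, 't, 'n, 'r) pair_form \<Rightarrow> ('x, 't, 'n, 'r) pair_form" where
  "TE_diff_hom M E W \<theta> i = (\<lambda>(A, \<phi>).
     (restrict_end M E (\<lambda>c t.
        mdelbar (A c t) + B_op (W c t) i (\<phi> c) + gcomm 1 i (\<theta> c t) (A c t) + C_op (W c t) (\<theta> c t) i (\<phi> c)),
      restrict_tan M (\<lambda>c. vdelbar (\<phi> c))))"

definition TE_diff :: "('x, 'n::finite) cmanifold \<Rightarrow> ('x, 't, 'r::finite) vbundle \<Rightarrow>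
    ('x, 't, 'n, 'r) end_form \<Rightarrow> ('x, 't, 'n, 'r) end_form \<Rightarrow>
    ('x, 't, 'n, 'r) pair_form \<Rightarrow> ('x, 't, 'n, 'r) pair_form" where
  "TE_diff M E W \<theta> a = (\<Sum>i\<le>2 * CARD('n). TE_diff_hom M E W \<theta> i (degree_part i a))"

end

theory Submission
  imports Defs
begin

text \<open>
  All axioms are identities between forms, so they can be checked in a coordinate domain with a
  holomorphic frame.  There, with \<open>W\<close> the matrix of the Chern connection and
  \<open>D = \<partial> + [W, _]\<close>, put \<open>lie v = D \<circ> (v \<lrcorner>) \<plusminus> (v \<lrcorner>) \<circ> D\<close>.
  Since the metric forces the curvature to be of type \<open>(1, 1)\<close>, that is \<open>\<partial>W + W \<and> W = 0\<close>, we have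
  \<open>D\<^sup>2 = 0\<close> and hence \<open>[lie v, lie w] = lie [v, w]\<close>: the bracket is that of a semidirect product,
  in which \<open>TX\<close>-valued forms act on \<open>End(E)\<close>-valued forms by the derivations \<open>lie v\<close>.  The operator
  \<open>\<partial>bar\<close> does not commute with this action, and the defect is the bracket with \<open>v \<lrcorner> F\<close>; the
  term \<open>\<B>\<close> corrects it.  Finally the Higgs part of the differential is the bracket with
  \<open>(- \<theta>, 0)\<close>, which satisfies the Maurer--Cartan equation because \<open>\<partial>bar \<theta> = 0\<close> and
  \<open>\<theta> \<and> \<theta> = 0\<close>.

  What remains is to see that the local expressions for the operations are compatible with changes
  of coordinates and of frames.
\<close>

section \<open>Smooth functions\<close>

text \<open>One normalisation makes the signs transparent. If \<open>lie v\<close> is (-1)^i times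
  the brace of the connection with the contraction by v, the first component of the bracket reads
  lie v B - (-1)^(ij) lie w A - [A, B]. The minus sign before [A, B] is the reason why - \<theta>,
  and not \<theta>, is the Maurer--Cartan element. The curvature has no (2,0)-part because the
  metric condition says \<partial>h = h W: differentiating again, second derivatives are symmetric
  and h is injective. Matrices of forms do not commute even up to sign, so all sign computations are
  made in an abstract calculus with an associative product; it is instantiated on every coordinate
  domain and used again for changes of frame. Coefficientwise derivatives, which enter the
  Schouten--Nijenhuis bracket, are not invariant under coordinate changes. On (0,q)-forms, however,
  \<partial>/\<partial>z_a equals insertion after \<partial>, and both of these transform well; the
  second derivatives of the coordinate change that remain cancel by symmetry.\<close>

lemma Ck_on_SucD: "Ck_on (Suc k) S f \<Longrightarrow> Ck_on k S f"
proof (induction k arbitrary: f)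
  case 0
  then show ?case
    using differentiable_imp_continuous_on[of f S]
    by (simp add: differentiable_on_def differentiable_at_withinI)
next
  case (Suc k)
  then show ?case by (metis Ck_on.simps(2))
qed

lemma smooth_on_differentiable: "smooth_on S f \<Longrightarrow> x \<in> S \<Longrightarrow> f differentiable (at x)"
  unfolding smooth_on_def by (metis Ck_on.simps(2))

lemma smooth_on_frechet: "smooth_on S f \<Longrightarrow> smooth_on S (\<lambda>x. frechet_derivative f (at x) v)"
  unfolding smooth_on_def by (metis Ck_on.simps(2))

lemma smooth_on_continuous: "smooth_on S f \<Longrightarrow> continuous_on S f"
  unfolding smooth_on_def by (metis Ck_on.simps(1))

text \<open>Both functions have the same candidates for a derivative at \<open>x\<close>, so the
  choice operator in \<open>frechet_derivative\<close> picks the same one; this covers points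
  without a derivative as well.\<close>

lemma frechet_derivative_cong_open:
  assumes "open S" "x \<in> S" "\<And>y. y \<in> S \<Longrightarrow> f y = g y"
  shows "frechet_derivative f (at x) = frechet_derivative g (at x)"
proof -
  have ev: "\<forall>\<^sub>F y in nhds x. f y = g y"
    using assms eventually_nhds by blast
  have "(f has_derivative D) (at x) \<longleftrightarrow> (g has_derivative D) (at x)" for D
    using has_derivative_transform_within_open[OF _ assms(1,2)] assms(3) by metis
  then show ?thesis unfolding frechet_derivative_def by simp
qed

lemma differentiable_cong_open:
  assumes "open S" "x \<in> S" "\<And>y. y \<in> S \<Longrightarrow> f y = g y"
  shows "f differentiable (at x) \<longleftrightarrow> g differentiable (at x)"
  using has_derivative_transform_within_open[OF _ assms(1,2)] assms(3)
  unfolding differentiable_def by metis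

lemma Ck_on_cong:
  assumes "open S" "\<And>y. y \<in> S \<Longrightarrow> f y = g y"
  shows "Ck_on k S f \<longleftrightarrow> Ck_on k S g"
  using assms(2)
proof (induction k arbitrary: f g)
  case 0
  then show ?case by (simp cong: continuous_on_cong)
next
  case (Suc k)
  have "\<And>v. Ck_on k S (\<lambda>x. frechet_derivative f (at x) v) \<longleftrightarrow>
            Ck_on k S (\<lambda>x. frechet_derivative g (at x) v)"
    by (rule Suc.IH) (simp add: frechet_derivative_cong_open[OF assms(1) _ Suc.prems])
  then show ?case
    using differentiable_cong_open[OF assms(1) _ Suc.prems] by auto
qed

lemma smooth_on_cong:
  "open S \<Longrightarrow> (\<And>y. y \<in> S \<Longrightarrow> f y = g y) \<Longrightarrow> smooth_on S f \<longleftrightarrow> smooth_on S g"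
  unfolding smooth_on_def using Ck_on_cong by metis

lemma smooth_on_subset: "smooth_on S f \<Longrightarrow> T \<subseteq> S \<Longrightarrow> smooth_on T f"
proof -
  have "Ck_on k S f \<Longrightarrow> T \<subseteq> S \<Longrightarrow> Ck_on k T f" for k
    by (induction k arbitrary: f) (auto intro: continuous_on_subset)
  then show "smooth_on S f \<Longrightarrow> T \<subseteq> S \<Longrightarrow> smooth_on T f" unfolding smooth_on_def by blast
qed

lemma smooth_on_const [simp]: "smooth_on S (\<lambda>_. c)"
proof -
  have "Ck_on k S (\<lambda>_. c)" for k
    by (induction k arbitrary: c) auto
  then show ?thesis unfolding smooth_on_def by blast
qed

lemma smooth_on_empty [simp]: "smooth_on {} f"
proof -
  have "Ck_on k {} f" for k
    by (induction k arbitrary: f) auto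
  then show ?thesis unfolding smooth_on_def by blast
qed

lemma has_frechet_derivative:
  "f differentiable (at x) \<Longrightarrow> (f has_derivative frechet_derivative f (at x)) (at x)"
  by (simp add: frechet_derivative_works)

lemma frechet_derivative_eqI:
  "(f has_derivative D) (at x) \<Longrightarrow> frechet_derivative f (at x) = D"
  by (metis frechet_derivative_at)

lemma frechet_derivative_add:
  "f differentiable (at x) \<Longrightarrow> g differentiable (at x) \<Longrightarrow>
   frechet_derivative (\<lambda>x. f x + g x) (at x) =
     (\<lambda>v. frechet_derivative f (at x) v + frechet_derivative g (at x) v)"
  by (intro frechet_derivative_eqI has_derivative_add has_frechet_derivative)

lemma frechet_derivative_mult:
  fixes f g :: "'a::real_normed_vector \<Rightarrow> 'b::real_normed_algebra"
  shows "f differentiable (at x) \<Longrightarrow> g differentiable (at x) \<Longrightarrow>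
   frechet_derivative (\<lambda>x. f x * g x) (at x) =
     (\<lambda>v. f x * frechet_derivative g (at x) v + frechet_derivative f (at x) v * g x)"
  by (intro frechet_derivative_eqI has_derivative_mult has_frechet_derivative)

lemma frechet_derivative_bounded_linear:
  "bounded_linear h \<Longrightarrow> f differentiable (at x) \<Longrightarrow>
   frechet_derivative (\<lambda>x. h (f x)) (at x) = (\<lambda>v. h (frechet_derivative f (at x) v))"
  using frechet_derivative_eqI[OF bounded_linear.has_derivative[OF _ has_frechet_derivative]] .

text \<open>Allows an explicit derivative \<open>D\<close> in place of
  \<open>frechet_derivative\<close>. The two agree on \<open>S\<close>, and for open
  \<open>S\<close> the predicate \<open>Ck_on\<close> depends only on the values there.\<close>

lemma Ck_on_SucI:
  assumes "open S" "\<And>x. x \<in> S \<Longrightarrow> (f has_derivative D x) (at x)"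
    and "\<And>v. Ck_on k S (\<lambda>x. D x v)"
  shows "Ck_on (Suc k) S f"
proof -
  have "Ck_on k S (\<lambda>x. frechet_derivative f (at x) v)" for v
  proof -
    have "frechet_derivative f (at x) v = D x v" if "x \<in> S" for x
      using frechet_derivative_eqI[OF assms(2)[OF that]] by simp
    from Ck_on_cong[OF assms(1) this] assms(3)[of v] show ?thesis by (rule iffD2)
  qed
  then show ?thesis using assms(2) by (auto simp: differentiable_def)
qed

lemma Ck_on_SucE:
  assumes "Ck_on (Suc k) S f"
  shows "\<And>x. x \<in> S \<Longrightarrow> (f has_derivative frechet_derivative f (at x)) (at x)"
    and "\<And>v. Ck_on k S (\<lambda>x. frechet_derivative f (at x) v)"
  using assms by (auto simp: has_frechet_derivative)

lemma Ck_on_add: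
  assumes "open S"
  shows "Ck_on k S f \<Longrightarrow> Ck_on k S g \<Longrightarrow> Ck_on k S (\<lambda>x. f x + g x)"
proof (induction k arbitrary: f g)
  case 0
  then show ?case by (simp add: continuous_on_add)
next
  case (Suc k)
  show ?case
    by (rule Ck_on_SucI[OF assms has_derivative_add[OF Ck_on_SucE(1)[OF Suc.prems(1)] Ck_on_SucE(1)[OF Suc.prems(2)]]
          Suc.IH[OF Ck_on_SucE(2)[OF Suc.prems(1)] Ck_on_SucE(2)[OF Suc.prems(2)]]])
qed

lemma Ck_on_mult:
  fixes f g :: "'a::real_normed_vector \<Rightarrow> 'b::real_normed_algebra"
  assumes "open S"
  shows "Ck_on k S f \<Longrightarrow> Ck_on k S g \<Longrightarrow> Ck_on k S (\<lambda>x. f x * g x)"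
proof (induction k arbitrary: f g)
  case 0
  then show ?case by (simp add: continuous_on_mult)
next
  case (Suc k)
  have k: "Ck_on k S f" "Ck_on k S g" using Suc.prems Ck_on_SucD by blast+
  show ?case
    by (rule Ck_on_SucI[OF assms has_derivative_mult[OF Ck_on_SucE(1)[OF Suc.prems(1)] Ck_on_SucE(1)[OF Suc.prems(2)]]
          Ck_on_add[OF assms Suc.IH[OF k(1) Ck_on_SucE(2)[OF Suc.prems(2)]]
            Suc.IH[OF Ck_on_SucE(2)[OF Suc.prems(1)] k(2)]]])
qed

lemma smooth_on_add:
  "open S \<Longrightarrow> smooth_on S f \<Longrightarrow> smooth_on S g \<Longrightarrow> smooth_on S (\<lambda>x. f x + g x)"
  unfolding smooth_on_def using Ck_on_add by blast

lemma smooth_on_mult: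
  fixes f g :: "'a::real_normed_vector \<Rightarrow> 'b::real_normed_algebra"
  shows "open S \<Longrightarrow> smooth_on S f \<Longrightarrow> smooth_on S g \<Longrightarrow> smooth_on S (\<lambda>x. f x * g x)"
  unfolding smooth_on_def using Ck_on_mult by blast

lemma smooth_on_bounded_linear:
  assumes "bounded_linear h" "open S" "smooth_on S f"
  shows "smooth_on S (\<lambda>x. h (f x))"
proof -
  have "Ck_on k S f \<Longrightarrow> Ck_on k S (\<lambda>x. h (f x))" for k
  proof (induction k arbitrary: f)
    case 0
    then show ?case using assms(1) bounded_linear.continuous_on by auto
  next
    case (Suc k)
    show ?case
      by (rule Ck_on_SucI[OF assms(2) bounded_linear.has_derivative[OF assms(1) Ck_on_SucE(1)[OF Suc.prems]]
            Suc.IH[OF Ck_on_SucE(2)[OF Suc.prems]]])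
  qed
  then show ?thesis using assms(3) unfolding smooth_on_def by blast
qed

lemma smooth_on_sum:
  "open S \<Longrightarrow> (\<And>i. i \<in> I \<Longrightarrow> smooth_on S (f i)) \<Longrightarrow> smooth_on S (\<lambda>x. \<Sum>i\<in>I. f i x)"
  by (induction I rule: infinite_finite_induct) (auto intro: smooth_on_add)

lemma smooth_on_uminus: "open S \<Longrightarrow> smooth_on S f \<Longrightarrow> smooth_on S (\<lambda>x. - f x)"
  by (rule smooth_on_bounded_linear[OF bounded_linear_minus[OF bounded_linear_ident]])

lemma has_real_derivative_along_line:
  fixes f :: "'a::real_normed_vector \<Rightarrow> real"
  assumes "(c has_derivative (\<lambda>t. t *\<^sub>R u)) (at a)" "(f has_derivative L) (at (c a))"
  shows "((\<lambda>t. f (c t)) has_real_derivative L u) (at a)"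
proof -
  have "(\<lambda>t. L (t *\<^sub>R u)) = (*) (L u)"
    using linear_scale[OF has_derivative_linear[OF assms(2)]] by (simp add: fun_eq_iff)
  then show ?thesis
    using has_derivative_compose[OF assms] by (simp add: has_field_derivative_def)
qed

text \<open>Schwarz' theorem, by applying the mean value theorem twice to the second difference.\<close>

lemma real_frechet_derivative_symmetric:
  fixes f :: "'a::real_normed_vector \<Rightarrow> real"
  assumes "open S" "Ck_on 2 S f" "x \<in> S"
  shows "frechet_derivative (\<lambda>y. frechet_derivative f (at y) u) (at x) v =
         frechet_derivative (\<lambda>y. frechet_derivative f (at y) v) (at x) u"
proof -
  define d where "d u v = (\<lambda>y. frechet_derivative (\<lambda>y. frechet_derivative f (at y) u) (at y) v)" for u v
  have f1: "(f has_derivative frechet_derivative f (at y)) (at y)" if "y \<in> S" for y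
    using assms(2) that by (intro has_frechet_derivative) (simp add: numeral_2_eq_2)
  have f2: "((\<lambda>y. frechet_derivative f (at y) u) has_derivative (\<lambda>v. d u v y)) (at y)"
    if "y \<in> S" for y u
    unfolding d_def using assms(2) that by (intro has_frechet_derivative) (simp add: numeral_2_eq_2)
  have cont: "continuous_on S (d u v)" for u v
    unfolding d_def using assms(2) by (simp add: numeral_2_eq_2)
  obtain r where r: "r > 0" "ball x r \<subseteq> S"
    using assms(1,3) openE by blast
  have second_difference: "\<exists>a b. 0 < a \<and> a < h \<and> 0 < b \<and> b < h \<and>
      f (x + h *\<^sub>R u + h *\<^sub>R v) - f (x + h *\<^sub>R u) - (f (x + h *\<^sub>R v) - f x) =
      h * h * d u v (x + a *\<^sub>R u + b *\<^sub>R v)"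
    if h: "h > 0" "h * (norm u + norm v) < r" for h u v
  proof -
    have inS: "x + a *\<^sub>R u + b *\<^sub>R v \<in> S" if "0 \<le> a" "a \<le> h" "0 \<le> b" "b \<le> h" for a b
    proof -
      have "norm (a *\<^sub>R u + b *\<^sub>R v) \<le> a * norm u + b * norm v"
        using norm_triangle_ineq[of "a *\<^sub>R u" "b *\<^sub>R v"] that by simp
      also have "\<dots> \<le> h * (norm u + norm v)"
        using that by (simp add: distrib_left add_mono mult_right_mono)
      finally have "norm (a *\<^sub>R u + b *\<^sub>R v) < r" using h by linarith
      moreover have "dist x (x + a *\<^sub>R u + b *\<^sub>R v) = norm (a *\<^sub>R u + b *\<^sub>R v)"
        by (metis add.assoc add_diff_cancel_left' dist_commute dist_norm)
      ultimately show ?thesis using r by auto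
    qed
    obtain a where a: "0 < a" "a < h"
      "f (x + h *\<^sub>R u + h *\<^sub>R v) - f (x + h *\<^sub>R u) - (f (x + h *\<^sub>R v) - f x) =
       h * (frechet_derivative f (at (x + a *\<^sub>R u + h *\<^sub>R v)) u - frechet_derivative f (at (x + a *\<^sub>R u)) u)"
    proof -
      have der: "((\<lambda>a. f (x + a *\<^sub>R u + b *\<^sub>R v)) has_real_derivative
          frechet_derivative f (at (x + a *\<^sub>R u + b *\<^sub>R v)) u) (at a)"
        if "0 \<le> a" "a \<le> h" "b = 0 \<or> b = h" for a b
      proof -
        have S: "x + a *\<^sub>R u + b *\<^sub>R v \<in> S" using inS[of a b] that h by auto
        have "((\<lambda>a. x + a *\<^sub>R u + b *\<^sub>R v) has_derivative (\<lambda>t. t *\<^sub>R u)) (at a)"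
          by (auto intro!: derivative_eq_intros)
        from has_real_derivative_along_line[OF this f1[OF S]] show ?thesis .
      qed
      \<comment> \<open>The zero multiple of \<open>v\<close> gives both terms the shape of
        \<open>der\<close>, once with \<open>b = h\<close> and once with
        \<open>b = 0\<close>.\<close>
      define F where "F = (\<lambda>a. f (x + a *\<^sub>R u + h *\<^sub>R v) - f (x + a *\<^sub>R u + 0 *\<^sub>R v))"
      define F' where "F' = (\<lambda>a. frechet_derivative f (at (x + a *\<^sub>R u + h *\<^sub>R v)) u -
          frechet_derivative f (at (x + a *\<^sub>R u + 0 *\<^sub>R v)) u)"
      have "(F has_real_derivative F' a) (at a)" if "0 \<le> a" "a \<le> h" for a
        unfolding F_def F'_def by (rule DERIV_diff[OF der[OF that] der[OF that]]) simp_all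
      from MVT2[OF h(1) this] obtain a where "0 < a" "a < h" "F h - F 0 = (h - 0) * F' a"
        by blast
      then show ?thesis using that[of a] by (simp add: F_def F'_def)
    qed
    obtain b where "0 < b" "b < h"
      "frechet_derivative f (at (x + a *\<^sub>R u + h *\<^sub>R v)) u - frechet_derivative f (at (x + a *\<^sub>R u)) u =
      h * d u v (x + a *\<^sub>R u + b *\<^sub>R v)"
    proof -
      have der: "((\<lambda>b. frechet_derivative f (at (x + a *\<^sub>R u + b *\<^sub>R v)) u) has_real_derivative
          d u v (x + a *\<^sub>R u + b *\<^sub>R v)) (at b)" if "0 \<le> b" "b \<le> h" for b
      proof -
        have S: "x + a *\<^sub>R u + b *\<^sub>R v \<in> S" using inS that a by auto
        have "((\<lambda>b. x + a *\<^sub>R u + b *\<^sub>R v) has_derivative (\<lambda>t. t *\<^sub>R v)) (at b)"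
          by (auto intro!: derivative_eq_intros)
        from has_real_derivative_along_line[OF this f2[OF S]] show ?thesis .
      qed
      from MVT2[OF h(1) der] obtain b where "0 < b" "b < h"
        "frechet_derivative f (at (x + a *\<^sub>R u + h *\<^sub>R v)) u -
          frechet_derivative f (at (x + a *\<^sub>R u + 0 *\<^sub>R v)) u = (h - 0) * d u v (x + a *\<^sub>R u + b *\<^sub>R v)"
        by blast
      then show ?thesis using that[of b] by simp
    qed
    then show ?thesis using a by auto
  qed
  have close: "\<bar>d u v x - d v u x\<bar> \<le> 2 * e" if e: "e > 0" for e
  proof -
    obtain s1 where s1: "s1 > 0" "\<And>y. dist y x < s1 \<Longrightarrow> y \<in> S \<Longrightarrow> dist (d u v y) (d u v x) < e"
      using cont[of u v] assms(3) e unfolding continuous_on_iff by metis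
    obtain s2 where s2: "s2 > 0" "\<And>y. dist y x < s2 \<Longrightarrow> y \<in> S \<Longrightarrow> dist (d v u y) (d v u x) < e"
      using cont[of v u] assms(3) e unfolding continuous_on_iff by metis
    define s where "s = min r (min s1 s2)"
    \<comment> \<open>Half of \<open>s\<close> keeps the later bound strict; the summand 1 avoids a
      zero denominator when \<open>u = v = 0\<close>.\<close>
    define h where "h = s / 2 / (norm u + norm v + 1)"
    have s: "s > 0" using r s1 s2 by (simp add: s_def)
    have np: "norm u + norm v + 1 > 0" by (smt (verit) norm_ge_zero)
    have h: "h > 0" unfolding h_def using s np by simp
    have "h * (norm u + norm v) \<le> h * (norm u + norm v + 1)" using h by simp
    also have "\<dots> = s / 2" unfolding h_def using np by (metis nonzero_eq_divide_eq less_irrefl)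
    finally have hs: "h * (norm u + norm v) < s" using s by simp
    have near: "dist (x + a *\<^sub>R u + b *\<^sub>R v) x < s" if "0 < a" "a < h" "0 < b" "b < h" for a b
    proof -
      have "norm (a *\<^sub>R u + b *\<^sub>R v) \<le> a * norm u + b * norm v"
        using norm_triangle_ineq[of "a *\<^sub>R u" "b *\<^sub>R v"] that by simp
      also have "\<dots> \<le> h * (norm u + norm v)"
        using that by (simp add: distrib_left add_mono mult_right_mono)
      finally show ?thesis using hs by (simp add: dist_norm add.assoc)
    qed
    have hr: "h * (norm u + norm v) < r" "h * (norm v + norm u) < r"
      using hs by (auto simp: s_def add.commute)
    obtain a b where ab: "0 < a" "a < h" "0 < b" "b < h"
      "f (x + h *\<^sub>R u + h *\<^sub>R v) - f (x + h *\<^sub>R u) - (f (x + h *\<^sub>R v) - f x) =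
      h * h * d u v (x + a *\<^sub>R u + b *\<^sub>R v)" using second_difference[OF h hr(1)] by blast
    obtain a' b' where ab': "0 < a'" "a' < h" "0 < b'" "b' < h"
      "f (x + h *\<^sub>R v + h *\<^sub>R u) - f (x + h *\<^sub>R v) - (f (x + h *\<^sub>R u) - f x) =
      h * h * d v u (x + a' *\<^sub>R v + b' *\<^sub>R u)" using second_difference[OF h hr(2)] by blast
    \<comment> \<open>The second difference of \<open>f\<close> is symmetric in \<open>u\<close> and
      \<open>v\<close>, so the two mean values are equal. Both points lie within \<open>s\<close> of
      \<open>x\<close>, where continuity controls the mixed derivatives.\<close>
    have "h * h * d u v (x + a *\<^sub>R u + b *\<^sub>R v) = h * h * d v u (x + a' *\<^sub>R v + b' *\<^sub>R u)"
      using ab(5) ab'(5) by (simp add: algebra_simps)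
    then have eq: "d u v (x + a *\<^sub>R u + b *\<^sub>R v) = d v u (x + a' *\<^sub>R v + b' *\<^sub>R u)"
      using h by simp
    have n1: "dist (x + a *\<^sub>R u + b *\<^sub>R v) x < s" using near ab by blast
    have n2: "dist (x + a' *\<^sub>R v + b' *\<^sub>R u) x < s"
      using near[of b' a'] ab' by (simp add: algebra_simps)
    have "dist (d u v (x + a *\<^sub>R u + b *\<^sub>R v)) (d u v x) < e"
      using n1 r by (intro s1) (auto simp: s_def dist_commute)
    moreover have "dist (d v u (x + a' *\<^sub>R v + b' *\<^sub>R u)) (d v u x) < e"
      using n2 r by (intro s2) (auto simp: s_def dist_commute)
    ultimately show ?thesis using eq unfolding dist_real_def by linarith
  qed
  have "\<bar>d u v x - d v u x\<bar> \<le> 0"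
  proof (rule field_le_epsilon)
    fix e :: real assume "0 < e"
    then show "\<bar>d u v x - d v u x\<bar> \<le> 0 + e" using close[of "e / 2"] by simp
  qed
  then show ?thesis unfolding d_def by simp
qed

text \<open>The mean value theorem is real, hence the detour through \<open>Re\<close> and
  \<open>Im\<close>, which as bounded linear maps commute with derivatives.\<close>

lemma frechet_derivative_symmetric:
  fixes f :: "'a::real_normed_vector \<Rightarrow> complex"
  assumes "open S" "smooth_on S f" "x \<in> S"
  shows "frechet_derivative (\<lambda>y. frechet_derivative f (at y) u) (at x) v =
         frechet_derivative (\<lambda>y. frechet_derivative f (at y) v) (at x) u"
proof -
  have *: "h (frechet_derivative (\<lambda>y. frechet_derivative f (at y) u) (at x) v) =
         h (frechet_derivative (\<lambda>y. frechet_derivative f (at y) v) (at x) u)"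
    if h: "bounded_linear h" for h :: "complex \<Rightarrow> real"
  proof -
    have eq: "frechet_derivative (\<lambda>y. frechet_derivative (\<lambda>y. h (f y)) (at y) u) (at x) =
       (\<lambda>v. h (frechet_derivative (\<lambda>y. frechet_derivative f (at y) u) (at x) v))" for u
    proof -
      have "frechet_derivative (\<lambda>y. frechet_derivative (\<lambda>y. h (f y)) (at y) u) (at x) =
        frechet_derivative (\<lambda>y. h (frechet_derivative f (at y) u)) (at x)"
        by (intro frechet_derivative_cong_open[OF assms(1,3)])
          (simp add: frechet_derivative_bounded_linear[OF h smooth_on_differentiable[OF assms(2)]])
      also have "\<dots> = (\<lambda>v. h (frechet_derivative (\<lambda>y. frechet_derivative f (at y) u) (at x) v))"
        using assms smooth_on_differentiable smooth_on_frechet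
        by (intro frechet_derivative_bounded_linear[OF h]) blast
      finally show ?thesis .
    qed
    have "Ck_on 2 S (\<lambda>y. h (f y))"
      using smooth_on_bounded_linear[OF h assms(1,2)] unfolding smooth_on_def by blast
    from real_frechet_derivative_symmetric[OF assms(1) this assms(3), of u v]
    show ?thesis unfolding eq .
  qed
  show ?thesis
    using *[OF bounded_linear_Re] *[OF bounded_linear_Im] by (simp add: complex_eq_iff)
qed

section \<open>The wedge product\<close>

text \<open>The sign (-1)^i on an arbitrary additive group, so that forms, matrices and pairs share
  one notation and a case distinction on parity removes it.\<close>

definition sg :: "nat \<Rightarrow> 'a::ab_group_add \<Rightarrow> 'a" where
  "sg i A = (if even i then A else - A)"

lemma power_minus_one_times_eq_sg: "(- 1) ^ i * A = sg i (A :: 'a::ring_1)"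
  by (simp add: sg_def)

lemma sum_fun_apply: "(\<Sum>i\<in>I. f i) x = (\<Sum>i\<in>I. f i x)"
  by (induction I rule: infinite_finite_induct) auto

definition ins :: "complex^'n \<Rightarrow> 'n form \<Rightarrow> 'n form" where
  "ins v \<omega> y vs = \<omega> y (v # vs)"

text \<open>The grading involution. It carries the sign of an antiderivation without asking its
  argument to be homogeneous.\<close>

definition eps :: "'n form \<Rightarrow> 'n form" where
  "eps \<omega> y vs = (- 1) ^ length vs * \<omega> y vs"

text \<open>The new index 0 lies outside the shifted set and below all of it, so each element of
  \<open>S\<close> gains exactly one inversion.\<close>

lemma shuffle_sign_Suc:
  assumes "S \<subseteq> {..<n}"
  shows "shuffle_sign (Suc n) (Suc ` S) = (- 1) ^ card S * shuffle_sign n S"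
proof -
  let ?I = "{(i, j). i \<in> S \<and> j \<in> {..<n} - S \<and> j < i}"
  have fin: "finite S" using assms finite_subset by blast
  have "finite ?I"
    by (rule finite_subset[of _ "S \<times> {..<n}"]) (use fin in auto)
  have eq: "{(i, j). i \<in> Suc ` S \<and> j \<in> {..<Suc n} - Suc ` S \<and> j < i} =
      map_prod Suc Suc ` ?I \<union> (\<lambda>i. (Suc i, 0)) ` S" (is "?L = ?R")
  proof
    show "?L \<subseteq> ?R"
    proof
      fix p assume "p \<in> ?L"
      then obtain i j where p: "p = (Suc i, j)" "i \<in> S" "j < Suc n" "j \<notin> Suc ` S" "j < Suc i" by auto
      then show "p \<in> ?R" by (cases j) (auto simp: map_prod_def image_iff)
    qed
    show "?R \<subseteq> ?L" using assms by auto
  qed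
  have "card ?R = card (map_prod Suc Suc ` ?I) + card ((\<lambda>i. (Suc i, 0::nat)) ` S)"
    using \<open>finite ?I\<close> fin by (intro card_Un_disjoint) auto
  also have "card (map_prod Suc Suc ` ?I) = card ?I"
    by (intro card_image inj_on_subset[OF prod.inj_map]) auto
  also have "card ((\<lambda>i. (Suc i, 0::nat)) ` S) = card S"
    by (intro card_image) (auto simp: inj_on_def)
  finally show ?thesis
    unfolding shuffle_sign_def eq by (simp add: power_add)
qed

text \<open>Here 0 belongs to the set and precedes everything, so no inversion is added.\<close>

lemma shuffle_sign_insert_0:
  "shuffle_sign (Suc n) (insert 0 (Suc ` S)) = shuffle_sign n S"
proof -
  let ?I = "{(i, j). i \<in> S \<and> j \<in> {..<n} - S \<and> j < i}"
  have eq: "{(i, j). i \<in> insert 0 (Suc ` S) \<and> j \<in> {..<Suc n} - insert 0 (Suc ` S) \<and> j < i} =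
      map_prod Suc Suc ` ?I" (is "?L = ?R")
  proof
    show "?L \<subseteq> ?R"
    proof
      fix p assume "p \<in> ?L"
      then obtain i j where p: "p = (Suc i, j)" "i \<in> S" "j < Suc n" "j \<noteq> 0" "j \<notin> Suc ` S" "j < Suc i" by auto
      then show "p \<in> ?R" by (cases j) (auto simp: map_prod_def image_iff)
    qed
    show "?R \<subseteq> ?L" by auto
  qed
  have "card (map_prod Suc Suc ` ?I) = card ?I"
    by (intro card_image inj_on_subset[OF prod.inj_map]) auto
  then show ?thesis unfolding shuffle_sign_def eq by simp
qed

lemma nths_Cons_shift:
  "nths (v # vs) (Suc ` S) = nths vs S"
  "nths (v # vs) (insert 0 (Suc ` S)) = v # nths vs S"
  "nths (v # vs) (- Suc ` S) = v # nths vs (- S)"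
  "nths (v # vs) (- insert 0 (Suc ` S)) = nths vs (- S)"
  by (auto simp: nths_Cons image_iff intro!: arg_cong[of _ _ "nths vs"])

lemma wedge_Nil [simp]: "wedge \<alpha> \<beta> y [] = \<alpha> y [] * \<beta> y []"
  by (simp add: wedge_def shuffle_sign_def)

text \<open>The laws of the wedge product follow from this recursion by induction on the list of
  arguments.\<close>

lemma wedge_Cons:
  "wedge \<alpha> \<beta> y (v # vs) = wedge (ins v \<alpha>) \<beta> y vs + wedge (eps \<alpha>) (ins v \<beta>) y vs"
proof -
  let ?n = "length vs"
  let ?P = "Pow {..<?n}"
  let ?t = "\<lambda>S. shuffle_sign (Suc ?n) S * \<alpha> y (nths (v # vs) S) * \<beta> y (nths (v # vs) (- S))"
  \<comment> \<open>Index sets are split by whether they contain 0, that is, by which factor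
    receives the first argument \<open>v\<close>.\<close>
  have "Pow {..<Suc ?n} = insert 0 ` (`) Suc ` ?P \<union> (`) Suc ` ?P"
    by (simp add: lessThan_Suc_eq_insert_0 Pow_insert image_Pow_surj Un_commute)
  then have "wedge \<alpha> \<beta> y (v # vs) = sum ?t (insert 0 ` (`) Suc ` ?P \<union> (`) Suc ` ?P)"
    unfolding wedge_def by simp
  also have "\<dots> = sum ?t (insert 0 ` (`) Suc ` ?P) + sum ?t ((`) Suc ` ?P)"
    by (intro sum.union_disjoint) auto
  also have "sum ?t (insert 0 ` (`) Suc ` ?P) = sum (?t \<circ> (\<lambda>S. insert 0 (Suc ` S))) ?P"
    unfolding image_image
  proof (rule sum.reindex)
    show "inj_on (\<lambda>S. insert 0 (Suc ` S)) ?P"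
      by (rule inj_onI) (metis Suc_neq_Zero imageE inj_Suc inj_image_eq_iff insert_ident)
  qed
  also have "\<dots> = wedge (ins v \<alpha>) \<beta> y vs"
    unfolding wedge_def ins_def by (simp add: shuffle_sign_insert_0 nths_Cons_shift)
  also have "sum ?t ((`) Suc ` ?P) = sum (?t \<circ> (`) Suc) ?P"
    by (rule sum.reindex) (simp add: inj_on_def inj_image_eq_iff)
  also have "\<dots> = wedge (eps \<alpha>) (ins v \<beta>) y vs"
    unfolding wedge_def ins_def eps_def
  proof (rule sum.cong[OF refl])
    fix S assume S: "S \<in> ?P"
    then have "{i. i < ?n \<and> i \<in> S} = S" by auto
    then have "length (nths vs S) = card S" by (simp add: length_nths)
    then show "(?t \<circ> (`) Suc) S = shuffle_sign ?n S * ((- 1) ^ length (nths vs S) * \<alpha> y (nths vs S)) * \<beta> y (v # nths vs (- S))"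
      using S by (simp add: shuffle_sign_Suc nths_Cons_shift)
  qed
  finally show ?thesis .
qed

lemma ins_wedge: "ins v (wedge \<alpha> \<beta>) = wedge (ins v \<alpha>) \<beta> + wedge (eps \<alpha>) (ins v \<beta>)"
  by (simp add: fun_eq_iff ins_def[of v "wedge \<alpha> \<beta>"] wedge_Cons)

lemma wedge_add_left: "wedge (\<alpha> + \<beta>) \<gamma> = wedge \<alpha> \<gamma> + wedge \<beta> \<gamma>"
  by (simp add: fun_eq_iff wedge_def algebra_simps sum.distrib)

lemma wedge_add_right: "wedge \<gamma> (\<alpha> + \<beta>) = wedge \<gamma> \<alpha> + wedge \<gamma> \<beta>"
  by (simp add: fun_eq_iff wedge_def algebra_simps sum.distrib)

lemma wedge_minus_left: "wedge (- \<alpha>) \<gamma> = - wedge \<alpha> \<gamma>"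
  by (simp add: fun_eq_iff wedge_def sum_negf)

lemma wedge_minus_right: "wedge \<gamma> (- \<alpha>) = - wedge \<gamma> \<alpha>"
  by (simp add: fun_eq_iff wedge_def sum_negf)

lemma wedge_0 [simp]: "wedge 0 \<gamma> = 0" "wedge \<gamma> 0 = 0"
  by (simp_all add: fun_eq_iff wedge_def)

lemma wedge_diff_left: "wedge (\<alpha> - \<beta>) \<gamma> = wedge \<alpha> \<gamma> - wedge \<beta> \<gamma>"
  using wedge_add_left[of \<alpha> "- \<beta>"] by (simp add: wedge_minus_left)

lemma wedge_diff_right: "wedge \<gamma> (\<alpha> - \<beta>) = wedge \<gamma> \<alpha> - wedge \<gamma> \<beta>"
  using wedge_add_right[of \<gamma> \<alpha> "- \<beta>"] by (simp add: wedge_minus_right)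

lemma wedge_sum_left: "wedge (\<Sum>i\<in>I. f i) \<gamma> = (\<Sum>i\<in>I. wedge (f i) \<gamma>)"
  using sum_comp_morphism[of "\<lambda>\<alpha>. wedge \<alpha> \<gamma>" f I] by (simp add: wedge_add_left o_def)

lemma wedge_sum_right: "wedge \<gamma> (\<Sum>i\<in>I. f i) = (\<Sum>i\<in>I. wedge \<gamma> (f i))"
  using sum_comp_morphism[of "wedge \<gamma>" f I] by (simp add: wedge_add_right o_def)

lemma sg_0 [simp]: "sg i 0 = 0" by (simp add: sg_def)
lemma sg_sg [simp]: "sg i (sg j A) = sg (i + j) A" by (simp add: sg_def)
lemma sg_add: "sg i (A + B) = sg i A + sg i B" by (simp add: sg_def)
lemma sg_minus: "sg i (- A) = - sg i A" by (simp add: sg_def)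
lemma sg_diff: "sg i (A - B) = sg i A - sg i B" by (simp add: sg_def)
lemma sg_sum: "sg i (\<Sum>x\<in>X. f x) = (\<Sum>x\<in>X. sg i (f x))" by (simp add: sg_def sum_negf)
lemma sg_apply: "sg i f x = sg i (f x)" by (simp add: sg_def)
lemma wedge_sg: "wedge (sg i \<alpha>) \<beta> = sg i (wedge \<alpha> \<beta>)" "wedge \<alpha> (sg i \<beta>) = sg i (wedge \<alpha> \<beta>)"
  by (simp_all add: sg_def wedge_minus_left wedge_minus_right)

lemma eps_eps [simp]: "eps (eps \<omega>) = \<omega>"
  by (simp add: fun_eq_iff eps_def flip: mult.assoc power_add)

lemma eps_linear: "eps (\<alpha> + \<beta>) = eps \<alpha> + eps \<beta>" "eps (- \<alpha>) = - eps \<alpha>" "eps 0 = 0"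
  by (simp_all add: fun_eq_iff eps_def algebra_simps)

lemma ins_linear: "ins v (\<alpha> + \<beta>) = ins v \<alpha> + ins v \<beta>" "ins v (- \<alpha>) = - ins v \<alpha>" "ins v 0 = 0"
  by (simp_all add: fun_eq_iff ins_def)

lemma ins_eps: "ins v (eps \<omega>) = - eps (ins v \<omega>)"
  by (simp add: fun_eq_iff eps_def ins_def)

lemma eps_wedge: "eps (wedge \<alpha> \<beta>) = wedge (eps \<alpha>) (eps \<beta>)"
proof (intro ext)
  fix y vs
  show "eps (wedge \<alpha> \<beta>) y vs = wedge (eps \<alpha>) (eps \<beta>) y vs"
  proof (induction vs arbitrary: \<alpha> \<beta>)
    case Nil
    then show ?case by (simp add: eps_def)
  next
    case (Cons v vs)
    have "eps (wedge \<alpha> \<beta>) y (v # vs) = - eps (ins v (wedge \<alpha> \<beta>)) y vs"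
      by (simp add: eps_def ins_def)
    also have "\<dots> = - wedge (eps (ins v \<alpha>)) (eps \<beta>) y vs - wedge \<alpha> (eps (ins v \<beta>)) y vs"
      by (simp add: ins_wedge eps_linear Cons.IH)
    finally show ?case
      by (simp add: wedge_Cons ins_eps wedge_minus_left wedge_minus_right)
  qed
qed

lemma wedge_assoc: "wedge (wedge \<alpha> \<beta>) \<gamma> = wedge \<alpha> (wedge \<beta> \<gamma>)"
proof (intro ext)
  fix y vs
  show "wedge (wedge \<alpha> \<beta>) \<gamma> y vs = wedge \<alpha> (wedge \<beta> \<gamma>) y vs"
    by (induction vs arbitrary: \<alpha> \<beta> \<gamma>)
      (simp_all add: wedge_Cons ins_wedge eps_wedge wedge_add_left wedge_add_right)
qed

section \<open>Parity and graded commutativity\<close>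

definition par :: "nat \<Rightarrow> 'n form \<Rightarrow> bool" where
  "par m \<omega> \<longleftrightarrow> (\<forall>y vs. odd (length vs + m) \<longrightarrow> \<omega> y vs = 0)"

lemma par_cong: "even i = even j \<Longrightarrow> par i \<omega> = par j \<omega>"
  by (simp add: par_def)

lemma par_add: "par m \<alpha> \<Longrightarrow> par m \<beta> \<Longrightarrow> par m (\<alpha> + \<beta>)" by (simp add: par_def)
lemma par_uminus: "par m \<alpha> \<Longrightarrow> par m (- \<alpha>)" by (simp add: par_def)
lemma par_diff: "par m \<alpha> \<Longrightarrow> par m \<beta> \<Longrightarrow> par m (\<alpha> - \<beta>)" by (simp add: par_def)
lemma par_0 [simp]: "par m 0" by (simp add: par_def)
lemma par_sum: "(\<And>i. i \<in> I \<Longrightarrow> par m (f i)) \<Longrightarrow> par m (\<Sum>i\<in>I. f i)"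
  by (simp add: par_def sum_fun_apply)

lemma par_ins: "par m \<omega> \<Longrightarrow> par (Suc m) (ins v \<omega>)"
  by (simp add: par_def ins_def)

lemma eps_eq_sg: "par m \<omega> \<Longrightarrow> eps \<omega> = sg m \<omega>"
  by (auto simp: fun_eq_iff eps_def sg_def par_def minus_one_power_iff)

text \<open>Parity becomes an eigenvalue equation for \<open>eps\<close>, and additivity under
  \<open>wedge\<close> can be read off from \<open>eps_wedge\<close>.\<close>

lemma par_iff_eps:
  fixes \<omega> :: "'n::finite form"
  shows "par m \<omega> \<longleftrightarrow> eps \<omega> = sg m \<omega>"
proof
  assume *: "eps \<omega> = sg m \<omega>"
  show "par m \<omega>"
    unfolding par_def
  proof (intro allI impI)
    fix y and vs :: "(complex^'n) list" assume "odd (length vs + m)"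
    then show "\<omega> y vs = 0"
      using fun_cong[OF fun_cong[OF *], of y vs]
      by (cases "even m") (auto simp: eps_def sg_def minus_one_power_iff)
  qed
qed (rule eps_eq_sg)

lemma par_wedge: "par p \<alpha> \<Longrightarrow> par q \<beta> \<Longrightarrow> par (p + q) (wedge \<alpha> \<beta>)"
  by (simp add: par_iff_eps eps_wedge wedge_sg add.commute)

lemma wedge_commute:
  assumes "par p \<alpha>" "par q \<beta>"
  shows "wedge \<alpha> \<beta> = sg (p * q) (wedge \<beta> \<alpha>)"
proof (intro ext)
  fix y vs
  show "wedge \<alpha> \<beta> y vs = sg (p * q) (wedge \<beta> \<alpha>) y vs"
    using assms
  proof (induction vs arbitrary: \<alpha> \<beta> p q)
    case Nil
    then have "odd p \<longrightarrow> \<alpha> y [] = 0" "odd q \<longrightarrow> \<beta> y [] = 0" by (auto simp: par_def)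
    then show ?case by (auto simp: sg_def)
  next
    case (Cons v vs)
    have 1: "wedge (ins v \<alpha>) \<beta> y vs = sg (Suc p * q) (wedge \<beta> (ins v \<alpha>)) y vs"
      by (rule Cons.IH) (use Cons.prems in \<open>auto simp: par_ins\<close>)
    have 2: "wedge \<alpha> (ins v \<beta>) y vs = sg (p * Suc q) (wedge (ins v \<beta>) \<alpha>) y vs"
      by (rule Cons.IH) (use Cons.prems in \<open>auto simp: par_ins\<close>)
    show ?case
      using Cons.prems
      by (cases "even p"; cases "even q")
        (simp_all add: sg_apply wedge_Cons 1 eps_eq_sg wedge_sg 2 sg_add, simp_all add: sg_def)
  qed
qed

lemma iota_wedge: "iota a (wedge \<alpha> \<beta>) = wedge (iota a \<alpha>) \<beta> + wedge (eps \<alpha>) (iota a \<beta>)"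
proof (intro ext)
  fix y vs
  have 1: "wedge (iota a \<alpha>) \<beta> y vs =
      (wedge (ins (axis a 1) \<alpha>) \<beta> y vs - \<i> * wedge (ins (axis a \<i>) \<alpha>) \<beta> y vs) / 2"
    unfolding wedge_def iota_def ins_def eps_def sum_distrib_left sum_subtractf[symmetric] sum_divide_distrib
    by (rule sum.cong[OF refl]) (simp add: algebra_simps)
  have 2: "wedge (eps \<alpha>) (iota a \<beta>) y vs =
      (wedge (eps \<alpha>) (ins (axis a 1) \<beta>) y vs - \<i> * wedge (eps \<alpha>) (ins (axis a \<i>) \<beta>) y vs) / 2"
    unfolding wedge_def iota_def ins_def eps_def sum_distrib_left sum_subtractf[symmetric] sum_divide_distrib
    by (rule sum.cong[OF refl]) (simp add: algebra_simps)
  show "iota a (wedge \<alpha> \<beta>) y vs = (wedge (iota a \<alpha>) \<beta> + wedge (eps \<alpha>) (iota a \<beta>)) y vs"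
    unfolding iota_def[of a "wedge \<alpha> \<beta>"] plus_fun_apply 1 2 wedge_Cons by (simp add: field_simps)
qed

lemma iota_linear:
  "iota a (\<alpha> + \<beta>) = iota a \<alpha> + iota a \<beta>" "iota a (- \<alpha>) = - iota a \<alpha>"
  "iota a (\<alpha> - \<beta>) = iota a \<alpha> - iota a \<beta>" "iota a 0 = 0"
  by (simp_all add: fun_eq_iff iota_def algebra_simps add_divide_distrib diff_divide_distrib)

lemma iota_sum: "iota a (\<Sum>i\<in>I. f i) = (\<Sum>i\<in>I. iota a (f i))"
  using sum_comp_morphism[of "iota a" f I] by (simp add: iota_linear o_def)

lemma iota_sg: "iota a (sg i \<alpha>) = sg i (iota a \<alpha>)"
  by (simp add: sg_def iota_linear)

lemma par_iota: "par m \<omega> \<Longrightarrow> par (Suc m) (iota a \<omega>)"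
  by (simp add: par_def iota_def)

section \<open>Alternating forms\<close>

definition alt :: "'n form \<Rightarrow> bool" where
  "alt \<omega> \<longleftrightarrow> (\<forall>y us v w vs. \<omega> y (us @ v # w # vs) = - \<omega> y (us @ w # v # vs))"

lemma altD: "alt \<omega> \<Longrightarrow> \<omega> y (us @ v # w # vs) = - \<omega> y (us @ w # v # vs)"
  unfolding alt_def by (elim allE)

lemma altI: "(\<And>y us v w vs. \<omega> y (us @ v # w # vs) = - \<omega> y (us @ w # v # vs)) \<Longrightarrow> alt \<omega>"
  unfolding alt_def by (intro allI)

lemma alt_add: "alt \<alpha> \<Longrightarrow> alt \<beta> \<Longrightarrow> alt (\<alpha> + \<beta>)"
proof (rule altI)
  fix y us v w vs assume "alt \<alpha>" "alt \<beta>"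
  from altD[OF this(1), of y us v w vs] altD[OF this(2), of y us v w vs]
  show "(\<alpha> + \<beta>) y (us @ v # w # vs) = - (\<alpha> + \<beta>) y (us @ w # v # vs)" by simp
qed
lemma alt_uminus: "alt \<alpha> \<Longrightarrow> alt (- \<alpha>)"
proof (rule altI)
  fix y us v w vs assume "alt \<alpha>"
  from altD[OF this, of y us v w vs]
  show "(- \<alpha>) y (us @ v # w # vs) = - (- \<alpha>) y (us @ w # v # vs)" by simp
qed
lemma alt_0 [simp]: "alt 0" by (rule altI) simp
lemma alt_sum: "(\<And>i. i \<in> I \<Longrightarrow> alt (f i)) \<Longrightarrow> alt (\<Sum>i\<in>I. f i)"
  by (rule altI) (unfold sum_fun_apply sum_negf[symmetric], rule sum.cong[OF refl altD])
lemma alt_ins: "alt \<omega> \<Longrightarrow> alt (ins v \<omega>)"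
proof (rule altI)
  fix y us u w vs assume "alt \<omega>"
  from altD[OF this, of y "v # us" u w vs]
  show "ins v \<omega> y (us @ u # w # vs) = - ins v \<omega> y (us @ w # u # vs)" by (simp add: ins_def)
qed
lemma alt_eps: "alt \<omega> \<Longrightarrow> alt (eps \<omega>)"
proof (rule altI)
  fix y us u w vs assume "alt \<omega>"
  from altD[OF this, of y us u w vs]
  show "eps \<omega> y (us @ u # w # vs) = - eps \<omega> y (us @ w # u # vs)" by (simp add: eps_def)
qed
lemma alt_iota: "alt \<omega> \<Longrightarrow> alt (iota a \<omega>)"
proof (rule altI)
  fix y us u w vs assume *: "alt \<omega>"
  have "\<omega> y (x # us @ u # w # vs) = - \<omega> y (x # us @ w # u # vs)" for x
    using altD[OF *, of y "x # us" u w vs] by simp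
  from this[of "axis a 1"] this[of "axis a \<i>"]
  show "iota a \<omega> y (us @ u # w # vs) = - iota a \<omega> y (us @ w # u # vs)"
    by (simp add: iota_def diff_divide_distrib)
qed

lemma alt_ins_ins: "alt \<omega> \<Longrightarrow> ins v (ins w \<omega>) = - ins w (ins v \<omega>)"
proof (intro ext)
  fix y vs assume "alt \<omega>"
  from altD[OF this, of y "[]" w v vs]
  show "ins v (ins w \<omega>) y vs = (- ins w (ins v \<omega>)) y vs" by (simp add: ins_def)
qed

text \<open>The type of forms admits arbitrary functions of lists, so antisymmetry has to be carried
  along as a predicate. This consequence is what the Cartan calculus draws from it.\<close>

lemma alt_iota_iota: "alt \<omega> \<Longrightarrow> iota a (iota b \<omega>) = - iota b (iota a \<omega>)"
proof (intro ext)
  fix y vs assume "alt \<omega>"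
  then have *: "\<omega> y (v # w # vs) = - \<omega> y (w # v # vs)" for v w
    using altD[of \<omega> y "[]" v w vs] by simp
  show "iota a (iota b \<omega>) y vs = (- iota b (iota a \<omega>)) y vs"
    by (simp add: iota_def *[of "axis b _" "axis a _"] algebra_simps diff_divide_distrib)
qed

lemma alt_wedge:
  assumes "alt \<alpha>" "alt \<beta>"
  shows "alt (wedge \<alpha> \<beta>)"
  unfolding alt_def
proof (intro allI)
  fix y us v w vs
  show "wedge \<alpha> \<beta> y (us @ v # w # vs) = - wedge \<alpha> \<beta> y (us @ w # v # vs)"
    using assms
  proof (induction us arbitrary: \<alpha> \<beta>)
    case Nil
    have "ins w (ins v \<alpha>) = - ins v (ins w \<alpha>)" "ins w (ins v \<beta>) = - ins v (ins w \<beta>)"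
      using alt_ins_ins[OF Nil(1), of w v] alt_ins_ins[OF Nil(2), of w v] by auto
    then show ?case
      by (simp add: wedge_Cons ins_wedge ins_eps eps_wedge wedge_add_left wedge_add_right
          wedge_minus_left wedge_minus_right ins_linear eps_linear)
  next
    case (Cons u us)
    then show ?case by (simp add: wedge_Cons alt_ins alt_eps)
  qed
qed

lemma form_eq_minus_self: "\<omega> = - \<omega> \<Longrightarrow> \<omega> = (0::'n::finite form)"
proof (intro ext)
  fix y vs assume "\<omega> = - \<omega>"
  then have "\<omega> y vs = - \<omega> y vs" by (metis fun_Compl_def)
  then show "\<omega> y vs = 0 y vs" by simp
qed

section \<open>Wirtinger derivatives\<close>

text \<open>\<open>k = - \<i>\<close> gives \<open>\<partial>/\<partial>z\<^sub>a\<close> and \<open>k = \<i>\<close> its conjugate.\<close>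

definition pdf :: "complex \<Rightarrow> 'n::finite \<Rightarrow> (complex^'n \<Rightarrow> complex) \<Rightarrow> complex^'n \<Rightarrow> complex" where
  "pdf k a f y = (frechet_derivative f (at y) (axis a 1) + k * frechet_derivative f (at y) (axis a \<i>)) / 2"

lemma pdz_eq_pdf: "pdz a = pdf (- \<i>) a"
  by (simp add: fun_eq_iff pdz_def pdf_def)

lemma pdzbar_eq_pdf: "pdzbar a = pdf \<i> a"
  by (simp add: fun_eq_iff pdzbar_def pdf_def)

lemma pdf_const [simp]: "pdf k a (\<lambda>_. c) y = 0"
  by (simp add: pdf_def)

lemma pdf_add:
  "f differentiable (at y) \<Longrightarrow> g differentiable (at y) \<Longrightarrow> pdf k a (\<lambda>u. f u + g u) y = pdf k a f y + pdf k a g y"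
  by (simp add: pdf_def frechet_derivative_add algebra_simps add_divide_distrib)

lemma pdf_mult:
  "f differentiable (at y) \<Longrightarrow> g differentiable (at y) \<Longrightarrow>
   pdf k a (\<lambda>u. f u * g u) y = pdf k a f y * g y + f y * pdf k a g y"
  by (simp add: pdf_def frechet_derivative_mult algebra_simps add_divide_distrib)

lemma pdf_cmult:
  "f differentiable (at y) \<Longrightarrow> pdf k a (\<lambda>u. c * f u) y = c * pdf k a f y"
  using pdf_mult[of "\<lambda>_. c" y f k a] by simp

lemma pdf_minus: "f differentiable (at y) \<Longrightarrow> pdf k a (\<lambda>u. - f u) y = - pdf k a f y"
  using pdf_cmult[of f y k a "-1"] by simp

lemma pdf_sum:
  assumes "\<And>i. i \<in> I \<Longrightarrow> f i differentiable (at y)"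
  shows "pdf k a (\<lambda>u. \<Sum>i\<in>I. f i u) y = (\<Sum>i\<in>I. pdf k a (f i) y)"
  using assms
proof (induction I rule: infinite_finite_induct)
  case (insert x F)
  have "(\<lambda>u. \<Sum>i\<in>F. f i u) differentiable (at y)"
    using insert by (intro differentiable_sum) auto
  then show ?case using insert by (simp add: pdf_add)
qed simp_all

lemma pdf_cong_open:
  "open D \<Longrightarrow> y \<in> D \<Longrightarrow> (\<And>u. u \<in> D \<Longrightarrow> f u = g u) \<Longrightarrow> pdf k a f y = pdf k a g y"
  using frechet_derivative_cong_open[of D y f g] by (simp add: pdf_def)

lemma smooth_on_pdf: "open D \<Longrightarrow> smooth_on D f \<Longrightarrow> smooth_on D (pdf k a f)"
  unfolding pdf_def[abs_def] divide_inverse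
  by (intro smooth_on_mult smooth_on_add smooth_on_frechet smooth_on_const)

text \<open>Wirtinger derivatives are complex combinations of directional ones. With
  \<open>k\<close> and \<open>l\<close> free, Schwarz' theorem yields all pairs of holomorphic and
  antiholomorphic derivatives at once.\<close>

lemma pdf_commute:
  assumes "open D" "smooth_on D f" "y \<in> D"
  shows "pdf k a (pdf l b f) y = pdf l b (pdf k a f) y"
proof -
  have dif: "(\<lambda>x. frechet_derivative f (at x) v) differentiable (at y)" for v
    using assms smooth_on_frechet smooth_on_differentiable by blast
  have *: "frechet_derivative (pdf l b f) (at y) w =
      (frechet_derivative (\<lambda>x. frechet_derivative f (at x) (axis b 1)) (at y) w +
       l * frechet_derivative (\<lambda>x. frechet_derivative f (at x) (axis b \<i>)) (at y) w) / 2" for l b w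
  proof -
    have "((\<lambda>y. (frechet_derivative f (at y) (axis b 1) + l * frechet_derivative f (at y) (axis b \<i>)) / 2)
      has_derivative (\<lambda>w. (frechet_derivative (\<lambda>x. frechet_derivative f (at x) (axis b 1)) (at y) w +
       l * frechet_derivative (\<lambda>x. frechet_derivative f (at x) (axis b \<i>)) (at y) w) / 2)) (at y)"
      by (rule bounded_linear.has_derivative[OF bounded_linear_divide
            has_derivative_add[OF has_frechet_derivative[OF dif]
              has_derivative_mult_right[OF has_frechet_derivative[OF dif]]]])
    then show ?thesis unfolding pdf_def[abs_def] by (simp add: frechet_derivative_eqI)
  qed
  have sym: "frechet_derivative (\<lambda>x. frechet_derivative f (at x) u) (at y) v =
      frechet_derivative (\<lambda>x. frechet_derivative f (at x) v) (at y) u" for u v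
    by (rule frechet_derivative_symmetric[OF assms])
  show ?thesis
    unfolding pdf_def[of k a "pdf l b f"] pdf_def[of l b "pdf k a f"] *
    by (simp add: sym[of "axis a _" "axis b _"] algebra_simps add_divide_distrib)
qed

section \<open>Forms on an open set\<close>

locale open_domain =
  fixes D :: "(complex^'n::finite) set"
  assumes open_D: "open D"
begin

text \<open>Derivatives are cut off outside \<open>D\<close>, so that identities between forms on \<open>D\<close> become
  equations between functions; \<open>smo\<close> says nothing about the values outside \<open>D\<close>.\<close>

definition pd :: "complex \<Rightarrow> 'n \<Rightarrow> 'n form \<Rightarrow> 'n form" where
  "pd k a \<omega> y vs = (if y \<in> D then pdf k a (\<lambda>u. \<omega> u vs) y else 0)"

definition smo :: "'n form \<Rightarrow> bool" where
  "smo \<omega> \<longleftrightarrow> (\<forall>vs. smooth_on D (\<lambda>y. \<omega> y vs)) \<and> alt \<omega>"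

definition zo :: "'n form \<Rightarrow> bool" where
  "zo \<omega> \<longleftrightarrow> (\<forall>y vs. y \<notin> D \<longrightarrow> \<omega> y vs = 0)"

lemma smo_alt: "smo \<omega> \<Longrightarrow> alt \<omega>" by (simp add: smo_def)

lemma smo_smooth: "smo \<omega> \<Longrightarrow> smooth_on D (\<lambda>y. \<omega> y vs)" by (simp add: smo_def)

lemma smo_dif: "smo \<omega> \<Longrightarrow> y \<in> D \<Longrightarrow> (\<lambda>y. \<omega> y vs) differentiable (at y)"
  using smooth_on_differentiable smo_smooth by blast

lemma smo_0 [simp]: "smo 0"
  by (simp add: smo_def)

lemma smo_add [simp]: "smo \<alpha> \<Longrightarrow> smo \<beta> \<Longrightarrow> smo (\<alpha> + \<beta>)"
  by (simp add: smo_def alt_add smooth_on_add open_D)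

lemma smo_uminus [simp]: "smo \<alpha> \<Longrightarrow> smo (- \<alpha>)"
  by (simp add: smo_def alt_uminus smooth_on_uminus open_D)

lemma smo_diff [simp]: "smo \<alpha> \<Longrightarrow> smo \<beta> \<Longrightarrow> smo (\<alpha> - \<beta>)"
  using smo_add[of \<alpha> "- \<beta>"] by simp

lemma smo_sg [simp]: "smo \<alpha> \<Longrightarrow> smo (sg i \<alpha>)"
  by (simp add: sg_def)

lemma smo_sum [simp]: "(\<And>i. i \<in> I \<Longrightarrow> smo (f i)) \<Longrightarrow> smo (\<Sum>i\<in>I. f i)"
  by (simp add: smo_def alt_sum smooth_on_sum open_D sum_fun_apply)

lemma smo_wedge [simp]: "smo \<alpha> \<Longrightarrow> smo \<beta> \<Longrightarrow> smo (wedge \<alpha> \<beta>)"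
  unfolding smo_def wedge_def[abs_def]
  by (auto simp: alt_wedge[unfolded wedge_def[abs_def]] intro!: smooth_on_sum smooth_on_mult open_D)

lemma smo_ins [simp]: "smo \<alpha> \<Longrightarrow> smo (ins v \<alpha>)"
  by (simp add: smo_def alt_ins, simp add: ins_def)

lemma smo_eps [simp]: "smo \<alpha> \<Longrightarrow> smo (eps \<alpha>)"
  unfolding smo_def eps_def[abs_def]
  by (auto intro!: smooth_on_mult open_D alt_eps[unfolded eps_def[abs_def]])

lemma smooth_on_linear_combination:
  fixes f g :: "complex^'n \<Rightarrow> complex"
  assumes "smooth_on D f" "smooth_on D g"
  shows "smooth_on D (\<lambda>y. c * f y + d * g y)"
proof (rule smooth_on_add[OF open_D])
  show "smooth_on D (\<lambda>y. c * f y)"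
    by (rule smooth_on_bounded_linear[OF bounded_linear_mult_right open_D assms(1)])
  show "smooth_on D (\<lambda>y. d * g y)"
    by (rule smooth_on_bounded_linear[OF bounded_linear_mult_right open_D assms(2)])
qed

lemma smo_iota [simp]: "smo \<alpha> \<Longrightarrow> smo (iota a \<alpha>)"
proof -
  assume *: "smo \<alpha>"
  have "iota a \<alpha> y vs = 1 / 2 * \<alpha> y (axis a 1 # vs) + (- \<i> / 2) * \<alpha> y (axis a \<i> # vs)" for y vs
    by (simp add: iota_def diff_divide_distrib)
  then have "smooth_on D (\<lambda>y. iota a \<alpha> y vs)" for vs
    using smooth_on_linear_combination[OF smo_smooth[OF *] smo_smooth[OF *]] by presburger
  then show ?thesis
    unfolding smo_def using alt_iota[OF smo_alt[OF *]] by blast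
qed

lemma pd_at: "y \<in> D \<Longrightarrow> pd k a \<omega> y vs = pdf k a (\<lambda>u. \<omega> u vs) y"
  by (simp add: pd_def)

lemma smo_pd [simp]: 
  assumes "smo \<alpha>" shows "smo (pd k a \<alpha>)"
proof -
  have "smooth_on D (\<lambda>y. pd k a \<alpha> y vs)" for vs
  proof -
    have "smooth_on D (pdf k a (\<lambda>u. \<alpha> u vs))"
      by (rule smooth_on_pdf[OF open_D smo_smooth[OF assms]])
    then show ?thesis
      using smooth_on_cong[OF open_D, of "\<lambda>y. pd k a \<alpha> y vs"] by (simp add: pd_def)
  qed
  moreover have "alt (pd k a \<alpha>)"
  proof (rule altI)
    fix y us v w vs
    have "(\<lambda>u. \<alpha> u (us @ v # w # vs)) = (\<lambda>u. - \<alpha> u (us @ w # v # vs))"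
      by (intro ext altD smo_alt assms)
    then show "pd k a \<alpha> y (us @ v # w # vs) = - pd k a \<alpha> y (us @ w # v # vs)"
      by (simp add: pd_def pdf_minus smo_dif[OF assms])
  qed
  ultimately show ?thesis by (simp add: smo_def)
qed

lemma zo_0 [simp]: "zo 0" by (simp add: zo_def)
lemma zo_add [simp]: "zo \<alpha> \<Longrightarrow> zo \<beta> \<Longrightarrow> zo (\<alpha> + \<beta>)" by (simp add: zo_def)
lemma zo_uminus [simp]: "zo \<alpha> \<Longrightarrow> zo (- \<alpha>)" by (simp add: zo_def)
lemma zo_diff [simp]: "zo \<alpha> \<Longrightarrow> zo \<beta> \<Longrightarrow> zo (\<alpha> - \<beta>)" by (simp add: zo_def)
lemma zo_sg [simp]: "zo \<alpha> \<Longrightarrow> zo (sg i \<alpha>)" by (simp add: sg_def)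
lemma zo_sum [simp]: "(\<And>i. i \<in> I \<Longrightarrow> zo (f i)) \<Longrightarrow> zo (\<Sum>i\<in>I. f i)"
  by (simp add: zo_def sum_fun_apply)
lemma zo_wedge_left: "zo \<alpha> \<Longrightarrow> zo (wedge \<alpha> \<beta>)" by (simp add: zo_def wedge_def)
lemma zo_wedge_right: "zo \<beta> \<Longrightarrow> zo (wedge \<alpha> \<beta>)" by (simp add: zo_def wedge_def)
lemma zo_iota [simp]: "zo \<alpha> \<Longrightarrow> zo (iota a \<alpha>)" by (simp add: zo_def iota_def)
lemma zo_pd [simp]: "zo (pd k a \<alpha>)" by (simp add: zo_def pd_def)

lemma pd_0 [simp]: "pd k a 0 = 0"
  by (simp add: fun_eq_iff pd_def)

lemma pd_add: "smo \<alpha> \<Longrightarrow> smo \<beta> \<Longrightarrow> pd k a (\<alpha> + \<beta>) = pd k a \<alpha> + pd k a \<beta>"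
  by (simp add: fun_eq_iff pd_def pdf_add smo_dif)

lemma pd_minus: "smo \<alpha> \<Longrightarrow> pd k a (- \<alpha>) = - pd k a \<alpha>"
  by (simp add: fun_eq_iff pd_def pdf_minus smo_dif)

lemma pd_diff: "smo \<alpha> \<Longrightarrow> smo \<beta> \<Longrightarrow> pd k a (\<alpha> - \<beta>) = pd k a \<alpha> - pd k a \<beta>"
  using pd_add[of \<alpha> "- \<beta>"] by (simp add: pd_minus)

lemma pd_sg: "smo \<alpha> \<Longrightarrow> pd k a (sg i \<alpha>) = sg i (pd k a \<alpha>)"
  by (simp add: sg_def pd_minus)

lemma pd_sum: "(\<And>i. i \<in> I \<Longrightarrow> smo (f i)) \<Longrightarrow> pd k a (\<Sum>i\<in>I. f i) = (\<Sum>i\<in>I. pd k a (f i))"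
  by (simp add: fun_eq_iff pd_def sum_fun_apply pdf_sum smo_dif)

lemma pd_ins: "ins v (pd k a \<omega>) = pd k a (ins v \<omega>)"
  by (simp add: fun_eq_iff pd_def ins_def)

lemma pd_eps: "smo \<omega> \<Longrightarrow> eps (pd k a \<omega>) = pd k a (eps \<omega>)"
  by (simp add: fun_eq_iff pd_def eps_def pdf_cmult smo_dif)

lemma par_pd: "par m \<omega> \<Longrightarrow> par m (pd k a \<omega>)"
  by (simp add: par_def pd_def)

lemma pd_iota: "smo \<omega> \<Longrightarrow> iota b (pd k a \<omega>) = pd k a (iota b \<omega>)"
proof -
  assume *: "smo \<omega>"
  have "pdf k a (\<lambda>u. (\<omega> u (axis b 1 # vs) - \<i> * \<omega> u (axis b \<i> # vs)) / 2) y =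
        (pdf k a (\<lambda>u. \<omega> u (axis b 1 # vs)) y - \<i> * pdf k a (\<lambda>u. \<omega> u (axis b \<i> # vs)) y) / 2"
    if "y \<in> D" for y vs
  proof -
    have "pdf k a (\<lambda>u. (\<omega> u (axis b 1 # vs) - \<i> * \<omega> u (axis b \<i> # vs)) / 2) y =
        pdf k a (\<lambda>u. 1/2 * \<omega> u (axis b 1 # vs) + (- \<i>/2) * \<omega> u (axis b \<i> # vs)) y"
      by (simp add: algebra_simps diff_divide_distrib)
    also have "\<dots> = 1/2 * pdf k a (\<lambda>u. \<omega> u (axis b 1 # vs)) y + (- \<i>/2) * pdf k a (\<lambda>u. \<omega> u (axis b \<i> # vs)) y"
      using smo_dif[OF * that] by (subst pdf_add) (auto simp only: pdf_cmult intro!: differentiable_mult differentiable_const)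
    finally show ?thesis by (simp add: algebra_simps diff_divide_distrib)
  qed
  then show ?thesis by (simp add: fun_eq_iff pd_def iota_def)
qed

text \<open>A coefficientwise derivative commutes with \<open>ins\<close> and \<open>eps\<close>,
  hence with the recursion for \<open>wedge\<close>, and is therefore a derivation without
  sign.\<close>

lemma pd_wedge:
  assumes "smo \<alpha>" "smo \<beta>"
  shows "pd k a (wedge \<alpha> \<beta>) = wedge (pd k a \<alpha>) \<beta> + wedge \<alpha> (pd k a \<beta>)"
proof (intro ext)
  fix y vs
  show "pd k a (wedge \<alpha> \<beta>) y vs = (wedge (pd k a \<alpha>) \<beta> + wedge \<alpha> (pd k a \<beta>)) y vs"
    using assms
  proof (induction vs arbitrary: \<alpha> \<beta>)
    case Nil
    then show ?case by (simp add: pd_def pdf_mult smo_dif)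
  next
    case (Cons v vs)
    have "pd k a (wedge \<alpha> \<beta>) y (v # vs) = pd k a (ins v (wedge \<alpha> \<beta>)) y vs"
      by (simp add: pd_def ins_def)
    also have "\<dots> = pd k a (wedge (ins v \<alpha>) \<beta>) y vs + pd k a (wedge (eps \<alpha>) (ins v \<beta>)) y vs"
      by (simp add: ins_wedge pd_add Cons.prems)
    also have "\<dots> = (wedge (pd k a \<alpha>) \<beta> + wedge \<alpha> (pd k a \<beta>)) y (v # vs)"
      by (simp add: Cons.IH Cons.prems wedge_Cons pd_ins pd_eps)
    finally show ?case .
  qed
qed

lemma pd_pd: "smo \<omega> \<Longrightarrow> pd k a (pd l b \<omega>) = pd l b (pd k a \<omega>)"
proof (intro ext)
  fix y vs assume \<omega>: "smo \<omega>"
  show "pd k a (pd l b \<omega>) y vs = pd l b (pd k a \<omega>) y vs"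
  proof (cases "y \<in> D")
    case True
    have *: "pd k a (pd l b \<omega>) y vs = pdf k a (pdf l b (\<lambda>u. \<omega> u vs)) y" for k a l b
      using True by (simp add: pd_at) (intro pdf_cong_open[OF open_D], auto simp: pd_at)
    show ?thesis
      unfolding * by (rule pdf_commute[OF open_D smo_smooth[OF \<omega>] True])
  qed (simp add: pd_def)
qed

text \<open>What \<open>dz\<close> and \<open>dzbar\<close> have in common as coframes with constant
  coefficients. It allows \<partial> and its conjugate to be treated as two instances of one
  operator \<open>rd k w\<close>.\<close>

definition cst :: "('n \<Rightarrow> 'n form) \<Rightarrow> bool" where
  "cst w \<longleftrightarrow> (\<forall>a. smo (w a) \<and> par 1 (w a) \<and> (\<forall>k b. pd k b (w a) = 0))"

lemma cst_const:
  assumes "\<And>a y y' vs. w a y vs = w a y' vs" "\<And>a y vs. length vs \<noteq> 1 \<Longrightarrow> w a y vs = 0"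
  shows "cst w"
proof -
  have *: "(\<lambda>u. w a u vs) = (\<lambda>_. w a undefined vs)" for a vs using assms(1) by auto
  have "alt (w a)" for a by (rule altI) (simp add: assms(2))
  moreover have "par 1 (w a)" for a unfolding par_def using assms(2) by (metis odd_one even_add)
  moreover have "pd k b (w a) = 0" for k b a
    unfolding fun_eq_iff pd_def * by simp
  moreover have "smooth_on D (\<lambda>u. w a u vs)" for a vs unfolding * by simp
  ultimately show ?thesis unfolding cst_def smo_def by blast
qed

lemma cst_dz: "cst dz"
  by (rule cst_const) (auto simp: dz_def split: list.splits)

lemma cst_dzbar: "cst dzbar"
  by (rule cst_const) (auto simp: dzbar_def split: list.splits)

lemma cstD: "cst w \<Longrightarrow> smo (w a)" "cst w \<Longrightarrow> par 1 (w a)" "cst w \<Longrightarrow> pd k b (w a) = 0"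
  by (auto simp: cst_def)

lemma smo_dz [simp]: "smo (dz a)" and par_dz: "par 1 (dz a)" and pd_dz [simp]: "pd k b (dz a) = 0"
  using cst_dz by (auto simp: cst_def)

lemma smo_dzbar [simp]: "smo (dzbar a)" and par_dzbar: "par 1 (dzbar a)" and pd_dzbar [simp]: "pd k b (dzbar a) = 0"
  using cst_dzbar by (auto simp: cst_def)

end

lemma iota_dz: "iota a (dz b) = (if a = b then one_form else 0)"
  by (auto simp: fun_eq_iff iota_def dz_def one_form_def axis_def split: list.splits)

lemma iota_dzbar: "iota a (dzbar b) = 0"
  by (auto simp: fun_eq_iff iota_def dzbar_def axis_def split: list.splits)

lemma wedge_one_form [simp]: "wedge one_form \<omega> = \<omega>"
proof (intro ext)
  fix y vs
  show "wedge one_form \<omega> y vs = \<omega> y vs"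
  proof (induction vs arbitrary: \<omega>)
    case (Cons v vs)
    have *: "ins v one_form = 0" "eps one_form = one_form"
      by (auto simp: fun_eq_iff ins_def eps_def one_form_def)
    have "wedge one_form \<omega> y (v # vs) = wedge (ins v one_form) \<omega> y vs + wedge (eps one_form) (ins v \<omega>) y vs"
      by (rule wedge_Cons)
    also have "\<dots> = \<omega> y (v # vs)"
      unfolding * Cons.IH by (simp add: ins_def)
    finally show ?case .
  qed (simp add: one_form_def)
qed

lemma wedge_one_form_right [simp]: "wedge \<omega> one_form = \<omega>"
proof (intro ext)
  fix y vs
  show "wedge \<omega> one_form y vs = \<omega> y vs"
  proof (induction vs arbitrary: \<omega>)
    case (Cons v vs)
    have *: "ins v one_form = 0"
      by (auto simp: fun_eq_iff ins_def one_form_def)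
    have "wedge \<omega> one_form y (v # vs) = wedge (ins v \<omega>) one_form y vs + wedge (eps \<omega>) (ins v one_form) y vs"
      by (rule wedge_Cons)
    also have "\<dots> = \<omega> y (v # vs)"
      unfolding * Cons.IH by (simp add: ins_def)
    finally show ?case .
  qed (simp add: one_form_def)
qed

section \<open>Cartan calculus of scalar forms\<close>

definition ctr :: "'n::finite vform \<Rightarrow> 'n form \<Rightarrow> 'n form" where
  "ctr \<phi> \<omega> = (\<Sum>a\<in>UNIV. wedge (\<phi> a) (iota a \<omega>))"

lemma contr_eq_ctr: "contr \<phi> A i j = ctr \<phi> (A i j)"
  by (simp add: contr_def ctr_def)

lemma ctr_linear:
  "ctr \<phi> (\<alpha> + \<beta>) = ctr \<phi> \<alpha> + ctr \<phi> \<beta>" "ctr \<phi> (- \<alpha>) = - ctr \<phi> \<alpha>"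
  "ctr \<phi> (\<alpha> - \<beta>) = ctr \<phi> \<alpha> - ctr \<phi> \<beta>" "ctr \<phi> 0 = 0"
  by (simp_all add: ctr_def iota_linear wedge_add_right wedge_minus_right wedge_diff_right
      sum.distrib sum_negf sum_subtractf)

lemma ctr_sum: "ctr \<phi> (\<Sum>i\<in>I. f i) = (\<Sum>i\<in>I. ctr \<phi> (f i))"
  using sum_comp_morphism[of "ctr \<phi>" f I] by (simp add: ctr_linear o_def)

lemma ctr_add_left: "ctr (\<phi> + \<psi>) \<alpha> = ctr \<phi> \<alpha> + ctr \<psi> \<alpha>"
  by (simp add: ctr_def wedge_add_left sum.distrib)

lemma ctr_0_left [simp]: "ctr 0 \<alpha> = 0"
  by (simp add: ctr_def)

context open_domain
begin

text \<open>In \<open>vf\<close>, the vanishing of \<open>iota b (\<phi> a)\<close> expresses that the form is of type \<open>(0, q)\<close>.\<close>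

definition sm :: "'n form \<Rightarrow> bool" where
  "sm \<omega> \<longleftrightarrow> smo \<omega> \<and> zo \<omega>"

definition sf :: "nat \<Rightarrow> 'n form \<Rightarrow> bool" where
  "sf m \<omega> \<longleftrightarrow> sm \<omega> \<and> par m \<omega>"

definition vf :: "nat \<Rightarrow> 'n vform \<Rightarrow> bool" where
  "vf i \<phi> \<longleftrightarrow> (\<forall>a. sf i (\<phi> a) \<and> (\<forall>b. iota b (\<phi> a) = 0))"

lemma sm_smo [simp]: "sm \<omega> \<Longrightarrow> smo \<omega>" by (simp add: sm_def)
lemma sf_sm: "sf m \<omega> \<Longrightarrow> sm \<omega>" by (simp add: sf_def)
lemma sf_smo: "sf m \<omega> \<Longrightarrow> smo \<omega>" by (simp add: sf_def)
lemma sf_par: "sf m \<omega> \<Longrightarrow> par m \<omega>" by (simp add: sf_def)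
lemma vf_sf: "vf i \<phi> \<Longrightarrow> sf i (\<phi> a)" by (simp add: vf_def)
lemma vf_smo [simp]: "vf i \<phi> \<Longrightarrow> smo (\<phi> a)"
  unfolding vf_def using sf_smo by blast
lemma vf_par: "vf i \<phi> \<Longrightarrow> par i (\<phi> a)" by (simp add: vf_def sf_par)
lemma vf_iota: "vf i \<phi> \<Longrightarrow> iota b (\<phi> a) = 0" by (simp add: vf_def)

lemma sm_0 [simp]: "sm 0" by (simp add: sm_def)
lemma sm_add [simp]: "sm \<alpha> \<Longrightarrow> sm \<beta> \<Longrightarrow> sm (\<alpha> + \<beta>)" by (simp add: sm_def)
lemma sm_uminus [simp]: "sm \<alpha> \<Longrightarrow> sm (- \<alpha>)" by (simp add: sm_def)
lemma sm_diff [simp]: "sm \<alpha> \<Longrightarrow> sm \<beta> \<Longrightarrow> sm (\<alpha> - \<beta>)" by (simp add: sm_def)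
lemma sm_sum [simp]: "(\<And>i. i \<in> I \<Longrightarrow> sm (f i)) \<Longrightarrow> sm (\<Sum>i\<in>I. f i)" by (simp add: sm_def)
lemma sm_wedge_left: "sm \<alpha> \<Longrightarrow> smo \<beta> \<Longrightarrow> sm (wedge \<alpha> \<beta>)" by (simp add: sm_def zo_wedge_left)
lemma sm_wedge_right: "smo \<alpha> \<Longrightarrow> sm \<beta> \<Longrightarrow> sm (wedge \<alpha> \<beta>)" by (simp add: sm_def zo_wedge_right)
lemma sm_wedge [simp]: "sm \<alpha> \<Longrightarrow> sm \<beta> \<Longrightarrow> sm (wedge \<alpha> \<beta>)" by (simp add: sm_wedge_left)
lemma sm_pd [simp]: "smo \<alpha> \<Longrightarrow> sm (pd k a \<alpha>)" by (simp add: sm_def)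

lemma sf_0 [simp]: "sf m 0" by (simp add: sf_def)
lemma sf_add: "sf m \<alpha> \<Longrightarrow> sf m \<beta> \<Longrightarrow> sf m (\<alpha> + \<beta>)" by (simp add: sf_def par_add)
lemma sf_uminus: "sf m \<alpha> \<Longrightarrow> sf m (- \<alpha>)" by (simp add: sf_def par_uminus)
lemma sf_diff: "sf m \<alpha> \<Longrightarrow> sf m \<beta> \<Longrightarrow> sf m (\<alpha> - \<beta>)" by (simp add: sf_def par_diff)
lemma sf_sum: "(\<And>i. i \<in> I \<Longrightarrow> sf m (f i)) \<Longrightarrow> sf m (\<Sum>i\<in>I. f i)" by (simp add: sf_def par_sum)
lemma sf_wedge: "sf p \<alpha> \<Longrightarrow> sf q \<beta> \<Longrightarrow> sf (p + q) (wedge \<alpha> \<beta>)" by (simp add: sf_def par_wedge)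
lemma sf_pd: "sf m \<alpha> \<Longrightarrow> sf m (pd k a \<alpha>)" by (simp add: sf_def par_pd)
lemma sf_cong: "even i = even j \<Longrightarrow> sf i \<omega> = sf j \<omega>"
  using par_cong[of i j \<omega>] by (simp add: sf_def)

definition rd :: "complex \<Rightarrow> ('n \<Rightarrow> 'n form) \<Rightarrow> 'n form \<Rightarrow> 'n form" where
  "rd k w \<omega> = (\<Sum>a\<in>UNIV. wedge (w a) (pd k a \<omega>))"

abbreviation "rdel \<equiv> rd (- \<i>) dz"
abbreviation "rdelb \<equiv> rd \<i> dzbar"

lemma sm_rd [simp]: "cst w \<Longrightarrow> smo \<omega> \<Longrightarrow> sm (rd k w \<omega>)"
  unfolding rd_def by (rule sm_sum) (simp add: sm_wedge_right cstD)

lemma par_rd: "cst w \<Longrightarrow> par m \<omega> \<Longrightarrow> par (Suc m) (rd k w \<omega>)"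
  unfolding rd_def
proof (rule par_sum)
  fix a assume "cst w" "par m \<omega>"
  then show "par (Suc m) (wedge (w a) (pd k a \<omega>))"
    using par_wedge[OF cstD(2)[of w a] par_pd[of m \<omega> k a]] by simp
qed

lemma sf_rd: "cst w \<Longrightarrow> sf m \<omega> \<Longrightarrow> sf (Suc m) (rd k w \<omega>)"
  by (simp add: sf_def par_rd)

lemma rd_0 [simp]: "rd k w 0 = 0" by (simp add: rd_def)
lemma rd_add: "smo \<alpha> \<Longrightarrow> smo \<beta> \<Longrightarrow> rd k w (\<alpha> + \<beta>) = rd k w \<alpha> + rd k w \<beta>"
  by (simp add: rd_def pd_add wedge_add_right sum.distrib)
lemma rd_minus: "smo \<alpha> \<Longrightarrow> rd k w (- \<alpha>) = - rd k w \<alpha>"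
  by (simp add: rd_def pd_minus wedge_minus_right sum_negf)
lemma rd_diff: "smo \<alpha> \<Longrightarrow> smo \<beta> \<Longrightarrow> rd k w (\<alpha> - \<beta>) = rd k w \<alpha> - rd k w \<beta>"
  using rd_add[of \<alpha> "- \<beta>"] by (simp add: rd_minus)
lemma rd_sg: "smo \<alpha> \<Longrightarrow> rd k w (sg i \<alpha>) = sg i (rd k w \<alpha>)"
  by (simp add: sg_def rd_minus)
lemma rd_sum:
  "(\<And>i. i \<in> I \<Longrightarrow> smo (f i)) \<Longrightarrow> rd k w (\<Sum>i\<in>I. f i) = (\<Sum>i\<in>I. rd k w (f i))"
  unfolding rd_def by (subst sum.swap) (simp add: pd_sum wedge_sum_right)

lemma wedge_swap:
  "par p \<alpha> \<Longrightarrow> par q \<beta> \<Longrightarrow> wedge \<alpha> (wedge \<beta> \<gamma>) = sg (p * q) (wedge \<beta> (wedge \<alpha> \<gamma>))"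
  unfolding wedge_assoc[symmetric] by (subst wedge_commute, assumption+) (simp add: wedge_sg)

lemma rd_wedge:
  assumes "cst w" "smo \<alpha>" "par i \<alpha>" "smo \<beta>"
  shows "rd k w (wedge \<alpha> \<beta>) = wedge (rd k w \<alpha>) \<beta> + sg i (wedge \<alpha> (rd k w \<beta>))"
  using assms cstD(2)[OF assms(1)]
  by (simp add: rd_def pd_wedge wedge_add_right wedge_sum_left wedge_sum_right sum.distrib wedge_assoc
      wedge_swap[of 1 _ i \<alpha>] sg_sum)

lemma rd_rd_expand:
  assumes "cst w'" "smo \<omega>"
  shows "rd k w (rd k' w' \<omega>) = (\<Sum>a\<in>UNIV. \<Sum>b\<in>UNIV. wedge (w a) (wedge (w' b) (pd k a (pd k' b \<omega>))))"
  using assms by (simp add: rd_def pd_sum pd_wedge cstD wedge_sum_right)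

text \<open>Second derivatives commute while the one-forms anticommute. Taking \<open>w = w'\<close>
  and \<open>k = k'\<close> gives that both Dolbeault operators square to zero; the mixed case is
  their anticommutation.\<close>

lemma rd_rd:
  assumes "cst w" "cst w'" "smo \<omega>"
  shows "rd k w (rd k' w' \<omega>) = - rd k' w' (rd k w \<omega>)"
proof -
  have "rd k' w' (rd k w \<omega>) = (\<Sum>a\<in>UNIV. \<Sum>b\<in>UNIV. wedge (w' b) (wedge (w a) (pd k' b (pd k a \<omega>))))"
    unfolding rd_rd_expand[OF assms(1,3)] by (rule sum.swap)
  also have "\<dots> = (\<Sum>a\<in>UNIV. \<Sum>b\<in>UNIV. - wedge (w a) (wedge (w' b) (pd k a (pd k' b \<omega>))))"
  proof (intro sum.cong refl)
    fix a b
    show "wedge (w' b) (wedge (w a) (pd k' b (pd k a \<omega>))) = - wedge (w a) (wedge (w' b) (pd k a (pd k' b \<omega>)))"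
      using wedge_swap[OF cstD(2)[OF assms(2), of b] cstD(2)[OF assms(1), of a]] pd_pd[OF assms(3), of k a k' b]
      by (simp add: sg_def)
  qed
  finally show ?thesis using assms by (simp add: rd_rd_expand sum_negf)
qed

lemma rd_self: "cst w \<Longrightarrow> smo \<omega> \<Longrightarrow> rd k w (rd k w \<omega>) = 0"
  by (rule form_eq_minus_self) (rule rd_rd)

lemma sm_ctr [simp]: "vf i \<phi> \<Longrightarrow> smo \<omega> \<Longrightarrow> sm (ctr \<phi> \<omega>)"
  unfolding ctr_def by (rule sm_sum[OF sm_wedge_left[OF sf_sm[OF vf_sf] smo_iota]])

lemma par_ctr: "vf i \<phi> \<Longrightarrow> par m \<omega> \<Longrightarrow> par (i + Suc m) (ctr \<phi> \<omega>)"
  unfolding ctr_def by (rule par_sum[OF par_wedge[OF vf_par par_iota]])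

lemma sf_ctr: "vf i \<phi> \<Longrightarrow> sf m \<omega> \<Longrightarrow> sf (i + Suc m) (ctr \<phi> \<omega>)"
  unfolding sf_def using par_ctr sm_ctr sm_smo by blast

lemma ctr_wedge:
  assumes "vf i \<phi>" "par p \<alpha>"
  shows "ctr \<phi> (wedge \<alpha> \<beta>) = wedge (ctr \<phi> \<alpha>) \<beta> + sg ((i + 1) * p) (wedge \<alpha> (ctr \<phi> \<beta>))"
proof -
  have "wedge (\<phi> a) (iota a (wedge \<alpha> \<beta>)) =
      wedge (wedge (\<phi> a) (iota a \<alpha>)) \<beta> + sg ((i + 1) * p) (wedge \<alpha> (wedge (\<phi> a) (iota a \<beta>)))" for a
    using wedge_swap[OF vf_par[OF assms(1)] assms(2), of a "iota a \<beta>"] assms(2)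
    by (simp add: iota_wedge wedge_add_right wedge_assoc eps_eq_sg wedge_sg algebra_simps)
  then show ?thesis
    by (simp add: ctr_def sum.distrib wedge_sum_left wedge_sum_right sg_sum)
qed

text \<open>Cartan's formula for the constant field \<partial>/\<partial>z_a, whose Lie derivative
  acts on coefficients only.\<close>

lemma iota_rdel: 
  assumes "smo \<omega>" shows "iota a (rdel \<omega>) = pd (- \<i>) a \<omega> - rdel (iota a \<omega>)"
proof -
  have "iota a (wedge (dz b) (pd (- \<i>) b \<omega>)) =
     (if a = b then pd (- \<i>) b \<omega> else 0) - wedge (dz b) (pd (- \<i>) b (iota a \<omega>))" for b
    using eps_eq_sg[OF par_dz, of b] assms
    by (simp add: iota_wedge iota_dz wedge_sg pd_iota) (simp add: sg_def)
  then show ?thesis by (simp add: rd_def iota_sum sum_subtractf)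
qed

text \<open>The same computation without a Lie derivative term, since \<partial>/\<partial>z_a
  annihilates every \<open>dzbar b\<close>.\<close>

lemma iota_rdelb: 
  assumes "smo \<omega>" shows "iota a (rdelb \<omega>) = - rdelb (iota a \<omega>)"
proof -
  have "iota a (wedge (dzbar b) (pd \<i> b \<omega>)) = - wedge (dzbar b) (pd \<i> b (iota a \<omega>))" for b
    using eps_eq_sg[OF par_dzbar, of b] assms
    by (simp add: iota_wedge iota_dzbar wedge_sg pd_iota) (simp add: sg_def)
  then show ?thesis by (simp add: rd_def iota_sum sum_negf)
qed

lemma rdelb_ctr:
  assumes "vf i \<phi>" "smo \<omega>"
  shows "rdelb (ctr \<phi> \<omega>) = ctr (\<lambda>a. rdelb (\<phi> a)) \<omega> - sg i (ctr \<phi> (rdelb \<omega>))"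
  using assms
  by (simp add: ctr_def rd_sum rd_wedge[OF cst_dzbar _ vf_par[OF assms(1)]] sum.distrib iota_rdelb
      wedge_minus_right sg_minus sg_sum sum_negf)

text \<open>The Lie derivative along a TX-valued form of degree \<open>i\<close>. The sign sits on
  the first summand so that the derivative \<phi>_a \<partial>/\<partial>z_a enters with coefficient
  +1 whatever the parity.\<close>

definition lieS :: "nat \<Rightarrow> 'n vform \<Rightarrow> 'n form \<Rightarrow> 'n form" where
  "lieS i \<phi> \<omega> = sg i (rdel (ctr \<phi> \<omega>)) + ctr \<phi> (rdel \<omega>)"

text \<open>By \<open>iota_rdel\<close> the two contributions
  \<open>wedge (\<phi> a) (rdel (iota a \<omega>))\<close> cancel, which leaves one derivative of
  \<omega> and one of \<phi>.\<close>

lemma lieS_expand: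
  assumes "vf i \<phi>" "smo \<omega>"
  shows "lieS i \<phi> \<omega> =
    (\<Sum>a\<in>UNIV. wedge (\<phi> a) (pd (- \<i>) a \<omega>) + sg i (wedge (rdel (\<phi> a)) (iota a \<omega>)))"
proof -
  have "sg i (rdel (wedge (\<phi> a) (iota a \<omega>))) + wedge (\<phi> a) (iota a (rdel \<omega>)) =
     wedge (\<phi> a) (pd (- \<i>) a \<omega>) + sg i (wedge (rdel (\<phi> a)) (iota a \<omega>))" for a
    using assms
    by (simp add: rd_wedge[OF cst_dz _ vf_par[OF assms(1)]] iota_rdel wedge_diff_right sg_add)
      (simp add: sg_def)
  then show ?thesis
    using assms by (simp add: lieS_def ctr_def rd_sum sg_sum flip: sum.distrib)
qed

definition SN :: "'n vform \<Rightarrow> 'n vform \<Rightarrow> 'n vform" where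
  "SN \<phi> \<psi> b = (\<Sum>a\<in>UNIV. wedge (\<phi> a) (pd (- \<i>) a (\<psi> b)) - wedge (pd (- \<i>) a (\<phi> b)) (\<psi> a))"

text \<open>The Cartan identity [L_\<phi>, i_\<psi>] = i_[\<phi>,\<psi>]. The terms \<open>P\<close>
  (derivative on \<omega>) and \<open>Q\<close> (two insertions) occur on both sides; what remains
  are \<open>R\<close>, where \<phi> differentiates \<psi>, and \<open>U\<close>, where \<psi>
  differentiates \<phi>, and their difference is the bracket.\<close>

lemma lieS_ctr:
  assumes "vf i \<phi>" "vf j \<psi>" "smo \<omega>"
  shows "lieS i \<phi> (ctr \<psi> \<omega>) = sg (i * (j + 1)) (ctr \<psi> (lieS i \<phi> \<omega>)) + ctr (SN \<phi> \<psi>) \<omega>"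
proof -
  let ?d = "pd (- \<i>)"
  define P where "P a b = wedge (\<phi> a) (wedge (\<psi> b) (?d a (iota b \<omega>)))" for a b
  define Q where "Q a b = wedge (rdel (\<phi> a)) (wedge (\<psi> b) (iota a (iota b \<omega>)))" for a b
  define R where "R a b = wedge (\<phi> a) (wedge (?d a (\<psi> b)) (iota b \<omega>))" for a b
  define U where "U a b = wedge (?d b (\<phi> a)) (wedge (\<psi> b) (iota a \<omega>))" for a b
  have smo: "smo (ctr \<psi> \<omega>)" using sm_ctr[OF assms(2,3)] by simp
  have dpar: "par (Suc i) (rdel (\<phi> a))" for a by (intro par_rd cst_dz vf_par assms)
  have L: "wedge (\<phi> a) (?d a (wedge (\<psi> b) (iota b \<omega>))) + sg i (wedge (rdel (\<phi> a)) (iota a (wedge (\<psi> b) (iota b \<omega>))))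
     = R a b + P a b + sg (i + j) (Q a b)" for a b
    using assms
    by (simp add: P_def Q_def R_def pd_wedge iota_wedge vf_iota[OF assms(2)] eps_eq_sg[OF vf_par[OF assms(2)]]
        wedge_sg wedge_add_right)
  \<comment> \<open>This uses that \<phi> has type (0, i): only the \<open>dz\<close> produced by
    \<partial> can absorb the insertion.\<close>
  have iphi: "iota b (rdel (\<phi> a)) = ?d b (\<phi> a)" for a b
    using assms by (simp add: iota_rdel vf_iota[OF assms(1)])
  have comm: "wedge (\<psi> b) (wedge (\<phi> a) \<gamma>) = sg (i * j) (wedge (\<phi> a) (wedge (\<psi> b) \<gamma>))"
    "wedge (\<psi> b) (wedge (rdel (\<phi> a)) \<gamma>) = sg (Suc i * j) (wedge (rdel (\<phi> a)) (wedge (\<psi> b) \<gamma>))"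
    "wedge (\<psi> b) (wedge (?d b (\<phi> a)) \<gamma>) = sg (i * j) (wedge (?d b (\<phi> a)) (wedge (\<psi> b) \<gamma>))" for a b \<gamma>
    using wedge_swap[OF vf_par[OF assms(2), of b] vf_par[OF assms(1), of a], of \<gamma>]
      wedge_swap[OF vf_par[OF assms(2), of b] dpar, of a \<gamma>]
      wedge_swap[OF vf_par[OF assms(2), of b] par_pd[OF vf_par[OF assms(1), of a]], of "- \<i>" b \<gamma>]
    by (simp_all only: mult.commute[of j])
  have M: "wedge (\<psi> b) (iota b (wedge (\<phi> a) (?d a \<omega>) + sg i (wedge (rdel (\<phi> a)) (iota a \<omega>))))
     = sg (i * (j + 1)) (P a b + sg (i + j) (Q a b) + U a b)" for a b
  proof -
    have *: "iota b (iota a \<omega>) = - iota a (iota b \<omega>)" by (rule alt_iota_iota[OF smo_alt[OF assms(3)]])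
    show ?thesis
      using assms
      by (simp add: P_def Q_def U_def iota_linear iota_sg iota_wedge vf_iota[OF assms(1)] iphi * comm
          eps_eq_sg[OF vf_par[OF assms(1)]] eps_eq_sg[OF dpar] wedge_sg wedge_add_right pd_iota
          wedge_minus_right sg_add sg_minus)
        (cases "even i"; cases "even j"; simp add: sg_def wedge_add_right wedge_diff_right comm)
  qed
  have N: "ctr (SN \<phi> \<psi>) \<omega> = (\<Sum>b\<in>UNIV. \<Sum>a\<in>UNIV. R a b - U b a)"
    by (simp add: ctr_def SN_def R_def U_def wedge_sum_left wedge_diff_left wedge_assoc)
  have L': "lieS i \<phi> (ctr \<psi> \<omega>) = (\<Sum>a\<in>UNIV. \<Sum>b\<in>UNIV. R a b + P a b + sg (i + j) (Q a b))"
    unfolding L[symmetric] lieS_expand[OF assms(1) smo]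
    using assms by (simp add: ctr_def pd_sum iota_sum wedge_sum_right sg_sum sum.distrib)
  have "ctr \<psi> (lieS i \<phi> \<omega>) = (\<Sum>b\<in>UNIV. \<Sum>a\<in>UNIV. sg (i * (j + 1)) (P a b + sg (i + j) (Q a b) + U a b))"
    unfolding M[symmetric] lieS_expand[OF assms(1,3)]
    by (simp add: ctr_def iota_sum wedge_sum_right)
  also have "\<dots> = (\<Sum>a\<in>UNIV. \<Sum>b\<in>UNIV. sg (i * (j + 1)) (P a b + sg (i + j) (Q a b) + U a b))"
    by (rule sum.swap)
  finally have M': "sg (i * (j + 1)) (ctr \<psi> (lieS i \<phi> \<omega>)) =
    (\<Sum>a\<in>UNIV. \<Sum>b\<in>UNIV. P a b + sg (i + j) (Q a b) + U a b)"
    by (simp add: sg_sum) (simp add: sg_def)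
  have "(\<Sum>b\<in>UNIV. \<Sum>a\<in>UNIV. R a b) = (\<Sum>a\<in>UNIV. \<Sum>b\<in>UNIV. R a b)" by (rule sum.swap)
  then show ?thesis
    unfolding L' M' N by (simp add: sum.distrib sum_subtractf)
qed

section \<open>The Schouten--Nijenhuis bracket\<close>

text \<open>The derivation \<phi>_a \<partial>/\<partial>z_a acting on coefficients. In terms of it
  the Schouten--Nijenhuis bracket is a graded commutator (\<open>Xop_Xop\<close>), so its Lie
  identities are those of operators.\<close>

definition Xop :: "'n vform \<Rightarrow> 'n form \<Rightarrow> 'n form" where
  "Xop \<phi> \<omega> = (\<Sum>a\<in>UNIV. wedge (\<phi> a) (pd (- \<i>) a \<omega>))"

lemma smo_Xop [simp]: "vf i \<phi> \<Longrightarrow> smo \<omega> \<Longrightarrow> smo (Xop \<phi> \<omega>)"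
  by (simp add: Xop_def)

lemma Xop_linear:
  "smo \<alpha> \<Longrightarrow> smo \<beta> \<Longrightarrow> Xop \<phi> (\<alpha> + \<beta>) = Xop \<phi> \<alpha> + Xop \<phi> \<beta>"
  "smo \<alpha> \<Longrightarrow> smo \<beta> \<Longrightarrow> Xop \<phi> (\<alpha> - \<beta>) = Xop \<phi> \<alpha> - Xop \<phi> \<beta>"
  "smo \<alpha> \<Longrightarrow> Xop \<phi> (- \<alpha>) = - Xop \<phi> \<alpha>"
  "smo \<alpha> \<Longrightarrow> Xop \<phi> (sg i \<alpha>) = sg i (Xop \<phi> \<alpha>)"
  by (simp_all add: Xop_def pd_add pd_minus pd_diff pd_sg wedge_add_right wedge_minus_right
      wedge_diff_right wedge_sg sum.distrib sum_negf sum_subtractf sg_sum)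

lemma Xop_Xop_expand:
  assumes "vf j \<psi>" "smo \<omega>"
  shows "Xop \<phi> (Xop \<psi> \<omega>) = (\<Sum>a\<in>UNIV. \<Sum>b\<in>UNIV.
     wedge (\<phi> a) (wedge (pd (- \<i>) a (\<psi> b)) (pd (- \<i>) b \<omega>)) +
     wedge (\<phi> a) (wedge (\<psi> b) (pd (- \<i>) a (pd (- \<i>) b \<omega>))))"
  using assms by (simp add: Xop_def pd_sum pd_wedge wedge_add_right wedge_sum_right)

text \<open>The second-order terms \<open>Q\<close> are symmetric and drop out of the graded
  commutator; the first-order terms \<open>P\<close> and \<open>R\<close> make up the
  bracket.\<close>

lemma Xop_Xop:
  assumes "vf i \<phi>" "vf j \<psi>" "smo \<omega>"
  shows "Xop \<phi> (Xop \<psi> \<omega>) = sg (i * j) (Xop \<psi> (Xop \<phi> \<omega>)) + Xop (SN \<phi> \<psi>) \<omega>"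
proof -
  let ?d = "pd (- \<i>)"
  define P where "P a b = wedge (\<phi> a) (wedge (?d a (\<psi> b)) (?d b \<omega>))" for a b
  define Q where "Q a b = wedge (\<phi> a) (wedge (\<psi> b) (?d a (?d b \<omega>)))" for a b
  define R where "R a b = wedge (?d a (\<phi> b)) (wedge (\<psi> a) (?d b \<omega>))" for a b
  have 1: "Xop \<phi> (Xop \<psi> \<omega>) = (\<Sum>a\<in>UNIV. \<Sum>b\<in>UNIV. P a b) + (\<Sum>a\<in>UNIV. \<Sum>b\<in>UNIV. Q a b)"
    unfolding Xop_Xop_expand[OF assms(2,3)] by (simp add: P_def Q_def sum.distrib)
  have "wedge (\<psi> a) (wedge (?d a (\<phi> b)) (?d b \<omega>)) = sg (i * j) (R a b)" for a b
    unfolding R_def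
    using wedge_swap[OF vf_par[OF assms(2)] par_pd[OF vf_par[OF assms(1)]]] by (simp add: mult.commute)
  moreover have "wedge (\<psi> a) (wedge (\<phi> b) (?d a (?d b \<omega>))) = sg (i * j) (Q b a)" for a b
    unfolding Q_def pd_pd[OF assms(3), of _ a _ b]
    using wedge_swap[OF vf_par[OF assms(2)] vf_par[OF assms(1)]] by (simp add: mult.commute)
  ultimately have 2: "sg (i * j) (Xop \<psi> (Xop \<phi> \<omega>)) = (\<Sum>a\<in>UNIV. \<Sum>b\<in>UNIV. R a b) + (\<Sum>a\<in>UNIV. \<Sum>b\<in>UNIV. Q b a)"
    unfolding Xop_Xop_expand[OF assms(1,3)]
    by (simp add: sum.distrib sg_sum sg_add) (simp add: sg_def)
  have "(\<Sum>a\<in>UNIV. \<Sum>b\<in>UNIV. Q b a) = (\<Sum>a\<in>UNIV. \<Sum>b\<in>UNIV. Q a b)" by (rule sum.swap)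
  moreover have "Xop (SN \<phi> \<psi>) \<omega> = (\<Sum>a\<in>UNIV. \<Sum>b\<in>UNIV. P a b) - (\<Sum>a\<in>UNIV. \<Sum>b\<in>UNIV. R a b)"
    unfolding sum.swap[of P] sum.swap[of R]
    by (simp add: P_def R_def Xop_def SN_def wedge_sum_left wedge_diff_left wedge_assoc sum_subtractf)
  ultimately show ?thesis using 1 2 by simp
qed

lemma SN_eq_Xop:
  assumes "vf i \<phi>" "vf j \<psi>"
  shows "SN \<phi> \<psi> b = Xop \<phi> (\<psi> b) - sg (i * j) (Xop \<psi> (\<phi> b))"
proof -
  have "wedge (pd (- \<i>) a (\<phi> b)) (\<psi> a) = sg (i * j) (wedge (\<psi> a) (pd (- \<i>) a (\<phi> b)))" for a
    by (rule wedge_commute[OF par_pd[OF vf_par[OF assms(1)]] vf_par[OF assms(2)]])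
  then show ?thesis
    by (simp add: SN_def Xop_def sum_subtractf sg_sum)
qed

lemma vf_SN:
  assumes "vf i \<phi>" "vf j \<psi>"
  shows "vf (i + j) (SN \<phi> \<psi>)"
proof -
  have "iota c (SN \<phi> \<psi> b) = 0" for b c
    using assms by (simp add: SN_def iota_sum iota_linear iota_wedge vf_iota[of i] vf_iota[of j] pd_iota)
  moreover have "sf (i + j) (SN \<phi> \<psi> b)" for b
    unfolding SN_def by (intro sf_sum sf_diff sf_wedge sf_pd vf_sf assms)
  ultimately show ?thesis by (simp add: vf_def)
qed

lemma SN_antisym:
  assumes "vf i \<phi>" "vf j \<psi>"
  shows "SN \<phi> \<psi> = - sg (i * j) (SN \<psi> \<phi>)"
proof
  fix b
  show "SN \<phi> \<psi> b = (- sg (i * j) (SN \<psi> \<phi>)) b"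
    using SN_eq_Xop[OF assms, of b] SN_eq_Xop[OF assms(2,1), of b]
    by (simp add: sg_apply sg_diff mult.commute) (simp add: sg_def)
qed

text \<open>By \<open>SN_eq_Xop\<close> and \<open>Xop_Xop\<close> every term becomes an iterated
  \<open>Xop\<close> applied to the coefficients \<open>\<phi> b\<close>, \<open>\<psi> b\<close>
  and \<open>\<xi> b\<close>; these match as in the Jacobi identity for graded commutators.\<close>

lemma SN_Jacobi:
  assumes "vf i \<phi>" "vf j \<psi>" "vf k \<xi>"
  shows "SN \<phi> (SN \<psi> \<xi>) = SN (SN \<phi> \<psi>) \<xi> + sg (i * j) (SN \<psi> (SN \<phi> \<xi>))"
proof -
  have "SN \<phi> (SN \<psi> \<xi>) b = SN (SN \<phi> \<psi>) \<xi> b + sg (i * j) (SN \<psi> (SN \<phi> \<xi>) b)" for b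
  proof -
  have smo: "smo (\<phi> b)" "smo (\<psi> b)" "smo (\<xi> b)" using assms by (meson vf_smo)+
  have X: "Xop (SN \<phi> \<psi>) \<omega> = Xop \<phi> (Xop \<psi> \<omega>) - sg (i * j) (Xop \<psi> (Xop \<phi> \<omega>))"
    "Xop (SN \<psi> \<xi>) \<omega> = Xop \<psi> (Xop \<xi> \<omega>) - sg (j * k) (Xop \<xi> (Xop \<psi> \<omega>))"
    "Xop (SN \<phi> \<xi>) \<omega> = Xop \<phi> (Xop \<xi> \<omega>) - sg (i * k) (Xop \<xi> (Xop \<phi> \<omega>))" if "smo \<omega>" for \<omega>
    using Xop_Xop[OF assms(1,2) that] Xop_Xop[OF assms(2,3) that] Xop_Xop[OF assms(1,3) that] by simp_all
  have smoX: "smo (Xop \<phi> \<omega>)" "smo (Xop \<psi> \<omega>)" "smo (Xop \<xi> \<omega>)" if "smo \<omega>" for \<omega>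
    using assms that by (meson smo_Xop)+
  show ?thesis
    unfolding
      SN_eq_Xop[OF assms(1) vf_SN[OF assms(2,3)], of b] SN_eq_Xop[OF vf_SN[OF assms(1,2)] assms(3), of b]
      SN_eq_Xop[OF assms(2) vf_SN[OF assms(1,3)], of b]
      SN_eq_Xop[OF assms(1,2), of b] SN_eq_Xop[OF assms(2,3), of b] SN_eq_Xop[OF assms(1,3), of b]
    by (simp add: X smo smoX Xop_linear sg_diff)
      (cases "even i"; cases "even j"; cases "even k"; simp add: sg_def smo smoX Xop_linear)
  qed
  then show ?thesis by (simp add: fun_eq_iff sg_apply)
qed

lemma pd_rd: "cst w \<Longrightarrow> smo \<omega> \<Longrightarrow> pd k a (rd l w \<omega>) = rd l w (pd k a \<omega>)"
  by (simp add: rd_def pd_sum pd_wedge cstD pd_pd[of \<omega> k a])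

lemma vf_rdelb:
  assumes "vf i \<phi>"
  shows "vf (Suc i) (\<lambda>a. rdelb (\<phi> a))"
  using assms sf_rd[OF cst_dzbar vf_sf] vf_smo[of i \<phi>] by (simp add: vf_def iota_rdelb)

lemma rdelb_Xop:
  assumes "vf i \<phi>" "smo \<omega>"
  shows "rdelb (Xop \<phi> \<omega>) = Xop (\<lambda>a. rdelb (\<phi> a)) \<omega> + sg i (Xop \<phi> (rdelb \<omega>))"
  using assms
  by (simp add: Xop_def rd_sum rd_wedge[OF cst_dzbar _ vf_par[OF assms(1)]] pd_rd[OF cst_dzbar] sum.distrib sg_sum)

text \<open>The Dolbeault operator is an antiderivation that commutes with \<partial>/\<partial>z_a
  on coefficients, so it passes through \<open>Xop\<close>, and thus through the bracket, with the
  sign of \<phi>.\<close>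

lemma SN_rdelb:
  assumes "vf i \<phi>" "vf j \<psi>"
  shows "(\<lambda>a. rdelb (SN \<phi> \<psi> a)) = SN (\<lambda>a. rdelb (\<phi> a)) \<psi> + sg i (SN \<phi> (\<lambda>a. rdelb (\<psi> a)))"
proof -
  have "rdelb (SN \<phi> \<psi> b) = SN (\<lambda>a. rdelb (\<phi> a)) \<psi> b + sg i (SN \<phi> (\<lambda>a. rdelb (\<psi> a)) b)" for b
  proof -
  have smo: "smo (\<phi> b)" "smo (\<psi> b)" using assms by (meson vf_smo)+
  have smoX: "smo (Xop \<phi> \<omega>)" "smo (Xop \<psi> \<omega>)" if "smo \<omega>" for \<omega>
    using assms that by (meson smo_Xop)+
  show ?thesis
    unfolding SN_eq_Xop[OF assms(1) vf_rdelb[OF assms(2)], of b] SN_eq_Xop[OF vf_rdelb[OF assms(1)] assms(2), of b]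
      SN_eq_Xop[OF assms, of b]
    by (simp add: smo smoX rd_diff rd_sg rdelb_Xop[OF assms(1)] rdelb_Xop[OF assms(2)] sg_diff sg_add)
      (cases "even i"; cases "even j"; simp add: sg_def smo smoX rd_diff rd_minus rdelb_Xop[OF assms(1)] rdelb_Xop[OF assms(2)])
  qed
  then show ?thesis by (simp add: fun_eq_iff sg_apply)
qed

lemma vf_0 [simp]: "vf i 0" by (simp add: vf_def iota_linear)
end

section \<open>The sign calculus\<close>

lemma sg_double [simp]: "sg (i + i) A = A"
  by (simp add: sg_def)

text \<open>\<open>S\<close> consists of all forms, \<open>Om i\<close> and \<open>T i\<close> of those whose degree has the parity of \<open>i\<close>.
  Grading by parity only avoids the truncated degree \<open>i + j - 1\<close> of a contraction.\<close>

locale super_calculus =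
  fixes S :: "'a::ab_group_add set" and Om :: "nat \<Rightarrow> 'a set"
    and V :: "'v::ab_group_add set" and T :: "nat \<Rightarrow> 'v set"
    and mul :: "'a \<Rightarrow> 'a \<Rightarrow> 'a" (infixl "\<star>" 70)
    and dl db :: "'a \<Rightarrow> 'a" and ct :: "'v \<Rightarrow> 'a \<Rightarrow> 'a"
    and vb :: "'v \<Rightarrow> 'v" and SN :: "'v \<Rightarrow> 'v \<Rightarrow> 'v"
  assumes S_0 [simp]: "0 \<in> S"
    and S_add [simp]: "A \<in> S \<Longrightarrow> B \<in> S \<Longrightarrow> A + B \<in> S"
    and S_minus [simp]: "A \<in> S \<Longrightarrow> - A \<in> S"
    and S_mul [simp]: "A \<in> S \<Longrightarrow> B \<in> S \<Longrightarrow> A \<star> B \<in> S"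
    and S_dl [simp]: "A \<in> S \<Longrightarrow> dl A \<in> S"
    and S_db [simp]: "A \<in> S \<Longrightarrow> db A \<in> S"
    and S_ct [simp]: "v \<in> V \<Longrightarrow> A \<in> S \<Longrightarrow> ct v A \<in> S"
    and Om_S: "A \<in> Om i \<Longrightarrow> A \<in> S"
    and Om_0: "0 \<in> Om i"
    and Om_add: "A \<in> Om i \<Longrightarrow> B \<in> Om i \<Longrightarrow> A + B \<in> Om i"
    and Om_minus: "A \<in> Om i \<Longrightarrow> - A \<in> Om i"
    and Om_mul: "A \<in> Om i \<Longrightarrow> B \<in> Om j \<Longrightarrow> A \<star> B \<in> Om (i + j)"
    and Om_dl: "A \<in> Om i \<Longrightarrow> dl A \<in> Om (Suc i)"
    and Om_db: "A \<in> Om i \<Longrightarrow> db A \<in> Om (Suc i)"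
    and Om_ct: "v \<in> T i \<Longrightarrow> A \<in> Om j \<Longrightarrow> ct v A \<in> Om (i + Suc j)"
    and Om_cong: "A \<in> Om i \<Longrightarrow> even i = even j \<Longrightarrow> A \<in> Om j"
    and T_V: "v \<in> T i \<Longrightarrow> v \<in> V"
    and T_SN: "v \<in> T i \<Longrightarrow> w \<in> T j \<Longrightarrow> SN v w \<in> T (i + j)"
    and T_vb: "v \<in> T i \<Longrightarrow> vb v \<in> T (Suc i)"
    and T_0: "0 \<in> T i"
    and SN_0 [simp]: "SN 0 v = 0" "SN v 0 = 0"
    and ct_0 [simp]: "ct 0 A = 0"
    and mul_assoc: "A \<star> B \<star> C = A \<star> (B \<star> C)"
    and mul_add: "A \<star> (B + C) = A \<star> B + A \<star> C" "(A + B) \<star> C = A \<star> C + B \<star> C"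
    and mul_minus [simp]: "A \<star> (- B) = - (A \<star> B)" "(- A) \<star> B = - (A \<star> B)"
    and dl_add: "A \<in> S \<Longrightarrow> B \<in> S \<Longrightarrow> dl (A + B) = dl A + dl B"
    and dl_minus: "A \<in> S \<Longrightarrow> dl (- A) = - dl A"
    and db_add: "A \<in> S \<Longrightarrow> B \<in> S \<Longrightarrow> db (A + B) = db A + db B"
    and db_minus: "A \<in> S \<Longrightarrow> db (- A) = - db A"
    and ct_add: "ct v (A + B) = ct v A + ct v B"
    and ct_minus: "ct v (- A) = - ct v A"
    and ct_add_left: "ct (v + w) A = ct v A + ct w A"
    and dl_mul: "A \<in> Om i \<Longrightarrow> B \<in> S \<Longrightarrow> dl (A \<star> B) = dl A \<star> B + sg i (A \<star> dl B)"
    and db_mul: "A \<in> Om i \<Longrightarrow> B \<in> S \<Longrightarrow> db (A \<star> B) = db A \<star> B + sg i (A \<star> db B)"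
    and ct_mul: "v \<in> T i \<Longrightarrow> A \<in> Om p \<Longrightarrow> ct v (A \<star> B) = ct v A \<star> B + sg ((i + 1) * p) (A \<star> ct v B)"
    and dl_dl: "A \<in> S \<Longrightarrow> dl (dl A) = 0"
    and db_db: "A \<in> S \<Longrightarrow> db (db A) = 0"
    and db_dl: "A \<in> S \<Longrightarrow> db (dl A) = - dl (db A)"
    and db_ct: "v \<in> T i \<Longrightarrow> A \<in> S \<Longrightarrow> db (ct v A) = ct (vb v) A - sg i (ct v (db A))"
    and lie_ct_flat: "v \<in> T i \<Longrightarrow> w \<in> T j \<Longrightarrow> A \<in> S \<Longrightarrow>
        sg i (dl (ct v (ct w A))) + ct v (dl (ct w A)) =
        sg (i * (j + 1)) (ct w (sg i (dl (ct v A)) + ct v (dl A))) + ct (SN v w) A"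
    and SN_antisym: "v \<in> T i \<Longrightarrow> w \<in> T j \<Longrightarrow> SN v w = - sg (i * j) (SN w v)"
    and SN_Jacobi: "u \<in> T i \<Longrightarrow> v \<in> T j \<Longrightarrow> w \<in> T k \<Longrightarrow>
        SN u (SN v w) = SN (SN u v) w + sg (i * j) (SN v (SN u w))"
    and SN_vb: "v \<in> T i \<Longrightarrow> w \<in> T j \<Longrightarrow> vb (SN v w) = SN (vb v) w + sg i (SN v (vb w))"
    and vb_vb: "v \<in> T i \<Longrightarrow> vb (vb v) = 0"
begin

lemma S_diff [simp]: "A \<in> S \<Longrightarrow> B \<in> S \<Longrightarrow> A - B \<in> S"
  using S_add[of A "- B"] by simp

lemma S_sg [simp]: "A \<in> S \<Longrightarrow> sg i A \<in> S"
  by (simp add: sg_def)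

lemma Om_diff: "A \<in> Om i \<Longrightarrow> B \<in> Om i \<Longrightarrow> A - B \<in> Om i"
  using Om_add[of A i "- B"] by (simp add: Om_minus)

lemma Om_sg: "A \<in> Om i \<Longrightarrow> sg j A \<in> Om i"
  by (simp add: sg_def Om_minus)

lemma dl_diff: "A \<in> S \<Longrightarrow> B \<in> S \<Longrightarrow> dl (A - B) = dl A - dl B"
  using dl_add[of A "- B"] by (simp add: dl_minus)

lemma db_diff: "A \<in> S \<Longrightarrow> B \<in> S \<Longrightarrow> db (A - B) = db A - db B"
  using db_add[of A "- B"] by (simp add: db_minus)

lemma ct_diff: "ct v (A - B) = ct v A - ct v B"
  using ct_add[of v A "- B"] by (simp add: ct_minus)

lemma mul_diff: "A \<star> (B - C) = A \<star> B - A \<star> C" "(A - B) \<star> C = A \<star> C - B \<star> C"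
  using mul_add(1)[of A B "- C"] mul_add(2)[of A "- B" C] by simp_all

lemma mul_0 [simp]: "A \<star> 0 = 0" "0 \<star> A = 0"
  using mul_diff(1)[of A A A] mul_diff(2)[of A A A] by simp_all

lemma ct_zero [simp]: "ct v 0 = 0"
  using ct_diff[of v 0 0] by simp

lemma dl_zero [simp]: "dl 0 = 0" and db_zero [simp]: "db 0 = 0"
  using dl_diff[of 0 0] db_diff[of 0 0] by simp_all

lemmas mul_simps = mul_add mul_diff mul_assoc
definition cm :: "nat \<Rightarrow> nat \<Rightarrow> 'a \<Rightarrow> 'a \<Rightarrow> 'a" where
  "cm i j A B = A \<star> B - sg (i * j) (B \<star> A)"

lemma S_cm [simp]: "A \<in> S \<Longrightarrow> B \<in> S \<Longrightarrow> cm i j A B \<in> S"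
  by (simp add: cm_def)

lemma Om_cm: "A \<in> Om i \<Longrightarrow> B \<in> Om j \<Longrightarrow> cm i j A B \<in> Om (i + j)"
  unfolding cm_def using Om_mul[of A i B j] Om_mul[of B j A i] by (simp add: Om_diff Om_sg add.commute)

end

text \<open>Types are encoded by contractions: \<open>W\<close> and \<open>db W\<close> contain a
  single \<open>dz\<close>, so two contractions kill them. Given that \<open>W\<close> has type
  (1,0), \<open>flat_W\<close> removes the (2,0)-part of the curvature, which is then
  \<open>db W\<close>.\<close>

locale super_connection = super_calculus +
  fixes W :: 'a
  assumes W_Om: "W \<in> Om 1"
    and ct_ct_W: "v \<in> V \<Longrightarrow> w \<in> V \<Longrightarrow> ct w (ct v W) = 0"
    and ct_ct_F: "v \<in> V \<Longrightarrow> w \<in> V \<Longrightarrow> ct w (ct v (db W)) = 0"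
    and flat_W: "dl W = - (W \<star> W)"
begin

abbreviation "F \<equiv> db W"

lemma W_S [simp]: "W \<in> S" using W_Om Om_S by blast

lemma F_Om: "F \<in> Om 0" using Om_cong[OF Om_db[OF W_Om], of 0] by simp

definition Dc :: "nat \<Rightarrow> 'a \<Rightarrow> 'a" where
  "Dc m A = dl A + cm 1 m W A"

lemma Dc_cong: "even m = even n \<Longrightarrow> Dc m A = Dc n A"
  by (simp add: Dc_def cm_def sg_def)

lemma S_Dc [simp]: "A \<in> S \<Longrightarrow> Dc m A \<in> S"
  by (simp add: Dc_def)

lemma Om_Dc: "A \<in> Om m \<Longrightarrow> Dc m A \<in> Om (Suc m)"
  unfolding Dc_def using Om_cm[OF W_Om, of A m] by (simp add: Om_add Om_dl)

lemma Dc_add: "A \<in> S \<Longrightarrow> B \<in> S \<Longrightarrow> Dc m (A + B) = Dc m A + Dc m B"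
  by (simp add: Dc_def cm_def dl_add mul_add sg_add)

lemma Dc_minus: "A \<in> S \<Longrightarrow> Dc m (- A) = - Dc m A"
  by (simp add: Dc_def cm_def dl_minus sg_minus)

lemma Dc_diff: "A \<in> S \<Longrightarrow> B \<in> S \<Longrightarrow> Dc m (A - B) = Dc m A - Dc m B"
  using Dc_add[of A "- B"] by (simp add: Dc_minus)

lemma Dc_zero [simp]: "Dc m 0 = 0"
  using Dc_diff[of 0 0] by simp

lemma Dc_mul:
  assumes "A \<in> Om i" "B \<in> Om j"
  shows "Dc (i + j) (A \<star> B) = Dc i A \<star> B + sg i (A \<star> Dc j B)"
  using assms Om_S[OF assms(1)] Om_S[OF assms(2)]
  by (simp add: Dc_def cm_def dl_mul[OF assms(1)])
    (cases "even i"; cases "even j"; simp add: sg_def mul_simps)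

text \<open>The square of the covariant derivative is the commutator with
  \<open>dl W + W \<star> W\<close>, which is zero by \<open>flat_W\<close>.\<close>

lemma Dc_Dc:
  assumes "A \<in> Om m"
  shows "Dc (Suc m) (Dc m A) = 0"
  using Om_S[OF assms]
  by (simp add: Dc_def cm_def)
    (cases "even m"; simp add: sg_def mul_simps dl_add dl_diff dl_dl dl_mul[OF assms] dl_mul[OF W_Om] flat_W)

text \<open>The anticommutator of \<open>db\<close> and the covariant derivative is the commutator
  with the curvature \<open>F\<close>, a form of even degree.\<close>

lemma db_Dc:
  assumes "A \<in> Om m"
  shows "db (Dc m A) = F \<star> A - A \<star> F - Dc (Suc m) (db A)"
  using Om_S[OF assms]
  by (simp add: Dc_def cm_def)
    (cases "even m"; simp add: sg_def mul_simps db_add db_diff db_dl db_mul[OF assms] db_mul[OF W_Om])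

text \<open>Bianchi's identity, obtained by applying \<open>db\<close> to
  \<open>flat_W\<close>.\<close>

lemma Dc_F: "Dc 0 F = 0"
proof -
  have "dl F = - db (dl W)" using db_dl[of W] by simp
  also have "\<dots> = F \<star> W - W \<star> F"
    by (simp add: flat_W db_minus db_mul[OF W_Om]) (simp add: sg_def)
  finally show ?thesis by (simp add: Dc_def cm_def sg_def)
qed

text \<open>Up to the sign (-1)^i this is the brace of the theorem; the normalisation makes it a
  derivation of degree \<open>i\<close> and turns the bracket into that of a semidirect product. The
  index \<open>i + j + 1\<close> has the parity of the degree \<open>i + j - 1\<close> of a
  contraction.\<close>

definition lie :: "nat \<Rightarrow> nat \<Rightarrow> 'b \<Rightarrow> 'a \<Rightarrow> 'a" where
  "lie i j v A = sg i (Dc (i + j + 1) (ct v A)) + ct v (Dc j A)"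

lemma lie_cong: "even i = even i' \<Longrightarrow> even j = even j' \<Longrightarrow> lie i j v A = lie i' j' v A"
  using Dc_cong[of "i + j + 1" "i' + j' + 1"] Dc_cong[of j j'] by (simp add: lie_def sg_def)

lemma S_lie [simp]: "v \<in> V \<Longrightarrow> A \<in> S \<Longrightarrow> lie i j v A \<in> S"
  by (simp add: lie_def)

lemma Om_lie:
  assumes "v \<in> T i" "A \<in> Om j"
  shows "lie i j v A \<in> Om (i + j)"
proof -
  have "Dc (i + j + 1) (ct v A) \<in> Om (i + j)"
    using Om_Dc[of "ct v A" "i + j + 1"] Om_ct[OF assms] Om_cong[of _ "Suc (i + j + 1)" "i + j"] by simp
  moreover have "ct v (Dc j A) \<in> Om (i + j)"
    using Om_ct[OF assms(1) Om_Dc[OF assms(2)]] Om_cong[of _ "i + Suc (Suc j)" "i + j"] by simp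
  ultimately show ?thesis unfolding lie_def by (intro Om_add Om_sg)
qed

lemma lie_add: "v \<in> V \<Longrightarrow> A \<in> S \<Longrightarrow> B \<in> S \<Longrightarrow> lie i j v (A + B) = lie i j v A + lie i j v B"
  by (simp add: lie_def Dc_add ct_add sg_add)

lemma lie_minus: "v \<in> V \<Longrightarrow> A \<in> S \<Longrightarrow> lie i j v (- A) = - lie i j v A"
  by (simp add: lie_def Dc_minus ct_minus sg_minus)

lemma lie_diff: "v \<in> V \<Longrightarrow> A \<in> S \<Longrightarrow> B \<in> S \<Longrightarrow> lie i j v (A - B) = lie i j v A - lie i j v B"
  using lie_add[of v A "- B"] by (simp add: lie_minus)

lemma lie_sg: "v \<in> V \<Longrightarrow> A \<in> S \<Longrightarrow> lie i j v (sg k A) = sg k (lie i j v A)"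
  by (simp add: sg_def lie_minus)

lemma lie_0 [simp]: "lie i j v 0 = 0" "lie i j 0 A = 0"
  by (simp_all add: lie_def)

lemma lie_add_left:
  "v \<in> V \<Longrightarrow> w \<in> V \<Longrightarrow> A \<in> S \<Longrightarrow> lie i j (v + w) A = lie i j v A + lie i j w A"
  by (simp add: lie_def ct_add_left Dc_add sg_add)

lemma lie_sum:
  assumes "v \<in> V" "finite I" "\<And>p. p \<in> I \<Longrightarrow> f p \<in> S"
  shows "lie i j v (\<Sum>p\<in>I. f p) = (\<Sum>p\<in>I. lie i j v (f p))"
proof -
  have "(\<Sum>p\<in>I. f p) \<in> S \<and> lie i j v (\<Sum>p\<in>I. f p) = (\<Sum>p\<in>I. lie i j v (f p))"
    using assms(2,3) by (induction I rule: finite_induct) (auto simp: lie_add assms(1))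
  then show ?thesis by simp
qed

text \<open>A graded commutator of the two derivations \<open>Dc\<close> and \<open>ct v\<close> is
  again a derivation, here of the parity of \<open>i\<close>.\<close>

lemma lie_mul:
  assumes "v \<in> T i" "A \<in> Om p" "B \<in> Om q"
  shows "lie i (p + q) v (A \<star> B) = lie i p v A \<star> B + sg (i * p) (A \<star> lie i q v B)"
proof -
  have S: "A \<in> S" "B \<in> S" "v \<in> V" using assms Om_S T_V by auto
  have cA: "ct v A \<in> Om (i + Suc p)" and cB: "ct v B \<in> Om (i + Suc q)" using assms Om_ct by auto
  have "Dc (i + (p + q) + 1) (ct v A \<star> B) = Dc (i + Suc p) (ct v A) \<star> B + sg (i + Suc p) (ct v A \<star> Dc q B)"
    using Dc_mul[OF cA assms(3)] by (simp add: add.assoc)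
  moreover have "Dc (i + (p + q) + 1) (A \<star> ct v B) = Dc p A \<star> ct v B + sg p (A \<star> Dc (i + Suc q) (ct v B))"
    using Dc_mul[OF assms(2) cB] by (simp add: add.left_commute)
  ultimately show ?thesis
    using S
    by (simp add: lie_def Dc_mul[OF assms(2,3)] ct_mul[OF assms(1,2)] ct_mul[OF assms(1) Om_Dc[OF assms(2)]]
        Dc_add ct_add)
      (cases "even i"; cases "even p"; simp add: sg_def Dc_minus ct_minus ct_mul[OF assms(1,2)] mul_simps)
qed

text \<open>By \<open>Dc_Dc\<close> both sides reduce to the covariant derivative of the contraction
  of \<open>Dc j A\<close>.\<close>

lemma Dc_lie:
  assumes "v \<in> T i" "A \<in> Om j"
  shows "Dc (i + j) (lie i j v A) = sg i (lie i (Suc j) v (Dc j A))"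
proof -
  have S: "A \<in> S" "v \<in> V" using assms Om_S T_V by auto
  have "Dc (i + j) (Dc (i + j + 1) (ct v A)) = 0"
    using Dc_Dc[OF Om_ct[OF assms]] Dc_cong[of "i + j" "Suc (i + Suc j)"] by simp
  then show ?thesis
    using S Dc_cong[of "i + Suc j + 1" "i + j"]
    by (simp add: lie_def Dc_add Dc_Dc[OF assms(2)] sg_add)
      (cases "even i"; simp add: sg_def Dc_minus)
qed

text \<open>Separates the derivative from the action of the connection matrix: the products of
  \<open>W\<close> with the contracted \<open>A\<close> cancel, and \<open>W\<close> survives only
  as \<open>ct v W\<close>.\<close>

lemma lie_eq_flat:
  assumes "v \<in> T i" "A \<in> Om j"
  shows "lie i j v A = sg i (dl (ct v A)) + ct v (dl A) + cm i j (ct v W) A"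
  using Om_S[OF assms(2)] T_V[OF assms(1)]
  by (simp add: lie_def Dc_def cm_def ct_add ct_diff ct_mul[OF assms(1) W_Om] sg_add)
    (cases "even i"; cases "even j"; simp add: sg_def ct_minus ct_mul[OF assms] mul_simps)

text \<open>The flat Cartan identity carries over because \<open>ct w (ct v W) = 0\<close>:
  contraction by \<open>w\<close> commutes, up to sign, with the commutator by \<open>ct v W\<close>
  that \<open>lie_eq_flat\<close> adds.\<close>

lemma lie_ct:
  assumes "v \<in> T i" "w \<in> T j" "A \<in> Om k"
  shows "lie i (j + Suc k) v (ct w A) = sg (i * (j + 1)) (ct w (lie i k v A)) + ct (SN v w) A"
proof -
  have S: "A \<in> S" "v \<in> V" "w \<in> V" using assms Om_S T_V by auto
  have P: "ct v W \<in> Om i" using Om_cong[OF Om_ct[OF assms(1) W_Om], of i] by simp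
  show ?thesis
    unfolding lie_eq_flat[OF assms(1) Om_ct[OF assms(2,3)]] lie_eq_flat[OF assms(1,3)] ct_add sg_add
    using lie_ct_flat[OF assms(1,2) S(1)] ct_ct_W[OF S(2,3)]
    by (simp add: cm_def ct_diff ct_add)
      (cases "even i"; cases "even j"; cases "even k";
        simp add: sg_def ct_minus ct_mul[OF assms(2) P] ct_mul[OF assms(2,3)] mul_simps)
qed

text \<open>\<open>lie w A\<close> consists of a derivative of \<open>ct w A\<close> and a
  contraction of \<open>Dc k A\<close>. Moving \<open>lie v\<close> past \<open>Dc\<close> costs
  nothing by \<open>Dc_lie\<close>, and past \<open>ct w\<close> it costs \<open>ct (SN v w)\<close>
  by \<open>lie_ct\<close>.\<close>

lemma lie_lie:
  assumes "v \<in> T i" "w \<in> T j" "A \<in> Om k"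
  shows "lie i (j + k) v (lie j k w A) = sg (i * j) (lie j (i + k) w (lie i k v A)) + lie (i + j) k (SN v w) A"
proof -
  have S: "A \<in> S" "v \<in> V" "w \<in> V" using assms Om_S T_V by auto
  have 1: "lie i (j + k) v (Dc (j + k + 1) (ct w A)) =
      sg i (Dc (i + (j + k + 1)) (lie i (j + Suc k) v (ct w A)))"
    using Dc_lie[OF assms(1) Om_ct[OF assms(2,3)]] lie_cong[of i i "Suc (j + Suc k)" "j + k"] by simp
  have 2: "lie i (j + k) v (ct w (Dc k A)) = sg (i * (j + 1)) (ct w (lie i (Suc k) v (Dc k A))) + ct (SN v w) (Dc k A)"
    using lie_ct[OF assms(1,2) Om_Dc[OF assms(3)]] lie_cong[of i i "j + Suc (Suc k)" "j + k"] by simp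
  have 3: "lie j (i + k) w (lie i k v A) = sg j (Dc (j + (i + k) + 1) (ct w (lie i k v A))) + sg i (ct w (lie i (Suc k) v (Dc k A)))"
    unfolding lie_def[of j "i + k"] Dc_lie[OF assms(1,3)] by (simp add: sg_def ct_minus)
  have 4: "Dc (i + (j + k + 1)) (lie i (j + Suc k) v (ct w A)) =
      sg (i * (j + 1)) (Dc (j + (i + k) + 1) (ct w (lie i k v A))) + Dc (i + j + k + 1) (ct (SN v w) A)"
    unfolding lie_ct[OF assms]
    using S T_V[OF T_SN[OF assms(1,2)]]
    by (simp add: Dc_add add.assoc add.left_commute)
      (cases "even i"; cases "even j"; simp add: sg_def Dc_minus)
  show ?thesis
    unfolding lie_def[of j k w] lie_def[of "i + j" k] 3
    using S 1 2 4
    by (simp add: lie_add lie_sg sg_add)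
      (cases "even i"; cases "even j"; simp add: sg_def)
qed

text \<open>The curvature terms of \<open>db_Dc\<close> meet the contraction by \<open>v\<close>.
  Since contraction is a derivation, those in which \<open>A\<close> is contracted cancel and the
  commutator with \<open>ct v F\<close> is left.\<close>

lemma db_lie:
  assumes "v \<in> T i" "A \<in> Om k"
  shows "db (lie i k v A) = lie (Suc i) k (vb v) A + sg i (lie i (Suc k) v (db A)) - cm (Suc i) k (sg i (ct v F)) A"
proof -
  have S: "A \<in> S" "v \<in> V" "vb v \<in> V" using assms Om_S T_V T_V[OF T_vb] by auto
  have F: "ct v (F \<star> A) = ct v F \<star> A + F \<star> ct v A" "ct v (A \<star> F) = ct v A \<star> F + sg ((i + 1) * k) (A \<star> ct v F)"
    using ct_mul[OF assms(1) F_Om, of A] ct_mul[OF assms, of F] by (simp_all add: sg_def)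
  have 1: "db (Dc (i + k + 1) (ct v A)) = F \<star> ct v A - ct v A \<star> F - Dc (i + k) (db (ct v A))"
    using db_Dc[OF Om_ct[OF assms]] Dc_cong[of "Suc (i + Suc k)" "i + k"] by simp
  have 2: "Dc (i + k) (db (ct v A)) = Dc (Suc i + k + 1) (ct (vb v) A) - sg i (Dc (i + Suc k + 1) (ct v (db A)))"
    using S Dc_cong[of "i + k" "Suc i + k + 1"] Dc_cong[of "i + k" "i + Suc k + 1"]
    by (simp add: db_ct[OF assms(1)] Dc_diff) (simp add: sg_def Dc_minus)
  have 3: "db (ct v (Dc k A)) = ct (vb v) (Dc k A) - sg i (ct v (F \<star> A - A \<star> F - Dc (Suc k) (db A)))"
    using S by (simp add: db_ct[OF assms(1)] db_Dc[OF assms(2)])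
  have 4: "db (lie i k v A) = sg i (db (Dc (i + k + 1) (ct v A))) + db (ct v (Dc k A))"
    unfolding lie_def using S by (simp add: db_add) (simp add: sg_def db_minus)
  show ?thesis
    unfolding 4 1 2 3 lie_def[of "Suc i"] lie_def[of i "Suc k"]
    by (simp add: ct_diff F cm_def)
      (cases "even i"; cases "even k"; simp add: sg_def mul_simps)
qed

text \<open>The map from \<open>v\<close> to \<open>ct v F\<close> is a cocycle for the action
  \<open>lie\<close>. Bianchi's identity turns \<open>lie v F\<close> into a derivative of
  \<open>ct v F\<close>, and \<open>ct_ct_F\<close> leaves only one half of
  \<open>lie w (ct v F)\<close>.\<close>

lemma lie_ct_F:
  assumes "v \<in> T i" "w \<in> T j"
  shows "lie i (Suc j) v (ct w F) = sg (i * j) (lie j (Suc i) w (ct v F)) + ct (SN v w) F"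
proof -
  have S: "v \<in> V" "w \<in> V" using assms T_V by auto
  have "lie i (Suc j) v (ct w F) = sg (i * (j + 1)) (ct w (lie i 0 v F)) + ct (SN v w) F"
    using lie_ct[OF assms F_Om] by simp
  moreover have "lie i 0 v F = sg i (Dc (i + 1) (ct v F))"
    by (simp add: lie_def Dc_F)
  moreover have "lie j (Suc i) w (ct v F) = ct w (Dc (i + 1) (ct v F))"
    by (simp add: lie_def ct_ct_F S)
  ultimately show ?thesis
    by (cases "even i"; cases "even j"; simp add: sg_def ct_minus)
qed

text \<open>The first component of the semidirect product bracket in the normalisation of
  \<open>lie\<close>; its second component is \<open>SN v w\<close>.\<close>

definition brE :: "nat \<Rightarrow> nat \<Rightarrow> 'a \<Rightarrow> 'b \<Rightarrow> 'a \<Rightarrow> 'b \<Rightarrow> 'a" where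
  "brE i j A v B w = lie i j v B - sg (i * j) (lie j i w A) - cm i j A B"

lemma Om_brE:
  assumes "A \<in> Om i" "v \<in> T i" "B \<in> Om j" "w \<in> T j"
  shows "brE i j A v B w \<in> Om (i + j)"
  unfolding brE_def using Om_lie[OF assms(2,3)] Om_lie[OF assms(4,1)] Om_cm[OF assms(1,3)]
  by (simp add: Om_diff Om_sg add.commute)

lemma brE_antisym: "brE i j A v B w = - sg (i * j) (brE j i B w A v)"
  by (cases "even i"; cases "even j"; simp add: brE_def cm_def sg_def)

lemma brE_add_left:
  "w \<in> V \<Longrightarrow> A \<in> S \<Longrightarrow> A' \<in> S \<Longrightarrow> brE i j (A + A') v B w = brE i j A v B w + brE i j A' 0 B w"
  by (cases "even (i * j)"; simp add: brE_def cm_def sg_def lie_add mul_add)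

lemma brE_add_right:
  "v \<in> V \<Longrightarrow> B \<in> S \<Longrightarrow> B' \<in> S \<Longrightarrow> brE i j A v (B + B') w = brE i j A v B w + brE i j A v B' 0"
  by (cases "even (i * j)"; simp add: brE_def cm_def sg_def lie_add mul_add)

lemma brE_add:
  assumes "v \<in> V" "v' \<in> V" "w \<in> V" "A \<in> S" "A' \<in> S" "B \<in> S"
  shows "brE i j (A + A') (v + v') B w = brE i j A v B w + brE i j A' v' B w"
  using assms by (cases "even (i * j)"; simp add: brE_def cm_def sg_def lie_add lie_add_left mul_add)

text \<open>The usual verification for a semidirect product: \<open>lie_lie\<close> says that the
  vector part acts, \<open>lie_mul\<close> that it acts by derivations, and associativity gives the
  Jacobi identity of the commutator.\<close>

lemma brE_Jacobi:
  assumes "A \<in> Om i" "u \<in> T i" "B \<in> Om j" "v \<in> T j" "C \<in> Om k" "w \<in> T k"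
  shows "brE i (j + k) A u (brE j k B v C w) (SN v w) =
    brE (i + j) k (brE i j A u B v) (SN u v) C w +
    sg (i * j) (brE j (i + k) B v (brE i k A u C w) (SN u w))"
proof -
  have S [simp]: "A \<in> S" "B \<in> S" "C \<in> S" "u \<in> V" "v \<in> V" "w \<in> V" using assms Om_S T_V by auto
  note ll =
    lie_lie[OF assms(4,6,1)] lie_lie[OF assms(2,4,5)] lie_lie[OF assms(2,6,3)]
  have m: "lie i (j + k) u (B \<star> C) = lie i j u B \<star> C + sg (i * j) (B \<star> lie i k u C)"
    "lie i (j + k) u (C \<star> B) = lie i k u C \<star> B + sg (i * k) (C \<star> lie i j u B)"
    "lie k (i + j) w (A \<star> B) = lie k i w A \<star> B + sg (k * i) (A \<star> lie k j w B)"
    "lie k (i + j) w (B \<star> A) = lie k j w B \<star> A + sg (k * j) (B \<star> lie k i w A)"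
    "lie j (i + k) v (A \<star> C) = lie j i v A \<star> C + sg (j * i) (A \<star> lie j k v C)"
    "lie j (i + k) v (C \<star> A) = lie j k v C \<star> A + sg (j * k) (C \<star> lie j i v A)"
    using lie_mul[OF assms(2,3,5)] lie_mul[OF assms(2,5,3)] lie_mul[OF assms(6,1,3)]
      lie_mul[OF assms(6,3,1)] lie_mul[OF assms(4,1,5)] lie_mul[OF assms(4,5,1)]
    by (simp_all add: add.commute)
  have l: "lie (j + k) i (SN v w) A = lie j (k + i) v (lie k i w A) - sg (j * k) (lie k (j + i) w (lie j i v A))"
    "lie (i + j) k (SN u v) C = lie i (j + k) u (lie j k v C) - sg (i * j) (lie j (i + k) v (lie i k u C))"
    "lie (i + k) j (SN u w) B = lie i (k + j) u (lie k j w B) - sg (i * k) (lie k (i + j) w (lie i j u B))"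
    unfolding ll by simp_all
  show ?thesis
    unfolding brE_def cm_def l
    by (simp add: lie_diff lie_sg m add.commute)
      (cases "even i"; cases "even j"; cases "even k"; simp add: sg_def mul_simps)
qed

text \<open>The differential without Higgs field is a derivation of the bracket. The commutator left
  over by \<open>db_lie\<close> is the bracket with \<open>ct v F\<close>, and the term
  \<open>ct (SN v w) F\<close> is matched by the cocycle property \<open>lie_ct_F\<close>.\<close>

lemma db_brE:
  assumes "A \<in> Om i" "v \<in> T i" "B \<in> Om j" "w \<in> T j"
  shows "db (brE i j A v B w) + sg (i + j) (ct (SN v w) F) =
    brE (Suc i) j (db A + sg i (ct v F)) (vb v) B w +
    sg i (brE i (Suc j) A v (db B + sg j (ct w F)) (vb w))"
proof -
  have S [simp]: "A \<in> S" "B \<in> S" "v \<in> V" "w \<in> V" "vb v \<in> V" "vb w \<in> V"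
    using assms Om_S T_V T_V[OF T_vb] by auto
  have F: "ct (SN v w) F = lie i (Suc j) v (ct w F) - sg (i * j) (lie j (Suc i) w (ct v F))"
    using lie_ct_F[OF assms(2,4)] by simp
  show ?thesis
    unfolding brE_def F
    by (simp add: db_diff lie_add lie_sg)
      (cases "even i"; cases "even j";
        simp add: sg_def cm_def db_add db_minus db_diff db_mul[OF assms(1)] db_mul[OF assms(3)]
          db_lie[OF assms(2,3)] db_lie[OF assms(4,1)] mul_simps lie_minus)
qed

end

section \<open>The twist by the Higgs field\<close>

locale super_higgs = super_connection +
  fixes \<theta> :: 'a
  assumes \<theta>_Om: "\<theta> \<in> Om 1"
    and db_\<theta>: "db \<theta> = 0"
    and \<theta>_\<theta>: "\<theta> \<star> \<theta> = 0"
begin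

definition dE :: "nat \<Rightarrow> 'a \<Rightarrow> 'b \<Rightarrow> 'a" where
  "dE i A v = db A + sg i (ct v F) + cm 1 i \<theta> A + sg i (lie i 1 v \<theta>)"

lemma dE_add:
  assumes "v \<in> V" "v' \<in> V" "A \<in> S" "A' \<in> S"
  shows "dE i (A + A') (v + v') = dE i A v + dE i A' v'"
  using assms Om_S[OF \<theta>_Om] F_Om Om_S
  by (simp add: dE_def db_add ct_add_left cm_def mul_add lie_add_left sg_add)

lemma \<theta>_S [simp]: "\<theta> \<in> S" using \<theta>_Om Om_S by blast

text \<open>The Higgs part of the differential is the adjoint action of the Maurer--Cartan element
  \<open>(- \<theta>, 0)\<close>.\<close>

lemma brE_\<theta>: "brE 1 i (- \<theta>) 0 A v = cm 1 i \<theta> A + sg i (lie i 1 v \<theta>)" if "v \<in> V"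
  using that by (cases "even i"; simp add: brE_def cm_def sg_def lie_minus)

lemma dE_eq: "v \<in> V \<Longrightarrow> dE i A v = (db A + sg i (ct v F)) + brE 1 i (- \<theta>) 0 A v"
  by (simp only: dE_def brE_\<theta> add.assoc)

text \<open>By \<open>dE_eq\<close> the differential is the sum of the derivation of
  \<open>db_brE\<close> and an inner one; for the latter the Leibniz rule is the Jacobi
  identity.\<close>

lemma dE_Leibniz:
  assumes "A \<in> Om i" "v \<in> T i" "B \<in> Om j" "w \<in> T j"
  shows "dE (i + j) (brE i j A v B w) (SN v w) =
    brE (Suc i) j (dE i A v) (vb v) B w + sg i (brE i (Suc j) A v (dE j B w) (vb w))"
proof -
  have S [simp]: "A \<in> S" "B \<in> S" "v \<in> V" "w \<in> V" "SN v w \<in> V"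
    using assms Om_S T_V T_V[OF T_SN] by auto
  have S': "brE 1 i (- \<theta>) 0 A v \<in> S" "brE 1 j (- \<theta>) 0 B w \<in> S"
    using Om_brE[OF Om_minus[OF \<theta>_Om] T_0] assms Om_S by blast+
  have "brE 1 (i + j) (- \<theta>) 0 (brE i j A v B w) (SN v w) =
    brE (Suc i) j (brE 1 i (- \<theta>) 0 A v) 0 B w + sg i (brE i (Suc j) A v (brE 1 j (- \<theta>) 0 B w) 0)"
    using brE_Jacobi[OF Om_minus[OF \<theta>_Om] T_0 assms] by simp
  moreover have "brE (Suc i) j (dE i A v) (vb v) B w =
      brE (Suc i) j (db A + sg i (ct v F)) (vb v) B w + brE (Suc i) j (brE 1 i (- \<theta>) 0 A v) 0 B w"
    unfolding dE_eq[OF S(3)] by (rule brE_add_left) (use S' in simp_all)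
  moreover have "brE i (Suc j) A v (dE j B w) (vb w) =
      brE i (Suc j) A v (db B + sg j (ct w F)) (vb w) + brE i (Suc j) A v (brE 1 j (- \<theta>) 0 B w) 0"
    unfolding dE_eq[OF S(4)] by (rule brE_add_right) (use S' in simp_all)
  ultimately show ?thesis
    unfolding dE_eq[OF S(5)] db_brE[OF assms] by (simp add: sg_add)
qed

lemma dE_dE:
  assumes "A \<in> Om i" "v \<in> T i"
  shows "dE (Suc i) (dE i A v) (vb v) = 0"
proof -
  have S [simp]: "A \<in> S" "v \<in> V" "vb v \<in> V" using assms Om_S T_V T_V[OF T_vb] by auto
  \<comment> \<open>The square of the part without \<theta>: \<open>db_ct\<close> produces the term
    in \<open>vb v\<close> with the cancelling sign, and \<open>db F = 0\<close> because
    \<open>F = db W\<close>.\<close>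
  have "db (db A + sg i (ct v F)) + sg (Suc i) (ct (vb v) F) = 0"
    by (cases "even i"; simp add: sg_def db_add db_diff db_minus db_db db_ct[OF assms(2)])
  moreover have "db (cm 1 i \<theta> A) + cm 1 (Suc i) \<theta> (db A) = 0"
    by (cases "even i"; simp add: cm_def sg_def db_add db_diff db_mul[OF \<theta>_Om] db_mul[OF assms(1)] db_\<theta>)
  moreover have "cm 1 (Suc i) \<theta> (cm 1 i \<theta> A) = 0"
  proof -
    have "\<theta> \<star> (\<theta> \<star> C) = 0" for C using \<theta>_\<theta> mul_assoc[of \<theta> \<theta> C] by simp
    then show ?thesis by (cases "even i"; simp add: cm_def sg_def mul_simps \<theta>_\<theta>)
  qed
  \<comment> \<open>With \<open>db \<theta> = 0\<close>, the defect in \<open>db_lie\<close> is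
    exactly the commutator of \<theta> with the contracted curvature.\<close>
  moreover have "cm 1 (Suc i) \<theta> (sg i (ct v F)) + db (sg i (lie i 1 v \<theta>)) + sg (Suc i) (lie (Suc i) 1 (vb v) \<theta>) = 0"
    by (cases "even i"; simp add: sg_def db_minus db_lie[OF assms(2) \<theta>_Om, unfolded One_nat_def] db_\<theta> cm_def)
  \<comment> \<open>As \<open>lie\<close> is a derivation, this commutator is up to sign
    \<open>lie\<close> applied to \<open>\<theta> \<star> \<theta> = 0\<close>.\<close>
  moreover have "cm 1 (Suc i) \<theta> (sg i (lie i 1 v \<theta>)) = 0"
    using lie_mul[OF assms(2) \<theta>_Om \<theta>_Om]
    by (cases "even i"; simp add: sg_def cm_def \<theta>_\<theta>)
      (metis add.commute add_eq_0_iff minus_minus)+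
  moreover have "dE (Suc i) (dE i A v) (vb v) =
      (db (db A + sg i (ct v F)) + sg (Suc i) (ct (vb v) F)) +
      (db (cm 1 i \<theta> A) + cm 1 (Suc i) \<theta> (db A)) + cm 1 (Suc i) \<theta> (cm 1 i \<theta> A) +
      (cm 1 (Suc i) \<theta> (sg i (ct v F)) + db (sg i (lie i 1 v \<theta>)) + sg (Suc i) (lie (Suc i) 1 (vb v) \<theta>)) +
      cm 1 (Suc i) \<theta> (sg i (lie i 1 v \<theta>))"
  proof -
    have cm_add: "cm (Suc 0) (Suc i) \<theta> (X + Y) = cm (Suc 0) (Suc i) \<theta> X + cm (Suc 0) (Suc i) \<theta> Y" for X Y
      by (simp add: cm_def mul_add sg_add)
    show ?thesis by (simp add: dE_def db_add cm_add)
  qed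
  ultimately show ?thesis by simp
qed

end

text \<open>The calculus lives on additive groups without scalars. Multiplication by one fixed
  complex number enters as a pair of additive maps \<open>sA\<close> and \<open>sV\<close> that pass
  through the operations, which suffices for homogeneity of bracket and differential.\<close>

locale super_scaling = super_higgs +
  fixes sA :: "'a \<Rightarrow> 'a" and sV :: "'b \<Rightarrow> 'b"
  assumes sA_add: "sA (A + B) = sA A + sA B" and sA_minus: "sA (- A) = - sA A"
    and sA_mul: "sA A \<star> B = sA (A \<star> B)" "A \<star> sA B = sA (A \<star> B)"
    and sA_dl: "A \<in> S \<Longrightarrow> dl (sA A) = sA (dl A)" and sA_db: "A \<in> S \<Longrightarrow> db (sA A) = sA (db A)"
    and sA_ct: "ct v (sA A) = sA (ct v A)" "ct (sV v) A = sA (ct v A)"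
begin

lemma sA_diff: "sA (A - B) = sA A - sA B"
  using sA_add[of A "- B"] by (simp add: sA_minus)

lemma sA_sg: "sA (sg i A) = sg i (sA A)"
  by (simp add: sg_def sA_minus)

lemma cm_scale: "cm i j (sA A) B = sA (cm i j A B)" "cm i j A (sA B) = sA (cm i j A B)"
  by (simp_all add: cm_def sA_mul sA_diff sA_sg)

lemma Dc_scale: "A \<in> S \<Longrightarrow> Dc m (sA A) = sA (Dc m A)"
  by (simp add: Dc_def sA_dl cm_scale sA_add)

lemma lie_scale:
  "v \<in> V \<Longrightarrow> A \<in> S \<Longrightarrow> lie i j v (sA A) = sA (lie i j v A)"
  "v \<in> V \<Longrightarrow> A \<in> S \<Longrightarrow> lie i j (sV v) A = sA (lie i j v A)"
  by (simp_all add: lie_def sA_ct Dc_scale sA_add sA_sg)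

lemma brE_scale:
  assumes "v \<in> V" "w \<in> V" "A \<in> S" "B \<in> S"
  shows "brE i j (sA A) (sV v) B w = sA (brE i j A v B w)" "brE i j A v (sA B) (sV w) = sA (brE i j A v B w)"
  using assms by (simp_all add: brE_def lie_scale cm_scale sA_diff sA_sg)

lemma dE_scale:
  assumes "v \<in> V" "A \<in> S"
  shows "dE i (sA A) (sV v) = sA (dE i A v)"
  using assms by (simp add: dE_def sA_db sA_ct lie_scale cm_scale sA_add sA_sg)

end

section \<open>Matrices of forms on an open set\<close>

lemma mwedge_assoc: "mwedge (mwedge A B) C = mwedge A (mwedge B C)"
  unfolding mwedge_def[abs_def] fun_eq_iff wedge_sum_left wedge_sum_right wedge_assoc sum_fun_apply
  by (intro allI sum.swap)

lemma mwedge_linear: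
  "mwedge A (B + C) = mwedge A B + mwedge A C" "mwedge (A + B) C = mwedge A C + mwedge B C"
  "mwedge A (- B) = - mwedge A B" "mwedge (- A) B = - mwedge A B"
  by (simp_all add: fun_eq_iff mwedge_def wedge_add_right wedge_add_left wedge_minus_left wedge_minus_right
      sum.distrib sum_negf sum_fun_apply)

lemma contr_linear:
  "contr v (A + B) = contr v A + contr v B" "contr v (- A) = - contr v A" "contr v 0 = 0" "contr 0 A = 0"
  by (simp_all add: fun_eq_iff contr_eq_ctr ctr_linear)

definition rs :: "(complex^'n) set \<Rightarrow> 'n form \<Rightarrow> 'n form" where
  "rs D \<omega> y vs = (if y \<in> D then \<omega> y vs else 0)"

lemma wedge_cong_at:
  "(\<And>vs. \<alpha> y vs = \<alpha>' y vs) \<Longrightarrow> (\<And>vs. \<beta> y vs = \<beta>' y vs) \<Longrightarrow> wedge \<alpha> \<beta> y vs = wedge \<alpha>' \<beta>' y vs"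
  by (simp add: wedge_def)

lemma iota_cong_at: "(\<And>vs. \<alpha> y vs = \<alpha>' y vs) \<Longrightarrow> iota a \<alpha> y vs = iota a \<alpha>' y vs"
  by (simp add: iota_def)

lemma contr_cong_at:
  "(\<And>a vs. v a y vs = v' a y vs) \<Longrightarrow> (\<And>i j vs. A i j y vs = A' i j y vs) \<Longrightarrow> contr v A i j y vs = contr v' A' i j y vs"
  unfolding contr_def sum_fun_apply by (intro sum.cong refl wedge_cong_at iota_cong_at) auto

lemma mwedge_cong_at:
  "(\<And>i j vs. A i j y vs = A' i j y vs) \<Longrightarrow> (\<And>i j vs. B i j y vs = B' i j y vs) \<Longrightarrow> mwedge A B i j y vs = mwedge A' B' i j y vs"
  unfolding mwedge_def sum_fun_apply by (intro sum.cong refl wedge_cong_at) auto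

context open_domain
begin

lemma zo_rs: "zo \<omega> \<Longrightarrow> rs D \<omega> = \<omega>"
  by (auto simp: fun_eq_iff rs_def zo_def)

lemma zo_rs_zo [simp]: "zo (rs D \<omega>)"
  by (simp add: zo_def rs_def)

lemma pd_rs [simp]: "pd k a (rs D \<omega>) = pd k a \<omega>"
proof -
  have "pdf k a (\<lambda>u. rs D \<omega> u vs) y = pdf k a (\<lambda>u. \<omega> u vs) y" if "y \<in> D" for y vs
    by (rule pdf_cong_open[OF open_D that]) (simp add: rs_def)
  then show ?thesis by (simp add: fun_eq_iff pd_def)
qed

lemma smo_rs [simp]: "smo \<omega> \<Longrightarrow> smo (rs D \<omega>)"
proof -
  assume *: "smo \<omega>"
  have "smooth_on D (\<lambda>y. rs D \<omega> y vs)" for vs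
    using smo_smooth[OF *, of vs] smooth_on_cong[OF open_D, of "\<lambda>y. rs D \<omega> y vs" "\<lambda>y. \<omega> y vs"]
    by (simp add: rs_def)
  moreover have "alt (rs D \<omega>)"
  proof (rule altI)
    fix y us v w vs
    show "rs D \<omega> y (us @ v # w # vs) = - rs D \<omega> y (us @ w # v # vs)"
      using altD[OF smo_alt[OF *], of y us v w vs] by (simp add: rs_def)
  qed
  ultimately show ?thesis by (simp add: smo_def)
qed

lemma sm_rs [simp]: "smo \<omega> \<Longrightarrow> sm (rs D \<omega>)"
  by (simp add: sm_def)

lemma del_at: "y \<in> D \<Longrightarrow> del \<omega> y vs = rdel \<omega> y vs"
  unfolding del_def rd_def sum_fun_apply
  by (intro sum.cong refl wedge_cong_at) (simp_all add: pd_at coeff_dz_def pdz_eq_pdf)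

lemma delbar_at: "y \<in> D \<Longrightarrow> delbar \<omega> y vs = rdelb \<omega> y vs"
  unfolding delbar_def rd_def sum_fun_apply
  by (intro sum.cong refl wedge_cong_at) (simp_all add: pd_at coeff_dzbar_def pdzbar_eq_pdf)

lemma SN_bracket_at:
  assumes "y \<in> D"
  shows "SN_bracket \<phi> \<psi> b y vs = SN (\<lambda>a. rs D (\<phi> a)) (\<lambda>a. rs D (\<psi> a)) b y vs"
  unfolding SN_bracket_def SN_def sum_fun_apply fun_diff_def using assms
  by (intro sum.cong refl arg_cong2[of _ _ _ _ "(-)"] wedge_cong_at)
    (simp_all add: pd_at coeff_dz_def pdz_eq_pdf rs_def)

definition mS :: "('n, 'r::finite) mform set" where
  "mS = {A. \<forall>i j. sm (A i j)}"

definition mOm :: "nat \<Rightarrow> ('n, 'r::finite) mform set" where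
  "mOm m = {A. \<forall>i j. sf m (A i j)}"

definition mdl :: "('n, 'r::finite) mform \<Rightarrow> ('n, 'r) mform" where
  "mdl A i j = rdel (A i j)"

definition mdb :: "('n, 'r::finite) mform \<Rightarrow> ('n, 'r) mform" where
  "mdb A i j = rdelb (A i j)"

definition vV :: "'n vform set" where
  "vV = {v. \<exists>i. vf i v}"

definition vb :: "'n vform \<Rightarrow> 'n vform" where
  "vb v a = rdelb (v a)"

lemma mS_D: "A \<in> mS \<Longrightarrow> smo (A i j)" "A \<in> mS \<Longrightarrow> sm (A i j)"
  by (auto simp: mS_def)

lemma mOm_D: "A \<in> mOm m \<Longrightarrow> par m (A i j)" "A \<in> mOm m \<Longrightarrow> smo (A i j)" "A \<in> mOm m \<Longrightarrow> sf m (A i j)"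
  by (auto simp: mOm_def sf_def)

lemma mwedge_rd:
  assumes "cst w" "A \<in> mOm m" "B \<in> mS"
  shows "rd k w (mwedge A B i j) =
    (\<Sum>l\<in>UNIV. wedge (rd k w (A i l)) (B l j)) + sg m (\<Sum>l\<in>UNIV. wedge (A i l) (rd k w (B l j)))"
proof -
  have "rd k w (mwedge A B i j) = (\<Sum>l\<in>UNIV. rd k w (wedge (A i l) (B l j)))"
    unfolding mwedge_def by (rule rd_sum) (simp add: mS_D[OF assms(3)] mOm_D[OF assms(2)])
  also have "\<dots> = (\<Sum>l\<in>UNIV. wedge (rd k w (A i l)) (B l j) + sg m (wedge (A i l) (rd k w (B l j))))"
    by (intro sum.cong refl rd_wedge assms mOm_D[OF assms(2)] mS_D[OF assms(3)])
  finally show ?thesis by (simp add: sum.distrib sg_sum)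
qed

lemma lie_ct_flat:
  assumes "vf i v" "vf j w" "A \<in> mS"
  shows "sg i (mdl (contr v (contr w A))) + contr v (mdl (contr w A)) =
    sg (i * (j + 1)) (contr w (sg i (mdl (contr v A)) + contr v (mdl A))) + contr (SN v w) A"
proof (intro ext)
  fix k l y vs
  have e: "(sg i (mdl (contr v B)) + contr v (mdl B)) k l = lieS i v (B k l)" for B k l
    by (simp add: sg_apply mdl_def contr_eq_ctr lieS_def)
  have "(sg i (mdl (contr v (contr w A))) + contr v (mdl (contr w A))) k l = lieS i v (ctr w (A k l))"
    unfolding e by (simp add: contr_eq_ctr)
  also have "\<dots> = sg (i * (j + 1)) (ctr w (lieS i v (A k l))) + ctr (SN v w) (A k l)"
    by (rule lieS_ctr[OF assms(1,2) mS_D(1)[OF assms(3)]])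
  also have "\<dots> = (sg (i * (j + 1)) (contr w (sg i (mdl (contr v A)) + contr v (mdl A))) + contr (SN v w) A) k l"
    by (simp only: plus_fun_apply sg_apply contr_eq_ctr mdl_def lieS_def)
  finally show "(sg i (mdl (contr v (contr w A))) + contr v (mdl (contr w A))) k l y vs =
    (sg (i * (j + 1)) (contr w (sg i (mdl (contr v A)) + contr v (mdl A))) + contr (SN v w) A) k l y vs"
    by (simp only:)
qed

text \<open>Graded commutativity is lost for matrices, which is why the calculus asks only for an
  associative, biadditive product; each of its laws is checked entry by entry from the scalar
  ones.\<close>

lemma super_calculus_mform:
  "super_calculus (mS :: ('n, 'r::finite) mform set) mOm vV (\<lambda>i. {v. vf i v}) mwedge mdl mdb contr vb SN"
proof
  fix A B :: "('n, 'r) mform" and v w u :: "'n vform" and i j k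
  show "0 \<in> (mS :: ('n, 'r) mform set)" "0 \<in> (mOm i :: ('n, 'r) mform set)" by (simp_all add: mS_def mOm_def)
  show "A \<in> mS \<Longrightarrow> B \<in> mS \<Longrightarrow> A + B \<in> mS" by (simp add: mS_def)
  show "A \<in> mS \<Longrightarrow> - A \<in> mS" by (simp add: mS_def)
  show "A \<in> mS \<Longrightarrow> B \<in> mS \<Longrightarrow> mwedge A B \<in> mS" by (simp add: mS_def mwedge_def)
  show "A \<in> mS \<Longrightarrow> mdl A \<in> mS" by (simp add: mS_def mdl_def cst_dz)
  show "A \<in> mS \<Longrightarrow> mdb A \<in> mS" by (simp add: mS_def mdb_def cst_dzbar)
  show "v \<in> vV \<Longrightarrow> A \<in> mS \<Longrightarrow> contr v A \<in> mS" unfolding vV_def mS_def contr_eq_ctr using sm_ctr sm_smo by blast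
  show "A \<in> mOm i \<Longrightarrow> A \<in> mS" unfolding mS_def mOm_def using sf_sm by blast
  show "A \<in> mOm i \<Longrightarrow> B \<in> mOm i \<Longrightarrow> A + B \<in> mOm i" by (simp add: mOm_def sf_add)
  show "A \<in> mOm i \<Longrightarrow> - A \<in> mOm i" by (simp add: mOm_def sf_uminus)
  show "A \<in> mOm i \<Longrightarrow> B \<in> mOm j \<Longrightarrow> mwedge A B \<in> mOm (i + j)" by (simp add: mOm_def mwedge_def sf_wedge sf_sum)
  show "A \<in> mOm i \<Longrightarrow> mdl A \<in> mOm (Suc i)" by (simp add: mOm_def mdl_def sf_rd cst_dz)
  show "A \<in> mOm i \<Longrightarrow> mdb A \<in> mOm (Suc i)" by (simp add: mOm_def mdb_def sf_rd cst_dzbar)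
  show "v \<in> {v. vf i v} \<Longrightarrow> A \<in> mOm j \<Longrightarrow> contr v A \<in> mOm (i + Suc j)"
    unfolding mOm_def contr_eq_ctr using sf_ctr by blast
  show "A \<in> mOm i \<Longrightarrow> even i = even j \<Longrightarrow> A \<in> mOm j" unfolding mOm_def using sf_cong by blast
  show "v \<in> {v. vf i v} \<Longrightarrow> v \<in> vV" by (auto simp: vV_def)
  show "v \<in> {v. vf i v} \<Longrightarrow> w \<in> {v. vf j v} \<Longrightarrow> SN v w \<in> {v. vf (i + j) v}" by (simp add: vf_SN)
  show "v \<in> {v. vf i v} \<Longrightarrow> vb v \<in> {v. vf (Suc i) v}" using vf_rdelb[of i v] by (simp add: vb_def[abs_def])
  show "0 \<in> {v. vf i v}" by simp
  show "SN 0 v = 0" "SN v 0 = 0" by (simp_all add: SN_def fun_eq_iff sum_fun_apply)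
  show "contr 0 A = 0" by (rule contr_linear)
  show "mwedge (mwedge A B) C = mwedge A (mwedge B C)" for C by (rule mwedge_assoc)
  show "mwedge A (B + C) = mwedge A B + mwedge A C" "mwedge (A + B) C = mwedge A C + mwedge B C"
    "mwedge A (- B) = - mwedge A B" "mwedge (- A) B = - mwedge A B" for C by (rule mwedge_linear)+
  show "A \<in> mS \<Longrightarrow> B \<in> mS \<Longrightarrow> mdl (A + B) = mdl A + mdl B"
    by (intro ext) (simp add: mdl_def rd_add mS_D)
  show "A \<in> mS \<Longrightarrow> mdl (- A) = - mdl A"
    by (intro ext) (simp add: mdl_def rd_minus mS_D)
  show "A \<in> mS \<Longrightarrow> B \<in> mS \<Longrightarrow> mdb (A + B) = mdb A + mdb B"
    by (intro ext) (simp add: mdb_def rd_add mS_D)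
  show "A \<in> mS \<Longrightarrow> mdb (- A) = - mdb A"
    by (intro ext) (simp add: mdb_def rd_minus mS_D)
  show "contr v (A + B) = contr v A + contr v B" "contr v (- A) = - contr v A" by (rule contr_linear)+
  show "contr (v + w) A = contr v A + contr w A"
    by (intro ext) (simp add: contr_eq_ctr ctr_add_left)
  show "A \<in> mOm i \<Longrightarrow> B \<in> mS \<Longrightarrow> mdl (mwedge A B) = mwedge (mdl A) B + sg i (mwedge A (mdl B))"
    by (intro ext) (simp add: mdl_def mwedge_rd[OF cst_dz] sg_apply mwedge_def[of "mdl A"] mwedge_def[of A "mdl B"] sum_fun_apply)
  show "A \<in> mOm i \<Longrightarrow> B \<in> mS \<Longrightarrow> mdb (mwedge A B) = mwedge (mdb A) B + sg i (mwedge A (mdb B))"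
    by (intro ext) (simp add: mdb_def mwedge_rd[OF cst_dzbar] sg_apply mwedge_def[of "mdb A"] mwedge_def[of A "mdb B"] sum_fun_apply)
  show "contr v (mwedge A B) = mwedge (contr v A) B + sg ((i + 1) * j) (mwedge A (contr v B))"
    if "v \<in> {v. vf i v}" "A \<in> mOm j"
  proof (intro ext)
    fix k l y vs
    have "contr v (mwedge A B) k l = (\<Sum>m\<in>UNIV. wedge (ctr v (A k m)) (B m l) + sg ((i + 1) * j) (wedge (A k m) (ctr v (B m l))))"
      unfolding contr_eq_ctr mwedge_def ctr_sum
      by (intro sum.cong refl ctr_wedge mOm_D[OF that(2)]) (use that in simp)
    then show "contr v (mwedge A B) k l y vs = (mwedge (contr v A) B + sg ((i + 1) * j) (mwedge A (contr v B))) k l y vs"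
      by (simp add: sum.distrib sg_apply mwedge_def contr_eq_ctr sg_sum)
  qed
  show "A \<in> mS \<Longrightarrow> mdl (mdl A) = 0"
    by (intro ext) (simp add: mdl_def rd_self cst_dz mS_D)
  show "A \<in> mS \<Longrightarrow> mdb (mdb A) = 0"
    by (intro ext) (simp add: mdb_def rd_self cst_dzbar mS_D)
  show "A \<in> mS \<Longrightarrow> mdb (mdl A) = - mdl (mdb A)"
    by (intro ext) (simp add: mdb_def mdl_def rd_rd[OF cst_dzbar cst_dz mS_D(1)])
  show "v \<in> {v. vf i v} \<Longrightarrow> A \<in> mS \<Longrightarrow> mdb (contr v A) = contr (vb v) A - sg i (contr v (mdb A))"
    by (intro ext) (simp add: mdb_def contr_eq_ctr vb_def[abs_def] sg_apply rdelb_ctr[OF _ mS_D(1)])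
  show "v \<in> {v. vf i v} \<Longrightarrow> w \<in> {v. vf j v} \<Longrightarrow> A \<in> mS \<Longrightarrow>
    sg i (mdl (contr v (contr w A))) + contr v (mdl (contr w A)) =
    sg (i * (j + 1)) (contr w (sg i (mdl (contr v A)) + contr v (mdl A))) + contr (SN v w) A"
    by (rule lie_ct_flat) auto
  show "v \<in> {v. vf i v} \<Longrightarrow> w \<in> {v. vf j v} \<Longrightarrow> SN v w = - sg (i * j) (SN w v)"
    by (rule SN_antisym) auto
  show "u \<in> {v. vf i v} \<Longrightarrow> v \<in> {v. vf j v} \<Longrightarrow> w \<in> {v. vf k v} \<Longrightarrow>
     SN u (SN v w) = SN (SN u v) w + sg (i * j) (SN v (SN u w))"
    by (rule SN_Jacobi) auto
  show "v \<in> {v. vf i v} \<Longrightarrow> w \<in> {v. vf j v} \<Longrightarrow> vb (SN v w) = SN (vb v) w + sg i (SN v (vb w))"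
    unfolding vb_def[abs_def] by (rule SN_rdelb) auto
  show "v \<in> {v. vf i v} \<Longrightarrow> vb (vb v) = 0"
    by (intro ext) (simp add: vb_def rd_self[OF cst_dzbar vf_smo])
qed

end

section \<open>Forms of type (p, q)\<close>

text \<open>Exact degree, finer than \<open>par\<close>. It is what lets \<open>degree_part\<close>
  recover the homogeneous components of a sum.\<close>

definition deg :: "nat \<Rightarrow> 'n form \<Rightarrow> bool" where
  "deg m \<omega> \<longleftrightarrow> (\<forall>y vs. length vs \<noteq> m \<longrightarrow> \<omega> y vs = 0)"

lemma deg_par: "deg m (\<omega> :: 'a::finite form) \<Longrightarrow> par m \<omega>"
  unfolding deg_def par_def
proof (intro allI impI)
  fix y and vs :: "(complex^'a) list"
  assume "\<forall>y vs. length vs \<noteq> m \<longrightarrow> \<omega> y vs = 0" and "odd (length vs + m)"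
  moreover from this(2) have "length vs \<noteq> m" by auto
  ultimately show "\<omega> y vs = 0" by blast
qed

lemma length_nths_Compl: "length (nths vs S) + length (nths vs (- S)) = length vs"
proof -
  have "card {i. i < length vs \<and> i \<in> S} + card {i. i < length vs \<and> i \<in> - S} =
      card ({i. i < length vs \<and> i \<in> S} \<union> {i. i < length vs \<and> i \<in> - S})"
    by (rule card_Un_disjoint[symmetric]) auto
  also have "{i. i < length vs \<and> i \<in> S} \<union> {i. i < length vs \<and> i \<in> - S} = {..<length vs}" by auto
  finally show ?thesis by (simp add: length_nths)
qed

lemma deg_wedge:
  assumes "deg p \<alpha>" "deg q \<beta>"
  shows "deg (p + q) (wedge \<alpha> \<beta>)"
proof -
  have "\<alpha> y (nths vs S) * \<beta> y (nths vs (- S)) = 0" if "length vs \<noteq> p + q" for y vs S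
    using assms length_nths_Compl[of vs S] that unfolding deg_def by (metis mult_eq_0_iff)
  then show ?thesis
    unfolding deg_def wedge_def mult.assoc by (intro allI impI sum.neutral ballI) simp
qed

text \<open>Real linearity in the first slot. A pullback inserts images of vectors under a
  differential, and expanding these in the coordinate basis needs this property
  (\<open>iota_pb\<close>).\<close>

definition lin1 :: "'n::finite form \<Rightarrow> bool" where
  "lin1 \<omega> \<longleftrightarrow> (\<forall>y vs. linear (\<lambda>v. \<omega> y (v # vs)))"

lemma linear_sum_fun: "(\<And>i. i \<in> I \<Longrightarrow> linear (f i)) \<Longrightarrow> linear (\<lambda>v. \<Sum>i\<in>I. f i v)"
  by (rule linear_compose_sum) simp

lemma linear_cmult: "linear f \<Longrightarrow> linear (\<lambda>v. c * f v)" for f :: "'a::real_vector \<Rightarrow> complex"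
  by (simp add: linear_iff algebra_simps)

lemma lin1_wedge:
  assumes "lin1 \<alpha>" "lin1 \<beta>"
  shows "lin1 (wedge \<alpha> \<beta>)"
  unfolding lin1_def
proof (intro allI)
  fix y and vs :: "(complex^'a) list"
  have a: "linear (\<lambda>v. wedge (ins v \<alpha>) \<beta> y vs)"
    unfolding wedge_def ins_def
    by (intro linear_sum_fun)
      (use assms in \<open>simp add: lin1_def mult.assoc mult.commute[of "\<alpha> _ _"] linear_cmult\<close>)
  have b: "linear (\<lambda>v. wedge (eps \<alpha>) (ins v \<beta>) y vs)"
    unfolding wedge_def ins_def
    by (intro linear_sum_fun linear_cmult) (use assms in \<open>simp add: lin1_def\<close>)
  show "linear (\<lambda>v. wedge \<alpha> \<beta> y (v # vs))"
    unfolding wedge_Cons by (rule linear_compose_add[OF a b])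
qed

lemma lin1_dz: "lin1 (dz a)"
proof -
  have "linear (\<lambda>v. dz a y (v # vs))" for y vs
    by (cases vs) (simp_all add: dz_def linear_iff)
  then show ?thesis by (simp add: lin1_def)
qed

lemma lin1_dzbar: "lin1 (dzbar a)"
proof -
  have "linear (\<lambda>v. dzbar a y (v # vs))" for y vs
    by (cases vs) (simp_all add: dzbar_def linear_iff)
  then show ?thesis by (simp add: lin1_def)
qed

lemma lin1_one_form: "lin1 one_form"
  by (simp add: lin1_def one_form_def linear_iff)

lemma deg_dz: "deg 1 (dz a)" and deg_dzbar: "deg 1 (dzbar a)" and deg_one_form: "deg 0 one_form"
  by (auto simp: deg_def dz_def dzbar_def one_form_def split: list.splits)

lemma alt_deg_1: "deg 1 \<omega> \<Longrightarrow> alt \<omega>"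
  by (rule altI) (simp add: deg_def)

lemma alt_deg_0: "deg 0 \<omega> \<Longrightarrow> alt \<omega>"
  by (rule altI) (simp add: deg_def)

lemma dz_dzbar_Cons: "dz_dzbar (a # I) J = wedge (dz a) (dz_dzbar I J)"
  by (simp add: dz_dzbar_def)

lemma dz_dzbar_Nil_Cons: "dz_dzbar [] (b # J) = wedge (dzbar b) (dz_dzbar [] J)"
  by (simp add: dz_dzbar_def)

lemma dz_dzbar_Nil [simp]: "dz_dzbar [] [] = one_form"
  by (simp add: dz_dzbar_def)

lemma dz_dzbar_induct [case_names Nil dzbar dz]:
  assumes "P [] []" "\<And>b J. P [] J \<Longrightarrow> P [] (b # J)" "\<And>a I J. P I J \<Longrightarrow> P (a # I) J"
  shows "P I J"
proof (induction I)
  case Nil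
  show ?case by (induction J) (auto intro: assms)
qed (auto intro: assms)

lemma deg_dz_dzbar: "deg (length I + length J) (dz_dzbar I J)"
proof (induction I J rule: dz_dzbar_induct)
  case (dzbar b J)
  then show ?case using deg_wedge[OF deg_dzbar, of "length J" "dz_dzbar [] J" b] by (simp add: dz_dzbar_Nil_Cons)
next
  case (dz a I J)
  then show ?case using deg_wedge[OF deg_dz, of "length I + length J" "dz_dzbar I J" a] by (simp add: dz_dzbar_Cons)
qed (simp add: deg_one_form)

lemma alt_dz_dzbar: "alt (dz_dzbar I J)"
  by (induction I J rule: dz_dzbar_induct)
    (simp_all add: dz_dzbar_Cons dz_dzbar_Nil_Cons alt_wedge alt_deg_1[OF deg_dz] alt_deg_1[OF deg_dzbar] alt_deg_0[OF deg_one_form])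

lemma lin1_dz_dzbar: "lin1 (dz_dzbar I J)"
  by (induction I J rule: dz_dzbar_induct)
    (simp_all add: dz_dzbar_Cons dz_dzbar_Nil_Cons lin1_wedge lin1_dz lin1_dzbar lin1_one_form)

lemma dz_dzbar_const: "dz_dzbar I J y vs = dz_dzbar I J y' vs"
proof -
  have w: "wedge \<alpha> \<beta> y vs = wedge \<alpha> \<beta> y' vs"
    if "\<And>vs. \<alpha> y vs = \<alpha> y' vs" "\<And>vs. \<beta> y vs = \<beta> y' vs" for \<alpha> \<beta> :: "'a form" and vs
    using that by (simp add: wedge_def)
  show ?thesis
    by (induction I J arbitrary: vs rule: dz_dzbar_induct)
      (auto simp: dz_dzbar_Cons dz_dzbar_Nil_Cons one_form_def dz_def[abs_def] dzbar_def[abs_def] intro!: w)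
qed

lemma dz_dzbar_split: "dz_dzbar I J = wedge (dz_dzbar I []) (dz_dzbar [] J)"
  by (induction I) (simp_all add: dz_dzbar_Cons wedge_assoc)

lemma dz_dzbar_append: "wedge (dz_dzbar I []) (dz_dzbar I' J) = dz_dzbar (I @ I') J"
  by (induction I) (simp_all add: dz_dzbar_Cons wedge_assoc)

lemma dz_dzbar_append_bar: "wedge (dz_dzbar [] J) (dz_dzbar [] J') = dz_dzbar [] (J @ J')"
  by (induction J) (simp_all add: dz_dzbar_Nil_Cons wedge_assoc)

text \<open>The sign comes from moving the block of \<open>dz\<close> factors of the second form
  past the \<open>dzbar\<close> factors of the first.\<close>

lemma wedge_dz_dzbar:
  "wedge (dz_dzbar I J) (dz_dzbar I' J') = sg (length J * length I') (dz_dzbar (I @ I') (J @ J'))"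
proof -
  have "wedge (dz_dzbar [] J) (dz_dzbar I' []) = sg (length J * length I') (wedge (dz_dzbar I' []) (dz_dzbar [] J))"
    using deg_par[OF deg_dz_dzbar[of "[]" J]] deg_par[OF deg_dz_dzbar[of I' "[]"]] by (intro wedge_commute) auto
  note swap = this
  have "wedge (dz_dzbar I J) (dz_dzbar I' J') =
      wedge (dz_dzbar I []) (wedge (wedge (dz_dzbar [] J) (dz_dzbar I' [])) (dz_dzbar [] J'))"
    unfolding dz_dzbar_split[of I J] dz_dzbar_split[of I' J'] by (simp only: wedge_assoc)
  also have "\<dots> = sg (length J * length I')
      (wedge (wedge (dz_dzbar I []) (dz_dzbar I' [])) (wedge (dz_dzbar [] J) (dz_dzbar [] J')))"
    unfolding swap by (simp only: wedge_assoc wedge_sg)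
  also have "\<dots> = sg (length J * length I') (dz_dzbar (I @ I') (J @ J'))"
    unfolding dz_dzbar_append dz_dzbar_append_bar by simp
  finally show ?thesis .
qed

lemma wedge_dz_dz: "wedge (dz a) (wedge (dz b) \<gamma>) = - wedge (dz b) (wedge (dz a) \<gamma>)"
  "wedge (dzbar a) (wedge (dzbar b) \<gamma>) = - wedge (dzbar b) (wedge (dzbar a) \<gamma>)"
  using wedge_commute[OF deg_par[OF deg_dz] deg_par[OF deg_dz], of a b]
    wedge_commute[OF deg_par[OF deg_dzbar] deg_par[OF deg_dzbar], of a b]
  by (simp_all add: sg_def wedge_minus_left flip: wedge_assoc)

lemma wedge_dz_dz_self: "wedge (dz a) (wedge (dz a) \<gamma>) = 0" "wedge (dzbar a) (wedge (dzbar a) \<gamma>) = 0"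
  using form_eq_minus_self wedge_dz_dz(1)[of a a] wedge_dz_dz(2)[of a a] by blast+

lemma wedge_dz_dz_0: "wedge (dz a) \<gamma> = 0 \<Longrightarrow> wedge (dz a) (wedge (dz b) \<gamma>) = 0"
  "wedge (dzbar a) \<gamma> = 0 \<Longrightarrow> wedge (dzbar a) (wedge (dzbar b) \<gamma>) = 0"
  using wedge_dz_dz(1)[of a b \<gamma>] wedge_dz_dz(2)[of a b \<gamma>] by simp_all

lemma wedge_dz_mem: "a \<in> set I \<Longrightarrow> wedge (dz a) (dz_dzbar I J) = 0"
proof (induction I)
  case (Cons b I)
  have "wedge (dz a) (dz_dzbar (b # I) J) = 0"
  proof (cases "a = b")
    case False
    then have "a \<in> set I" using Cons.prems by simp
    from Cons.IH[OF this] show ?thesis unfolding dz_dzbar_Cons by (rule wedge_dz_dz_0)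
  qed (simp add: dz_dzbar_Cons wedge_dz_dz_self)
  then show ?case .
qed simp

lemma wedge_dzbar_mem: "a \<in> set J \<Longrightarrow> wedge (dzbar a) (dz_dzbar [] J) = 0"
proof (induction J)
  case (Cons b J)
  have "wedge (dzbar a) (dz_dzbar [] (b # J)) = 0"
  proof (cases "a = b")
    case False
    then have "a \<in> set J" using Cons.prems by simp
    from Cons.IH[OF this] show ?thesis unfolding dz_dzbar_Nil_Cons by (rule wedge_dz_dz_0)
  qed (simp add: dz_dzbar_Nil_Cons wedge_dz_dz_self)
  then show ?case .
qed simp

lemma dz_dzbar_not_distinct: "\<not> distinct I \<Longrightarrow> dz_dzbar I J = 0"
  by (induction I) (auto simp: dz_dzbar_Cons wedge_dz_mem)

lemma dz_dzbar_not_distinct_bar: "\<not> distinct J \<Longrightarrow> dz_dzbar I J = 0"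
proof -
  assume "\<not> distinct J"
  then have "dz_dzbar [] J = 0"
    by (induction J) (auto simp: dz_dzbar_Nil_Cons wedge_dzbar_mem)
  then show ?thesis by (simp add: dz_dzbar_split[of I J])
qed

text \<open>So many factors force a repeated index among the \<open>dz\<close> or among the
  \<open>dzbar\<close>. This justifies the cut-off at \<open>2 * CARD('n)\<close> in the global
  bracket and differential.\<close>

lemma dz_dzbar_large:
  fixes I J :: "'n::finite list"
  assumes "length I + length J > 2 * CARD('n)"
  shows "dz_dzbar I J = 0"
proof -
  have "length K \<le> CARD('n)" if "distinct K" for K :: "'n list"
    using distinct_card[OF that] card_mono[of UNIV "set K"] by simp
  then show ?thesis
    using assms dz_dzbar_not_distinct dz_dzbar_not_distinct_bar
    by (metis add_mono_thms_linordered_semiring(1) leD mult_2)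
qed

definition fm :: "(complex^'n \<Rightarrow> complex) \<Rightarrow> 'n form \<Rightarrow> 'n form" where
  "fm f \<omega> y vs = f y * \<omega> y vs"

lemma fm_sum: "fm f (\<Sum>i\<in>I. g i) = (\<Sum>i\<in>I. fm f (g i))"
  by (simp add: fun_eq_iff fm_def sum_fun_apply sum_distrib_left)

lemma wedge_fm: "wedge (fm f \<alpha>) \<beta> = fm f (wedge \<alpha> \<beta>)" "wedge \<alpha> (fm f \<beta>) = fm f (wedge \<alpha> \<beta>)"
  by (simp_all add: fun_eq_iff fm_def wedge_def sum_distrib_left algebra_simps)

lemma iota_fm: "iota a (fm f \<omega>) = fm f (iota a \<omega>)"
  by (simp add: fun_eq_iff fm_def iota_def algebra_simps)

lemma alt_fm: "alt \<omega> \<Longrightarrow> alt (fm f \<omega>)"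
proof (rule altI)
  fix y us u w vs assume "alt \<omega>"
  from altD[OF this, of y us u w vs]
  show "fm f \<omega> y (us @ u # w # vs) = - fm f \<omega> y (us @ w # u # vs)" by (simp add: fm_def)
qed

text \<open>The basis forms have constant coefficients, so \<open>undefined\<close> stands for an
  arbitrary base point.\<close>

lemma fm_dz_dzbar: "fm f (dz_dzbar I J) y vs = f y * dz_dzbar I J undefined vs"
  unfolding fm_def by (rule arg_cong[OF dz_dzbar_const])

lemma finite_lists_length: "finite {I :: 'n::finite list. length I = p}"
  using finite_lists_length_eq[of "UNIV :: 'n set" p] by simp

context open_domain
begin

abbreviation pq :: "nat \<Rightarrow> nat \<Rightarrow> 'n form \<Rightarrow> bool" where
  "pq \<equiv> pq_form_on D"

definition pq_sum_of :: "nat \<Rightarrow> nat \<Rightarrow> ('n list \<Rightarrow> 'n list \<Rightarrow> complex^'n \<Rightarrow> complex) \<Rightarrow> 'n form" where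
  "pq_sum_of p q f = (\<Sum>I | length I = p. \<Sum>J | length J = q. fm (f I J) (dz_dzbar I J))"

lemma pqD:
  assumes "pq p q \<omega>"
  obtains f where "\<forall>I J. smooth_on D (f I J)" "\<forall>y\<in>D. \<forall>vs. \<omega> y vs = pq_sum_of p q f y vs"
proof -
  from assms obtain f where f: "\<forall>I J. smooth_on D (f I J)"
    "\<forall>y\<in>D. \<forall>vs. \<omega> y vs = (\<Sum>I | length I = p. \<Sum>J | length J = q. f I J y * dz_dzbar I J y vs)"
    unfolding pq_form_on_def by blast
  show thesis
    by (rule that[of f]) (use f in \<open>simp_all add: pq_sum_of_def sum_fun_apply fm_def\<close>)
qed

lemma pq_cong: "(\<And>y vs. y \<in> D \<Longrightarrow> \<omega> y vs = \<omega>' y vs) \<Longrightarrow> pq p q \<omega> \<Longrightarrow> pq p q \<omega>'"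
  unfolding pq_form_on_def by (elim ex_forward) simp

lemma pq_0 [simp]: "pq p q 0"
  unfolding pq_form_on_def by (rule exI[of _ "\<lambda>_ _ _. 0"]) simp

lemma pq_add: 
  assumes "pq p q \<alpha>" "pq p q \<beta>" shows "pq p q (\<alpha> + \<beta>)"
proof -
  obtain f g where f: "\<And>I J. smooth_on D (f I J)"
    "\<And>y vs. y \<in> D \<Longrightarrow> \<alpha> y vs = (\<Sum>I | length I = p. \<Sum>J | length J = q. f I J y * dz_dzbar I J y vs)"
    and g: "\<And>I J. smooth_on D (g I J)"
    "\<And>y vs. y \<in> D \<Longrightarrow> \<beta> y vs = (\<Sum>I | length I = p. \<Sum>J | length J = q. g I J y * dz_dzbar I J y vs)"
    using assms unfolding pq_form_on_def by blast
  show ?thesis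
    unfolding pq_form_on_def
    by (rule exI[of _ "\<lambda>I J y. f I J y + g I J y"])
      (simp add: f g smooth_on_add open_D algebra_simps sum.distrib)
qed

lemma pq_fm: 
  assumes "smooth_on D g" "pq p q \<alpha>" shows "pq p q (fm g \<alpha>)"
proof -
  obtain f where f: "\<And>I J. smooth_on D (f I J)"
    "\<And>y vs. y \<in> D \<Longrightarrow> \<alpha> y vs = (\<Sum>I | length I = p. \<Sum>J | length J = q. f I J y * dz_dzbar I J y vs)"
    using assms unfolding pq_form_on_def by blast
  have "\<forall>I J. smooth_on D (\<lambda>y. g y * f I J y)"
    using smooth_on_mult[OF open_D assms(1) f(1)] by blast
  then show ?thesis
    unfolding pq_form_on_def
    by (intro exI[of _ "\<lambda>I J y. g y * f I J y"])
      (simp add: f(2) fm_def sum_distrib_left mult.assoc)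
qed

lemma pq_uminus: "pq p q \<alpha> \<Longrightarrow> pq p q (- \<alpha>)"
  by (rule pq_cong[OF _ pq_fm[OF smooth_on_const[of D "-1"]]]) (simp_all add: fm_def)

lemma pq_diff: "pq p q \<alpha> \<Longrightarrow> pq p q \<beta> \<Longrightarrow> pq p q (\<alpha> - \<beta>)"
  using pq_add[of p q \<alpha> "- \<beta>"] by (simp add: pq_uminus)

lemma pq_sg: "pq p q \<alpha> \<Longrightarrow> pq p q (sg i \<alpha>)"
  by (simp add: sg_def pq_uminus)

lemma pq_sum: "(\<And>i. i \<in> I \<Longrightarrow> pq p q (f i)) \<Longrightarrow> pq p q (\<Sum>i\<in>I. f i)"
proof (induction I rule: infinite_finite_induct)
  case (insert x F)
  have "(\<Sum>i\<in>insert x F. f i) = f x + (\<Sum>i\<in>F. f i)" by (rule sum.insert[OF insert.hyps(1,2)])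
  then show ?case by (rule ssubst) (rule pq_add, use insert in auto)
qed (simp_all only: sum.infinite sum.empty pq_0 simp_thms)

lemma pq_dz_dzbar: "pq (length I) (length J) (dz_dzbar I J)"
proof -
  have "dz_dzbar I J y vs = (\<Sum>I' | length I' = length I. \<Sum>J' | length J' = length J.
     (if I' = I \<and> J' = J then 1 else 0) * dz_dzbar I' J' y vs)" for y vs
  proof -
    have "(\<Sum>I' | length I' = length I. \<Sum>J' | length J' = length J.
       (if I' = I \<and> J' = J then 1 else 0) * dz_dzbar I' J' y vs) =
      (\<Sum>I' | length I' = length I. if I' = I then (\<Sum>J' | length J' = length J.
       if J' = J then dz_dzbar I' J' y vs else 0) else 0)"
      by (intro sum.cong refl) (auto intro!: sum.cong)
    then show ?thesis
      by (simp add: finite_lists_length)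
  qed
  then show ?thesis
    unfolding pq_form_on_def by (intro exI[of _ "\<lambda>I' J' y. if I' = I \<and> J' = J then 1 else 0"]) simp
qed

lemma pq_dz: "pq 1 0 (dz a)" and pq_dzbar: "pq 0 1 (dzbar a)"
  using pq_dz_dzbar[of "[a]" "[]"] pq_dz_dzbar[of "[]" "[a]"]
  by (simp_all add: dz_dzbar_Cons dz_dzbar_Nil_Cons)

lemma pq_wedge:
  assumes "pq p q \<alpha>" "pq p' q' \<beta>"
  shows "pq (p + p') (q + q') (wedge \<alpha> \<beta>)"
proof -
  obtain f where "\<forall>I J. smooth_on D (f I J)" "\<forall>y\<in>D. \<forall>vs. \<alpha> y vs = pq_sum_of p q f y vs"
    using pqD[OF assms(1)] by blast
  then have f: "\<And>I J. smooth_on D (f I J)"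
    "\<And>y vs. y \<in> D \<Longrightarrow> \<alpha> y vs = (\<Sum>I | length I = p. \<Sum>J | length J = q. fm (f I J) (dz_dzbar I J)) y vs"
    unfolding pq_sum_of_def by blast+
  obtain g where "\<forall>I J. smooth_on D (g I J)" "\<forall>y\<in>D. \<forall>vs. \<beta> y vs = pq_sum_of p' q' g y vs"
    using pqD[OF assms(2)] by blast
  then have g: "\<And>I J. smooth_on D (g I J)"
    "\<And>y vs. y \<in> D \<Longrightarrow> \<beta> y vs = (\<Sum>I | length I = p'. \<Sum>J | length J = q'. fm (g I J) (dz_dzbar I J)) y vs"
    unfolding pq_sum_of_def by blast+
  let ?\<alpha> = "\<Sum>I | length I = p. \<Sum>J | length J = q. fm (f I J) (dz_dzbar I J)"
  let ?\<beta> = "\<Sum>I | length I = p'. \<Sum>J | length J = q'. fm (g I J) (dz_dzbar I J)"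
  have basis: "pq (p + p') (q + q') (wedge (dz_dzbar I J) (dz_dzbar I' J'))"
    if "length I = p" "length J = q" "length I' = p'" "length J' = q'" for I J I' J'
    unfolding wedge_dz_dzbar using pq_sg[OF pq_dz_dzbar[of "I @ I'" "J @ J'"]] that by simp
  have "pq (p + p') (q + q') (wedge ?\<alpha> ?\<beta>)"
    unfolding wedge_sum_left wedge_sum_right wedge_fm
    by (intro pq_sum pq_fm f g basis) auto
  note closed = this
  have eq: "wedge \<alpha> \<beta> y vs = wedge ?\<alpha> ?\<beta> y vs" if "y \<in> D" for y vs
    using f(2)[OF that] g(2)[OF that] by (rule wedge_cong_at)
  from closed show ?thesis by (rule pq_cong[rotated]) (rule eq[symmetric])
qed

lemma iota_dz_dzbar_Nil: "iota a (dz_dzbar [] J) = 0"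
proof (induction J)
  case Nil
  show ?case by (simp add: fun_eq_iff iota_def one_form_def)
next
  case (Cons b J)
  then show ?case by (simp only: dz_dzbar_Nil_Cons iota_wedge iota_dzbar wedge_0 add_0)
qed

text \<open>Without any \<open>dz\<close> the insertion vanishes, which makes the truncated
  \<open>length I - 1\<close> correct for empty \<open>I\<close> too.\<close>

lemma pq_iota_dz_dzbar: "pq (length I - 1) (length J) (iota a (dz_dzbar I J))"
proof (induction I J rule: dz_dzbar_induct)
  case Nil
  show ?case by (simp only: iota_dz_dzbar_Nil pq_0)
next
  case (dzbar b J)
  show ?case by (simp only: iota_dz_dzbar_Nil pq_0)
next
  case (dz b I J)
  have e: "eps (dz b) = - dz b" using eps_eq_sg[OF deg_par[OF deg_dz]] by (simp add: sg_def)
  have eq: "iota a (dz_dzbar (b # I) J) = (if a = b then dz_dzbar I J else 0) - wedge (dz b) (iota a (dz_dzbar I J))"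
    by (simp add: dz_dzbar_Cons iota_wedge iota_dz e wedge_minus_left)
  have 1: "pq (length I) (length J) (if a = b then dz_dzbar I J else 0)"
    using pq_dz_dzbar by simp
  \<comment> \<open>Wedging with \<open>dz b\<close> restores the lost degree only if
    \<open>I\<close> is nonempty; otherwise the term is zero.\<close>
  have 2: "pq (length I) (length J) (wedge (dz b) (iota a (dz_dzbar I J)))"
  proof (cases I)
    case Nil
    show ?thesis unfolding Nil iota_dz_dzbar_Nil by simp
  next
    case (Cons c I')
    then show ?thesis using pq_wedge[OF pq_dz dz.IH, of b] by simp
  qed
  have "pq (length I) (length J) (iota a (dz_dzbar (b # I) J))"
    unfolding eq by (rule pq_diff[OF 1 2])
  then show ?case by (simp only: length_Cons diff_Suc_1)
qed

lemma pq_iota: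
  assumes "pq p q \<omega>"
  shows "pq (p - 1) q (iota a \<omega>)"
proof -
  obtain f where "\<forall>I J. smooth_on D (f I J)" "\<forall>y\<in>D. \<forall>vs. \<omega> y vs = pq_sum_of p q f y vs"
    using pqD[OF assms] by blast
  then have f: "\<And>I J. smooth_on D (f I J)"
    "\<And>y vs. y \<in> D \<Longrightarrow> \<omega> y vs = (\<Sum>I | length I = p. \<Sum>J | length J = q. fm (f I J) (dz_dzbar I J)) y vs"
    unfolding pq_sum_of_def by blast+
  let ?\<omega> = "\<Sum>I | length I = p. \<Sum>J | length J = q. fm (f I J) (dz_dzbar I J)"
  have "pq (p - 1) q (iota a ?\<omega>)"
    unfolding iota_sum iota_fm by (intro pq_sum pq_fm f) (use pq_iota_dz_dzbar in auto)
  note closed = this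
  have eq: "iota a \<omega> y vs = iota a ?\<omega> y vs" if "y \<in> D" for y vs
    using f(2)[OF that] by (rule iota_cong_at)
  from closed show ?thesis by (rule pq_cong[rotated]) (rule eq[symmetric])
qed

lemma pq_0_iota:
  assumes "pq 0 q \<omega>" "zo \<omega>"
  shows "iota a \<omega> = 0"
proof -
  obtain f where "\<forall>I J. smooth_on D (f I J)" "\<forall>y\<in>D. \<forall>vs. \<omega> y vs = pq_sum_of 0 q f y vs"
    using pqD[OF assms(1)] by blast
  then have f: "\<And>I J. smooth_on D (f I J)"
    "\<And>y vs. y \<in> D \<Longrightarrow> \<omega> y vs = (\<Sum>I | length I = 0. \<Sum>J | length J = q. fm (f I J) (dz_dzbar I J)) y vs"
    unfolding pq_sum_of_def by blast+
  have "iota a (\<Sum>I | length I = 0. \<Sum>J | length J = q. fm (f I J) (dz_dzbar I J)) = 0"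
    by (simp add: iota_sum iota_fm iota_dz_dzbar_Nil) (simp add: fun_eq_iff sum_fun_apply fm_def)
  moreover have "iota a \<omega> y vs = iota a (\<Sum>I | length I = 0. \<Sum>J | length J = q. fm (f I J) (dz_dzbar I J)) y vs" if "y \<in> D" for y vs
    using f(2)[OF that] by (rule iota_cong_at)
  ultimately have "iota a \<omega> y vs = 0" if "y \<in> D" for y vs using that by simp
  moreover have "iota a \<omega> y vs = 0" if "y \<notin> D" for y vs
    using assms(2) that by (simp add: iota_def zo_def)
  ultimately show ?thesis by (auto simp: fun_eq_iff)
qed

lemma smooth_on_fm_dz_dzbar: "smooth_on D f \<Longrightarrow> smooth_on D (\<lambda>y. fm f (dz_dzbar I J) y vs)"
  unfolding fm_dz_dzbar by (rule smooth_on_mult[OF open_D]) simp_all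

lemma pq_pd:
  assumes "pq p q \<omega>"
  shows "pq p q (pd k a \<omega>)"
proof -
  obtain f where "\<forall>I J. smooth_on D (f I J)" "\<forall>y\<in>D. \<forall>vs. \<omega> y vs = pq_sum_of p q f y vs"
    using pqD[OF assms] by blast
  then have f: "\<And>I J. smooth_on D (f I J)"
    "\<And>y vs. y \<in> D \<Longrightarrow> \<omega> y vs = (\<Sum>I | length I = p. \<Sum>J | length J = q. fm (f I J) (dz_dzbar I J)) y vs"
    unfolding pq_sum_of_def by blast+
  have eq: "pd k a \<omega> y vs = (\<Sum>I | length I = p. \<Sum>J | length J = q. fm (pdf k a (f I J)) (dz_dzbar I J)) y vs"
    if y: "y \<in> D" for y vs
  proof -
    have dif: "(\<lambda>u. fm (f I J) (dz_dzbar I J) u vs) differentiable (at y)" for I J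
      using smooth_on_differentiable[OF smooth_on_fm_dz_dzbar[OF f(1)] y] .
    have "pd k a \<omega> y vs = pdf k a (\<lambda>u. \<Sum>I | length I = p. \<Sum>J | length J = q. fm (f I J) (dz_dzbar I J) u vs) y"
      using y f(2) by (simp add: pd_at sum_fun_apply) (rule pdf_cong_open[OF open_D], simp_all)
    also have "\<dots> = (\<Sum>I | length I = p. \<Sum>J | length J = q. pdf k a (\<lambda>u. fm (f I J) (dz_dzbar I J) u vs) y)"
      by (simp add: pdf_sum dif differentiable_sum finite_lists_length)
    also have "\<dots> = (\<Sum>I | length I = p. \<Sum>J | length J = q. fm (pdf k a (f I J)) (dz_dzbar I J) y vs)"
    proof (intro sum.cong refl)
      fix I J
      show "pdf k a (\<lambda>u. fm (f I J) (dz_dzbar I J) u vs) y = fm (pdf k a (f I J)) (dz_dzbar I J) y vs"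
        using pdf_mult[OF smooth_on_differentiable[OF f(1) y] differentiable_const, of k a I J "dz_dzbar I J undefined vs"]
        by (simp add: fm_dz_dzbar)
    qed
    finally show ?thesis by (simp add: sum_fun_apply)
  qed
  have closed: "pq p q (\<Sum>I | length I = p. \<Sum>J | length J = q. fm (pdf k a (f I J)) (dz_dzbar I J))"
    by (intro pq_sum pq_fm smooth_on_pdf[OF open_D] f) (use pq_dz_dzbar in auto)
  from closed show ?thesis by (rule pq_cong[rotated]) (rule eq[symmetric])
qed

lemma pq_rdel: "pq p q \<omega> \<Longrightarrow> pq (Suc p) q (rdel \<omega>)"
  unfolding rd_def using pq_wedge[OF pq_dz pq_pd[of p q]] by (intro pq_sum) simp

lemma pq_rdelb: "pq p q \<omega> \<Longrightarrow> pq p (Suc q) (rdelb \<omega>)"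
  unfolding rd_def using pq_wedge[OF pq_dzbar pq_pd[of p q]] by (intro pq_sum) simp

lemma pq_smo:
  assumes "pq p q \<omega>" "zo \<omega>"
  shows "sm \<omega>" "deg (p + q) \<omega>" "lin1 \<omega>"
proof -
  obtain f where "\<forall>I J. smooth_on D (f I J)" "\<forall>y\<in>D. \<forall>vs. \<omega> y vs = pq_sum_of p q f y vs"
    using pqD[OF assms(1)] by blast
  then have f: "\<And>I J. smooth_on D (f I J)"
    "\<And>y vs. y \<in> D \<Longrightarrow> \<omega> y vs = (\<Sum>I | length I = p. \<Sum>J | length J = q. fm (f I J) (dz_dzbar I J)) y vs"
    unfolding pq_sum_of_def by blast+
  have "smooth_on D (\<lambda>y. (\<Sum>I | length I = p. \<Sum>J | length J = q. fm (f I J) (dz_dzbar I J)) y vs)" for vs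
    unfolding sum_fun_apply by (intro smooth_on_sum open_D smooth_on_fm_dz_dzbar f)
  then have "smooth_on D (\<lambda>y. \<omega> y vs)" for vs
    by (subst smooth_on_cong[OF open_D f(2)])
  moreover have "alt \<omega>"
  proof (rule altI)
    fix y us v w vs
    show "\<omega> y (us @ v # w # vs) = - \<omega> y (us @ w # v # vs)"
    proof (cases "y \<in> D")
      case True
      have "alt (\<Sum>I | length I = p. \<Sum>J | length J = q. fm (f I J) (dz_dzbar I J))"
        by (intro alt_sum alt_fm alt_dz_dzbar)
      from altD[OF this, of y us v w vs] show ?thesis using f(2)[OF True] by simp
    qed (use assms(2) in \<open>simp add: zo_def\<close>)
  qed
  ultimately show "sm \<omega>" using assms(2) by (simp add: sm_def smo_def)
  show "deg (p + q) \<omega>"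
    unfolding deg_def
  proof (intro allI impI)
    fix y and vs :: "(complex^'n) list" assume *: "length vs \<noteq> p + q"
    show "\<omega> y vs = 0"
    proof (cases "y \<in> D")
      case True
      have "fm (f I J) (dz_dzbar I J) y vs = 0" if "length I = p" "length J = q" for I J
        using deg_dz_dzbar[of I J] that * by (simp add: deg_def fm_def)
      then show ?thesis using f(2)[OF True] by (simp add: sum_fun_apply)
    qed (use assms(2) in \<open>simp add: zo_def\<close>)
  qed
  show "lin1 \<omega>"
    unfolding lin1_def
  proof (intro allI)
    fix y vs
    show "linear (\<lambda>v. \<omega> y (v # vs))"
    proof (cases "y \<in> D")
      case True
      show ?thesis
        unfolding f(2)[OF True] sum_fun_apply fm_def
        by (intro linear_sum_fun linear_cmult) (use lin1_dz_dzbar in \<open>auto simp: lin1_def\<close>)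
    qed (use assms(2) in \<open>simp add: zo_def linear_iff\<close>)
  qed
qed

lemma pq_sf: "pq p q \<omega> \<Longrightarrow> zo \<omega> \<Longrightarrow> sf (p + q) \<omega>"
  unfolding sf_def using pq_smo(1,2) deg_par by blast

lemma pq_vf: "(\<And>a. pq 0 i (\<phi> a)) \<Longrightarrow> (\<And>a. zo (\<phi> a)) \<Longrightarrow> vf i \<phi>"
  unfolding vf_def using pq_sf[of 0 i] pq_0_iota by (metis add_0)

lemma pq_large:
  assumes "pq p q \<omega>" "zo \<omega>" "p + q > 2 * CARD('n)"
  shows "\<omega> = 0"
proof (intro ext)
  fix y vs
  obtain f where "\<forall>I J. smooth_on D (f I J)" "\<forall>y\<in>D. \<forall>vs. \<omega> y vs = pq_sum_of p q f y vs"
    using pqD[OF assms(1)] by blast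
  then have f: "\<And>I J. smooth_on D (f I J)"
    "\<And>y vs. y \<in> D \<Longrightarrow> \<omega> y vs = (\<Sum>I | length I = p. \<Sum>J | length J = q. fm (f I J) (dz_dzbar I J)) y vs"
    unfolding pq_sum_of_def by blast+
  show "\<omega> y vs = 0 y vs"
  proof (cases "y \<in> D")
    case True
    then show ?thesis
      using assms(3) by (simp add: f(2) sum_fun_apply fm_def dz_dzbar_large)
  qed (use assms(2) in \<open>simp add: zo_def\<close>)
qed

end

section \<open>Holomorphic changes of coordinates\<close>

lemma sum_axis: "(\<Sum>a\<in>UNIV. axis a (v $ a)) = (v :: complex^'n::finite)"
  by (simp add: vec_eq_iff axis_def)

lemma axis_Re_Im: "axis a z = Re z *\<^sub>R axis a 1 + Im z *\<^sub>R (axis a \<i> :: complex^'n::finite)"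
  by (auto simp: vec_eq_iff axis_def complex_eq_iff)

lemma linear_axis: "linear (axis a :: complex \<Rightarrow> complex^'n::finite)"
  by (auto simp: linear_iff vec_eq_iff axis_def)

text \<open>The decomposition of a real linear map into its complex linear and its antilinear
  part.\<close>

lemma linear_Wirtinger:
  fixes L :: "complex^'n::finite \<Rightarrow> complex"
  assumes "linear L"
  shows "L v = (\<Sum>a\<in>UNIV. v $ a * ((L (axis a 1) - \<i> * L (axis a \<i>)) / 2) +
                          cnj (v $ a) * ((L (axis a 1) + \<i> * L (axis a \<i>)) / 2))"
proof -
  have "L v = (\<Sum>a\<in>UNIV. L (axis a (v $ a)))"
    using linear_sum[OF assms, of "\<lambda>a. axis a (v $ a)" UNIV] by (simp add: sum_axis)
  also have "\<dots> = (\<Sum>a\<in>UNIV. of_real (Re (v $ a)) * L (axis a 1) + of_real (Im (v $ a)) * L (axis a \<i>))"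
    by (intro sum.cong refl, subst axis_Re_Im)
      (unfold linear_add[OF assms] linear_scale[OF assms], simp add: scaleR_conv_of_real)
  also have "\<dots> = (\<Sum>a\<in>UNIV. v $ a * ((L (axis a 1) - \<i> * L (axis a \<i>)) / 2) +
                          cnj (v $ a) * ((L (axis a 1) + \<i> * L (axis a \<i>)) / 2))"
  proof (intro sum.cong refl)
    fix a
    have z: "v $ a = of_real (Re (v $ a)) + \<i> * of_real (Im (v $ a))" by (rule complex_eq)
    have zc: "cnj (v $ a) = of_real (Re (v $ a)) - \<i> * of_real (Im (v $ a))"
      by (simp add: complex_eq_iff)
    show "of_real (Re (v $ a)) * L (axis a 1) + of_real (Im (v $ a)) * L (axis a \<i>) =
      v $ a * ((L (axis a 1) - \<i> * L (axis a \<i>)) / 2) + cnj (v $ a) * ((L (axis a 1) + \<i> * L (axis a \<i>)) / 2)"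
      unfolding zc by (subst (3) z) (simp add: field_simps)
  qed
  finally show ?thesis .
qed

lemma frechet_derivative_Wirtinger:
  "f differentiable (at y) \<Longrightarrow>
   frechet_derivative f (at y) v = (\<Sum>a\<in>UNIV. v $ a * pdf (- \<i>) a f y + cnj (v $ a) * pdf \<i> a f y)"
  using linear_Wirtinger[OF linear_frechet_derivative[of f "at y"], of v] by (simp add: pdf_def)

lemma pdf_cnj: "f differentiable (at y) \<Longrightarrow> pdf k a (\<lambda>u. cnj (f u)) y = cnj (pdf (cnj k) a f y)"
  by (simp add: pdf_def frechet_derivative_bounded_linear[OF bounded_linear_cnj])

context open_domain
begin

text \<open>A function as a 0-form, cut off outside \<open>D\<close>: multiplication by it becomes a
  wedge product, to which the derivation rules apply.\<close>

definition hf :: "(complex^'n \<Rightarrow> complex) \<Rightarrow> 'n form" where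
  "hf f = rs D (fm f one_form)"

lemma hf_apply: "hf f y vs = (if y \<in> D \<and> vs = [] then f y else 0)"
  by (simp add: hf_def rs_def fm_def one_form_def)

lemma hf_cong: "(\<And>y. y \<in> D \<Longrightarrow> f y = f' y) \<Longrightarrow> hf f = hf f'"
  by (auto simp: fun_eq_iff hf_apply)

lemma zo_hf [simp]: "zo (hf f)"
  by (simp add: hf_def)

lemma par_hf: "par 0 (hf f)"
  by (auto simp: par_def hf_apply)

lemma sm_hf: "smooth_on D f \<Longrightarrow> sm (hf f)"
proof -
  assume f: "smooth_on D f"
  have "smooth_on D (\<lambda>y. fm f one_form y vs)" for vs
    using smooth_on_fm_dz_dzbar[OF f, of "[]" "[]"] by simp
  moreover have "alt (fm f one_form)" by (intro alt_fm alt_deg_0 deg_one_form)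
  ultimately show ?thesis unfolding hf_def by (intro sm_rs) (simp add: smo_def)
qed

lemma sf_hf: "smooth_on D f \<Longrightarrow> sf 0 (hf f)"
  by (simp add: sf_def sm_hf par_hf)

lemma pd_hf: "pd k a (hf f) = hf (pdf k a f)"
proof (intro ext)
  fix y vs
  have "pdf k a (\<lambda>u. hf f u vs) y = pdf k a (\<lambda>u. if vs = [] then f u else 0) y" if "y \<in> D"
    by (rule pdf_cong_open[OF open_D that]) (simp add: hf_apply)
  then show "pd k a (hf f) y vs = hf (pdf k a f) y vs"
    by (cases "vs = []") (simp_all add: pd_def hf_apply)
qed

lemma iota_hf [simp]: "iota a (hf f) = 0"
  by (simp add: fun_eq_iff iota_def hf_apply)

lemma wedge_hf: "zo \<omega> \<Longrightarrow> wedge (hf f) \<omega> = fm f \<omega>" "zo \<omega> \<Longrightarrow> wedge \<omega> (hf f) = fm f \<omega>"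
proof -
  have *: "wedge (hf f) \<omega> y vs = wedge (fm f one_form) \<omega> y vs" "wedge \<omega> (hf f) y vs = wedge \<omega> (fm f one_form) y vs"
    if "y \<in> D" for y vs
    using that by (intro wedge_cong_at; simp add: hf_apply fm_def one_form_def)+
  assume "zo \<omega>"
  then have 0: "fm f \<omega> y vs = 0" "wedge (hf f) \<omega> y vs = 0" "wedge \<omega> (hf f) y vs = 0" if "y \<notin> D" for y vs
    using that by (simp_all add: fm_def zo_def wedge_def)
  have "wedge (hf f) \<omega> y vs = fm f \<omega> y vs \<and> wedge \<omega> (hf f) y vs = fm f \<omega> y vs" for y vs
    by (cases "y \<in> D") (simp_all add: * 0 wedge_fm)
  then show "wedge (hf f) \<omega> = fm f \<omega>" "wedge \<omega> (hf f) = fm f \<omega>"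
    by (simp_all add: fun_eq_iff)
qed

lemma rd_hf: "rd k w (hf f) = rs D (\<Sum>a\<in>UNIV. fm (pdf k a f) (w a))"
proof (intro ext)
  fix y vs
  have *: "wedge (w a) (hf (pdf k a f)) y vs = fm (pdf k a f) (w a) y vs" if "y \<in> D" for a
  proof -
    have "wedge (w a) (hf (pdf k a f)) y vs = wedge (w a) (fm (pdf k a f) one_form) y vs"
      using that by (intro wedge_cong_at) (simp_all add: hf_apply fm_def one_form_def)
    then show ?thesis by (simp add: wedge_fm)
  qed
  have "wedge (w a) (hf (pdf k a f)) y vs = 0" if "y \<notin> D" for a
    using that by (simp add: wedge_def hf_apply)
  then show "rd k w (hf f) y vs = rs D (\<Sum>a\<in>UNIV. fm (pdf k a f) (w a)) y vs"
    using * by (simp add: rd_def pd_hf sum_fun_apply rs_def)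
qed

lemma pd_cong: "(\<And>y vs. y \<in> D \<Longrightarrow> \<omega> y vs = \<omega>' y vs) \<Longrightarrow> pd k a \<omega> = pd k a \<omega>'"
proof (intro ext)
  fix y vs assume *: "\<And>y vs. y \<in> D \<Longrightarrow> \<omega> y vs = \<omega>' y vs"
  have "pdf k a (\<lambda>u. \<omega> u vs) y = pdf k a (\<lambda>u. \<omega>' u vs) y" if "y \<in> D"
    by (rule pdf_cong_open[OF open_D that]) (rule *)
  then show "pd k a \<omega> y vs = pd k a \<omega>' y vs" by (simp add: pd_def)
qed

lemma rd_cong: "(\<And>y vs. y \<in> D \<Longrightarrow> \<omega> y vs = \<omega>' y vs) \<Longrightarrow> rd k w \<omega> = rd k w \<omega>'"
  unfolding rd_def by (intro sum.cong refl arg_cong2[of _ _ _ _ wedge] pd_cong)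

lemma smo_fm_dz_dzbar: "smooth_on D f \<Longrightarrow> smo (fm f (dz_dzbar I J))"
  by (simp add: smo_def smooth_on_fm_dz_dzbar alt_fm alt_dz_dzbar)

end

text \<open>In the applications \<open>X\<close> is an overlap seen in the source chart, while
  \<open>Y\<close> is a whole coordinate domain of the target chart.\<close>

locale coordinate_change = O: open_domain X + U: open_domain Y
  for X Y :: "(complex^'n::finite) set" +
  fixes g :: "complex^'n \<Rightarrow> complex^'n"
  assumes g_into: "y \<in> X \<Longrightarrow> g y \<in> Y"
    and g_holo: "holo_on X (\<lambda>y. g y $ b)"
begin

definition jac :: "'n \<Rightarrow> 'n \<Rightarrow> complex^'n \<Rightarrow> complex" where
  "jac b a = pdf (- \<i>) a (\<lambda>u. g u $ b)"

definition pb :: "'n form \<Rightarrow> 'n form" where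
  "pb \<omega> y vs = (if y \<in> X then \<omega> (g y) (map (frechet_derivative g (at y)) vs) else 0)"

lemma g_comp_smooth: "smooth_on X (\<lambda>y. g y $ b)" 
  using g_holo by (simp add: holo_on_def)

lemma g_comp_holo: "y \<in> X \<Longrightarrow> pdf \<i> a (\<lambda>u. g u $ b) y = 0"
  using g_holo by (simp add: holo_on_def pdzbar_eq_pdf)

lemma g_smooth: "smooth_on X g"
proof -
  have "smooth_on X (\<lambda>y. \<Sum>b\<in>UNIV. axis b (g y $ b))"
    by (intro smooth_on_sum O.open_D smooth_on_bounded_linear[OF linear_conv_bounded_linear[THEN iffD1, OF linear_axis]] g_comp_smooth)
  then show ?thesis by (simp add: sum_axis)
qed

lemma g_dif: "y \<in> X \<Longrightarrow> g differentiable (at y)"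
  using smooth_on_differentiable[OF g_smooth] .

lemma g_comp_dif: "y \<in> X \<Longrightarrow> (\<lambda>u. g u $ b) differentiable (at y)"
  using smooth_on_differentiable[OF g_comp_smooth] .

lemma Dg_comp: "y \<in> X \<Longrightarrow> frechet_derivative g (at y) v $ b = (\<Sum>a\<in>UNIV. v $ a * jac b a y)"
proof -
  assume y: "y \<in> X"
  have "frechet_derivative g (at y) v $ b = frechet_derivative (\<lambda>u. g u $ b) (at y) v"
    using frechet_derivative_bounded_linear[OF bounded_linear_vec_nth g_dif[OF y], of b] by simp
  also have "\<dots> = (\<Sum>a\<in>UNIV. v $ a * jac b a y)"
    by (simp add: frechet_derivative_Wirtinger g_comp_dif y g_comp_holo jac_def)
  finally show ?thesis .
qed

lemma Dg_axis: "y \<in> X \<Longrightarrow> frechet_derivative g (at y) (axis a z) $ b = z * jac b a y"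
proof -
  assume "y \<in> X"
  have "(\<Sum>c\<in>UNIV. axis a z $ c * jac b c y) = (\<Sum>c\<in>UNIV. if c = a then z * jac b a y else 0)"
    by (intro sum.cong refl) (auto simp: axis_def)
  then show ?thesis using \<open>y \<in> X\<close> by (simp add: Dg_comp)
qed

text \<open>The differential of \<open>g\<close> is complex linear by holomorphy, so it preserves
  the splitting into linear and antilinear parts and no mixed terms appear.\<close>

lemma linear_Dg_Wirtinger:
  assumes "linear L" "y \<in> X"
  shows "(L (frechet_derivative g (at y) (axis a 1)) - \<i> * L (frechet_derivative g (at y) (axis a \<i>))) / 2 =
      (\<Sum>b\<in>UNIV. jac b a y * ((L (axis b 1) - \<i> * L (axis b \<i>)) / 2))"
    "(L (frechet_derivative g (at y) (axis a 1)) + \<i> * L (frechet_derivative g (at y) (axis a \<i>))) / 2 =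
      (\<Sum>b\<in>UNIV. cnj (jac b a y) * ((L (axis b 1) + \<i> * L (axis b \<i>)) / 2))"
proof -
  define P where "P b = (L (axis b 1) - \<i> * L (axis b \<i>)) / 2" for b
  define Q where "Q b = (L (axis b 1) + \<i> * L (axis b \<i>)) / 2" for b
  have L: "L v = (\<Sum>b\<in>UNIV. v $ b * P b) + (\<Sum>b\<in>UNIV. cnj (v $ b) * Q b)" for v
    unfolding P_def Q_def by (subst linear_Wirtinger[OF assms(1)]) (rule sum.distrib)
  have 1: "L (frechet_derivative g (at y) (axis a 1)) = (\<Sum>b\<in>UNIV. jac b a y * P b) + (\<Sum>b\<in>UNIV. cnj (jac b a y) * Q b)"
    unfolding L Dg_axis[OF assms(2)] by simp
  have 2: "L (frechet_derivative g (at y) (axis a \<i>)) = \<i> * (\<Sum>b\<in>UNIV. jac b a y * P b) - \<i> * (\<Sum>b\<in>UNIV. cnj (jac b a y) * Q b)"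
    unfolding L Dg_axis[OF assms(2)] by (simp add: sum_distrib_left sum_negf mult.assoc)
  show "(L (frechet_derivative g (at y) (axis a 1)) - \<i> * L (frechet_derivative g (at y) (axis a \<i>))) / 2 =
      (\<Sum>b\<in>UNIV. jac b a y * ((L (axis b 1) - \<i> * L (axis b \<i>)) / 2))"
    unfolding 1 2 P_def[symmetric] by (simp add: algebra_simps)
  show "(L (frechet_derivative g (at y) (axis a 1)) + \<i> * L (frechet_derivative g (at y) (axis a \<i>))) / 2 =
      (\<Sum>b\<in>UNIV. cnj (jac b a y) * ((L (axis b 1) + \<i> * L (axis b \<i>)) / 2))"
    unfolding 1 2 Q_def[symmetric] by (simp add: algebra_simps)
qed

lemma frechet_derivative_comp:
  assumes "y \<in> X" "f differentiable (at (g y))"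
  shows "((\<lambda>u. f (g u)) has_derivative (\<lambda>v. frechet_derivative f (at (g y)) (frechet_derivative g (at y) v))) (at y)"
  by (rule has_derivative_compose[OF has_frechet_derivative[OF g_dif[OF assms(1)]] has_frechet_derivative[OF assms(2)]])

lemma pdf_comp:
  assumes "y \<in> X" "f differentiable (at (g y))"
  shows "pdf (- \<i>) a (\<lambda>u. f (g u)) y = (\<Sum>b\<in>UNIV. jac b a y * pdf (- \<i>) b f (g y))"
    "pdf \<i> a (\<lambda>u. f (g u)) y = (\<Sum>b\<in>UNIV. cnj (jac b a y) * pdf \<i> b f (g y))"
proof -
  have D: "frechet_derivative (\<lambda>u. f (g u)) (at y) =
      (\<lambda>v. frechet_derivative f (at (g y)) (frechet_derivative g (at y) v))"
    by (rule frechet_derivative_eqI[OF frechet_derivative_comp[OF assms]])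
  show "pdf (- \<i>) a (\<lambda>u. f (g u)) y = (\<Sum>b\<in>UNIV. jac b a y * pdf (- \<i>) b f (g y))"
    "pdf \<i> a (\<lambda>u. f (g u)) y = (\<Sum>b\<in>UNIV. cnj (jac b a y) * pdf \<i> b f (g y))"
    using linear_Dg_Wirtinger[OF linear_frechet_derivative[OF assms(2)] assms(1), of a]
    by (simp_all add: pdf_def D)
qed

text \<open>Induction on \<open>k\<close> for all \<open>f\<close> at once: the derivative of the
  composition is built from derivatives of \<open>g\<close> and from Wirtinger derivatives of
  \<open>f\<close> composed with \<open>g\<close>, and the latter fall under the induction
  hypothesis.\<close>

lemma smooth_comp:
  fixes f :: "complex^'n \<Rightarrow> complex"
  assumes "smooth_on Y f"
  shows "smooth_on X (\<lambda>y. f (g y))"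
proof -
  have "Ck_on k X (\<lambda>y. f (g y))" for k
    using assms
  proof (induction k arbitrary: f)
    case 0
    then show ?case
      using continuous_on_compose2[OF smooth_on_continuous[OF 0] smooth_on_continuous[OF g_smooth]] g_into by auto
  next
    case (Suc k)
    let ?D = "\<lambda>y v. \<Sum>b\<in>UNIV. frechet_derivative (\<lambda>u. g u $ b) (at y) v * pdf (- \<i>) b f (g y) +
        cnj (frechet_derivative (\<lambda>u. g u $ b) (at y) v) * pdf \<i> b f (g y)"
    have der: "((\<lambda>u. f (g u)) has_derivative ?D y) (at y)" if y: "y \<in> X" for y
    proof -
      have f: "f differentiable (at (g y))" by (rule smooth_on_differentiable[OF Suc.prems g_into[OF y]])
      have "frechet_derivative f (at (g y)) (frechet_derivative g (at y) v) = ?D y v" for v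
        using frechet_derivative_bounded_linear[OF bounded_linear_vec_nth g_dif[OF y]]
        by (simp add: frechet_derivative_Wirtinger[OF f])
      then show ?thesis using frechet_derivative_comp[OF y f] by simp
    qed
    have Dgb: "Ck_on k X (\<lambda>y. frechet_derivative (\<lambda>u. g u $ b) (at y) v)"
      "Ck_on k X (\<lambda>y. cnj (frechet_derivative (\<lambda>u. g u $ b) (at y) v))" for b v
      using smooth_on_frechet[OF g_comp_smooth]
        smooth_on_bounded_linear[OF bounded_linear_cnj O.open_D smooth_on_frechet[OF g_comp_smooth]]
      unfolding smooth_on_def by blast+
    have pdfg: "Ck_on k X (\<lambda>y. pdf l b f (g y))" for l b
      by (rule Suc.IH[OF smooth_on_pdf[OF U.open_D Suc.prems]])
    have sum: "finite I \<Longrightarrow> (\<And>i. i \<in> I \<Longrightarrow> Ck_on k X (h i)) \<Longrightarrow> Ck_on k X (\<lambda>x. \<Sum>i\<in>I. h i x)"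
      for I :: "'n set" and h :: "'n \<Rightarrow> complex^'n \<Rightarrow> complex"
    proof (induction I rule: finite_induct)
      case empty
      show ?case using smooth_on_const[of X "0::complex"] unfolding smooth_on_def by simp
    next
      case (insert x F)
      then show ?case using Ck_on_add[OF O.open_D, of k "h x" "\<lambda>x. \<Sum>i\<in>F. h i x"] by simp
    qed
    have D: "Ck_on k X (\<lambda>y. ?D y v)" for v
      by (rule sum) (simp, rule Ck_on_add[OF O.open_D Ck_on_mult[OF O.open_D Dgb(1) pdfg] Ck_on_mult[OF O.open_D Dgb(2) pdfg]])
    show ?case by (rule Ck_on_SucI[where D = ?D, OF O.open_D der D])
  qed
  then show ?thesis by (simp add: smooth_on_def)
qed

lemma pb_add: "pb (\<alpha> + \<beta>) = pb \<alpha> + pb \<beta>" and pb_minus: "pb (- \<alpha>) = - pb \<alpha>" and pb_0 [simp]: "pb 0 = 0"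
  by (simp_all add: fun_eq_iff pb_def)

lemma pb_diff: "pb (\<alpha> - \<beta>) = pb \<alpha> - pb \<beta>"
  using pb_add[of \<alpha> "- \<beta>"] by (simp add: pb_minus)

lemma pb_sg: "pb (sg i \<alpha>) = sg i (pb \<alpha>)"
  by (simp add: sg_def pb_minus)

lemma pb_sum: "pb (\<Sum>i\<in>I. f i) = (\<Sum>i\<in>I. pb (f i))"
  using sum_comp_morphism[of pb f I] by (simp add: pb_add o_def)

lemma pb_wedge: "pb (wedge \<alpha> \<beta>) = wedge (pb \<alpha>) (pb \<beta>)"
proof (intro ext)
  fix y vs
  show "pb (wedge \<alpha> \<beta>) y vs = wedge (pb \<alpha>) (pb \<beta>) y vs"
    by (simp add: pb_def wedge_def nths_map)
qed

lemma pb_fm: "pb (fm f \<omega>) = fm (\<lambda>y. f (g y)) (pb \<omega>)"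
  by (simp add: fun_eq_iff pb_def fm_def)

lemma zo_pb [simp]: "O.zo (pb \<omega>)"
  by (simp add: O.zo_def pb_def)

lemma par_pb: "par m \<omega> \<Longrightarrow> par m (pb \<omega>)"
  by (simp add: par_def pb_def)

lemma pb_cong: "(\<And>y vs. y \<in> Y \<Longrightarrow> \<omega> y vs = \<omega>' y vs) \<Longrightarrow> pb \<omega> = pb \<omega>'"
  by (simp add: fun_eq_iff pb_def g_into)

lemma pb_one_form: "pb one_form = O.hf (\<lambda>_. 1)"
  by (simp add: fun_eq_iff pb_def one_form_def O.hf_apply)

lemma pb_dz: "pb (dz b) = O.rdel (O.hf (\<lambda>y. g y $ b))"
proof (intro ext)
  fix y vs
  show "pb (dz b) y vs = O.rdel (O.hf (\<lambda>y. g y $ b)) y vs"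
    unfolding O.rd_hf
    by (auto simp: pb_def rs_def sum_fun_apply fm_def dz_def Dg_comp jac_def mult.commute split: list.splits)
qed

lemma pb_dzbar: "pb (dzbar b) = O.rdelb (O.hf (\<lambda>y. cnj (g y $ b)))"
proof (intro ext)
  fix y vs
  show "pb (dzbar b) y vs = O.rdelb (O.hf (\<lambda>y. cnj (g y $ b))) y vs"
    unfolding O.rd_hf
    by (auto simp: pb_def rs_def sum_fun_apply fm_def dzbar_def Dg_comp jac_def pdf_cnj g_comp_dif mult.commute split: list.splits)
qed

lemma smooth_cnj_g: "smooth_on X (\<lambda>y. cnj (g y $ b))"
  by (rule smooth_on_bounded_linear[OF bounded_linear_cnj O.open_D g_comp_smooth])

lemma sm_pb_dz: "O.sm (pb (dz b))" "O.sm (pb (dzbar b))"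
  unfolding pb_dz pb_dzbar
  by (simp_all add: O.sm_hf g_comp_smooth smooth_cnj_g O.cst_dz O.cst_dzbar)

text \<open>The pullback of \<open>dz b\<close> is \<partial> of the component \<open>g_b\<close>.
  It is closed under \<partial> because \<partial> squares to zero, and under the conjugate operator
  because the two anticommute and \<open>g_b\<close> is holomorphic; dually for
  \<open>dzbar b\<close>.\<close>

lemma rd_pb_dz:
  "O.rdel (pb (dz b)) = 0" "O.rdelb (pb (dz b)) = 0"
  "O.rdel (pb (dzbar b)) = 0" "O.rdelb (pb (dzbar b)) = 0"
proof -
  have s: "O.smo (O.hf (\<lambda>y. g y $ b))" "O.smo (O.hf (\<lambda>y. cnj (g y $ b)))"
    by (simp_all add: O.sm_hf g_comp_smooth smooth_cnj_g)
  have 1: "O.rdelb (O.hf (\<lambda>y. g y $ b)) = 0"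
    unfolding O.rd_hf by (simp add: fun_eq_iff rs_def sum_fun_apply fm_def g_comp_holo)
  have 2: "O.rdel (O.hf (\<lambda>y. cnj (g y $ b))) = 0"
    unfolding O.rd_hf by (simp add: fun_eq_iff rs_def sum_fun_apply fm_def g_comp_holo pdf_cnj g_comp_dif)
  show "O.rdel (pb (dz b)) = 0" "O.rdelb (pb (dzbar b)) = 0"
    unfolding pb_dz pb_dzbar using s by (simp_all add: O.rd_self O.cst_dz O.cst_dzbar)
  show "O.rdelb (pb (dz b)) = 0" "O.rdel (pb (dzbar b)) = 0"
    unfolding pb_dz pb_dzbar O.rd_rd[OF O.cst_dzbar O.cst_dz s(1)] O.rd_rd[OF O.cst_dz O.cst_dzbar s(2)] 1 2
    by simp_all
qed

lemma sm_pb_dz_dzbar: "O.sm (pb (dz_dzbar I J))"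
proof (induction I J rule: dz_dzbar_induct)
  case Nil
  show ?case unfolding dz_dzbar_Nil pb_one_form by (simp add: O.sm_hf)
next
  case (dzbar b J)
  then show ?case unfolding dz_dzbar_Nil_Cons pb_wedge by (intro O.sm_wedge sm_pb_dz)
next
  case (dz a I J)
  then show ?case unfolding dz_dzbar_Cons pb_wedge by (intro O.sm_wedge sm_pb_dz)
qed

lemma rd_pb_dz_dzbar:
  assumes w: "O.cst w" and z: "\<And>b. O.rd k w (pb (dz b)) = 0" "\<And>b. O.rd k w (pb (dzbar b)) = 0"
  shows "O.rd k w (pb (dz_dzbar I J)) = 0"
proof (induction I J rule: dz_dzbar_induct)
  case Nil
  have "O.rd k w (O.hf (\<lambda>_. 1)) = 0"
    unfolding O.rd_hf by (simp add: fun_eq_iff rs_def sum_fun_apply fm_def)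
  then show ?case unfolding dz_dzbar_Nil pb_one_form .
next
  case (dzbar b J)
  have "O.rd k w (wedge (pb (dzbar b)) (pb (dz_dzbar [] J))) = 0"
    unfolding O.rd_wedge[OF w O.sm_smo[OF sm_pb_dz(2)] par_pb[OF O.par_dzbar] O.sm_smo[OF sm_pb_dz_dzbar]] z dzbar
    by simp
  then show ?case unfolding dz_dzbar_Nil_Cons pb_wedge .
next
  case (dz b I J)
  have "O.rd k w (wedge (pb (dz b)) (pb (dz_dzbar I J))) = 0"
    unfolding O.rd_wedge[OF w O.sm_smo[OF sm_pb_dz(1)] par_pb[OF O.par_dz] O.sm_smo[OF sm_pb_dz_dzbar]] z dz
    by simp
  then show ?case unfolding dz_dzbar_Cons pb_wedge .
qed

text \<open>Both Dolbeault operators are covered. A form of type (p, q) is expanded in basis forms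
  whose pullbacks are closed by \<open>z\<close>, so only the coefficients are differentiated, and
  for these \<open>chain\<close> is the chain rule.\<close>

lemma pb_rd:
  assumes w: "O.cst w" "U.cst w"
    and z: "\<And>b. O.rd k w (pb (dz b)) = 0" "\<And>b. O.rd k w (pb (dzbar b)) = 0"
    and chain: "\<And>f. smooth_on Y f \<Longrightarrow>
      O.rd k w (O.hf (\<lambda>y. f (g y))) = (\<Sum>b\<in>UNIV. wedge (pb (w b)) (O.hf (\<lambda>y. pdf k b f (g y))))"
    and "U.pq p q \<omega>"
  shows "O.rd k w (pb \<omega>) = pb (U.rd k w \<omega>)" "O.sm (pb \<omega>)"
proof -
  obtain f where f': "\<forall>I J. smooth_on Y (f I J)" "\<forall>y\<in>Y. \<forall>vs. \<omega> y vs = U.pq_sum_of p q f y vs"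
    using U.pqD[OF assms(6)] by blast
  then have f: "smooth_on Y (f I J)" for I J by blast
  let ?e = "\<lambda>I J. fm (f I J) (dz_dzbar I J)"
  have smo: "U.smo (?e I J)" for I J by (rule U.smo_fm_dz_dzbar[OF f])
  have pbe: "pb (?e I J) = wedge (O.hf (\<lambda>y. f I J (g y))) (pb (dz_dzbar I J))" for I J
    unfolding pb_fm by (rule O.wedge_hf(1)[OF zo_pb, symmetric])
  have sme: "O.sm (pb (?e I J))" for I J
    unfolding pbe by (intro O.sm_wedge O.sm_hf smooth_comp f sm_pb_dz_dzbar)
  have gen: "O.rd k w (pb (?e I J)) = pb (U.rd k w (?e I J))" for I J
  proof -
    have "O.rd k w (pb (?e I J)) = wedge (O.rd k w (O.hf (\<lambda>y. f I J (g y)))) (pb (dz_dzbar I J))"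
      unfolding pbe
      by (subst O.rd_wedge[OF w(1) O.sm_smo[OF O.sm_hf[OF smooth_comp[OF f]]] O.par_hf O.sm_smo[OF sm_pb_dz_dzbar]])
        (simp add: rd_pb_dz_dzbar[OF w(1) z])
    also have "\<dots> = (\<Sum>b\<in>UNIV. wedge (pb (w b)) (wedge (O.hf (\<lambda>y. pdf k b (f I J) (g y))) (pb (dz_dzbar I J))))"
      unfolding chain[OF f] by (simp add: wedge_sum_left wedge_assoc)
    also have "\<dots> = (\<Sum>b\<in>UNIV. pb (wedge (w b) (fm (pdf k b (f I J)) (dz_dzbar I J))))"
      unfolding O.wedge_hf(1)[OF zo_pb] pb_wedge pb_fm ..
    also have "\<dots> = (\<Sum>b\<in>UNIV. pb (wedge (w b) (U.pd k b (?e I J))))"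
    proof (intro sum.cong refl pb_cong wedge_cong_at)
      fix b y vs assume y: "y \<in> Y"
      show "fm (pdf k b (f I J)) (dz_dzbar I J) y vs = U.pd k b (?e I J) y vs"
        using pdf_mult[OF smooth_on_differentiable[OF f y] differentiable_const, of k b I J "dz_dzbar I J undefined vs"] y
        by (simp add: U.pd_at fm_dz_dzbar)
    qed
    also have "\<dots> = pb (U.rd k w (?e I J))" unfolding U.rd_def pb_sum ..
    finally show ?thesis .
  qed
  let ?S = "\<Sum>I | length I = p. \<Sum>J | length J = q. ?e I J"
  have S: "\<omega> y vs = ?S y vs" if "y \<in> Y" for y vs
    using f'(2) that unfolding U.pq_sum_of_def by blast
  have pbS: "pb \<omega> = (\<Sum>I | length I = p. \<Sum>J | length J = q. pb (?e I J))"
    unfolding pb_sum[symmetric] by (rule pb_cong[OF S])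
  have "O.rd k w (pb \<omega>) = (\<Sum>I | length I = p. \<Sum>J | length J = q. O.rd k w (pb (?e I J)))"
    unfolding pbS using O.sm_smo[OF sme] by (simp add: O.rd_sum)
  also have "\<dots> = pb (\<Sum>I | length I = p. \<Sum>J | length J = q. U.rd k w (?e I J))"
    unfolding gen pb_sum ..
  also have "(\<Sum>I | length I = p. \<Sum>J | length J = q. U.rd k w (?e I J)) = U.rd k w ?S"
    using smo by (simp add: U.rd_sum)
  also have "\<dots> = U.rd k w \<omega>" by (rule U.rd_cong[OF S[symmetric]])
  finally show "O.rd k w (pb \<omega>) = pb (U.rd k w \<omega>)" .
  show "O.sm (pb \<omega>)" unfolding pbS by (intro O.sm_sum sme)
qed

lemma chain_del:
  assumes "smooth_on Y f"
  shows "O.rdel (O.hf (\<lambda>y. f (g y))) = (\<Sum>b\<in>UNIV. wedge (pb (dz b)) (O.hf (\<lambda>y. pdf (- \<i>) b f (g y))))"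
proof (intro ext)
  fix y vs
  have "(\<Sum>b\<in>UNIV. wedge (pb (dz b)) (O.hf (\<lambda>y. pdf (- \<i>) b f (g y)))) y vs =
     (\<Sum>b\<in>UNIV. fm (\<lambda>y. pdf (- \<i>) b f (g y)) (pb (dz b)) y vs)"
    by (simp add: sum_fun_apply O.wedge_hf(2))
  also have "\<dots> = O.rdel (O.hf (\<lambda>y. f (g y))) y vs"
  proof (cases "y \<in> X")
    case True
    have "(\<Sum>a\<in>UNIV. (\<Sum>b\<in>UNIV. jac b a y * pdf (- \<i>) b f (g y)) * dz a y vs) =
        (\<Sum>b\<in>UNIV. pdf (- \<i>) b f (g y) * (\<Sum>a\<in>UNIV. jac b a y * dz a y vs))"
      unfolding sum_distrib_left sum_distrib_right by (subst sum.swap) (simp add: algebra_simps)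
    then show ?thesis
      using True smooth_on_differentiable[OF assms g_into[OF True]]
      unfolding O.rd_hf pb_dz
      by (simp add: rs_def sum_fun_apply fm_def pdf_comp jac_def)
  qed (simp add: O.rd_hf rs_def fm_def pb_def)
  finally show "O.rdel (O.hf (\<lambda>y. f (g y))) y vs = (\<Sum>b\<in>UNIV. wedge (pb (dz b)) (O.hf (\<lambda>y. pdf (- \<i>) b f (g y)))) y vs" ..
qed

lemma chain_delbar:
  assumes "smooth_on Y f"
  shows "O.rdelb (O.hf (\<lambda>y. f (g y))) = (\<Sum>b\<in>UNIV. wedge (pb (dzbar b)) (O.hf (\<lambda>y. pdf \<i> b f (g y))))"
proof (intro ext)
  fix y vs
  have "(\<Sum>b\<in>UNIV. wedge (pb (dzbar b)) (O.hf (\<lambda>y. pdf \<i> b f (g y)))) y vs =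
     (\<Sum>b\<in>UNIV. fm (\<lambda>y. pdf \<i> b f (g y)) (pb (dzbar b)) y vs)"
    by (simp add: sum_fun_apply O.wedge_hf(2))
  also have "\<dots> = O.rdelb (O.hf (\<lambda>y. f (g y))) y vs"
  proof (cases "y \<in> X")
    case True
    have "(\<Sum>a\<in>UNIV. (\<Sum>b\<in>UNIV. cnj (jac b a y) * pdf \<i> b f (g y)) * dzbar a y vs) =
        (\<Sum>b\<in>UNIV. pdf \<i> b f (g y) * (\<Sum>a\<in>UNIV. cnj (jac b a y) * dzbar a y vs))"
      unfolding sum_distrib_left sum_distrib_right by (subst sum.swap) (simp add: algebra_simps)
    then show ?thesis
      using True smooth_on_differentiable[OF assms g_into[OF True]]
      unfolding O.rd_hf pb_dzbar
      by (simp add: rs_def sum_fun_apply fm_def pdf_comp jac_def pdf_cnj g_comp_dif)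
  qed (simp add: O.rd_hf rs_def fm_def pb_def)
  finally show "O.rdelb (O.hf (\<lambda>y. f (g y))) y vs = (\<Sum>b\<in>UNIV. wedge (pb (dzbar b)) (O.hf (\<lambda>y. pdf \<i> b f (g y)))) y vs" ..
qed

lemma pb_rdel: "U.pq p q \<omega> \<Longrightarrow> O.rdel (pb \<omega>) = pb (U.rdel \<omega>)"
  by (rule pb_rd(1)[OF O.cst_dz U.cst_dz rd_pb_dz(1,3) chain_del])

lemma pb_rdelb: "U.pq p q \<omega> \<Longrightarrow> O.rdelb (pb \<omega>) = pb (U.rdelb \<omega>)"
  by (rule pb_rd(1)[OF O.cst_dzbar U.cst_dzbar rd_pb_dz(2,4) chain_delbar])

lemma sm_pb: "U.pq p q \<omega> \<Longrightarrow> O.sm (pb \<omega>)"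
  by (rule pb_rd(2)[OF O.cst_dz U.cst_dz rd_pb_dz(1,3) chain_del])

text \<open>Inserting \<partial>/\<partial>z_a into a pullback amounts to inserting its image under
  the differential, which has components \<open>jac b a\<close>.\<close>

lemma iota_pb:
  assumes "lin1 \<omega>"
  shows "iota a (pb \<omega>) = (\<Sum>b\<in>UNIV. fm (jac b a) (pb (iota b \<omega>)))"
proof (intro ext)
  fix y vs
  show "iota a (pb \<omega>) y vs = (\<Sum>b\<in>UNIV. fm (jac b a) (pb (iota b \<omega>))) y vs"
  proof (cases "y \<in> X")
    case True
    have "linear (\<lambda>v. \<omega> (g y) (v # map (frechet_derivative g (at y)) vs))"
      using assms by (simp add: lin1_def)
    from linear_Dg_Wirtinger(1)[OF this True, of a] True show ?thesis
      by (simp add: iota_def pb_def sum_fun_apply fm_def)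
  qed (simp add: iota_def pb_def sum_fun_apply fm_def)
qed

text \<open>A coefficientwise derivative has no invariant meaning in general. On (0,q)-forms, where
  insertions vanish, it equals insertion after \<partial> by \<open>iota_rdel\<close>, and both of
  these steps are compatible with pullback.\<close>

lemma pd_pb:
  assumes "U.pq 0 q \<omega>" "U.zo \<omega>"
  shows "O.pd (- \<i>) a (pb \<omega>) = (\<Sum>b\<in>UNIV. fm (jac b a) (pb (U.pd (- \<i>) b \<omega>)))"
proof -
  note U = U.pq_smo[OF assms] U.pq_0_iota[OF assms]
  have "iota a (pb \<omega>) = 0"
    unfolding iota_pb[OF U(3)] U(4) by (simp add: fun_eq_iff fm_def sum_fun_apply)
  then have "O.pd (- \<i>) a (pb \<omega>) = iota a (O.rdel (pb \<omega>))"
    using O.sm_smo[OF sm_pb[OF assms(1)]] by (simp add: O.iota_rdel)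
  also have "\<dots> = iota a (pb (U.rdel \<omega>))"
    unfolding pb_rdel[OF assms(1)] ..
  also have "\<dots> = (\<Sum>b\<in>UNIV. fm (jac b a) (pb (iota b (U.rdel \<omega>))))"
    by (rule iota_pb[OF U.pq_smo(3)[OF U.pq_rdel[OF assms(1)]]])
      (use U(1) in \<open>simp add: U.sm_rd[unfolded U.sm_def] U.cst_dz\<close>)
  also have "\<dots> = (\<Sum>b\<in>UNIV. fm (jac b a) (pb (U.pd (- \<i>) b \<omega>)))"
    using U by (simp add: U.iota_rdel)
  finally show ?thesis .
qed

end

section \<open>Changes of frames\<close>

text \<open>\<open>G\<close> is a holomorphic transition matrix and \<open>H\<close> its inverse,
  both regarded as matrices of 0-forms.\<close>

locale frame_change = super_calculus +
  fixes G H one :: 'a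
  assumes G_Om: "G \<in> Om 0" and H_Om: "H \<in> Om 0"
    and HG: "H \<star> G = one" and GH: "G \<star> H = one"
    and one_left: "A \<in> S \<Longrightarrow> one \<star> A = A" and one_right: "A \<in> S \<Longrightarrow> A \<star> one = A"
    and dl_one: "dl one = 0"
    and db_G: "db G = 0" and db_H: "db H = 0"
    and ct_G: "v \<in> V \<Longrightarrow> ct v G = 0" and ct_H: "v \<in> V \<Longrightarrow> ct v H = 0"
begin

lemma GH_S [simp]: "G \<in> S" "H \<in> S" using G_Om H_Om Om_S by auto

lemma HG_left: "A \<in> S \<Longrightarrow> H \<star> (G \<star> A) = A"
  using mul_assoc[of H G A] by (simp add: HG one_left)

lemma dl_H: "dl H = - (H \<star> (dl G \<star> H))"
proof -
  have "dl H \<star> G + H \<star> dl G = 0"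
    using dl_mul[OF H_Om, of G] by (simp add: HG dl_one sg_def)
  then have "(dl H \<star> G + H \<star> dl G) \<star> H = 0" by simp
  then show ?thesis by (simp add: mul_simps GH one_right eq_neg_iff_add_eq_0)
qed

definition conj :: "'a \<Rightarrow> 'a" where
  "conj A = G \<star> (A \<star> H)"

lemma conj_mul: "A \<in> S \<Longrightarrow> B \<in> S \<Longrightarrow> conj (A \<star> B) = conj A \<star> conj B"
  by (simp add: conj_def mul_assoc HG_left)

lemma conj_db:
  assumes "A \<in> Om m"
  shows "db (conj A) = conj (db A)"
  using Om_S[OF assms] by (simp add: conj_def db_mul[OF G_Om] db_mul[OF assms] db_G db_H) (simp add: sg_def)

lemma conj_ct:
  assumes "v \<in> T i" "A \<in> Om m"
  shows "ct v (conj A) = conj (ct v A)"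
  using T_V[OF assms(1)]
  by (simp add: conj_def ct_mul[OF assms(1) G_Om] ct_mul[OF assms] ct_G ct_H) (simp add: sg_def)

text \<open>Gauge covariance: the derivatives of \<open>G\<close> and, through \<open>dl_H\<close>,
  of \<open>H\<close> are compensated by the inhomogeneous term in the transformation of the
  connection matrix.\<close>

lemma conj_Dc:
  assumes "A \<in> Om m" "W' \<in> Om 1" "W = conj W' - dl G \<star> H"
  shows "dl (conj A) + cm 1 m W (conj A) = conj (dl A + cm 1 m W' A)"
proof -
  have S [simp]: "A \<in> S" "W' \<in> S" using Om_S assms by auto
  have 1: "dl (conj A) = dl G \<star> (A \<star> H) + (G \<star> (dl A \<star> H) - sg m (G \<star> (A \<star> (H \<star> (dl G \<star> H)))))"
    by (simp add: conj_def dl_mul[OF G_Om] dl_mul[OF assms(1)] dl_H mul_simps)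
      (cases "even m"; simp add: sg_def mul_simps)
  have 2: "W \<star> conj A = G \<star> (W' \<star> (A \<star> H)) - dl G \<star> (A \<star> H)"
    by (simp add: assms(3) conj_def mul_simps HG_left)
  have 3: "conj A \<star> W = G \<star> (A \<star> (W' \<star> H)) - G \<star> (A \<star> (H \<star> (dl G \<star> H)))"
    by (simp add: assms(3) conj_def mul_simps HG_left)
  show ?thesis
    unfolding cm_def 1 2 3
    by (cases "even m"; simp add: conj_def sg_def mul_simps)
qed

text \<open>The inhomogeneous term \<open>dl G \<star> H\<close> is annihilated by
  \<open>db\<close>, since \<open>G\<close> and \<open>H\<close> are holomorphic and
  \<open>db\<close> anticommutes with \<open>dl\<close>.\<close>

lemma conj_F:
  assumes "W' \<in> Om 1" "W = conj W' - dl G \<star> H"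
  shows "db W = conj (db W')"
proof -
  have S [simp]: "W' \<in> S" using Om_S assms by auto
  have "conj W' \<in> S" by (simp add: conj_def)
  then show ?thesis
    by (simp add: assms(2) db_diff conj_db[OF assms(1)] db_mul[OF Om_dl[OF G_Om]] db_dl db_G db_H)
qed

end

section \<open>Covariance under changes of coordinates\<close>

context open_domain
begin

lemma pd_fm: 
  assumes "smooth_on D f" "sm \<omega>"
  shows "pd k a (fm f \<omega>) = fm (pdf k a f) \<omega> + fm f (pd k a \<omega>)"
proof -
  have "pd k a (wedge (hf f) \<omega>) = wedge (hf (pdf k a f)) \<omega> + wedge (hf f) (pd k a \<omega>)"
    using assms by (simp add: pd_wedge sm_hf pd_hf)
  then show ?thesis using assms(2) by (simp add: wedge_hf sm_def)
qed

lemma rd_fm: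
  assumes "smooth_on D f" "sm \<omega>" "cst w" "\<And>a y. y \<in> D \<Longrightarrow> pdf k a f y = 0"
  shows "rd k w (fm f \<omega>) = fm f (rd k w \<omega>)"
proof -
  have "fm (pdf k a f) \<omega> = 0" for a
    using assms(2,4) by (force simp: fun_eq_iff fm_def sm_def zo_def)
  then show ?thesis
    using assms by (simp add: rd_def pd_fm wedge_fm fm_sum)
qed

end

context coordinate_change
begin

lemma jac_smooth: "smooth_on X (jac b a)"
  unfolding jac_def by (rule smooth_on_pdf[OF O.open_D g_comp_smooth])

lemma jac_holo: "y \<in> X \<Longrightarrow> pdf \<i> c (jac b a) y = 0"
proof -
  assume y: "y \<in> X"
  have "pdf \<i> c (jac b a) y = pdf (- \<i>) a (pdf \<i> c (\<lambda>u. g u $ b)) y"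
    unfolding jac_def by (rule pdf_commute[OF O.open_D g_comp_smooth y])
  also have "\<dots> = pdf (- \<i>) a (\<lambda>_. 0) y"
    by (rule pdf_cong_open[OF O.open_D y]) (rule g_comp_holo)
  finally show ?thesis by simp
qed

lemma jac_sym: "y \<in> X \<Longrightarrow> pdf (- \<i>) c (jac b a) y = pdf (- \<i>) a (jac b c) y"
  unfolding jac_def by (rule pdf_commute[OF O.open_D g_comp_smooth])

text \<open>The transformation law of TX-valued forms by components: \<open>\<phi>'\<close> lives on
  \<open>Y\<close> in target coordinates, \<phi> on \<open>X\<close> in source coordinates.\<close>

definition vrel :: "'n vform \<Rightarrow> 'n vform \<Rightarrow> bool" where
  "vrel \<phi>' \<phi> \<longleftrightarrow> (\<forall>b. pb (\<phi>' b) = (\<Sum>a\<in>UNIV. fm (jac b a) (\<phi> a)))"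

text \<open>The Jacobian that relates \<open>\<phi>'\<close> to \<phi> is the one that
  \<open>iota_pb\<close> produces on the side of the form, so nothing is left over.\<close>

lemma pb_ctr:
  assumes "vrel \<phi>' \<phi>" "lin1 \<omega>"
  shows "pb (ctr \<phi>' \<omega>) = ctr \<phi> (pb \<omega>)"
proof -
  have "pb (ctr \<phi>' \<omega>) = (\<Sum>b\<in>UNIV. \<Sum>a\<in>UNIV. fm (jac b a) (wedge (\<phi> a) (pb (iota b \<omega>))))"
    using assms(1) by (simp add: ctr_def pb_sum pb_wedge vrel_def wedge_sum_left wedge_fm)
  also have "\<dots> = (\<Sum>a\<in>UNIV. \<Sum>b\<in>UNIV. fm (jac b a) (wedge (\<phi> a) (pb (iota b \<omega>))))"
    by (rule sum.swap)
  also have "\<dots> = ctr \<phi> (pb \<omega>)"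
    by (simp add: ctr_def iota_pb[OF assms(2)] wedge_sum_right wedge_fm)
  finally show ?thesis .
qed

text \<open>The Jacobian is holomorphic and therefore passes through the Dolbeault operator.\<close>

lemma vrel_rdelb:
  assumes "vrel \<phi>' \<phi>" "\<And>b. U.pq 0 q (\<phi>' b)" "\<And>a. O.sm (\<phi> a)"
  shows "vrel (\<lambda>b. U.rdelb (\<phi>' b)) (\<lambda>a. O.rdelb (\<phi> a))"
  unfolding vrel_def
proof
  fix b
  have "pb (U.rdelb (\<phi>' b)) = O.rdelb (pb (\<phi>' b))" by (rule pb_rdelb[OF assms(2), symmetric])
  also have "\<dots> = (\<Sum>a\<in>UNIV. O.rdelb (fm (jac b a) (\<phi> a)))"
  proof -
    have "O.smo (fm (jac b a) (\<phi> a))" for a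
      using O.sm_wedge[OF O.sm_hf[OF jac_smooth] assms(3)] O.wedge_hf(1) assms(3) by (metis O.sm_def)
    then show ?thesis using assms(1) by (simp add: vrel_def O.rd_sum)
  qed
  also have "\<dots> = (\<Sum>a\<in>UNIV. fm (jac b a) (O.rdelb (\<phi> a)))"
    by (intro sum.cong refl O.rd_fm jac_smooth assms(3) O.cst_dzbar jac_holo)
  finally show "pb (U.rdelb (\<phi>' b)) = (\<Sum>a\<in>UNIV. fm (jac b a) (O.rdelb (\<phi> a)))" .
qed

text \<open>Differentiating the transformed coefficients also hits the Jacobian. The resulting
  second derivatives of the coordinate change are symmetric in their two indices, so their
  contributions \<open>P\<close> and \<open>Q\<close> cancel in the bracket.\<close>

lemma vrel_SN:
  assumes "vrel \<phi>' \<phi>" "\<And>b. U.pq 0 i (\<phi>' b)" "\<And>b. U.zo (\<phi>' b)" "\<And>a. O.sm (\<phi> a)"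
    "vrel \<psi>' \<psi>" "\<And>b. U.pq 0 j (\<psi>' b)" "\<And>b. U.zo (\<psi>' b)" "\<And>a. O.sm (\<psi> a)"
  shows "vrel (U.SN \<phi>' \<psi>') (O.SN \<phi> \<psi>)"
  unfolding vrel_def
proof
  fix b
  let ?d = "O.pd (- \<i>)" and ?d' = "U.pd (- \<i>)"
  have fsm: "O.smo (fm (jac b a) \<omega>)" if "O.sm \<omega>" for a \<omega>
    using O.sm_wedge[OF O.sm_hf[OF jac_smooth] that] O.wedge_hf(1) that by (metis O.sm_def)
  have pdpb: "?d a (pb (\<xi>' b)) = (\<Sum>e\<in>UNIV. fm (pdf (- \<i>) a (jac b e)) (\<xi>'' e) + fm (jac b e) (?d a (\<xi>'' e)))"
    if "vrel \<xi>' \<xi>''" "\<And>a. O.sm (\<xi>'' a)" for \<xi>' \<xi>'' a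
  proof -
    have "?d a (pb (\<xi>' b)) = (\<Sum>e\<in>UNIV. ?d a (fm (jac b e) (\<xi>'' e)))"
      using that fsm by (simp add: vrel_def O.pd_sum)
    also have "\<dots> = (\<Sum>e\<in>UNIV. fm (pdf (- \<i>) a (jac b e)) (\<xi>'' e) + fm (jac b e) (?d a (\<xi>'' e)))"
      by (intro sum.cong refl O.pd_fm jac_smooth that(2))
    finally show ?thesis .
  qed
  \<comment> \<open>The Jacobian moves from the vector field to the derivative: on pulled back
    (0,q)-forms, \<open>pd_pb\<close> recombines it into a derivative in source coordinates.\<close>
  have 1: "(\<Sum>c\<in>UNIV. wedge (pb (\<phi>' c)) (pb (?d' c (\<psi>' b)))) = (\<Sum>a\<in>UNIV. wedge (\<phi> a) (?d a (pb (\<psi>' b))))"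
  proof -
    have "(\<Sum>c\<in>UNIV. wedge (pb (\<phi>' c)) (pb (?d' c (\<psi>' b)))) =
        (\<Sum>c\<in>UNIV. \<Sum>a\<in>UNIV. fm (jac c a) (wedge (\<phi> a) (pb (?d' c (\<psi>' b)))))"
      using assms(1) by (simp add: vrel_def wedge_sum_left wedge_fm)
    also have "\<dots> = (\<Sum>a\<in>UNIV. \<Sum>c\<in>UNIV. fm (jac c a) (wedge (\<phi> a) (pb (?d' c (\<psi>' b)))))"
      by (rule sum.swap)
    finally show ?thesis by (simp add: pd_pb[OF assms(6,7)] wedge_sum_right wedge_fm)
  qed
  have 2: "(\<Sum>c\<in>UNIV. wedge (pb (?d' c (\<phi>' b))) (pb (\<psi>' c))) = (\<Sum>a\<in>UNIV. wedge (?d a (pb (\<phi>' b))) (\<psi> a))"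
  proof -
    have "(\<Sum>c\<in>UNIV. wedge (pb (?d' c (\<phi>' b))) (pb (\<psi>' c))) =
        (\<Sum>c\<in>UNIV. \<Sum>a\<in>UNIV. fm (jac c a) (wedge (pb (?d' c (\<phi>' b))) (\<psi> a)))"
      using assms(5) by (simp add: vrel_def wedge_sum_right wedge_fm)
    also have "\<dots> = (\<Sum>a\<in>UNIV. \<Sum>c\<in>UNIV. fm (jac c a) (wedge (pb (?d' c (\<phi>' b))) (\<psi> a)))"
      by (rule sum.swap)
    finally show ?thesis by (simp add: pd_pb[OF assms(2,3)] wedge_sum_left wedge_fm)
  qed
  define P where "P a e = fm (pdf (- \<i>) a (jac b e)) (wedge (\<phi> a) (\<psi> e))" for a e
  define Q where "Q a e = fm (pdf (- \<i>) a (jac b e)) (wedge (\<phi> e) (\<psi> a))" for a e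
  define R where "R a e = fm (jac b e) (wedge (\<phi> a) (?d a (\<psi> e)))" for a e
  define R' where "R' a e = fm (jac b e) (wedge (?d a (\<phi> e)) (\<psi> a))" for a e
  \<comment> \<open>Symmetry of \<open>jac\<close> under differentiation holds on \<open>X\<close>
    only; outside, both products vanish.\<close>
  have "P a e = Q e a" for a e
  proof (intro ext)
    fix y vs
    have "wedge (\<phi> a) (\<psi> e) y vs = 0" if "y \<notin> X"
      using O.zo_wedge_left[of "\<phi> a" "\<psi> e"] assms(4)[of a] that by (simp add: O.sm_def O.zo_def)
    then show "P a e y vs = Q e a y vs"
      using jac_sym[of y a b e] by (cases "y \<in> X") (simp_all add: P_def Q_def fm_def)
  qed
  then have PQ: "(\<Sum>a\<in>UNIV. \<Sum>e\<in>UNIV. P a e) = (\<Sum>a\<in>UNIV. \<Sum>e\<in>UNIV. Q a e)"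
    by (simp only:) (rule sum.swap)
  have "pb (U.SN \<phi>' \<psi>' b) =
      (\<Sum>c\<in>UNIV. wedge (pb (\<phi>' c)) (pb (?d' c (\<psi>' b)))) - (\<Sum>c\<in>UNIV. wedge (pb (?d' c (\<phi>' b))) (pb (\<psi>' c)))"
    by (simp add: U.SN_def pb_sum pb_diff pb_wedge sum_subtractf)
  also have "\<dots> = (\<Sum>a\<in>UNIV. \<Sum>e\<in>UNIV. P a e) + (\<Sum>a\<in>UNIV. \<Sum>e\<in>UNIV. R a e) -
      ((\<Sum>a\<in>UNIV. \<Sum>e\<in>UNIV. Q a e) + (\<Sum>a\<in>UNIV. \<Sum>e\<in>UNIV. R' a e))"
    unfolding 1 2 pdpb[OF assms(5,8)] pdpb[OF assms(1,4)]
    by (simp add: wedge_sum_left wedge_sum_right wedge_add_left wedge_add_right wedge_fm sum.distrib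
        P_def Q_def R_def R'_def)
  also have "\<dots> = (\<Sum>e\<in>UNIV. \<Sum>a\<in>UNIV. R a e) - (\<Sum>e\<in>UNIV. \<Sum>a\<in>UNIV. R' a e)"
    unfolding PQ sum.swap[of R] sum.swap[of R'] by simp
  also have "\<dots> = (\<Sum>e\<in>UNIV. fm (jac b e) (O.SN \<phi> \<psi> e))"
  proof -
    have fm_diff: "fm f (\<alpha> - \<beta>) = fm f \<alpha> - fm f \<beta>" for f and \<alpha> \<beta> :: "'n form"
      by (simp add: fun_eq_iff fm_def algebra_simps)
    show ?thesis by (simp add: R_def R'_def O.SN_def fm_sum fm_diff sum_subtractf)
  qed
  finally show "pb (U.SN \<phi>' \<psi>' b) = (\<Sum>a\<in>UNIV. fm (jac b a) (O.SN \<phi> \<psi> a))" .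
qed

definition mpb :: "('n, 'r::finite) mform \<Rightarrow> ('n, 'r) mform" where
  "mpb A i j = pb (A i j)"

lemma mpb_mwedge: "mpb (mwedge A B) = mwedge (mpb A) (mpb B)"
proof -
  have "mpb (mwedge A B) i j = mwedge (mpb A) (mpb B) i j" for i j
    by (simp add: mpb_def mwedge_def pb_sum pb_wedge)
  then show ?thesis by (intro ext) metis
qed

end

section \<open>Flatness of the (1,0)-part of the Chern connection\<close>

context open_domain
begin

lemma pq_1_0:
  assumes "pq 1 0 \<omega>" "zo \<omega>"
  shows "\<omega> = (\<Sum>a\<in>UNIV. wedge (hf (\<lambda>y. \<omega> y [axis a 1])) (dz a))"
    and "smooth_on D (\<lambda>y. \<omega> y vs)"
    and "\<omega> y [axis a \<i>] = \<i> * \<omega> y [axis a 1]"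
proof -
  note pq = pq_smo[OF assms]
  show "smooth_on D (\<lambda>y. \<omega> y vs)" using pq(1) by (simp add: smo_smooth)
  have i: "\<omega> y [axis a \<i>] = \<i> * \<omega> y [axis a 1]" for y a
  proof (cases "y \<in> D")
    case True
    obtain f where "\<forall>I J. smooth_on D (f I J)" and f: "\<forall>y\<in>D. \<forall>vs. \<omega> y vs = pq_sum_of 1 0 f y vs"
      using pqD[OF assms(1)] by blast
    have "pq_sum_of 1 0 f y [axis a \<i>] = \<i> * pq_sum_of 1 0 f y [axis a 1]"
      unfolding pq_sum_of_def sum_fun_apply sum_distrib_left
    proof (intro sum.cong refl)
      fix I J :: "'n list" assume "I \<in> {I. length I = 1}" "J \<in> {J. length J = 0}"
      then obtain b where "I = [b]" "J = []" by (auto simp: length_Suc_conv)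
      then show "fm (f I J) (dz_dzbar I J) y [axis a \<i>] = \<i> * fm (f I J) (dz_dzbar I J) y [axis a 1]"
        by (simp add: fm_def dz_dzbar_Cons dz_def axis_def)
    qed
    then show ?thesis using f True by simp
  qed (use assms(2) in \<open>simp add: zo_def\<close>)
  then show "\<omega> y [axis a \<i>] = \<i> * \<omega> y [axis a 1]" .
  show "\<omega> = (\<Sum>a\<in>UNIV. wedge (hf (\<lambda>y. \<omega> y [axis a 1])) (dz a))"
  proof (intro ext)
    fix y vs
    show "\<omega> y vs = (\<Sum>a\<in>UNIV. wedge (hf (\<lambda>y. \<omega> y [axis a 1])) (dz a)) y vs"
    proof (cases "y \<in> D")
      case True
      have *: "wedge (hf f) (dz a) y vs = f y * dz a y vs" for f a
      proof -
        have "wedge (hf f) (dz a) y vs = wedge (fm f one_form) (dz a) y vs"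
          using True by (intro wedge_cong_at) (simp_all add: hf_apply fm_def one_form_def)
        then show ?thesis by (simp add: wedge_fm) (simp add: fm_def)
      qed
      show ?thesis
      proof (cases "length vs = 1")
        case True
        then obtain v where v: "vs = [v]" by (auto simp: length_Suc_conv)
        have "linear (\<lambda>v. \<omega> y [v])" using pq(3) by (simp add: lin1_def)
        from linear_Wirtinger[OF this, of v]
        have "\<omega> y [v] = (\<Sum>a\<in>UNIV. v $ a * \<omega> y [axis a 1])" unfolding i by simp
        then show ?thesis unfolding sum_fun_apply * by (simp add: v dz_def mult.commute)
      next
        case False
        then have "\<omega> y vs = 0" "dz a y vs = 0" for a
          using pq(2) deg_dz[of a] by (simp_all add: deg_def)
        then show ?thesis unfolding sum_fun_apply * by simp
      qed
    next
      case False
      then show ?thesis using assms(2) by (simp add: zo_def sum_fun_apply wedge_def hf_apply)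
    qed
  qed
qed

text \<open>The (1,0)-part of the metric condition reads \<partial>_a h = h w_a. A further
  derivative gives \<partial>_b \<partial>_a h = h C_ba with C_ba = w_b w_a + \<partial>_b w_a. The
  left side is symmetric in a and b, so C_ba is symmetric by injectivity of h; the form with
  coefficients C_ba, which is \<partial>W + W \<and> W, therefore vanishes.\<close>

lemma chern_flat:
  fixes W :: "('n, 'r::finite) mform" and h :: "complex^'n \<Rightarrow> complex^'r^'r"
  assumes W: "\<And>i j. pq 1 0 (W i j)" "\<And>i j. zo (W i j)"
    and h: "\<And>i j. smooth_on D (\<lambda>y. h y $ i $ j)"
    and pos: "\<And>y v. y \<in> D \<Longrightarrow> v \<noteq> 0 \<Longrightarrow> Re (herm (h y) v v) > 0"
    and metric: "\<And>y v k l. y \<in> D \<Longrightarrow> frechet_derivative (\<lambda>u. h u $ k $ l) (at y) v =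
      (\<Sum>j\<in>UNIV. h y $ k $ j * W j l y [v]) + (\<Sum>i\<in>UNIV. cnj (W i k y [v]) * h y $ i $ l)"
  shows "mdl W = - mwedge W W"
proof -
  define w where "w a i j = (\<lambda>y. W i j y [axis a 1])" for a i j
  have w_smooth: "smooth_on D (w a i j)" for a i j
    unfolding w_def by (rule pq_1_0(2)[OF W])
  have W_eq: "W i j = (\<Sum>a\<in>UNIV. wedge (hf (w a i j)) (dz a))" for i j
    unfolding w_def by (rule pq_1_0(1)[OF W])
  \<comment> \<open>A (1,0)-form takes at \<open>axis a \<i>\<close> the value at
    \<open>axis a 1\<close> times \<open>\<i>\<close>. In the combination defining
    \<open>pdf (- \<i>)\<close> the linear terms double and the conjugated ones cancel.\<close>
  have dh: "pdf (- \<i>) a (\<lambda>u. h u $ k $ l) y = (\<Sum>j\<in>UNIV. h y $ k $ j * w a j l y)" if "y \<in> D" for a k l y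
  proof -
    have "pdf (- \<i>) a (\<lambda>u. h u $ k $ l) y = ((\<Sum>j\<in>UNIV. h y $ k $ j * W j l y [axis a 1]) - \<i> * (\<Sum>j\<in>UNIV. h y $ k $ j * (\<i> * W j l y [axis a 1])) +
       ((\<Sum>i\<in>UNIV. cnj (W i k y [axis a 1]) * h y $ i $ l) - \<i> * (\<Sum>i\<in>UNIV. cnj (\<i> * W i k y [axis a 1]) * h y $ i $ l))) / 2"
      unfolding pdf_def metric[OF that] pq_1_0(3)[OF W] by (simp add: algebra_simps)
    also have "\<i> * (\<Sum>j\<in>UNIV. h y $ k $ j * (\<i> * W j l y [axis a 1])) = - (\<Sum>j\<in>UNIV. h y $ k $ j * W j l y [axis a 1])"
      by (simp add: sum_distrib_left sum_negf[symmetric] algebra_simps)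
    also have "\<i> * (\<Sum>i\<in>UNIV. cnj (\<i> * W i k y [axis a 1]) * h y $ i $ l) = (\<Sum>i\<in>UNIV. cnj (W i k y [axis a 1]) * h y $ i $ l)"
      by (simp add: sum_distrib_left algebra_simps)
    finally show ?thesis by (simp add: w_def)
  qed
  define C where "C b a m l y = (\<Sum>j\<in>UNIV. w b m j y * w a j l y) + pdf (- \<i>) b (w a m l) y" for b a m l y
  have ddh: "pdf (- \<i>) b (pdf (- \<i>) a (\<lambda>u. h u $ k $ l)) y = (\<Sum>m\<in>UNIV. h y $ k $ m * C b a m l y)"
    if y: "y \<in> D" for a b k l y
  proof -
    have dif: "(\<lambda>u. h u $ k $ j) differentiable (at y)" "(w a j l) differentiable (at y)" for j
      using smooth_on_differentiable[OF h y] smooth_on_differentiable[OF w_smooth y] by blast+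
    have "pdf (- \<i>) b (pdf (- \<i>) a (\<lambda>u. h u $ k $ l)) y = pdf (- \<i>) b (\<lambda>u. \<Sum>j\<in>UNIV. h u $ k $ j * w a j l u) y"
      by (rule pdf_cong_open[OF open_D y]) (rule dh)
    also have "\<dots> = (\<Sum>j\<in>UNIV. pdf (- \<i>) b (\<lambda>u. h u $ k $ j) y * w a j l y + h y $ k $ j * pdf (- \<i>) b (w a j l) y)"
      using dif by (subst pdf_sum) (auto intro!: differentiable_mult simp: pdf_mult)
    also have "\<dots> = (\<Sum>j\<in>UNIV. \<Sum>m\<in>UNIV. h y $ k $ m * (w b m j y * w a j l y)) + (\<Sum>j\<in>UNIV. h y $ k $ j * pdf (- \<i>) b (w a j l) y)"
      by (simp add: dh[OF y] sum.distrib sum_distrib_right mult.assoc)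
    also have "(\<Sum>j\<in>UNIV. \<Sum>m\<in>UNIV. h y $ k $ m * (w b m j y * w a j l y)) = (\<Sum>m\<in>UNIV. \<Sum>j\<in>UNIV. h y $ k $ m * (w b m j y * w a j l y))"
      by (rule sum.swap)
    finally show ?thesis
      by (simp add: C_def distrib_left sum.distrib sum_distrib_left)
  qed
  have C_sym: "C b a m l y = C a b m l y" if y: "y \<in> D" for a b m l y
  proof -
    \<comment> \<open>The metric matrix annihilates this vector, so
      \<open>herm (h y) x x = 0\<close> and positivity forces \<open>x = 0\<close>; this replaces
      multiplication by the inverse of \<open>h\<close>.\<close>
    define x where "x = (\<chi> m. C b a m l y - C a b m l y)"
    have "(\<Sum>m\<in>UNIV. h y $ k $ m * x $ m) = 0" for k
      using pdf_commute[OF open_D h y, of "- \<i>" b "- \<i>" a k l]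
      by (simp add: ddh[OF y] x_def right_diff_distrib sum_subtractf)
    then have "herm (h y) x x = 0"
      by (simp add: herm_def mult.assoc flip: sum_distrib_left)
    then have "x = 0" using pos[OF y, of x] by force
    then show ?thesis by (simp add: x_def vec_eq_iff)
  qed
  have sm_w: "sm (hf (w a i j))" for a i j by (rule sm_hf[OF w_smooth])
  have swap: "wedge (dz b) (wedge (hf f) (dz a)) = wedge (hf f) (wedge (dz b) (dz a))" for f a b
    using wedge_swap[OF par_dz par_hf, of b f "dz a"] by (simp add: sg_def)
  have "(mdl W + mwedge W W) i l = (0 :: 'n form)" for i l
  proof -
    have 1: "rdel (W i l) = (\<Sum>b\<in>UNIV. \<Sum>a\<in>UNIV. wedge (hf (pdf (- \<i>) b (w a i l))) (wedge (dz b) (dz a)))"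
    proof -
      have "pd (- \<i>) b (W i l) = (\<Sum>a\<in>UNIV. wedge (hf (pdf (- \<i>) b (w a i l))) (dz a))" for b
        unfolding W_eq using sm_w by (simp add: pd_sum pd_wedge pd_hf)
      then show ?thesis by (simp add: rd_def wedge_sum_right swap)
    qed
    have 2: "mwedge W W i l = (\<Sum>b\<in>UNIV. \<Sum>a\<in>UNIV. wedge (hf (\<lambda>y. \<Sum>j\<in>UNIV. w b i j y * w a j l y)) (wedge (dz b) (dz a)))"
    proof -
      have hh: "wedge (hf f) (wedge (hf f') \<gamma>) = wedge (hf (\<lambda>y. f y * f' y)) \<gamma>" for f f' and \<gamma> :: "'n form"
      proof -
        have "wedge (hf f) (hf f') = hf (\<lambda>y. f y * f' y)"
          unfolding wedge_hf(1)[OF zo_hf] by (auto simp: fun_eq_iff fm_def hf_apply)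
        then show ?thesis by (simp flip: wedge_assoc)
      qed
      have hsum: "hf (\<lambda>y. \<Sum>j\<in>UNIV. f j y) = (\<Sum>j\<in>UNIV. hf (f j))" for f :: "'r \<Rightarrow> complex^'n \<Rightarrow> complex"
        by (auto simp: fun_eq_iff hf_apply sum_fun_apply)
      have "wedge (W i j) (W j l) = (\<Sum>b\<in>UNIV. \<Sum>a\<in>UNIV. wedge (hf (\<lambda>y. w b i j y * w a j l y)) (wedge (dz b) (dz a)))" for j
        unfolding W_eq[of i j] W_eq[of j l] wedge_sum_left wedge_sum_right
        by (simp add: wedge_assoc swap hh) (rule sum.swap)
      then have "mwedge W W i l = (\<Sum>j\<in>UNIV. \<Sum>b\<in>UNIV. \<Sum>a\<in>UNIV. wedge (hf (\<lambda>y. w b i j y * w a j l y)) (wedge (dz b) (dz a)))"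
        by (simp add: mwedge_def)
      also have "\<dots> = (\<Sum>b\<in>UNIV. \<Sum>j\<in>UNIV. \<Sum>a\<in>UNIV. wedge (hf (\<lambda>y. w b i j y * w a j l y)) (wedge (dz b) (dz a)))"
        by (rule sum.swap)
      also have "\<dots> = (\<Sum>b\<in>UNIV. \<Sum>a\<in>UNIV. \<Sum>j\<in>UNIV. wedge (hf (\<lambda>y. w b i j y * w a j l y)) (wedge (dz b) (dz a)))"
        by (intro sum.cong refl sum.swap)
      finally show ?thesis by (simp add: hsum wedge_sum_left)
    qed
    define Z where "Z b a = wedge (hf (C b a i l)) (wedge (dz b) (dz a))" for b a
    have hadd: "hf f + hf f' = hf (\<lambda>y. f y + f' y)" for f f'
      by (auto simp: fun_eq_iff hf_apply)
    have Z: "Z b a = wedge (hf (\<lambda>y. \<Sum>j\<in>UNIV. w b i j y * w a j l y)) (wedge (dz b) (dz a)) +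
        wedge (hf (pdf (- \<i>) b (w a i l))) (wedge (dz b) (dz a))" for b a
      unfolding Z_def C_def[abs_def] hadd[symmetric] wedge_add_left ..
    have "(mdl W + mwedge W W) i l = rdel (W i l) + mwedge W W i l" by (simp add: mdl_def)
    also have "\<dots> = (\<Sum>b\<in>UNIV. \<Sum>a\<in>UNIV. Z b a)"
      unfolding 1 2 Z sum.distrib by (rule add.commute)
    finally have sum: "(mdl W + mwedge W W) i l = (\<Sum>b\<in>UNIV. \<Sum>a\<in>UNIV. Z b a)" .
    have anti: "Z b a = - Z a b" for a b
    proof -
      have "hf (C b a i l) = hf (C a b i l)" by (rule hf_cong) (rule C_sym)
      moreover have "wedge (dz b) (dz a) = - wedge (dz a) (dz b)"
        using wedge_dz_dz(1)[of b a one_form] by simp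
      ultimately show ?thesis by (simp add: Z_def wedge_minus_right)
    qed
    have "(\<Sum>b\<in>UNIV. \<Sum>a\<in>UNIV. Z b a) = (\<Sum>b\<in>UNIV. \<Sum>a\<in>UNIV. - Z a b)"
      by (intro sum.cong refl) (rule anti)
    also have "\<dots> = - (\<Sum>b\<in>UNIV. \<Sum>a\<in>UNIV. Z a b)" by (simp only: sum_negf)
    also have "(\<Sum>b\<in>UNIV. \<Sum>a\<in>UNIV. Z a b) = (\<Sum>b\<in>UNIV. \<Sum>a\<in>UNIV. Z b a)" by (rule sum.swap)
    finally show ?thesis unfolding sum by (rule form_eq_minus_self)
  qed
  then have "mdl W + mwedge W W = 0" by (intro ext) simp
  then show ?thesis by (simp add: eq_neg_iff_add_eq_0)
qed

end

section \<open>Global forms\<close>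

definition mrs :: "(complex^'n) set \<Rightarrow> ('n, 'r) mform \<Rightarrow> ('n, 'r) mform" where
  "mrs D A i j = rs D (A i j)"

definition lcov :: "(complex^'n::finite) set \<Rightarrow> ('n, 'r::finite) mform \<Rightarrow> nat \<Rightarrow> ('n, 'r) mform \<Rightarrow> ('n, 'r) mform" where
  "lcov D W m A = open_domain.mdl D A + gcomm 1 m W A"

lemma mrs_apply: "mrs D A i j y vs = (if y \<in> D then A i j y vs else 0)"
  by (simp add: mrs_def rs_def)

lemma mrs_mwedge: "mrs D (mwedge A B) = mwedge (mrs D A) (mrs D B)"
proof (intro ext)
  fix i j y vs
  show "mrs D (mwedge A B) i j y vs = mwedge (mrs D A) (mrs D B) i j y vs"
  proof (cases "y \<in> D")
    case True
    then have "mwedge A B i j y vs = mwedge (mrs D A) (mrs D B) i j y vs"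
      by (intro mwedge_cong_at) (simp_all add: mrs_apply)
    then show ?thesis using True by (simp add: mrs_apply)
  qed (simp add: mrs_apply mwedge_def sum_fun_apply wedge_def)
qed

lemma mrs_contr: "mrs D (contr v A) = contr (\<lambda>a. rs D (v a)) (mrs D A)"
proof (intro ext)
  fix i j y vs
  show "mrs D (contr v A) i j y vs = contr (\<lambda>a. rs D (v a)) (mrs D A) i j y vs"
  proof (cases "y \<in> D")
    case True
    then have "contr v A i j y vs = contr (\<lambda>a. rs D (v a)) (mrs D A) i j y vs"
      by (intro contr_cong_at) (simp_all add: mrs_apply rs_def)
    then show ?thesis using True by (simp add: mrs_apply)
  qed (simp add: mrs_apply contr_def sum_fun_apply wedge_def rs_def)
qed

lemma mrs_linear: "mrs D (A + B) = mrs D A + mrs D B" "mrs D (- A) = - mrs D A" "mrs D (A - B) = mrs D A - mrs D B"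
  by (simp_all add: fun_eq_iff mrs_apply)

lemma mrs_sg: "mrs D (sg i A) = sg i (mrs D A)"
  by (simp add: sg_def mrs_linear)

lemma gcomm_eq_sg: "gcomm i j A B = mwedge A B - sg (i * j) (mwedge B A)"
  by (simp add: gcomm_def power_minus_one_times_eq_sg)

lemma mrs_gcomm: "mrs D (gcomm i j A B) = gcomm i j (mrs D A) (mrs D B)"
  by (simp add: gcomm_eq_sg mrs_linear mrs_sg mrs_mwedge)

lemma rs_rd:
  assumes "open X" "open D" "X \<subseteq> D"
  shows "rs X (open_domain.rd D k w \<omega>) = open_domain.rd X k w (rs X \<omega>)"
proof -
  interpret X: open_domain X by (rule open_domain.intro) fact
  interpret D: open_domain D by (rule open_domain.intro) fact
  have "D.rd k w \<omega> y vs = X.rd k w \<omega> y vs" if "y \<in> X" for y vs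
    using assms(3) that unfolding D.rd_def X.rd_def sum_fun_apply
    by (intro sum.cong refl wedge_cong_at) (auto simp: D.pd_def X.pd_def)
  moreover have "X.zo (X.rd k w \<omega>)"
    unfolding X.rd_def by (intro X.zo_sum X.zo_wedge_right X.zo_pd)
  moreover have "X.rd k w (rs X \<omega>) = X.rd k w \<omega>" by (simp add: X.rd_def)
  ultimately show ?thesis by (auto simp: fun_eq_iff rs_def X.zo_def)
qed

lemma rs_SN:
  assumes "open X" "open D" "X \<subseteq> D"
  shows "rs X (open_domain.SN D \<phi> \<psi> b) = open_domain.SN X (\<lambda>a. rs X (\<phi> a)) (\<lambda>a. rs X (\<psi> a)) b"
proof -
  interpret X: open_domain X by (rule open_domain.intro) fact
  interpret D: open_domain D by (rule open_domain.intro) fact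
  have "D.SN \<phi> \<psi> b y vs = X.SN (\<lambda>a. rs X (\<phi> a)) (\<lambda>a. rs X (\<psi> a)) b y vs" if "y \<in> X" for y vs
    using assms(3) that unfolding D.SN_def X.SN_def sum_fun_apply fun_diff_def
    by (intro sum.cong refl arg_cong2[of _ _ _ _ "(-)"] wedge_cong_at)
      (auto simp: D.pd_def X.pd_rs, auto simp: X.pd_def rs_def)
  moreover have "X.zo (X.SN (\<lambda>a. rs X (\<phi> a)) (\<lambda>a. rs X (\<psi> a)) b)"
    unfolding X.SN_def by (intro X.zo_sum X.zo_diff X.zo_wedge_right X.zo_wedge_left X.zo_pd X.zo_rs_zo) 
  ultimately show ?thesis by (auto simp: fun_eq_iff rs_def X.zo_def)
qed

context open_domain
begin

lemma cov_del_at: "y \<in> D \<Longrightarrow> cov_del W m A i j y vs = lcov D W m A i j y vs"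
  by (simp add: cov_del_def lcov_def mdel_def mdl_def del_at)

definition typed :: "nat \<Rightarrow> nat \<Rightarrow> ('n, 'r::finite) mform \<Rightarrow> bool" where
  "typed p q A \<longleftrightarrow> (\<forall>i j. pq p q (A i j) \<and> zo (A i j))"

lemma typedD: "typed p q A \<Longrightarrow> pq p q (A i j)" "typed p q A \<Longrightarrow> zo (A i j)"
  by (auto simp: typed_def)

lemma typed_mOm: "typed p q A \<Longrightarrow> A \<in> mOm (p + q)"
  by (simp add: typed_def mOm_def pq_sf)

lemma typed_mwedge: "typed p q A \<Longrightarrow> typed p' q' B \<Longrightarrow> typed (p + p') (q + q') (mwedge A B)"
  unfolding typed_def mwedge_def by (intro allI conjI pq_sum pq_wedge zo_sum zo_wedge_left) auto

lemma typed_add: "typed p q A \<Longrightarrow> typed p q B \<Longrightarrow> typed p q (A + B)"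
  by (simp add: typed_def pq_add)

lemma typed_diff: "typed p q A \<Longrightarrow> typed p q B \<Longrightarrow> typed p q (A - B)"
  by (simp add: typed_def pq_diff)

lemma typed_sg: "typed p q A \<Longrightarrow> typed p q (sg i A)"
  by (simp add: typed_def sg_apply pq_sg)

lemma typed_gcomm:
  assumes "typed p q A" "typed p' q' B"
  shows "typed (p + p') (q + q') (gcomm i j A B)"
  unfolding gcomm_eq_sg using typed_mwedge[OF assms] typed_mwedge[OF assms(2,1)]
  by (intro typed_diff typed_sg) (simp_all add: add.commute)

lemma zo_rd: "zo (rd k w \<omega>)"
  unfolding rd_def by (intro zo_sum zo_wedge_right zo_pd)

lemma typed_mdl: "typed p q A \<Longrightarrow> typed (Suc p) q (mdl A)"
  by (simp add: typed_def mdl_def pq_rdel zo_rd)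

lemma typed_mdb: "typed p q A \<Longrightarrow> typed p (Suc q) (mdb A)"
  by (simp add: typed_def mdb_def pq_rdelb zo_rd)

lemma typed_lcov: "typed 1 0 W \<Longrightarrow> typed p q A \<Longrightarrow> typed (Suc p) q (lcov D W m A)"
  unfolding lcov_def using typed_gcomm[of 1 0 W p q A] by (intro typed_add typed_mdl) auto

lemma typed_contr:
  assumes "\<And>a. pq 0 i (\<phi> a)" "typed p q A"
  shows "typed (p - 1) (q + i) (contr \<phi> A)"
proof -
  have "pq (p - 1) (q + i) (wedge (\<phi> a) (iota a (A k l)))" for a k l
    using pq_wedge[OF assms(1) pq_iota[OF typedD(1)[OF assms(2)]]] by (simp add: add.commute)
  moreover have "zo (wedge (\<phi> a) (iota a (A k l)))" for a k l
    using typedD(2)[OF assms(2)] by (intro zo_wedge_right zo_iota)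
  ultimately show ?thesis
    unfolding typed_def contr_def by (intro allI conjI pq_sum zo_sum)
qed

lemma typed_0_contr:
  assumes "typed 0 q A"
  shows "contr \<phi> A = 0"
proof -
  have "ctr \<phi> (A i j) = 0" for i j
    by (simp add: ctr_def pq_0_iota[OF typedD[OF assms]])
  then show ?thesis by (intro ext) (simp add: contr_eq_ctr)
qed

text \<open>The first contraction consumes the only \<open>dz\<close>, and the form
  \<open>v\<close>, being of type (0, i), contributes no new one.\<close>

lemma typed_1_contr_contr:
  assumes "typed 1 q A" "v \<in> vV"
  shows "contr w (contr v A) = 0"
proof -
  obtain i where v: "vf i v" using assms(2) by (auto simp: vV_def)
  have "iota b (iota a (A k l)) = 0" for a b k l
  proof (rule pq_0_iota)
    show "pq 0 q (iota a (A k l))" using pq_iota[OF typedD(1)[OF assms(1), of k l], of a] by simp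
    show "zo (iota a (A k l))" by (rule zo_iota[OF typedD(2)[OF assms(1)]])
  qed
  then have "iota b (ctr v (A k l)) = 0" for b k l
    by (simp add: ctr_def iota_sum iota_wedge vf_iota[OF v])
  then have "ctr w (ctr v (A k l)) = 0" for k l
    by (simp add: ctr_def[of w])
  then show ?thesis by (intro ext) (simp add: contr_eq_ctr)
qed

end

section \<open>Charts, frames and their common domains\<close>

locale holomorphic_bundle =
  fixes M :: "('x, 'n::finite) cmanifold" and E :: "('x, 't, 'r::finite) vbundle"
  assumes manifold: "complex_manifold M" and vector_bundle: "holomorphic_vector_bundle M E"
begin

lemma chart_open_image:
  assumes "c \<in> charts M" "openin (space_of M) A"
  shows "open (snd c ` (fst c \<inter> A))"
proof -
  have c: "openin (space_of M) (fst c)" "open (snd c ` fst c)"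
    "homeomorphic_map (subtopology (space_of M) (fst c)) (top_of_set (snd c ` fst c)) (snd c)"
    using manifold assms(1) unfolding complex_manifold_def by auto
  have "openin (subtopology (space_of M) (fst c)) (fst c \<inter> A)"
    using assms(2) by (simp add: openin_subtopology_Int2)
  then have "openin (top_of_set (snd c ` fst c)) (snd c ` (fst c \<inter> A))"
    using homeomorphic_imp_open_map[OF c(3)] unfolding open_map_def by blast
  then show ?thesis using c(2) by (rule openin_open_trans)
qed

lemma inv_chart_eq:
  assumes "c \<in> charts M" "x \<in> fst c"
  shows "inv_chart c (snd c x) = x"
proof -
  have c: "openin (space_of M) (fst c)"
    "homeomorphic_map (subtopology (space_of M) (fst c)) (top_of_set (snd c ` fst c)) (snd c)"
    using manifold assms(1) unfolding complex_manifold_def by auto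
  have "topspace (subtopology (space_of M) (fst c)) = fst c"
    using openin_subset[OF c(1)] by (rule topspace_subtopology_subset)
  then have "inj_on (snd c) (fst c)"
    using homeomorphic_imp_injective_map[OF c(2)] by simp
  then show ?thesis unfolding inv_chart_def using assms(2) by (rule inv_into_f_f)
qed

lemma chart_openin: "c \<in> charts M \<Longrightarrow> openin (space_of M) (fst c)"
  using manifold unfolding complex_manifold_def by auto

lemma frame_openin: "t \<in> frames E \<Longrightarrow> openin (space_of M) (fdom E t)"
  using vector_bundle unfolding holomorphic_vector_bundle_def by auto

lemma open_vdom: "open (vdom M c)"
  using chart_open_image[of c "fst c"] chart_openin by (simp add: vdom_def)

lemma open_edom: "open (edom M E c t)"
  using chart_open_image[of c "fdom E t"] frame_openin by (simp add: edom_def)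

lemma edom_vdom: "edom M E c t \<subseteq> vdom M c"
  by (auto simp: edom_def vdom_def)

lemma ED: "open_domain (edom M E c t)" and VD: "open_domain (vdom M c)"
  by (simp_all add: open_domain_def open_edom open_vdom)

lemma holo_on_subset: "holo_on S f \<Longrightarrow> T \<subseteq> S \<Longrightarrow> holo_on T f"
  using smooth_on_subset unfolding holo_on_def by blast

lemma coord_change_holo:
  "c \<in> charts M \<Longrightarrow> c' \<in> charts M \<Longrightarrow> holo_on (snd c ` (fst c \<inter> fst c')) (\<lambda>y. coord_change c c' y $ a)"
  using manifold unfolding complex_manifold_def by auto

lemma coordinate_change_vdom:
  assumes "c \<in> charts M" "c' \<in> charts M"
  shows "coordinate_change (snd c ` (fst c \<inter> fst c')) (vdom M c') (coord_change c c')"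
proof (intro coordinate_change.intro coordinate_change_axioms.intro open_domain.intro)
  show "open (snd c ` (fst c \<inter> fst c'))" using assms chart_open_image chart_openin by blast
  show "open (vdom M c')" by (rule open_vdom)
  show "holo_on (snd c ` (fst c \<inter> fst c')) (\<lambda>y. coord_change c c' y $ b)" for b
    by (rule coord_change_holo[OF assms])
  show "coord_change c c' y \<in> vdom M c'" if "y \<in> snd c ` (fst c \<inter> fst c')" for y
    using that assms by (auto simp: coord_change_def inv_chart_eq vdom_def)
qed

end

section \<open>Comparison of two trivialisations\<close>

locale overlap = holomorphic_bundle M E
  for M :: "('x, 'n::finite) cmanifold" and E :: "('x, 't, 'r::finite) vbundle" +
  fixes c c' :: "('x, 'n) chart" and t s :: 't
  assumes cc: "c \<in> charts M" "c' \<in> charts M" and ts: "t \<in> frames E" "s \<in> frames E"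
begin

definition X :: "(complex^'n) set" where
  "X = snd c ` (fst c \<inter> fst c' \<inter> fdom E t \<inter> fdom E s)"

lemma open_X: "open X"
proof -
  have "openin (space_of M) (fst c' \<inter> fdom E t \<inter> fdom E s)"
    using chart_openin frame_openin cc ts by blast
  from chart_open_image[OF cc(1) this] show ?thesis by (simp add: X_def Int_assoc)
qed

lemma X_edom: "X \<subseteq> edom M E c t" and X_vdom: "X \<subseteq> snd c ` (fst c \<inter> fst c')"
  using cc ts by (auto simp: X_def edom_def)

sublocale CC: coordinate_change X "edom M E c' s" "coord_change c c'"
proof (intro coordinate_change.intro coordinate_change_axioms.intro open_domain.intro open_X open_edom)
  show "holo_on X (\<lambda>y. coord_change c c' y $ b)" for b
    using holo_on_subset[OF coord_change_holo[OF cc] X_vdom] .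
  show "coord_change c c' y \<in> edom M E c' s" if "y \<in> X" for y
    using that cc ts by (auto simp: coord_change_def inv_chart_eq edom_def X_def)
qed

definition tm :: "'t \<Rightarrow> 't \<Rightarrow> 'r \<Rightarrow> 'r \<Rightarrow> complex^'n \<Rightarrow> complex" where
  "tm t' s' i j = (\<lambda>y. tmap E t' s' (inv_chart c y) $ i $ j)"

lemma tm_holo: "holo_on X (tm t s i j)" "holo_on X (tm s t i j)"
proof -
  have h: "holo_on (snd c ` (fst c \<inter> fdom E t' \<inter> fdom E s')) (\<lambda>y. tmap E t' s' (inv_chart c y) $ i $ j)"
    if "t' \<in> frames E" "s' \<in> frames E" for t' s'
    using vector_bundle cc(1) that unfolding holomorphic_vector_bundle_def by blast
  show "holo_on X (tm t s i j)" "holo_on X (tm s t i j)"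
    unfolding tm_def by (rule holo_on_subset[OF h]; use ts in \<open>auto simp: X_def\<close>)+
qed

lemma tm_smooth: "smooth_on X (tm t s i j)" "smooth_on X (tm s t i j)"
  using tm_holo unfolding holo_on_def by auto

lemma tm_pdf: "y \<in> X \<Longrightarrow> pdf \<i> a (tm t s i j) y = 0" "y \<in> X \<Longrightarrow> pdf \<i> a (tm s t i j) y = 0"
  using tm_holo unfolding holo_on_def pdzbar_eq_pdf by auto

lemma tm_mult:
  assumes "y \<in> X"
  shows "(\<Sum>k\<in>UNIV. tm t s i k y * tm s t k j y) = (if i = j then 1 else 0)"
    "(\<Sum>k\<in>UNIV. tm s t i k y * tm t s k j y) = (if i = j then 1 else 0)"
proof -
  obtain x where x: "x \<in> fst c" "x \<in> fdom E t" "x \<in> fdom E s" "y = snd c x"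
    using assms by (auto simp: X_def)
  then have inv: "inv_chart c y = x" using inv_chart_eq[OF cc(1)] by simp
  have coc: "tmap E t' s' x ** tmap E s' t' x = mat 1" if "t' \<in> {t, s}" "s' \<in> {t, s}" for t' s'
    using vector_bundle x(2,3) ts that unfolding holomorphic_vector_bundle_def by (metis Int_iff empty_iff insert_iff)
  have "(\<Sum>k\<in>UNIV. tmap E t' s' x $ i $ k * tmap E s' t' x $ k $ j) = (if i = j then 1 else 0)"
    if "t' \<in> {t, s}" "s' \<in> {t, s}" for t' s'
    using arg_cong[OF coc[OF that], of "\<lambda>m. m $ i $ j"] by (simp add: matrix_matrix_mult_def mat_def)
  then show "(\<Sum>k\<in>UNIV. tm t s i k y * tm s t k j y) = (if i = j then 1 else 0)"
    "(\<Sum>k\<in>UNIV. tm s t i k y * tm t s k j y) = (if i = j then 1 else 0)"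
    by (auto simp: tm_def inv)
qed

definition G :: "('n, 'r) mform" where "G i j = CC.O.hf (tm t s i j)"
definition H :: "('n, 'r) mform" where "H i j = CC.O.hf (tm s t i j)"
definition one :: "('n, 'r) mform" where "one i j = (if i = j then CC.O.hf (\<lambda>_. 1) else 0)"

lemma mwedge_hf:
  "mwedge (\<lambda>i j. CC.O.hf (f i j)) (\<lambda>i j. CC.O.hf (f' i j)) i j = CC.O.hf (\<lambda>y. \<Sum>k\<in>UNIV. f i k y * f' k j y)"
  unfolding mwedge_def CC.O.wedge_hf(1)[OF CC.O.zo_hf]
  by (auto simp: fun_eq_iff fm_def CC.O.hf_apply sum_fun_apply)

sublocale SC: super_calculus "CC.O.mS :: ('n, 'r) mform set" CC.O.mOm CC.O.vV "\<lambda>i. {v. CC.O.vf i v}" mwedge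
  CC.O.mdl CC.O.mdb contr CC.O.vb CC.O.SN
  by (rule CC.O.super_calculus_mform)

sublocale FC: frame_change "CC.O.mS :: ('n, 'r) mform set" CC.O.mOm CC.O.vV "\<lambda>i. {v. CC.O.vf i v}" mwedge
  CC.O.mdl CC.O.mdb contr CC.O.vb CC.O.SN G H one
proof
  show "G \<in> CC.O.mOm 0" "H \<in> CC.O.mOm 0"
    by (simp_all add: CC.O.mOm_def G_def H_def CC.O.sf_hf tm_smooth)
  have one_hf: "one i j = CC.O.hf (\<lambda>_. if i = j then 1 else 0)" for i j
    by (simp add: one_def fun_eq_iff CC.O.hf_apply)
  have "mwedge H G i j = one i j" "mwedge G H i j = one i j" for i j
    unfolding G_def[abs_def] H_def[abs_def] mwedge_hf one_hf
    by (rule CC.O.hf_cong; rule tm_mult; assumption)+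
  then show "mwedge H G = one" "mwedge G H = one" by (intro ext, simp)+
  show "mwedge one A = A" "mwedge A one = A" if "A \<in> CC.O.mS" for A
  proof -
    have fm_1: "fm (\<lambda>_. 1) \<omega> = \<omega>" for \<omega> :: "'n form" by (simp add: fun_eq_iff fm_def)
    have "wedge (one i k) (A k j) = (if i = k then A k j else 0)" "wedge (A i k) (one k j) = (if k = j then A i k else 0)" for i j k
      using CC.O.mS_D(2)[OF that] fm_1 by (simp_all add: one_def CC.O.wedge_hf CC.O.sm_def)
    then show "mwedge one A = A" "mwedge A one = A"
      by (intro ext; simp add: mwedge_def)+
  qed
  show "CC.O.mdl one = 0"
    by (intro ext) (simp add: CC.O.mdl_def one_hf CC.O.rd_hf rs_def sum_fun_apply fm_def)
  show "CC.O.mdb G = 0" "CC.O.mdb H = 0"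
    by (intro ext, simp add: CC.O.mdb_def G_def H_def CC.O.rd_hf rs_def sum_fun_apply fm_def tm_pdf)+
  show "contr v G = 0" "contr v H = 0" for v
    by (intro ext, simp add: contr_def G_def H_def sum_fun_apply)+
qed

text \<open>The transformation laws of \<open>End(E)\<close>-valued forms (\<open>rel\<close>) and of connection matrices
  (\<open>wrel\<close>).\<close>

definition rel :: "('n, 'r) mform \<Rightarrow> ('n, 'r) mform \<Rightarrow> bool" where
  "rel a a' \<longleftrightarrow> mrs X a = FC.conj (CC.mpb a')"

lemma conj_apply:
  assumes "\<And>k l. CC.O.zo (B k l)" "y \<in> X"
  shows "FC.conj B i j y vs = (\<Sum>k\<in>UNIV. \<Sum>l\<in>UNIV. tm t s i k y * B k l y vs * tm s t l j y)"
proof -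
  have "mwedge B H k j = (\<Sum>l\<in>UNIV. fm (tm s t l j) (B k l))" for k
    by (simp add: mwedge_def H_def CC.O.wedge_hf assms(1))
  moreover have "CC.O.zo (mwedge B H k j)" for k
    unfolding mwedge_def by (intro CC.O.zo_sum CC.O.zo_wedge_left assms)
  ultimately have "FC.conj B i j = (\<Sum>k\<in>UNIV. fm (tm t s i k) (\<Sum>l\<in>UNIV. fm (tm s t l j) (B k l)))"
    by (simp add: FC.conj_def mwedge_def[of G] G_def CC.O.wedge_hf)
  then show ?thesis by (simp add: sum_fun_apply fm_def sum_distrib_left algebra_simps)
qed

lemma mpb_zo: "CC.O.zo (CC.mpb a' k l)"
  by (simp add: CC.mpb_def)

lemma conj_zo: "y \<notin> X \<Longrightarrow> FC.conj B i j y vs = 0"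
  by (simp add: FC.conj_def mwedge_def sum_fun_apply wedge_def G_def CC.O.hf_apply)

text \<open>Connects the pointwise law in \<open>end_forms\<close> with conjugation by the
  transition matrix, for which the algebra of \<open>frame_change\<close> is available.\<close>

lemma rel_iff:
  "rel a a' \<longleftrightarrow> (\<forall>y\<in>X. \<forall>i j vs. a i j y vs =
     (\<Sum>k\<in>UNIV. \<Sum>l\<in>UNIV. tmap E t s (inv_chart c y) $ i $ k *
       a' k l (coord_change c c' y) (map (frechet_derivative (coord_change c c') (at y)) vs) *
       tmap E s t (inv_chart c y) $ l $ j))"
proof -
  have "FC.conj (CC.mpb a') i j y vs = (\<Sum>k\<in>UNIV. \<Sum>l\<in>UNIV. tmap E t s (inv_chart c y) $ i $ k *
       a' k l (coord_change c c' y) (map (frechet_derivative (coord_change c c') (at y)) vs) *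
       tmap E s t (inv_chart c y) $ l $ j)" if "y \<in> X" for i j y vs
    using that by (simp add: conj_apply mpb_zo) (simp add: CC.mpb_def CC.pb_def tm_def)
  moreover have "rel a a' \<longleftrightarrow> (\<forall>y\<in>X. \<forall>i j vs. a i j y vs = FC.conj (CC.mpb a') i j y vs)"
    unfolding rel_def fun_eq_iff mrs_apply using conj_zo by auto
  ultimately show ?thesis by auto
qed

lemma mpb_mOm: "CC.U.typed p q a' \<Longrightarrow> CC.mpb a' \<in> CC.O.mOm (p + q)"
proof -
  assume h: "CC.U.typed p q a'"
  have "CC.O.sf (p + q) (CC.pb (a' i j))" for i j
    unfolding CC.O.sf_def
    using CC.sm_pb[OF CC.U.typedD(1)[OF h]] CC.par_pb[OF deg_par[OF CC.U.pq_smo(2)[OF CC.U.typedD[OF h]]]] by blast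
  then show ?thesis by (simp add: CC.O.mOm_def CC.mpb_def)
qed

lemma mpb_mS:
  fixes a' :: "('n, 'r) mform"
  shows "CC.U.typed p q a' \<Longrightarrow> CC.mpb a' \<in> CC.O.mS"
  by (rule SC.Om_S[OF mpb_mOm])

lemma mrs_mdl: "mrs X (open_domain.mdl (edom M E c t) a) = CC.O.mdl (mrs X a)"
  and mrs_mdb: "mrs X (open_domain.mdb (edom M E c t) a) = CC.O.mdb (mrs X a)"
proof -
  interpret D: open_domain "edom M E c t" by (rule ED)
  show "mrs X (D.mdl a) = CC.O.mdl (mrs X a)" "mrs X (D.mdb a) = CC.O.mdb (mrs X a)"
    by (simp_all add: fun_eq_iff mrs_def D.mdl_def CC.O.mdl_def D.mdb_def CC.O.mdb_def rs_rd[OF open_X open_edom X_edom])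
qed

lemma mpb_mdl: "CC.U.typed p q a' \<Longrightarrow> CC.mpb (CC.U.mdl a') = CC.O.mdl (CC.mpb a')"
  and mpb_mdb: "CC.U.typed p q a' \<Longrightarrow> CC.mpb (CC.U.mdb a') = CC.O.mdb (CC.mpb a')"
  unfolding CC.U.typed_def
  by (intro ext, simp add: CC.mpb_def CC.U.mdl_def CC.O.mdl_def CC.U.mdb_def CC.O.mdb_def CC.pb_rdel[of p q] CC.pb_rdelb[of p q])+

lemma mpb_linear: "CC.mpb (A + B) = CC.mpb A + CC.mpb B" "CC.mpb (A - B) = CC.mpb A - CC.mpb B" "CC.mpb (sg i A) = sg i (CC.mpb A)"
  by (intro ext, simp add: CC.mpb_def CC.pb_add CC.pb_diff CC.pb_sg sg_apply)+

lemma rel_mwedge: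
  assumes "rel a a'" "rel b b'" "CC.U.typed p q a'" "CC.U.typed p' q' b'"
  shows "rel (mwedge a b) (mwedge a' b')"
  using assms(1,2) FC.conj_mul[OF mpb_mS[OF assms(3)] mpb_mS[OF assms(4)]]
  by (simp add: rel_def mrs_mwedge CC.mpb_mwedge)

lemma rel_mdb:
  assumes "rel a a'" "CC.U.typed p q a'"
  shows "rel (open_domain.mdb (edom M E c t) a) (open_domain.mdb (edom M E c' s) a')"
  using assms(1) FC.conj_db[OF mpb_mOm[OF assms(2)]]
  by (simp add: rel_def mrs_mdb mpb_mdb[OF assms(2)])

lemma rel_contr:
  assumes "CC.vrel \<phi>' (\<lambda>a. rs X (\<phi> a))" "CC.O.vf i (\<lambda>a. rs X (\<phi> a))" "rel a a'" "CC.U.typed p q a'"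
  shows "rel (contr \<phi> a) (contr \<phi>' a')"
proof -
  have "CC.mpb (contr \<phi>' a') = contr (\<lambda>a. rs X (\<phi> a)) (CC.mpb a')"
    using CC.pb_ctr[OF assms(1) CC.U.pq_smo(3)[OF CC.U.typedD[OF assms(4)]]]
    by (intro ext) (simp add: CC.mpb_def contr_eq_ctr)
  then show ?thesis
    using assms(3) FC.conj_ct[OF _ mpb_mOm[OF assms(4)], of "\<lambda>a. rs X (\<phi> a)" i] assms(2)
    by (simp add: rel_def mrs_contr)
qed

definition wrel :: "('n, 'r) mform \<Rightarrow> ('n, 'r) mform \<Rightarrow> bool" where
  "wrel w w' \<longleftrightarrow> mrs X w = FC.conj (CC.mpb w') - mwedge (CC.O.mdl G) H"

lemma gcomm_cm: "gcomm i j A B = SC.cm i j A B"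
  by (simp add: gcomm_eq_sg SC.cm_def)

lemma rel_lcov:
  assumes "wrel w w'" "CC.U.typed 1 0 w'" "rel a a'" "CC.U.typed p q a'"
  shows "rel (lcov (edom M E c t) w (p + q) a) (lcov (edom M E c' s) w' (p + q) a')"
proof -
  have mpb_gcomm: "CC.mpb (gcomm 1 m w' a') = gcomm 1 m (CC.mpb w') (CC.mpb a')" for m
    by (simp add: gcomm_eq_sg mpb_linear CC.mpb_mwedge)
  have "mrs X (lcov (edom M E c t) w (p + q) a) = CC.O.mdl (mrs X a) + SC.cm 1 (p + q) (mrs X w) (mrs X a)"
    unfolding lcov_def mrs_linear mrs_mdl mrs_gcomm by (simp only: gcomm_cm)
  also have "\<dots> = FC.conj (CC.O.mdl (CC.mpb a') + SC.cm 1 (p + q) (CC.mpb w') (CC.mpb a'))"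
    using assms(3) FC.conj_Dc[OF mpb_mOm[OF assms(4)], of "CC.mpb w'" "mrs X w"] mpb_mOm[OF assms(2)] assms(1)
    by (simp add: rel_def wrel_def)
  also have "\<dots> = FC.conj (CC.mpb (lcov (edom M E c' s) w' (p + q) a'))"
    unfolding lcov_def mpb_linear mpb_mdl[OF assms(4)] mpb_gcomm by (simp only: gcomm_cm)
  finally show ?thesis by (simp only: rel_def)
qed

lemma rel_F:
  assumes "wrel w w'" "CC.U.typed 1 0 w'"
  shows "rel (open_domain.mdb (edom M E c t) w) (open_domain.mdb (edom M E c' s) w')"
  using FC.conj_F[of "CC.mpb w'" "mrs X w"] mpb_mOm[OF assms(2)] assms
  by (simp add: rel_def wrel_def mrs_mdb mpb_mdb[OF assms(2)])

text \<open>The law of \<open>connection\<close> reads w G = G w' - dG. Multiplication by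
  \<open>H\<close> from the right gives the form used in \<open>conj_Dc\<close>, with \<partial>G in
  place of dG because the transition matrix is holomorphic.\<close>

lemma wrel_connection:
  assumes conn: "\<And>y i j v. y \<in> X \<Longrightarrow> (\<Sum>k\<in>UNIV. w i k y [v] * tm t s k j y) =
      (\<Sum>k\<in>UNIV. tm t s i k y * w' k j (coord_change c c' y) [frechet_derivative (coord_change c c') (at y) v]) -
      frechet_derivative (tm t s i j) (at y) v"
    and w: "\<And>i j. deg 1 (w i j)" and w': "\<And>i j. deg 1 (w' i j)"
  shows "wrel w w'"
  unfolding wrel_def
proof (intro ext)
  fix i m y vs
  show "mrs X w i m y vs = (FC.conj (CC.mpb w') - mwedge (CC.O.mdl G) H) i m y vs"
  proof (cases "y \<in> X")
    case False
    then show ?thesis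
      by (simp add: mrs_apply conj_zo mwedge_def sum_fun_apply wedge_def H_def CC.O.hf_apply)
  next
    case y: True
    have zo: "CC.O.zo (CC.O.mdl G i j)" for j by (simp add: CC.O.mdl_def CC.O.zo_rd)
    have dG: "mwedge (CC.O.mdl G) H i m y vs = (\<Sum>j\<in>UNIV. CC.O.rdel (G i j) y vs * tm s t j m y)"
      by (simp add: mwedge_def H_def CC.O.wedge_hf zo sum_fun_apply) (simp add: fm_def CC.O.mdl_def mult.commute)
    have cj: "FC.conj (CC.mpb w') i m y vs = (\<Sum>j\<in>UNIV. (\<Sum>k\<in>UNIV. tm t s i k y * CC.mpb w' k j y vs) * tm s t j m y)"
      unfolding conj_apply[OF mpb_zo y] sum_distrib_right by (rule sum.swap)
    show ?thesis
    proof (cases "length vs = 1")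
      case False
      have "CC.mpb w' k j y vs = 0" for k j
        using w' False by (simp add: CC.mpb_def CC.pb_def deg_def)
      moreover have "CC.O.rdel (G i j) y vs = 0" for j
      proof -
        have "dz a y vs = 0" for a using deg_dz[of a] False by (simp add: deg_def)
        then show ?thesis unfolding G_def CC.O.rd_hf by (simp add: rs_def sum_fun_apply fm_def)
      qed
      moreover have "w i m y vs = 0" using w False by (simp add: deg_def)
      ultimately show ?thesis by (simp add: mrs_apply cj dG)
    next
      case True
      then obtain v where v: "vs = [v]" by (auto simp: length_Suc_conv)
      have r: "CC.O.rdel (G i j) y [v] = frechet_derivative (tm t s i j) (at y) v" for j
        unfolding G_def CC.O.rd_hf frechet_derivative_Wirtinger[OF smooth_on_differentiable[OF tm_smooth(1) y]]
        using y by (simp add: rs_def sum_fun_apply fm_def dz_def tm_pdf mult.commute)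
      \<comment> \<open>The identity matrix is inserted as \<open>G\<close> times \<open>H\<close>,
        so that the law \<open>conn\<close> applies to w G.\<close>
      have "w i m y [v] = (\<Sum>k\<in>UNIV. w i k y [v] * (\<Sum>j\<in>UNIV. tm t s k j y * tm s t j m y))"
        by (simp add: tm_mult[OF y] if_distrib cong: if_cong)
      also have "\<dots> = (\<Sum>j\<in>UNIV. (\<Sum>k\<in>UNIV. w i k y [v] * tm t s k j y) * tm s t j m y)"
        unfolding sum_distrib_left sum_distrib_right mult.assoc by (rule sum.swap)
      also have "\<dots> = (\<Sum>j\<in>UNIV. (\<Sum>k\<in>UNIV. tm t s i k y * CC.mpb w' k j y [v]) * tm s t j m y) -
          (\<Sum>j\<in>UNIV. CC.O.rdel (G i j) y [v] * tm s t j m y)"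
        unfolding conn[OF y] r by (simp add: left_diff_distrib sum_subtractf CC.mpb_def CC.pb_def y)
      finally show ?thesis using y by (simp add: mrs_apply cj[unfolded v] dG[unfolded v] v)
    qed
  qed
qed

end

section \<open>The spaces L\<close>

lemma pq_form_on_subset: "pq_form_on D p q \<omega> \<Longrightarrow> D' \<subseteq> D \<Longrightarrow> pq_form_on D' p q \<omega>"
  unfolding pq_form_on_def by (meson smooth_on_subset subsetD)

lemma mwedge_0: "mwedge 0 B = 0" "mwedge A 0 = 0"
  by (simp_all add: fun_eq_iff mwedge_def sum_fun_apply)

lemma mwedge_sum:
  "mwedge (\<Sum>p\<in>I. A p) B = (\<Sum>p\<in>I. mwedge (A p) B)" "mwedge B (\<Sum>p\<in>I. A p) = (\<Sum>p\<in>I. mwedge B (A p))"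
  using sum_comp_morphism[of "\<lambda>A. mwedge A B" A I] sum_comp_morphism[of "mwedge B" A I]
  by (simp_all add: mwedge_linear mwedge_0 o_def)

lemma herm_axis:
  "herm h v (axis k 1) = (\<Sum>j\<in>UNIV. h $ k $ j * v $ j)"
  "herm h (axis l 1) w = (\<Sum>i\<in>UNIV. cnj (w $ i) * h $ i $ l)"
proof -
  have "(\<Sum>i\<in>UNIV. \<Sum>j\<in>UNIV. cnj (axis k 1 $ i) * h $ i $ j * v $ j) =
      (\<Sum>i\<in>UNIV. if i = k then \<Sum>j\<in>UNIV. h $ k $ j * v $ j else 0)"
    by (intro sum.cong refl) (auto simp: axis_def)
  then show "herm h v (axis k 1) = (\<Sum>j\<in>UNIV. h $ k $ j * v $ j)" by (simp add: herm_def)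
  have "(\<Sum>j\<in>UNIV. cnj (w $ i) * h $ i $ j * axis l 1 $ j) = (\<Sum>j\<in>UNIV. if j = l then cnj (w $ i) * h $ i $ l else 0)" for i
    by (intro sum.cong refl) (auto simp: axis_def)
  then show "herm h (axis l 1) w = (\<Sum>i\<in>UNIV. cnj (w $ i) * h $ i $ l)" by (simp add: herm_def)
qed

context holomorphic_bundle
begin

abbreviation Dom :: "('x, 'n) chart \<Rightarrow> 't \<Rightarrow> (complex^'n) set" where
  "Dom c t \<equiv> edom M E c t"

lemma end_forms_typed:
  assumes "A \<in> end_forms M E p q"
  shows "open_domain.typed (Dom c t) p q (A c t)"
proof -
  interpret D: open_domain "Dom c t" by (rule ED)
  show ?thesis using assms unfolding end_forms_def D.typed_def D.zo_def by blast
qed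

lemma overlap_intro:
  "c \<in> charts M \<Longrightarrow> c' \<in> charts M \<Longrightarrow> t \<in> frames E \<Longrightarrow> s \<in> frames E \<Longrightarrow> overlap M E c c' t s"
  by (simp add: overlap_def overlap_axioms_def holomorphic_bundle_axioms)

lemma end_forms_rel:
  assumes "A \<in> end_forms M E p q" "overlap M E c c' t s"
  shows "overlap.rel E c c' t s (A c t) (A c' s)"
proof -
  interpret O: overlap M E c c' t s by fact
  show ?thesis
    unfolding O.rel_iff O.X_def using assms(1) O.cc O.ts unfolding end_forms_def by blast
qed

lemma end_formsI:
  assumes "\<And>c t. open_domain.typed (Dom c t) p q (A c t)"
    and "\<And>c c' t s. overlap M E c c' t s \<Longrightarrow> overlap.rel E c c' t s (A c t) (A c' s)"
  shows "A \<in> end_forms M E p q"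
  unfolding end_forms_def
proof (intro CollectI conjI allI ballI impI)
  fix c t i j
  interpret D: open_domain "Dom c t" by (rule ED)
  show "pq_form_on (Dom c t) p q (A c t i j)" by (rule D.typedD(1)[OF assms(1)])
  fix y vs assume "y \<notin> Dom c t"
  then show "A c t i j y vs = 0" using D.typedD(2)[OF assms(1)] by (simp add: D.zo_def)
next
  fix c c' t s y i j vs
  assume h: "c \<in> charts M" "c' \<in> charts M" "t \<in> frames E" "s \<in> frames E"
    "y \<in> snd c ` (fst c \<inter> fst c' \<inter> fdom E t \<inter> fdom E s)"
  interpret O: overlap M E c c' t s by (rule overlap_intro) fact+
  show "A c t i j y vs = (\<Sum>k\<in>UNIV. \<Sum>l\<in>UNIV. tmap E t s (inv_chart c y) $ i $ k *
           A c' s k l (coord_change c c' y) (map (frechet_derivative (coord_change c c') (at y)) vs) *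
           tmap E s t (inv_chart c y) $ l $ j)"
    using assms(2)[OF O.overlap_axioms] h(5) unfolding O.rel_iff O.X_def by blast
qed

lemma tan_forms_pq:
  assumes "\<phi> \<in> tan_forms M q"
  shows "pq_form_on (vdom M c) 0 q (\<phi> c a)" "open_domain.zo (vdom M c) (\<phi> c a)"
    "open_domain.vf (vdom M c) q (\<phi> c)"
proof -
  interpret D: open_domain "vdom M c" by (rule VD)
  show 1: "pq_form_on (vdom M c) 0 q (\<phi> c a)" "D.zo (\<phi> c a)" for a
    using assms unfolding tan_forms_def D.zo_def by blast+
  show "D.vf q (\<phi> c)" by (rule D.pq_vf[OF 1])
qed

lemma tan_forms_pq_subset:
  assumes "\<phi> \<in> tan_forms M q" "open X" "X \<subseteq> vdom M c"
  shows "pq_form_on X 0 q (\<phi> c a)" "open_domain.vf X q (\<lambda>a. rs X (\<phi> c a))"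
proof -
  interpret X: open_domain X by (rule open_domain.intro) fact
  show 1: "X.pq 0 q (\<phi> c a)" for a by (rule pq_form_on_subset[OF tan_forms_pq(1)[OF assms(1)] assms(3)])
  have "X.pq 0 q (rs X (\<phi> c a))" for a by (rule X.pq_cong[OF _ 1]) (simp add: rs_def)
  then show "X.vf q (\<lambda>a. rs X (\<phi> c a))" by (rule X.pq_vf) simp
qed

text \<open>TX-valued forms depend on a chart only, matrices also on a frame. Cutting the former
  down to the frame domain puts both into one local calculus.\<close>

definition rv :: "('x, 'n) chart \<Rightarrow> 't \<Rightarrow> ('x, 'n) tan_form \<Rightarrow> 'n vform" where
  "rv c t \<phi> = (\<lambda>a. rs (Dom c t) (\<phi> c a))"

lemma rv_vf: "\<phi> \<in> tan_forms M q \<Longrightarrow> open_domain.vf (Dom c t) q (rv c t \<phi>)"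
  unfolding rv_def by (rule tan_forms_pq_subset(2)[OF _ open_edom edom_vdom])

lemma tan_forms_vrel:
  assumes "\<phi> \<in> tan_forms M q" "c \<in> charts M" "c' \<in> charts M" "X \<subseteq> snd c ` (fst c \<inter> fst c')"
    "coordinate_change X Y (coord_change c c')"
  shows "coordinate_change.vrel X (coord_change c c') (\<phi> c') (\<lambda>a. rs X (\<phi> c a))"
proof -
  interpret CC: coordinate_change X Y "coord_change c c'" by fact
  have "\<phi> c' b (coord_change c c' y) (map (frechet_derivative (coord_change c c') (at y)) vs) =
        (\<Sum>a\<in>UNIV. pdz a (\<lambda>u. coord_change c c' u $ b) y * \<phi> c a y vs)" if "y \<in> X" for y b vs
  proof -
    from that assms(4) have "y \<in> snd c ` (fst c \<inter> fst c')" by blast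
    then show ?thesis using assms(1-3) unfolding tan_forms_def by blast
  qed
  then show ?thesis
    unfolding CC.vrel_def by (auto simp: fun_eq_iff CC.pb_def sum_fun_apply fm_def rs_def CC.jac_def pdz_eq_pdf)
qed

lemma tan_formsI:
  assumes "\<And>c a. pq_form_on (vdom M c) 0 q (\<phi> c a)" "\<And>c a. open_domain.zo (vdom M c) (\<phi> c a)"
    and "\<And>c c'. c \<in> charts M \<Longrightarrow> c' \<in> charts M \<Longrightarrow>
      coordinate_change.vrel (snd c ` (fst c \<inter> fst c')) (coord_change c c') (\<phi> c') (\<lambda>a. rs (snd c ` (fst c \<inter> fst c')) (\<phi> c a))"
  shows "\<phi> \<in> tan_forms M q"
  unfolding tan_forms_def
proof (intro CollectI conjI allI ballI impI)
  fix c a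
  interpret D: open_domain "vdom M c" by (rule VD)
  show "pq_form_on (vdom M c) 0 q (\<phi> c a)" by (rule assms)
  fix y vs assume "y \<notin> vdom M c"
  then show "\<phi> c a y vs = 0" using assms(2)[of c a] by (simp add: D.zo_def)
next
  fix c c' y b vs
  assume h: "c \<in> charts M" "c' \<in> charts M" "y \<in> snd c ` (fst c \<inter> fst c')"
  let ?X = "snd c ` (fst c \<inter> fst c')"
  interpret CC: coordinate_change ?X "vdom M c'" "coord_change c c'" by (rule coordinate_change_vdom) fact+
  have "CC.pb (\<phi> c' b) y vs = (\<Sum>a\<in>UNIV. fm (CC.jac b a) (rs ?X (\<phi> c a))) y vs"
    using assms(3)[OF h(1,2)] by (simp add: CC.vrel_def)
  then show "\<phi> c' b (coord_change c c' y) (map (frechet_derivative (coord_change c c') (at y)) vs) =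
        (\<Sum>a\<in>UNIV. pdz a (\<lambda>u. coord_change c c' u $ b) y * \<phi> c a y vs)"
    using h(3) by (simp add: CC.pb_def sum_fun_apply fm_def rs_def CC.jac_def pdz_eq_pdf)
qed

lemma tan_SN:
  assumes "\<phi> \<in> tan_forms M i" "\<psi> \<in> tan_forms M j"
  shows "(\<lambda>c. open_domain.SN (vdom M c) (\<phi> c) (\<psi> c)) \<in> tan_forms M (i + j)"
proof (rule tan_formsI)
  fix c a
  interpret D: open_domain "vdom M c" by (rule VD)
  note pq = tan_forms_pq(1,2)[OF assms(1), of c] tan_forms_pq(1,2)[OF assms(2), of c]
  have "D.pq 0 (i + j) (wedge (\<phi> c b) (D.pd (- \<i>) b (\<psi> c a)))" "D.pq 0 (i + j) (wedge (D.pd (- \<i>) b (\<phi> c a)) (\<psi> c b))" for b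
    using D.pq_wedge[OF pq(1) D.pq_pd[OF pq(3)]] D.pq_wedge[OF D.pq_pd[OF pq(1)] pq(3)] by simp_all
  then show "D.pq 0 (i + j) (D.SN (\<phi> c) (\<psi> c) a)"
    unfolding D.SN_def by (intro D.pq_sum D.pq_diff)
  show "D.zo (D.SN (\<phi> c) (\<psi> c) a)"
    unfolding D.SN_def by (intro D.zo_sum D.zo_diff D.zo_wedge_left D.zo_pd pq)
next
  fix c c' assume h: "c \<in> charts M" "c' \<in> charts M"
  let ?X = "snd c ` (fst c \<inter> fst c')"
  interpret CC: coordinate_change ?X "vdom M c'" "coord_change c c'" by (rule coordinate_change_vdom) fact+
  have X: "?X \<subseteq> vdom M c" using h by (auto simp: vdom_def)
  have sm: "CC.O.sm (rs ?X (\<phi> c a))" "CC.O.sm (rs ?X (\<psi> c a))" for a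
    using tan_forms_pq_subset(2)[OF assms(1) CC.O.open_D X] tan_forms_pq_subset(2)[OF assms(2) CC.O.open_D X]
    by (auto simp: CC.O.vf_def CC.O.sf_def)
  have "CC.vrel (CC.U.SN (\<phi> c') (\<psi> c')) (CC.O.SN (\<lambda>a. rs ?X (\<phi> c a)) (\<lambda>a. rs ?X (\<psi> c a)))"
    by (rule CC.vrel_SN[OF tan_forms_vrel[OF assms(1) h order_refl CC.coordinate_change_axioms] tan_forms_pq(1,2)[OF assms(1)] sm(1)
          tan_forms_vrel[OF assms(2) h order_refl CC.coordinate_change_axioms] tan_forms_pq(1,2)[OF assms(2)] sm(2)])
  then show "CC.vrel (CC.U.SN (\<phi> c') (\<psi> c')) (\<lambda>a. rs ?X (open_domain.SN (vdom M c) (\<phi> c) (\<psi> c) a))"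
    unfolding rs_SN[OF CC.O.open_D open_vdom X] .
qed

lemma tan_vb:
  assumes "\<phi> \<in> tan_forms M i"
  shows "(\<lambda>c. open_domain.vb (vdom M c) (\<phi> c)) \<in> tan_forms M (Suc i)"
proof (rule tan_formsI)
  fix c a
  interpret D: open_domain "vdom M c" by (rule VD)
  show "D.pq 0 (Suc i) (D.vb (\<phi> c) a)"
    unfolding D.vb_def by (rule D.pq_rdelb[OF tan_forms_pq(1)[OF assms]])
  show "D.zo (D.vb (\<phi> c) a)" unfolding D.vb_def by (rule D.zo_rd)
next
  fix c c' assume h: "c \<in> charts M" "c' \<in> charts M"
  let ?X = "snd c ` (fst c \<inter> fst c')"
  interpret CC: coordinate_change ?X "vdom M c'" "coord_change c c'" by (rule coordinate_change_vdom) fact+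
  interpret D: open_domain "vdom M c" by (rule VD)
  have X: "?X \<subseteq> vdom M c" using h by (auto simp: vdom_def)
  have sm: "CC.O.sm (rs ?X (\<phi> c a))" for a
    using tan_forms_pq_subset(2)[OF assms(1) CC.O.open_D X] by (auto simp: CC.O.vf_def CC.O.sf_def)
  have "CC.vrel (\<lambda>b. CC.U.rdelb (\<phi> c' b)) (\<lambda>a. CC.O.rdelb (rs ?X (\<phi> c a)))"
    by (rule CC.vrel_rdelb[OF tan_forms_vrel[OF assms(1) h order_refl CC.coordinate_change_axioms] tan_forms_pq(1)[OF assms(1)] sm])
  then show "CC.vrel (CC.U.vb (\<phi> c')) (\<lambda>a. rs ?X (D.vb (\<phi> c) a))"
    unfolding CC.U.vb_def[abs_def] D.vb_def rs_rd[OF CC.O.open_D open_vdom X] .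
qed

section \<open>Closure properties of the spaces of global forms\<close>

lemma end_add:
  assumes "A \<in> end_forms M E p q" "B \<in> end_forms M E p q"
  shows "A + B \<in> end_forms M E p q"
proof (rule end_formsI)
  fix c t
  interpret D: open_domain "Dom c t" by (rule ED)
  show "D.typed p q ((A + B) c t)"
    using D.typed_add[OF end_forms_typed[OF assms(1)] end_forms_typed[OF assms(2)]] by simp
next
  fix c c' t s assume "overlap M E c c' t s"
  then interpret O: overlap M E c c' t s .
  show "O.rel ((A + B) c t) ((A + B) c' s)"
    using end_forms_rel[OF assms(1) O.overlap_axioms] end_forms_rel[OF assms(2) O.overlap_axioms]
    by (simp add: O.rel_iff distrib_left distrib_right sum.distrib)
qed

definition scE :: "complex \<Rightarrow> ('x, 't, 'n, 'r) end_form \<Rightarrow> ('x, 't, 'n, 'r) end_form" where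
  "scE r A = (\<lambda>c t i j y vs. r * A c t i j y vs)"

definition scT :: "complex \<Rightarrow> ('x, 'n) tan_form \<Rightarrow> ('x, 'n) tan_form" where
  "scT r \<phi> = (\<lambda>c a y vs. r * \<phi> c a y vs)"

lemma end_scale:
  assumes "A \<in> end_forms M E p q"
  shows "scE r A \<in> end_forms M E p q"
proof (rule end_formsI)
  fix c t
  interpret D: open_domain "Dom c t" by (rule ED)
  have "D.pq p q (scE r A c t i j)" for i j
  proof -
    have "D.pq p q (A c t i j)" by (rule D.typedD(1)[OF end_forms_typed[OF assms]])
    from D.pq_fm[OF smooth_on_const[of _ r] this] show ?thesis
      by (rule D.pq_cong[rotated]) (simp add: fm_def scE_def)
  qed
  moreover have "D.zo (scE r A c t i j)" for i j
    using D.typedD(2)[OF end_forms_typed[OF assms]] by (simp add: D.zo_def scE_def)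
  ultimately show "D.typed p q (scE r A c t)" by (simp add: D.typed_def)
next
  fix c c' t s assume "overlap M E c c' t s"
  then interpret O: overlap M E c c' t s .
  show "O.rel (scE r A c t) (scE r A c' s)"
    using end_forms_rel[OF assms(1) O.overlap_axioms]
    by (simp add: O.rel_iff scE_def sum_distrib_left algebra_simps)
qed

lemma tan_add:
  assumes "\<phi> \<in> tan_forms M q" "\<psi> \<in> tan_forms M q"
  shows "\<phi> + \<psi> \<in> tan_forms M q"
proof -
  have "pq_form_on (vdom M c) 0 q ((\<phi> + \<psi>) c a)" for c a
    using open_domain.pq_add[OF VD tan_forms_pq(1)[OF assms(1)] tan_forms_pq(1)[OF assms(2)]] by simp
  then show ?thesis
    using assms unfolding tan_forms_def by (simp add: distrib_left sum.distrib)
qed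

lemma tan_scale:
  assumes "\<phi> \<in> tan_forms M q"
  shows "scT r \<phi> \<in> tan_forms M q"
proof -
  have "pq_form_on (vdom M c) 0 q (scT r \<phi> c a)" for c a
  proof -
    have "pq_form_on (vdom M c) 0 q (\<phi> c a)" by (rule tan_forms_pq(1)[OF assms])
    from open_domain.pq_fm[OF VD smooth_on_const[of _ r] this] show ?thesis
      by (rule open_domain.pq_cong[OF VD, rotated]) (simp add: fm_def scT_def)
  qed
  then show ?thesis
    using assms unfolding tan_forms_def by (simp add: scT_def sum_distrib_left algebra_simps)
qed

lemma end_0: "0 \<in> end_forms M E p q"
proof (rule end_formsI)
  fix c t
  interpret D: open_domain "Dom c t" by (rule ED)
  show "D.typed p q ((0 :: ('x, 't, 'n, 'r) end_form) c t)" by (simp add: D.typed_def)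
next
  fix c c' t s assume "overlap M E c c' t s"
  then interpret O: overlap M E c c' t s .
  show "O.rel ((0 :: ('x, 't, 'n, 'r) end_form) c t) ((0 :: ('x, 't, 'n, 'r) end_form) c' s)" by (simp add: O.rel_iff)
qed

lemma tan_0: "0 \<in> tan_forms M q"
proof -
  have "pq_form_on (vdom M c) 0 q ((0 :: ('x, 'n) tan_form) c a)" for c a
    using open_domain.pq_0[OF VD] by simp
  then show ?thesis unfolding tan_forms_def by simp
qed

lemma end_mwedge:
  assumes "A \<in> end_forms M E p q" "B \<in> end_forms M E p' q'"
  shows "(\<lambda>c t. mwedge (A c t) (B c t)) \<in> end_forms M E (p + p') (q + q')"
proof (rule end_formsI)
  fix c t
  interpret D: open_domain "Dom c t" by (rule ED)
  show "D.typed (p + p') (q + q') (mwedge (A c t) (B c t))"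
    by (rule D.typed_mwedge[OF end_forms_typed[OF assms(1)] end_forms_typed[OF assms(2)]])
next
  fix c c' t s assume "overlap M E c c' t s"
  then interpret O: overlap M E c c' t s .
  show "O.rel (mwedge (A c t) (B c t)) (mwedge (A c' s) (B c' s))"
    by (rule O.rel_mwedge[OF end_forms_rel[OF assms(1) O.overlap_axioms] end_forms_rel[OF assms(2) O.overlap_axioms]
          end_forms_typed[OF assms(1)] end_forms_typed[OF assms(2)]])
qed

lemma end_mdb:
  assumes "A \<in> end_forms M E p q"
  shows "(\<lambda>c t. open_domain.mdb (Dom c t) (A c t)) \<in> end_forms M E p (Suc q)"
proof (rule end_formsI)
  fix c t
  interpret D: open_domain "Dom c t" by (rule ED)
  show "D.typed p (Suc q) (D.mdb (A c t))" by (rule D.typed_mdb[OF end_forms_typed[OF assms]])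
next
  fix c c' t s assume "overlap M E c c' t s"
  then interpret O: overlap M E c c' t s .
  show "O.rel (open_domain.mdb (Dom c t) (A c t)) (open_domain.mdb (Dom c' s) (A c' s))"
    by (rule O.rel_mdb[OF end_forms_rel[OF assms(1) O.overlap_axioms] end_forms_typed[OF assms]])
qed

lemma end_contr:
  assumes "\<phi> \<in> tan_forms M i" "A \<in> end_forms M E p q"
  shows "(\<lambda>c t. contr (\<phi> c) (A c t)) \<in> end_forms M E (p - 1) (q + i)"
proof (rule end_formsI)
  fix c t
  interpret D: open_domain "Dom c t" by (rule ED)
  show "D.typed (p - 1) (q + i) (contr (\<phi> c) (A c t))"
    by (rule D.typed_contr[OF tan_forms_pq_subset(1)[OF assms(1) open_edom edom_vdom] end_forms_typed[OF assms(2)]])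
next
  fix c c' t s assume "overlap M E c c' t s"
  then interpret O: overlap M E c c' t s .
  have X: "O.X \<subseteq> vdom M c" using O.X_edom edom_vdom by blast
  show "O.rel (contr (\<phi> c) (A c t)) (contr (\<phi> c') (A c' s))"
    by (rule O.rel_contr[OF tan_forms_vrel[OF assms(1) O.cc O.X_vdom O.CC.coordinate_change_axioms]
          tan_forms_pq_subset(2)[OF assms(1) O.open_X X] end_forms_rel[OF assms(2) O.overlap_axioms] end_forms_typed[OF assms(2)]])
qed

text \<open>The endomorphism part of \<open>TE_space\<close> in degree \<open>k\<close>. Types mix
  within a degree, so closure is shown for each type (p, q) and extended to \<open>GA\<close> by
  additivity.\<close>

definition GA :: "nat \<Rightarrow> ('x, 't, 'n, 'r) end_form set" where
  "GA k = {\<Sum>p\<le>k. \<alpha> p |\<alpha>. \<forall>p\<le>k. \<alpha> p \<in> end_forms M E p (k - p)}"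

lemma GA_I:
  assumes "A \<in> end_forms M E p q" "p + q = k"
  shows "A \<in> GA k"
proof -
  have "A = (\<Sum>p'\<le>k. if p' = p then A else 0)" using assms(2) by (simp add: sum.delta)
  moreover have "\<forall>p'\<le>k. (if p' = p then A else 0) \<in> end_forms M E p' (k - p')"
    using assms end_0 by auto
  ultimately show ?thesis unfolding GA_def by blast
qed

lemma GA_add:
  assumes "A \<in> GA k" "B \<in> GA k"
  shows "A + B \<in> GA k"
proof -
  obtain \<alpha> \<beta> where "\<forall>p\<le>k. \<alpha> p \<in> end_forms M E p (k - p)" "A = (\<Sum>p\<le>k. \<alpha> p)"
    "\<forall>p\<le>k. \<beta> p \<in> end_forms M E p (k - p)" "B = (\<Sum>p\<le>k. \<beta> p)"
    using assms unfolding GA_def by blast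
  then have "A + B = (\<Sum>p\<le>k. \<alpha> p + \<beta> p)" "\<forall>p\<le>k. \<alpha> p + \<beta> p \<in> end_forms M E p (k - p)"
    by (simp_all add: sum.distrib end_add)
  then show ?thesis unfolding GA_def by (intro CollectI exI[of _ "\<lambda>p. \<alpha> p + \<beta> p"] conjI)
qed

lemma scE_sum: "scE r (\<Sum>p\<in>I. f p) = (\<Sum>p\<in>I. scE r (f p))"
  by (intro ext) (simp add: scE_def sum_fun_apply sum_distrib_left)

lemma GA_scale:
  assumes "A \<in> GA k"
  shows "scE r A \<in> GA k"
proof -
  obtain \<alpha> where "\<forall>p\<le>k. \<alpha> p \<in> end_forms M E p (k - p)" "A = (\<Sum>p\<le>k. \<alpha> p)"
    using assms unfolding GA_def by blast
  then have "scE r A = (\<Sum>p\<le>k. scE r (\<alpha> p))" "\<forall>p\<le>k. scE r (\<alpha> p) \<in> end_forms M E p (k - p)"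
    by (simp_all add: scE_sum end_scale)
  then show ?thesis unfolding GA_def by (intro CollectI exI[of _ "\<lambda>p. scE r (\<alpha> p)"] conjI)
qed

lemma GA_0: "0 \<in> GA k"
  by (rule GA_I[OF end_0[of 0 k]]) simp

lemma GA_minus: "A \<in> GA k \<Longrightarrow> - A \<in> GA k"
proof -
  assume "A \<in> GA k"
  moreover have "scE (- 1) A = - A" by (intro ext) (simp add: scE_def)
  ultimately show ?thesis using GA_scale[of A k "-1"] by simp
qed

lemma GA_diff: "A \<in> GA k \<Longrightarrow> B \<in> GA k \<Longrightarrow> A - B \<in> GA k"
  using GA_add[of A k "- B"] by (simp add: GA_minus)

lemma GA_sg: "A \<in> GA k \<Longrightarrow> sg i A \<in> GA k"
  by (simp add: sg_def GA_minus)

lemma GA_sum: "(\<And>i. i \<in> I \<Longrightarrow> f i \<in> GA k) \<Longrightarrow> (\<Sum>i\<in>I. f i) \<in> GA k"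
proof (induction I rule: infinite_finite_induct)
  case (insert x F)
  have "(\<Sum>i\<in>insert x F. f i) = f x + (\<Sum>i\<in>F. f i)" by (rule sum.insert[OF insert.hyps(1,2)])
  then show ?case by (rule ssubst) (rule GA_add, use insert in auto)
qed (simp_all only: sum.infinite sum.empty GA_0 simp_thms)

lemma GA_local:
  assumes "A \<in> GA k"
  shows "A c t \<in> open_domain.mOm (Dom c t) k" "deg k (A c t i j)"
    and "k > 2 * CARD('n) \<Longrightarrow> A = 0"
proof -
  obtain \<alpha> where \<alpha>: "\<And>p. p \<le> k \<Longrightarrow> \<alpha> p \<in> end_forms M E p (k - p)" "A = (\<Sum>p\<le>k. \<alpha> p)"
    using assms unfolding GA_def by blast
  have A: "A c t i j = (\<Sum>p\<le>k. \<alpha> p c t i j)" for c t i j by (simp add: \<alpha>(2) sum_fun_apply)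
  interpret D: open_domain "Dom c t" by (rule ED)
  have sf: "D.sf k (\<alpha> p c t i j)" "deg k (\<alpha> p c t i j)" if "p \<le> k" for p i j
    using D.pq_sf[OF D.typedD[OF end_forms_typed[OF \<alpha>(1)[OF that]]]]
      D.pq_smo(2)[OF D.typedD[OF end_forms_typed[OF \<alpha>(1)[OF that]]]] that by simp_all
  show "A c t \<in> D.mOm k" unfolding D.mOm_def A using sf(1) by (auto intro!: D.sf_sum)
  show "deg k (A c t i j)" unfolding A deg_def sum_fun_apply using sf(2) by (auto simp: deg_def intro!: sum.neutral)
  show "A = 0" if "k > 2 * CARD('n)"
  proof -
    have "\<alpha> p c t i j = 0" if "p \<le> k" for p c t i j
    proof -
      interpret D': open_domain "Dom c t" by (rule ED)
      show ?thesis
        using D'.pq_large[OF D'.typedD[OF end_forms_typed[OF \<alpha>(1)[OF that]]]] that \<open>k > 2 * CARD('n)\<close> by simp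
    qed
    then have "A c t i j = 0" for c t i j unfolding A by simp
    then show ?thesis by (intro ext) simp
  qed
qed

lemma GA_gcomm:
  assumes "A \<in> GA k" "B \<in> GA l"
  shows "(\<lambda>c t. gcomm i j (A c t) (B c t)) \<in> GA (k + l)"
proof -
  obtain \<alpha> where \<alpha>: "\<And>p. p \<le> k \<Longrightarrow> \<alpha> p \<in> end_forms M E p (k - p)" "A = (\<Sum>p\<le>k. \<alpha> p)"
    using assms(1) unfolding GA_def by blast
  obtain \<beta> where \<beta>: "\<And>p. p \<le> l \<Longrightarrow> \<beta> p \<in> end_forms M E p (l - p)" "B = (\<Sum>p\<le>l. \<beta> p)"
    using assms(2) unfolding GA_def by blast
  have "(\<lambda>c t. gcomm i j (A c t) (B c t)) =
    (\<Sum>p\<le>k. \<Sum>q\<le>l. (\<lambda>c t. mwedge (\<alpha> p c t) (\<beta> q c t))) - sg (i * j) (\<Sum>p\<le>k. \<Sum>q\<le>l. (\<lambda>c t. mwedge (\<beta> q c t) (\<alpha> p c t)))"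
    (is "?L = ?R")
  proof -
    have "?L c t = ?R c t" for c t
      unfolding gcomm_eq_sg \<alpha>(2) \<beta>(2) sum_fun_apply mwedge_sum fun_diff_def sg_apply
      by (subst (3) sum.swap) (rule refl)
    then show ?thesis by (intro ext) metis
  qed
  moreover have "(\<lambda>c t. mwedge (\<alpha> p c t) (\<beta> q c t)) \<in> GA (k + l)" "(\<lambda>c t. mwedge (\<beta> q c t) (\<alpha> p c t)) \<in> GA (k + l)"
    if "p \<le> k" "q \<le> l" for p q
    using that by (intro GA_I[OF end_mwedge[OF \<alpha>(1) \<beta>(1)]] GA_I[OF end_mwedge[OF \<beta>(1) \<alpha>(1)]]; simp)+
  ultimately show ?thesis
    by (auto intro!: GA_diff GA_sg GA_sum)
qed

end

section \<open>The differential graded Lie algebra of a Higgs bundle\<close>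

context open_domain
begin

lemma rd_const_fm: "smo \<omega> \<Longrightarrow> rd k w (fm (\<lambda>_. r) \<omega>) = fm (\<lambda>_. r) (rd k w \<omega>)"
proof -
  assume "smo \<omega>"
  then have "pd k a (fm (\<lambda>_. r) \<omega>) = fm (\<lambda>_. r) (pd k a \<omega>)" for a
    by (simp add: fun_eq_iff pd_def fm_def pdf_cmult smo_dif)
  then show ?thesis by (simp add: rd_def wedge_fm fm_sum)
qed

lemma SN_const_fm:
  assumes "\<And>a. smo (\<phi> a)" "\<And>a. smo (\<psi> a)"
  shows "SN (\<lambda>a. fm (\<lambda>_. r) (\<phi> a)) \<psi> b = fm (\<lambda>_. r) (SN \<phi> \<psi> b)"
    "SN \<phi> (\<lambda>a. fm (\<lambda>_. r) (\<psi> a)) b = fm (\<lambda>_. r) (SN \<phi> \<psi> b)"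
proof -
  have pd: "pd k a (fm (\<lambda>_. r) \<omega>) = fm (\<lambda>_. r) (pd k a \<omega>)" if "smo \<omega>" for k a \<omega>
    using that by (simp add: fun_eq_iff pd_def fm_def pdf_cmult smo_dif)
  have fm_diff: "fm f \<alpha> - fm f \<beta> = fm f (\<alpha> - \<beta>)" for f and \<alpha> \<beta> :: "'n form"
    by (simp add: fun_eq_iff fm_def algebra_simps)
  show "SN (\<lambda>a. fm (\<lambda>_. r) (\<phi> a)) \<psi> b = fm (\<lambda>_. r) (SN \<phi> \<psi> b)"
    "SN \<phi> (\<lambda>a. fm (\<lambda>_. r) (\<psi> a)) b = fm (\<lambda>_. r) (SN \<phi> \<psi> b)"
    using assms by (simp_all add: SN_def pd wedge_fm fm_diff fm_sum)
qed

lemma SN_add: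
  assumes "\<And>a. smo (\<phi> a)" "\<And>a. smo (\<phi>' a)" "\<And>a. smo (\<psi> a)"
  shows "SN (\<phi> + \<phi>') \<psi> = SN \<phi> \<psi> + SN \<phi>' \<psi>" "SN \<psi> (\<phi> + \<phi>') = SN \<psi> \<phi> + SN \<psi> \<phi>'"
proof -
  have "SN (\<phi> + \<phi>') \<psi> b = SN \<phi> \<psi> b + SN \<phi>' \<psi> b" "SN \<psi> (\<phi> + \<phi>') b = SN \<psi> \<phi> b + SN \<psi> \<phi>' b" for b
    using assms by (simp_all add: SN_def pd_add wedge_add_left wedge_add_right sum.distrib sum_subtractf)
  then show "SN (\<phi> + \<phi>') \<psi> = SN \<phi> \<psi> + SN \<phi>' \<psi>" "SN \<psi> (\<phi> + \<phi>') = SN \<psi> \<phi> + SN \<psi> \<phi>'"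
    by (simp_all add: fun_eq_iff)
qed

end

lemma coeff_0 [simp]: "coeff_dz a 0 = 0" "coeff_dzbar a 0 = 0"
  by (simp_all add: fun_eq_iff coeff_dz_def coeff_dzbar_def pdz_def pdzbar_def)

lemma mdel_0: "mdel 0 = 0" and mdelbar_0: "mdelbar 0 = 0"
  by (simp_all add: fun_eq_iff mdel_def mdelbar_def del_def delbar_def)

lemma gcomm_0: "gcomm p q A 0 = 0" "gcomm p q 0 A = 0"
  by (simp_all add: gcomm_eq_sg mwedge_0)

lemma brace_0: "brace w p q 0 A = 0" "brace w p q v 0 = 0"
  by (simp_all add: brace_def cov_del_def contr_linear mdel_0 gcomm_0)

lemma SN_bracket_0: "SN_bracket 0 \<phi> = 0" "SN_bracket \<phi> 0 = 0"
  by (simp_all add: fun_eq_iff SN_bracket_def sum_fun_apply)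

text \<open>On homogeneous arguments, all but at most one summand of \<open>TE_bracket\<close>
  contain a zero component and have to vanish.\<close>

lemma TE_bracket_hom_0: "TE_bracket_hom M E W i j 0 b = 0" "TE_bracket_hom M E W i j a 0 = 0"
  by (cases a, cases b,
      simp add: zero_prod_def TE_bracket_hom_def fun_eq_iff restrict_end_def restrict_tan_def
        brace_0 gcomm_0 SN_bracket_0)+

lemma TE_diff_hom_0: "TE_diff_hom M E W \<theta> i 0 = 0"
  by (simp add: zero_prod_def TE_diff_hom_def fun_eq_iff restrict_end_def restrict_tan_def
      mdelbar_0 gcomm_0 B_op_def C_op_def brace_0 contr_linear vdelbar_def delbar_def)

section \<open>The local calculus in every trivialisation\<close>

locale higgs_bundle = holomorphic_bundle M E
  for M :: "('x, 'n::finite) cmanifold" and E :: "('x, 't, 'r::finite) vbundle" +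
  fixes \<theta> W :: "('x, 't, 'n, 'r) end_form" and K :: "'t \<Rightarrow> 'x \<Rightarrow> complex^'r^'r"
  assumes higgs: "higgs_field M E \<theta>" and hermitian: "hermitian_metric M E K"
    and chern: "chern_connection M E K W"
begin

text \<open>A global form involves all pairs of chart and frame at once, so the operations of the
  calculus are applied to explicit parameters; interpretations, which fix one pair, are made inside
  proofs.\<close>

abbreviation Llie :: "('x, 'n) chart \<Rightarrow> 't \<Rightarrow> nat \<Rightarrow> nat \<Rightarrow> 'n vform \<Rightarrow> ('n, 'r) mform \<Rightarrow> ('n, 'r) mform" where
  "Llie c t \<equiv> super_connection.lie mwedge (open_domain.mdl (Dom c t)) contr (W c t)"

abbreviation LbrE where
  "LbrE c t \<equiv> super_connection.brE mwedge (open_domain.mdl (Dom c t)) contr (W c t)"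

abbreviation LdE where
  "LdE c t \<equiv> super_higgs.dE mwedge (open_domain.mdl (Dom c t)) (open_domain.mdb (Dom c t)) contr (W c t) (\<theta> c t)"

lemma W_typed: "open_domain.typed (Dom c t) 1 0 (W c t)"
proof -
  interpret D: open_domain "Dom c t" by (rule ED)
  have "pq_form_on (Dom c t) 1 0 (W c t i j)" for i j
    using chern unfolding chern_connection_def by blast
  moreover have "D.zo (W c t i j)" for i j
    using chern unfolding chern_connection_def connection_def D.zo_def by blast
  ultimately show ?thesis by (simp add: D.typed_def)
qed

lemma W_wrel:
  assumes "overlap M E c c' t s"
  shows "overlap.wrel E c c' t s (W c t) (W c' s)"
proof -
  interpret O: overlap M E c c' t s by fact
  have deg: "deg 1 (W c t i j)" for c t i j
    using open_domain.pq_smo(2)[OF ED open_domain.typedD(1)[OF ED W_typed] open_domain.typedD(2)[OF ED W_typed]] by simp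
  have "(\<Sum>k\<in>UNIV. W c t i k y [v] * tmap E t s (inv_chart c y) $ k $ j) =
        (\<Sum>k\<in>UNIV. tmap E t s (inv_chart c y) $ i $ k *
           W c' s k j (coord_change c c' y) [frechet_derivative (coord_change c c') (at y) v]) -
        frechet_derivative (\<lambda>u. tmap E t s (inv_chart c u) $ i $ j) (at y) v" if "y \<in> O.X" for y i j v
  proof -
    have "connection M E W" using chern by (simp add: chern_connection_def)
    from this[unfolded connection_def, THEN conjunct2, THEN conjunct2, THEN bspec, OF O.cc(1), THEN bspec, OF O.cc(2),
        THEN bspec, OF O.ts(1), THEN bspec, OF O.ts(2), THEN bspec, OF that[unfolded O.X_def]]
    show ?thesis by (elim allE)
  qed
  then show ?thesis
    by (intro O.wrel_connection[OF _ deg deg]) (simp only: O.tm_def)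
qed

text \<open>Metric compatibility is evaluated on the constant sections \<open>axis l 1\<close> and
  \<open>axis k 1\<close>, whose covariant derivatives are columns of \<open>W\<close>; this gives
  the matrix identity that \<open>chern_flat\<close> needs.\<close>

lemma W_flat: "open_domain.mdl (Dom c t) (W c t) = - mwedge (W c t) (W c t)"
proof -
  interpret D: open_domain "Dom c t" by (rule ED)
  show ?thesis
  proof (rule D.chern_flat[where h = "\<lambda>y. K t (inv_chart c y)"])
    show "D.pq 1 0 (W c t i j)" "D.zo (W c t i j)" for i j
      using D.typedD[OF W_typed] by blast+
    show "smooth_on (Dom c t) (\<lambda>y. K t (inv_chart c y) $ i $ j)" for i j
    proof (cases "c \<in> charts M \<and> t \<in> frames E")
      case True
      then show ?thesis using hermitian unfolding hermitian_metric_def by blast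
    qed (auto simp: edom_def)
    fix y assume y: "y \<in> Dom c t"
    then have ct: "c \<in> charts M" "t \<in> frames E" "y \<in> snd c ` (fst c \<inter> fdom E t)"
      by (auto simp: edom_def split: if_splits)
    then obtain x where x: "x \<in> fst c" "x \<in> fdom E t" "y = snd c x" by auto
    show "Re (herm (K t (inv_chart c y)) v v) > 0" if "v \<noteq> 0" for v
    proof -
      have "Re (herm (K t x) v v) > 0"
        using hermitian ct(2) x(2) that unfolding hermitian_metric_def by blast
      then show ?thesis using inv_chart_eq[OF ct(1) x(1)] x(3) by simp
    qed
    fix v and k l :: 'r
    have "frechet_derivative (\<lambda>u. herm (K t (inv_chart c u)) (axis l 1) (axis k 1)) (at y) v =
           herm (K t (inv_chart c y)) (nabla (W c t) (\<lambda>_. axis l 1) y v) (axis k 1) +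
           herm (K t (inv_chart c y)) (axis l 1) (nabla (W c t) (\<lambda>_. axis k 1) y v)"
      using chern y smooth_on_const[of "Dom c t" "axis l 1 :: complex^'r"] smooth_on_const[of "Dom c t" "axis k 1 :: complex^'r"]
      unfolding chern_connection_def by blast
    moreover have "herm (K t (inv_chart c u)) (axis l 1) (axis k 1) = K t (inv_chart c u) $ k $ l" for u
    proof -
      have "(\<Sum>j\<in>UNIV. K t (inv_chart c u) $ k $ j * axis l 1 $ j) = (\<Sum>j\<in>UNIV. if j = l then K t (inv_chart c u) $ k $ l else 0)"
        by (intro sum.cong refl) (auto simp: axis_def)
      then show ?thesis by (simp add: herm_axis(1))
    qed
    moreover have "nabla (W c t) (\<lambda>_. axis l 1) y v $ i = W c t i l y [v]" for i l
    proof -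
      have "(\<Sum>j\<in>UNIV. W c t i j y [v] * axis l 1 $ j) = (\<Sum>j\<in>UNIV. if j = l then W c t i l y [v] else 0)"
        by (intro sum.cong refl) (auto simp: axis_def)
      then show ?thesis by (simp add: nabla_def)
    qed
    ultimately show "frechet_derivative (\<lambda>u. K t (inv_chart c u) $ k $ l) (at y) v =
      (\<Sum>j\<in>UNIV. K t (inv_chart c y) $ k $ j * W c t j l y [v]) + (\<Sum>i\<in>UNIV. cnj (W c t i k y [v]) * K t (inv_chart c y) $ i $ l)"
      unfolding herm_axis by simp
  qed
qed

lemma \<theta>_end: "\<theta> \<in> end_forms M E 1 0"
  using higgs by (simp add: higgs_field_def)

lemma local_higgs:
  "super_higgs (open_domain.mS (Dom c t) :: ('n, 'r) mform set) (open_domain.mOm (Dom c t)) (open_domain.vV (Dom c t))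
    (\<lambda>i. {v. open_domain.vf (Dom c t) i v}) mwedge (open_domain.mdl (Dom c t)) (open_domain.mdb (Dom c t)) contr
    (open_domain.vb (Dom c t)) (open_domain.SN (Dom c t)) (W c t) (\<theta> c t)"
proof -
  interpret D: open_domain "Dom c t" by (rule ED)
  interpret SC: super_calculus "D.mS :: ('n, 'r) mform set" D.mOm D.vV "\<lambda>i. {v. D.vf i v}" mwedge D.mdl D.mdb contr D.vb D.SN
    by (rule D.super_calculus_mform)
  show ?thesis
  proof
    show "W c t \<in> D.mOm 1" using D.typed_mOm[OF W_typed] by simp
    show "contr w (contr v (W c t)) = 0" if "v \<in> D.vV" for v w
      by (rule D.typed_1_contr_contr[OF W_typed that])
    show "contr w (contr v (D.mdb (W c t))) = 0" if "v \<in> D.vV" for v w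
      by (rule D.typed_1_contr_contr[OF D.typed_mdb[OF W_typed] that])
    show "D.mdl (W c t) = - mwedge (W c t) (W c t)" by (rule W_flat)
    show "\<theta> c t \<in> D.mOm 1" using D.typed_mOm[OF end_forms_typed[OF \<theta>_end]] by simp
    have z: "restrict_end M E (\<lambda>c t. mdelbar (\<theta> c t)) = 0" "restrict_end M E (\<lambda>c t. mwedge (\<theta> c t) (\<theta> c t)) = 0"
      using higgs by (simp_all add: higgs_field_def)
    have "D.mdb (\<theta> c t) i j y vs = 0" for i j y vs
    proof (cases "y \<in> Dom c t")
      case True
      then show ?thesis
        using fun_cong[OF fun_cong[OF fun_cong[OF fun_cong[OF fun_cong[OF fun_cong[OF z(1)]]]]], of c t i j y vs]
        by (simp add: restrict_end_def mdelbar_def D.mdb_def D.delbar_at)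
    next
      case False
      then show ?thesis using D.zo_rd by (simp add: D.mdb_def D.zo_def)
    qed
    then show "D.mdb (\<theta> c t) = 0" by (intro ext) simp
    have "mwedge (\<theta> c t) (\<theta> c t) i j y vs = 0" for i j y vs
    proof (cases "y \<in> Dom c t")
      case True
      then show ?thesis
        using fun_cong[OF fun_cong[OF fun_cong[OF fun_cong[OF fun_cong[OF fun_cong[OF z(2)]]]]], of c t i j y vs]
        by (simp add: restrict_end_def)
    next
      case False
      then show ?thesis
        using D.typedD(2)[OF D.typed_mwedge[OF end_forms_typed[OF \<theta>_end] end_forms_typed[OF \<theta>_end]]] by (simp add: D.zo_def)
    qed
    then show "mwedge (\<theta> c t) (\<theta> c t) = 0" by (intro ext) simp
  qed
qed

lemma end_lcov:
  assumes "A \<in> end_forms M E p q"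
  shows "(\<lambda>c t. lcov (Dom c t) (W c t) (p + q) (A c t)) \<in> end_forms M E (Suc p) q"
proof (rule end_formsI)
  fix c t
  interpret D: open_domain "Dom c t" by (rule ED)
  show "D.typed (Suc p) q (lcov (Dom c t) (W c t) (p + q) (A c t))"
    by (rule D.typed_lcov[OF W_typed end_forms_typed[OF assms]])
next
  fix c c' t s assume "overlap M E c c' t s"
  then interpret O: overlap M E c c' t s .
  show "O.rel (lcov (Dom c t) (W c t) (p + q) (A c t)) (lcov (Dom c' s) (W c' s) (p + q) (A c' s))"
    by (rule O.rel_lcov[OF W_wrel[OF O.overlap_axioms] W_typed end_forms_rel[OF assms O.overlap_axioms] end_forms_typed[OF assms]])
qed

lemma end_F: "(\<lambda>c t. open_domain.mdb (Dom c t) (W c t)) \<in> end_forms M E 1 1"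
proof (rule end_formsI)
  fix c t
  interpret D: open_domain "Dom c t" by (rule ED)
  show "D.typed 1 1 (D.mdb (W c t))" using D.typed_mdb[OF W_typed] by simp
next
  fix c c' t s assume "overlap M E c c' t s"
  then interpret O: overlap M E c c' t s .
  show "O.rel (open_domain.mdb (Dom c t) (W c t)) (open_domain.mdb (Dom c' s) (W c' s))"
    by (rule O.rel_F[OF W_wrel[OF O.overlap_axioms] W_typed])
qed

lemma contr_rv:
  assumes "\<And>i j. open_domain.zo (Dom c t) (A i j)"
  shows "contr (rv c t \<phi>) A = contr (\<phi> c) A"
proof (intro ext)
  fix i j y vs
  interpret D: open_domain "Dom c t" by (rule ED)
  show "contr (rv c t \<phi>) A i j y vs = contr (\<phi> c) A i j y vs"
  proof (cases "y \<in> Dom c t")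
    case True
    then show ?thesis by (intro contr_cong_at) (simp_all add: rv_def rs_def)
  next
    case False
    have "D.zo (contr v A i j)" for v
      unfolding contr_def by (intro D.zo_sum D.zo_wedge_right D.zo_iota assms)
    then show ?thesis using False by (simp add: D.zo_def)
  qed
qed

text \<open>In the summand that differentiates first, the lowering of \<open>p\<close> by
  contraction is harmless. In the other one contraction comes first, and \<open>p = 0\<close> is
  separated because the contraction then vanishes.\<close>

lemma end_lie:
  assumes "\<phi> \<in> tan_forms M i" "A \<in> end_forms M E p q"
  shows "(\<lambda>c t. Llie c t i (p + q) (rv c t \<phi>) (A c t)) \<in> GA (i + (p + q))"
proof -
  let ?B = "\<lambda>c t. contr (\<phi> c) (lcov (Dom c t) (W c t) (p + q) (A c t))"
  have B: "?B \<in> GA (i + (p + q))"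
    using end_contr[OF assms(1) end_lcov[OF assms(2)]] by (rule GA_I) simp
  have zo: "open_domain.zo (Dom c t) (A c t k l)" "open_domain.zo (Dom c t) (lcov (Dom c t) (W c t) (p + q) (A c t) k l)" for c t k l
    using open_domain.typedD(2)[OF ED end_forms_typed[OF assms(2)]] open_domain.typedD(2)[OF ED end_forms_typed[OF end_lcov[OF assms(2)]]] by auto
  have Dc: "super_connection.Dc mwedge (open_domain.mdl (Dom c t)) (W c t) m C = lcov (Dom c t) (W c t) m C" for c t m C
  proof -
    interpret H: super_higgs "open_domain.mS (Dom c t) :: ('n, 'r) mform set" "open_domain.mOm (Dom c t)" "open_domain.vV (Dom c t)"
      "\<lambda>i. {v. open_domain.vf (Dom c t) i v}" mwedge "open_domain.mdl (Dom c t)" "open_domain.mdb (Dom c t)" contr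
      "open_domain.vb (Dom c t)" "open_domain.SN (Dom c t)" "W c t" "\<theta> c t" by (rule local_higgs)
    show ?thesis by (simp add: H.Dc_def lcov_def H.cm_def gcomm_eq_sg)
  qed
  have eq: "Llie c t i (p + q) (rv c t \<phi>) (A c t) =
     sg i (lcov (Dom c t) (W c t) (i + (p + q) + 1) (contr (\<phi> c) (A c t))) + ?B c t" for c t
  proof -
    interpret H: super_higgs "open_domain.mS (Dom c t) :: ('n, 'r) mform set" "open_domain.mOm (Dom c t)" "open_domain.vV (Dom c t)"
      "\<lambda>i. {v. open_domain.vf (Dom c t) i v}" mwedge "open_domain.mdl (Dom c t)" "open_domain.mdb (Dom c t)" contr
      "open_domain.vb (Dom c t)" "open_domain.SN (Dom c t)" "W c t" "\<theta> c t" by (rule local_higgs)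
    show ?thesis unfolding H.lie_def Dc by (simp add: contr_rv zo)
  qed
  show ?thesis
  proof (cases p)
    case 0
    have "lcov (Dom c t) (W c t) m (contr (\<phi> c) (A c t)) = 0" for c t m
    proof -
      interpret D: open_domain "Dom c t" by (rule ED)
      have "contr (\<phi> c) (A c t) = 0"
        using D.typed_0_contr end_forms_typed[OF assms(2), of c t] 0 by simp
      moreover have "D.mdl (0 :: ('n, 'r) mform) = 0" by (simp add: fun_eq_iff D.mdl_def)
      ultimately show ?thesis by (simp only: lcov_def gcomm_0 add_0)
    qed
    then show ?thesis unfolding eq using B by simp
  next
    case (Suc p')
    have C: "(\<lambda>c t. contr (\<phi> c) (A c t)) \<in> end_forms M E p' (q + i)"
      using end_contr[OF assms] Suc by simp
    \<comment> \<open>The index used by \<open>lie\<close> exceeds the true degree of the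
      contraction by 2, and the covariant derivative sees only parity.\<close>
    have par: "lcov (Dom c t) (W c t) (i + (p + q) + 1) X = lcov (Dom c t) (W c t) (p' + (q + i)) X" for c t X
    proof -
      have "i + (p + q) + 1 = p' + (q + i) + 2" using Suc by simp
      then have "even (i + (p + q) + 1) = even (p' + (q + i))" by (simp only: dvd_add_triv_right_iff)
      then show ?thesis by (simp only: lcov_def gcomm_eq_sg sg_def mult_1)
    qed
    have "(\<lambda>c t. lcov (Dom c t) (W c t) (i + (p + q) + 1) (contr (\<phi> c) (A c t))) \<in> GA (i + (p + q))"
      unfolding par by (rule GA_I[OF end_lcov[OF C]]) (simp add: Suc)
    from GA_add[OF GA_sg[OF this, of i] B]
    show ?thesis
      by (rule back_subst[of "\<lambda>X. X \<in> GA (i + (p + q))"]) (intro ext, simp add: eq sg_apply)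
  qed
qed

lemma local_membership:
  "A \<in> GA k \<Longrightarrow> A c t \<in> open_domain.mOm (Dom c t) k" "A \<in> GA k \<Longrightarrow> A c t \<in> open_domain.mS (Dom c t)"
  "\<phi> \<in> tan_forms M k \<Longrightarrow> rv c t \<phi> \<in> {v. open_domain.vf (Dom c t) k v}"
  "\<phi> \<in> tan_forms M k \<Longrightarrow> rv c t \<phi> \<in> open_domain.vV (Dom c t)"
proof -
  interpret D: open_domain "Dom c t" by (rule ED)
  interpret SC: super_calculus "D.mS :: ('n, 'r) mform set" D.mOm D.vV "\<lambda>i. {v. D.vf i v}" mwedge D.mdl D.mdb contr D.vb D.SN
    by (rule D.super_calculus_mform)
  show "A \<in> GA k \<Longrightarrow> A c t \<in> D.mOm k" by (rule GA_local)
  show "A \<in> GA k \<Longrightarrow> A c t \<in> D.mS" by (rule SC.Om_S[OF GA_local(1)])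
  show "\<phi> \<in> tan_forms M k \<Longrightarrow> rv c t \<phi> \<in> {v. D.vf k v}" using rv_vf by simp
  then show "\<phi> \<in> tan_forms M k \<Longrightarrow> rv c t \<phi> \<in> D.vV" by (rule SC.T_V)
qed

lemma GA_lie:
  assumes "\<phi> \<in> tan_forms M i" "A \<in> GA k"
  shows "(\<lambda>c t. Llie c t i k (rv c t \<phi>) (A c t)) \<in> GA (i + k)"
proof -
  obtain \<alpha> where \<alpha>: "\<And>p. p \<le> k \<Longrightarrow> \<alpha> p \<in> end_forms M E p (k - p)" "A = (\<Sum>p\<le>k. \<alpha> p)"
    using assms(2) unfolding GA_def by blast
  have "(\<lambda>c t. Llie c t i k (rv c t \<phi>) (A c t)) = (\<Sum>p\<le>k. (\<lambda>c t. Llie c t i k (rv c t \<phi>) (\<alpha> p c t)))"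
    (is "?L = ?R")
  proof -
    have "?L c t = ?R c t" for c t
    proof -
      interpret H: super_higgs "open_domain.mS (Dom c t) :: ('n, 'r) mform set" "open_domain.mOm (Dom c t)" "open_domain.vV (Dom c t)"
        "\<lambda>i. {v. open_domain.vf (Dom c t) i v}" mwedge "open_domain.mdl (Dom c t)" "open_domain.mdb (Dom c t)" contr
        "open_domain.vb (Dom c t)" "open_domain.SN (Dom c t)" "W c t" "\<theta> c t" by (rule local_higgs)
      have mem: "\<alpha> p c t \<in> open_domain.mS (Dom c t)" if "p \<in> {..k}" for p
        by (rule local_membership(2)[OF GA_I[OF \<alpha>(1)]]) (use that in auto)
      have "A c t = (\<Sum>p\<le>k. \<alpha> p c t)" "?R c t = (\<Sum>p\<le>k. Llie c t i k (rv c t \<phi>) (\<alpha> p c t))"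
        by (intro ext; simp add: \<alpha>(2) sum_fun_apply)+
      then show ?thesis
        using H.lie_sum[OF local_membership(4)[OF assms(1)] finite_atMost mem] by (simp only:)
    qed
    then show ?thesis by (intro ext) metis
  qed
  also have "\<dots> \<in> GA (i + k)"
  proof (rule GA_sum)
    fix p assume "p \<in> {..k}"
    then show "(\<lambda>c t. Llie c t i k (rv c t \<phi>) (\<alpha> p c t)) \<in> GA (i + k)"
      using end_lie[OF assms(1) \<alpha>(1)[of p]] by simp
  qed
  finally show ?thesis .
qed

lemma GA_mdb:
  assumes "A \<in> GA k"
  shows "(\<lambda>c t. open_domain.mdb (Dom c t) (A c t)) \<in> GA (Suc k)"
proof -
  obtain \<alpha> where \<alpha>: "\<And>p. p \<le> k \<Longrightarrow> \<alpha> p \<in> end_forms M E p (k - p)" "A = (\<Sum>p\<le>k. \<alpha> p)"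
    using assms unfolding GA_def by blast
  have "(\<lambda>c t. open_domain.mdb (Dom c t) (A c t)) = (\<Sum>p\<le>k. (\<lambda>c t. open_domain.mdb (Dom c t) (\<alpha> p c t)))"
    (is "?L = ?R")
  proof -
    have "?L c t i j = ?R c t i j" for c t i j
    proof -
      interpret D: open_domain "Dom c t" by (rule ED)
      have "\<alpha> p c t \<in> D.mS" if "p \<in> {..k}" for p
        by (rule local_membership(2)[OF GA_I[OF \<alpha>(1)]]) (use that in auto)
      then have "D.rdelb (\<Sum>p\<le>k. \<alpha> p c t i j) = (\<Sum>p\<le>k. D.rdelb (\<alpha> p c t i j))"
        using D.mS_D(1) by (intro D.rd_sum) blast
      moreover have "A c t i j = (\<Sum>p\<le>k. \<alpha> p c t i j)" "?R c t i j = (\<Sum>p\<le>k. D.rdelb (\<alpha> p c t i j))"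
        by (intro ext; simp add: \<alpha>(2) sum_fun_apply D.mdb_def)+
      ultimately show ?thesis by (simp only: D.mdb_def)
    qed
    then show ?thesis by (intro ext) metis
  qed
  also have "\<dots> \<in> GA (Suc k)"
    by (intro GA_sum GA_I[OF end_mdb[OF \<alpha>(1)]]) auto
  finally show ?thesis .
qed

lemma GA_brE:
  assumes "A \<in> GA i" "\<phi> \<in> tan_forms M i" "B \<in> GA j" "\<psi> \<in> tan_forms M j"
  shows "(\<lambda>c t. LbrE c t i j (A c t) (rv c t \<phi>) (B c t) (rv c t \<psi>)) \<in> GA (i + j)"
proof -
  have eq: "LbrE c t i j (A c t) (rv c t \<phi>) (B c t) (rv c t \<psi>) =
     Llie c t i j (rv c t \<phi>) (B c t) - sg (i * j) (Llie c t j i (rv c t \<psi>) (A c t)) - gcomm i j (A c t) (B c t)" for c t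
  proof -
    interpret H: super_higgs "open_domain.mS (Dom c t) :: ('n, 'r) mform set" "open_domain.mOm (Dom c t)" "open_domain.vV (Dom c t)"
      "\<lambda>i. {v. open_domain.vf (Dom c t) i v}" mwedge "open_domain.mdl (Dom c t)" "open_domain.mdb (Dom c t)" contr
      "open_domain.vb (Dom c t)" "open_domain.SN (Dom c t)" "W c t" "\<theta> c t" by (rule local_higgs)
    show ?thesis by (simp add: H.brE_def H.cm_def gcomm_eq_sg)
  qed
  have "(\<lambda>c t. Llie c t i j (rv c t \<phi>) (B c t)) - sg (i * j) (\<lambda>c t. Llie c t j i (rv c t \<psi>) (A c t)) -
      (\<lambda>c t. gcomm i j (A c t) (B c t)) \<in> GA (i + j)"
    using GA_lie[OF assms(2,3)] GA_lie[OF assms(4,1)] GA_gcomm[OF assms(1,3)]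
    by (intro GA_diff GA_sg) (simp_all add: add.commute)
  moreover have "(\<lambda>c t. LbrE c t i j (A c t) (rv c t \<phi>) (B c t) (rv c t \<psi>)) =
      (\<lambda>c t. Llie c t i j (rv c t \<phi>) (B c t)) - sg (i * j) (\<lambda>c t. Llie c t j i (rv c t \<psi>) (A c t)) -
      (\<lambda>c t. gcomm i j (A c t) (B c t))"
    by (intro ext) (simp add: eq sg_apply)
  ultimately show ?thesis by (simp only:)
qed

lemma GA_dE:
  assumes "A \<in> GA i" "\<phi> \<in> tan_forms M i"
  shows "(\<lambda>c t. LdE c t i (A c t) (rv c t \<phi>)) \<in> GA (Suc i)"
proof -
  let ?F = "\<lambda>c t. contr (\<phi> c) (open_domain.mdb (Dom c t) (W c t))"
  have \<theta>: "\<theta> \<in> GA 1" by (rule GA_I[OF \<theta>_end]) simp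
  have eq: "LdE c t i (A c t) (rv c t \<phi>) = open_domain.mdb (Dom c t) (A c t) + sg i (?F c t) +
      gcomm 1 i (\<theta> c t) (A c t) + sg i (Llie c t i 1 (rv c t \<phi>) (\<theta> c t))" for c t
  proof -
    interpret H: super_higgs "open_domain.mS (Dom c t) :: ('n, 'r) mform set" "open_domain.mOm (Dom c t)" "open_domain.vV (Dom c t)"
      "\<lambda>i. {v. open_domain.vf (Dom c t) i v}" mwedge "open_domain.mdl (Dom c t)" "open_domain.mdb (Dom c t)" contr
      "open_domain.vb (Dom c t)" "open_domain.SN (Dom c t)" "W c t" "\<theta> c t" by (rule local_higgs)
    have "contr (rv c t \<phi>) (open_domain.mdb (Dom c t) (W c t)) = ?F c t"
      by (rule contr_rv[OF open_domain.typedD(2)[OF ED end_forms_typed[OF end_F]]])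
    then show ?thesis by (simp add: H.dE_def H.cm_def gcomm_eq_sg)
  qed
  have "(\<lambda>c t. open_domain.mdb (Dom c t) (A c t)) + sg i ?F + (\<lambda>c t. gcomm 1 i (\<theta> c t) (A c t)) +
      sg i (\<lambda>c t. Llie c t i 1 (rv c t \<phi>) (\<theta> c t)) \<in> GA (Suc i)"
    using GA_mdb[OF assms(1)] GA_I[OF end_contr[OF assms(2) end_F], of "Suc i"] GA_gcomm[OF \<theta> assms(1), of 1 i] GA_lie[OF assms(2) \<theta>]
    by (intro GA_add GA_sg) simp_all
  moreover have "(\<lambda>c t. LdE c t i (A c t) (rv c t \<phi>)) =
      (\<lambda>c t. open_domain.mdb (Dom c t) (A c t)) + sg i ?F + (\<lambda>c t. gcomm 1 i (\<theta> c t) (A c t)) +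
      sg i (\<lambda>c t. Llie c t i 1 (rv c t \<phi>) (\<theta> c t))"
    by (intro ext) (simp add: eq sg_apply)
  ultimately show ?thesis by (simp only:)
qed

section \<open>Bracket and differential of homogeneous elements\<close>

definition gbr :: "nat \<Rightarrow> nat \<Rightarrow> ('x, 't, 'n, 'r) pair_form \<Rightarrow> ('x, 't, 'n, 'r) pair_form \<Rightarrow> ('x, 't, 'n, 'r) pair_form" where
  "gbr i j a b = (\<lambda>c t. LbrE c t i j (fst a c t) (rv c t (snd a)) (fst b c t) (rv c t (snd b)),
     \<lambda>c. open_domain.SN (vdom M c) (snd a c) (snd b c))"

definition gd :: "nat \<Rightarrow> ('x, 't, 'n, 'r) pair_form \<Rightarrow> ('x, 't, 'n, 'r) pair_form" where
  "gd i a = (\<lambda>c t. LdE c t i (fst a c t) (rv c t (snd a)), \<lambda>c. open_domain.vb (vdom M c) (snd a c))"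

definition PGA :: "nat \<Rightarrow> ('x, 't, 'n, 'r) pair_form set" where
  "PGA k = GA k \<times> tan_forms M k"

lemma PGA_gbr: "a \<in> PGA i \<Longrightarrow> b \<in> PGA j \<Longrightarrow> gbr i j a b \<in> PGA (i + j)"
  by (auto simp: PGA_def gbr_def intro: GA_brE tan_SN)

lemma PGA_gd: "a \<in> PGA i \<Longrightarrow> gd i a \<in> PGA (Suc i)"
  by (auto simp: PGA_def gd_def intro: GA_dE tan_vb)

text \<open>The truncated \<open>i + j - 1\<close> has the parity of \<open>i + j + 1\<close> as
  soon as \<open>j > 0\<close>; for \<open>j = 0\<close> the contraction it refers to is
  zero.\<close>

lemma brace_at:
  assumes "\<And>k l. deg j (A k l)" "\<And>k l. open_domain.zo (Dom c t) (A k l)" "y \<in> Dom c t"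
  shows "brace (W c t) i j (\<phi> c) A k l y vs = sg i (Llie c t i j (rv c t \<phi>) A) k l y vs"
proof -
  interpret D: open_domain "Dom c t" by (rule ED)
  interpret H: super_higgs "D.mS :: ('n, 'r) mform set" D.mOm D.vV "\<lambda>i. {v. D.vf i v}" mwedge D.mdl D.mdb contr
    D.vb D.SN "W c t" "\<theta> c t" by (rule local_higgs)
  have Dc: "H.Dc m C = lcov (Dom c t) (W c t) m C" for m C
    by (simp add: H.Dc_def lcov_def H.cm_def gcomm_eq_sg)
  have "H.Dc (i + j - 1) (contr (\<phi> c) A) = H.Dc (i + j + 1) (contr (\<phi> c) A)"
  proof (cases j)
    case 0
    have iota: "iota a (A k l) = 0" for a k l
      using assms(1)[of k l] 0 by (simp add: fun_eq_iff iota_def deg_def)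
    have "contr (\<phi> c) A = 0" by (intro ext) (simp add: contr_def sum_fun_apply iota)
    then show ?thesis by simp
  next
    case (Suc j')
    then show ?thesis by (intro H.Dc_cong) simp
  qed
  then have 1: "cov_del (W c t) (i + j - 1) (contr (\<phi> c) A) k l y vs = H.Dc (i + j + 1) (contr (rv c t \<phi>) A) k l y vs"
    using assms(3) by (simp add: D.cov_del_at Dc contr_rv assms(2))
  have 2: "contr (\<phi> c) (cov_del (W c t) j A) k l y vs = contr (rv c t \<phi>) (H.Dc j A) k l y vs"
    using assms(3) by (intro contr_cong_at) (simp_all add: rv_def rs_def D.cov_del_at Dc)
  show ?thesis
    unfolding brace_def power_minus_one_times_eq_sg plus_fun_apply sg_apply 1 2 H.lie_def
    by (simp add: sg_def)
qed

text \<open>By \<open>brace_at\<close> each brace is a signed \<open>lie\<close>. The prefactor of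
  the first becomes 1, that of the second (-1)^((i+1)j + j) = (-1)^(ij); these are the coefficients
  in \<open>brE\<close>.\<close>

lemma TE_bracket_hom_eq:
  assumes "a \<in> PGA i" "b \<in> PGA j"
  shows "TE_bracket_hom M E W i j a b = gbr i j a b"
proof -
  obtain A \<phi> B \<psi> where ab: "a = (A, \<phi>)" "b = (B, \<psi>)" by (cases a, cases b)
  have m: "A \<in> GA i" "\<phi> \<in> tan_forms M i" "B \<in> GA j" "\<psi> \<in> tan_forms M j"
    using assms by (auto simp: ab PGA_def)
  have 1: "restrict_end M E (\<lambda>c t.
        (- 1) ^ i * brace (W c t) i j (\<phi> c) (B c t)
        - (- 1) ^ ((i + 1) * j) * brace (W c t) j i (\<psi> c) (A c t)
        - gcomm i j (A c t) (B c t)) c t k l y vs =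
      LbrE c t i j (A c t) (rv c t \<phi>) (B c t) (rv c t \<psi>) k l y vs" for c t k l y vs
  proof -
    interpret D: open_domain "Dom c t" by (rule ED)
    interpret H: super_higgs "D.mS :: ('n, 'r) mform set" D.mOm D.vV "\<lambda>i. {v. D.vf i v}" mwedge D.mdl D.mdb contr
      D.vb D.SN "W c t" "\<theta> c t" by (rule local_higgs)
    have zo: "D.zo (A c t k l)" "D.zo (B c t k l)" for k l
      using D.mS_D(2)[OF local_membership(2)[OF m(1)]] D.mS_D(2)[OF local_membership(2)[OF m(3)]] by (simp_all add: D.sm_def)
    show ?thesis
    proof (cases "y \<in> Dom c t")
      case True
      have br: "brace (W c t) i j (\<phi> c) (B c t) k l y vs = sg i (H.lie i j (rv c t \<phi>) (B c t)) k l y vs"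
        "brace (W c t) j i (\<psi> c) (A c t) k l y vs = sg j (H.lie j i (rv c t \<psi>) (A c t)) k l y vs"
        by (rule brace_at[OF GA_local(2)[OF m(3)] zo(2) True], rule brace_at[OF GA_local(2)[OF m(1)] zo(1) True])
      show ?thesis
        using True unfolding restrict_end_def power_minus_one_times_eq_sg fun_diff_def sg_apply br H.brE_def
        by (cases "even i"; cases "even j"; simp add: sg_def H.cm_def gcomm_eq_sg)
    next
      case False
      have "D.zo (H.brE i j (A c t) (rv c t \<phi>) (B c t) (rv c t \<psi>) k l)"
        using D.mS_D(2)[OF local_membership(2)[OF GA_brE[OF m]]] by (simp add: D.sm_def)
      then show ?thesis using False by (simp add: restrict_end_def D.zo_def)
    qed
  qed
  have 2: "restrict_tan M (\<lambda>c. SN_bracket (\<phi> c) (\<psi> c)) c d y vs = open_domain.SN (vdom M c) (\<phi> c) (\<psi> c) d y vs" for c d y vs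
  proof -
    interpret D: open_domain "vdom M c" by (rule VD)
    have "D.zo (D.SN (\<phi> c) (\<psi> c) d)" by (rule tan_forms_pq(2)[OF tan_SN[OF m(2,4)]])
    then show ?thesis
      by (cases "y \<in> vdom M c")
        (simp_all add: restrict_tan_def D.SN_bracket_at D.zo_rs tan_forms_pq(2)[OF m(2)] tan_forms_pq(2)[OF m(4)] D.zo_def)
  qed
  show ?thesis
    unfolding ab TE_bracket_hom_def gbr_def prod.case fst_conv snd_conv
    by (intro arg_cong2[of _ _ _ _ Pair] ext 1 2)
qed

lemma TE_diff_hom_eq:
  assumes "a \<in> PGA i"
  shows "TE_diff_hom M E W \<theta> i a = gd i a"
proof -
  obtain A \<phi> where a: "a = (A, \<phi>)" by (cases a)
  have m: "A \<in> GA i" "\<phi> \<in> tan_forms M i" using assms by (auto simp: a PGA_def)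
  have \<theta>: "\<theta> \<in> GA 1" by (rule GA_I[OF \<theta>_end]) simp
  have 1: "restrict_end M E (\<lambda>c t. mdelbar (A c t) + B_op (W c t) i (\<phi> c) + gcomm 1 i (\<theta> c t) (A c t) +
        C_op (W c t) (\<theta> c t) i (\<phi> c)) c t k l y vs = LdE c t i (A c t) (rv c t \<phi>) k l y vs" for c t k l y vs
  proof -
    interpret D: open_domain "Dom c t" by (rule ED)
    interpret H: super_higgs "D.mS :: ('n, 'r) mform set" D.mOm D.vV "\<lambda>i. {v. D.vf i v}" mwedge D.mdl D.mdb contr
      D.vb D.SN "W c t" "\<theta> c t" by (rule local_higgs)
    show ?thesis
    proof (cases "y \<in> Dom c t")
      case True
      have zo: "D.zo (\<theta> c t k l)" for k l
        using D.mS_D(2)[OF local_membership(2)[OF \<theta>]] by (simp add: D.sm_def)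
      have br: "brace (W c t) i 1 (\<phi> c) (\<theta> c t) k l y vs = sg i (H.lie i 1 (rv c t \<phi>) (\<theta> c t)) k l y vs"
        by (rule brace_at[OF GA_local(2)[OF \<theta>] zo True])
      \<comment> \<open>Flatness cancels \<partial>W against W \<and> W in the curvature, so the
        operator \<B> of the theorem contracts with \<open>F\<close>.\<close>
      have "curv (W c t) k l y vs = D.mdb (W c t) k l y vs" for k l vs
      proof -
        have "curv (W c t) k l y vs = D.mdl (W c t) k l y vs + D.mdb (W c t) k l y vs + mwedge (W c t) (W c t) k l y vs"
          using True by (simp add: curv_def mdel_def mdelbar_def D.mdl_def D.mdb_def D.del_at D.delbar_at)
        then show ?thesis by (simp add: H.flat_W)
      qed
      then have F: "contr (\<phi> c) (curv (W c t)) k l y vs = contr (rv c t \<phi>) (D.mdb (W c t)) k l y vs"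
        using True by (intro contr_cong_at) (simp_all add: rv_def rs_def)
      have db: "mdelbar (A c t) k l y vs = D.mdb (A c t) k l y vs"
        using True by (simp add: mdelbar_def D.mdb_def D.delbar_at)
      show ?thesis
        using True unfolding restrict_end_def power_minus_one_times_eq_sg B_op_def C_op_def plus_fun_apply sg_apply br F db H.dE_def
        by (simp add: H.cm_def gcomm_eq_sg)
    next
      case False
      have "D.zo (H.dE i (A c t) (rv c t \<phi>) k l)"
        using D.mS_D(2)[OF local_membership(2)[OF GA_dE[OF m]]] by (simp add: D.sm_def)
      then show ?thesis using False by (simp add: restrict_end_def D.zo_def)
    qed
  qed
  have 2: "restrict_tan M (\<lambda>c. vdelbar (\<phi> c)) c d y vs = open_domain.vb (vdom M c) (\<phi> c) d y vs" for c d y vs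
  proof -
    interpret D: open_domain "vdom M c" by (rule VD)
    have "D.zo (D.vb (\<phi> c) d)" by (rule tan_forms_pq(2)[OF tan_vb[OF m(2)]])
    then show ?thesis
      by (cases "y \<in> vdom M c") (simp_all add: restrict_tan_def vdelbar_def D.vb_def D.delbar_at D.zo_def)
  qed
  show ?thesis
    unfolding a TE_diff_hom_def gd_def prod.case fst_conv snd_conv
    by (intro arg_cong2[of _ _ _ _ Pair] ext 1 2)
qed

end

lemma pair_form_sel:
  fixes x y :: "('x, 't, 'n::finite, 'r::finite) pair_form"
  shows "fst (x + y) c t = fst x c t + fst y c t" "snd (x + y) c = snd x c + snd y c"
    "fst (- x) c t = - fst x c t" "snd (- x) c = - snd x c"
    "fst (sg m x) c t = sg m (fst x c t)" "snd (sg m x) c = sg m (snd x c)"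
    "fst (0 :: ('x, 't, 'n, 'r) pair_form) c t = 0" "snd (0 :: ('x, 't, 'n, 'r) pair_form) c = 0"
  by (simp_all add: sg_def)

context higgs_bundle
begin

text \<open>Vector parts are bracketed on whole chart domains, but act on matrices over frame
  domains. Since the bracket is local, it may be computed before or after restriction.\<close>

lemma rv_SN: "rv c t (\<lambda>c. open_domain.SN (vdom M c) (\<phi> c) (\<psi> c)) = open_domain.SN (Dom c t) (rv c t \<phi>) (rv c t \<psi>)"
  unfolding rv_def by (rule ext) (rule rs_SN[OF open_edom open_vdom edom_vdom])

lemma rv_vb: "rv c t (\<lambda>c. open_domain.vb (vdom M c) (\<phi> c)) = open_domain.vb (Dom c t) (rv c t \<phi>)"
  unfolding rv_def open_domain.vb_def[OF VD, abs_def] open_domain.vb_def[OF ED, abs_def]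
  by (simp only: rs_rd[OF open_edom open_vdom edom_vdom])

lemma rv_add: "rv c t (\<phi> + \<psi>) = rv c t \<phi> + rv c t \<psi>"
  by (intro ext) (simp add: rv_def rs_def)

lemma rv_scT: "rv c t (scT r \<phi>) = (\<lambda>a. fm (\<lambda>_. r) (rv c t \<phi> a))"
  by (intro ext) (simp add: rv_def rs_def fm_def scT_def)

lemma gbr_sel:
  "fst (gbr i j a b) c t = LbrE c t i j (fst a c t) (rv c t (snd a)) (fst b c t) (rv c t (snd b))"
  "snd (gbr i j a b) c = open_domain.SN (vdom M c) (snd a c) (snd b c)"
  "rv c t (snd (gbr i j a b)) = open_domain.SN (Dom c t) (rv c t (snd a)) (rv c t (snd b))"
  by (simp_all add: gbr_def rv_SN)

lemma gd_sel:
  "fst (gd i a) c t = LdE c t i (fst a c t) (rv c t (snd a))"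
  "snd (gd i a) c = open_domain.vb (vdom M c) (snd a c)"
  "rv c t (snd (gd i a)) = open_domain.vb (Dom c t) (rv c t (snd a))"
  by (simp_all add: gd_def rv_vb)

lemma PGA_local:
  assumes "a \<in> PGA k"
  shows "fst a c t \<in> open_domain.mOm (Dom c t) k" "fst a c t \<in> open_domain.mS (Dom c t)"
    "rv c t (snd a) \<in> {v. open_domain.vf (Dom c t) k v}" "rv c t (snd a) \<in> open_domain.vV (Dom c t)"
    "snd a c \<in> {v. open_domain.vf (vdom M c) k v}"
proof -
  have m: "fst a \<in> GA k" "snd a \<in> tan_forms M k" using assms by (auto simp: PGA_def)
  show "fst a c t \<in> open_domain.mOm (Dom c t) k" "fst a c t \<in> open_domain.mS (Dom c t)"
    "rv c t (snd a) \<in> {v. open_domain.vf (Dom c t) k v}" "rv c t (snd a) \<in> open_domain.vV (Dom c t)"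
    by (rule local_membership(1,2)[OF m(1)] local_membership(3,4)[OF m(2)])+
  show "snd a c \<in> {v. open_domain.vf (vdom M c) k v}" using tan_forms_pq(3)[OF m(2)] by simp
qed

lemma pair_form_eqI:
  fixes x y :: "('x, 't, 'n, 'r) pair_form"
  assumes "\<And>c t. fst x c t = fst y c t" "\<And>c. snd x c = snd y c"
  shows "x = y"
  using assms by (intro prod_eqI ext) simp_all

lemma tan_calculus:
  "super_calculus (open_domain.mS (vdom M c) :: ('n, 'r) mform set) (open_domain.mOm (vdom M c)) (open_domain.vV (vdom M c))
    (\<lambda>i. {v. open_domain.vf (vdom M c) i v}) mwedge (open_domain.mdl (vdom M c)) (open_domain.mdb (vdom M c)) contr
    (open_domain.vb (vdom M c)) (open_domain.SN (vdom M c))"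
  by (rule open_domain.super_calculus_mform[OF VD])

lemma gbr_antisym:
  assumes "a \<in> PGA i" "b \<in> PGA j"
  shows "gbr i j a b = - sg (i * j) (gbr j i b a)"
proof (rule pair_form_eqI)
  fix c t
  have "super_connection (open_domain.mS (Dom c t) :: ('n, 'r) mform set) (open_domain.mOm (Dom c t)) (open_domain.vV (Dom c t))
    (\<lambda>i. {v. open_domain.vf (Dom c t) i v}) mwedge (open_domain.mdl (Dom c t)) (open_domain.mdb (Dom c t)) contr
    (open_domain.vb (Dom c t)) (open_domain.SN (Dom c t)) (W c t)" by (rule super_higgs.axioms(1)[OF local_higgs])
  from super_connection.brE_antisym[OF this, of i j "fst a c t" "rv c t (snd a)" "fst b c t" "rv c t (snd b)"]
  show "fst (gbr i j a b) c t = fst (- sg (i * j) (gbr j i b a)) c t"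
    by (simp only: pair_form_sel gbr_sel)
next
  fix c
  from super_calculus.SN_antisym[OF tan_calculus PGA_local(5)[OF assms(1)] PGA_local(5)[OF assms(2)]]
  show "snd (gbr i j a b) c = snd (- sg (i * j) (gbr j i b a)) c"
    by (simp only: pair_form_sel gbr_sel)
qed

lemma gbr_Jacobi:
  assumes "a \<in> PGA i" "b \<in> PGA j" "d \<in> PGA k"
  shows "gbr i (j + k) a (gbr j k b d) = gbr (i + j) k (gbr i j a b) d + sg (i * j) (gbr j (i + k) b (gbr i k a d))"
proof (rule pair_form_eqI)
  fix c t
  show "fst (gbr i (j + k) a (gbr j k b d)) c t =
    fst (gbr (i + j) k (gbr i j a b) d + sg (i * j) (gbr j (i + k) b (gbr i k a d))) c t"
    unfolding gbr_sel pair_form_sel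
    by (rule super_connection.brE_Jacobi[OF super_higgs.axioms(1)[OF local_higgs]])
      (rule PGA_local(1,3)[OF assms(1)] PGA_local(1,3)[OF assms(2)] PGA_local(1,3)[OF assms(3)])+
next
  fix c
  show "snd (gbr i (j + k) a (gbr j k b d)) c =
    snd (gbr (i + j) k (gbr i j a b) d + sg (i * j) (gbr j (i + k) b (gbr i k a d))) c"
    unfolding gbr_sel pair_form_sel
    by (rule super_calculus.SN_Jacobi[OF tan_calculus]) (rule PGA_local(5)[OF assms(1)] PGA_local(5)[OF assms(2)] PGA_local(5)[OF assms(3)])+
qed

lemma gd_Leibniz:
  assumes "a \<in> PGA i" "b \<in> PGA j"
  shows "gd (i + j) (gbr i j a b) = gbr (Suc i) j (gd i a) b + sg i (gbr i (Suc j) a (gd j b))"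
proof (rule pair_form_eqI)
  fix c t
  show "fst (gd (i + j) (gbr i j a b)) c t = fst (gbr (Suc i) j (gd i a) b + sg i (gbr i (Suc j) a (gd j b))) c t"
    unfolding gbr_sel gd_sel pair_form_sel
    by (rule super_higgs.dE_Leibniz[OF local_higgs]) (rule PGA_local(1,3)[OF assms(1)] PGA_local(1,3)[OF assms(2)])+
next
  fix c
  show "snd (gd (i + j) (gbr i j a b)) c = snd (gbr (Suc i) j (gd i a) b + sg i (gbr i (Suc j) a (gd j b))) c"
    unfolding gbr_sel gd_sel pair_form_sel
    by (rule super_calculus.SN_vb[OF tan_calculus]) (rule PGA_local(5)[OF assms(1)] PGA_local(5)[OF assms(2)])+
qed

lemma gd_gd:
  assumes "a \<in> PGA i"
  shows "gd (Suc i) (gd i a) = 0"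
proof (rule pair_form_eqI)
  fix c t
  show "fst (gd (Suc i) (gd i a)) c t = fst (0 :: ('x, 't, 'n, 'r) pair_form) c t"
    unfolding gd_sel pair_form_sel by (rule super_higgs.dE_dE[OF local_higgs PGA_local(1,3)[OF assms]])
next
  fix c
  show "snd (gd (Suc i) (gd i a)) c = snd (0 :: ('x, 't, 'n, 'r) pair_form) c"
    unfolding gd_sel pair_form_sel by (rule super_calculus.vb_vb[OF tan_calculus PGA_local(5)[OF assms]])
qed

lemma PGA_smo: "a \<in> PGA k \<Longrightarrow> open_domain.smo (vdom M c) (snd a c e)"
  using PGA_local(5)[of a k c] open_domain.vf_smo[OF VD] by blast

lemma gbr_add:
  assumes "a \<in> PGA i" "a' \<in> PGA i" "b \<in> PGA j"
  shows "gbr i j (a + a') b = gbr i j a b + gbr i j a' b"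
proof (rule pair_form_eqI)
  fix c t
  show "fst (gbr i j (a + a') b) c t = fst (gbr i j a b + gbr i j a' b) c t"
    unfolding gbr_sel pair_form_sel snd_add rv_add
    by (rule super_connection.brE_add[OF super_higgs.axioms(1)[OF local_higgs]])
      (rule PGA_local(2,4)[OF assms(1)] PGA_local(2,4)[OF assms(2)] PGA_local(2,4)[OF assms(3)])+
next
  fix c
  show "snd (gbr i j (a + a') b) c = snd (gbr i j a b + gbr i j a' b) c"
    unfolding gbr_sel pair_form_sel
    by (rule open_domain.SN_add(1)[OF VD]) (rule PGA_smo[OF assms(1)] PGA_smo[OF assms(2)] PGA_smo[OF assms(3)])+
qed

lemma gbr_add_right:
  assumes "a \<in> PGA i" "b \<in> PGA j" "b' \<in> PGA j"
  shows "gbr i j a (b + b') = gbr i j a b + gbr i j a b'"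
proof -
  have bb': "b + b' \<in> PGA j" using assms by (auto simp: PGA_def intro: GA_add tan_add)
  show ?thesis
    unfolding gbr_antisym[OF assms(1) bb'] gbr_antisym[OF assms(1,2)] gbr_antisym[OF assms(1,3)]
      gbr_add[OF assms(2,3,1)] by (simp add: sg_add)
qed

lemma gd_add:
  assumes "a \<in> PGA i" "a' \<in> PGA i"
  shows "gd i (a + a') = gd i a + gd i a'"
proof (rule pair_form_eqI)
  fix c t
  show "fst (gd i (a + a')) c t = fst (gd i a + gd i a') c t"
    unfolding gd_sel pair_form_sel snd_add rv_add
    by (rule super_higgs.dE_add[OF local_higgs]) (rule PGA_local(2,4)[OF assms(1)] PGA_local(2,4)[OF assms(2)])+
next
  fix c
  interpret D: open_domain "vdom M c" by (rule VD)
  show "snd (gd i (a + a')) c = snd (gd i a + gd i a') c"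
    by (intro ext) (simp add: gd_sel D.vb_def D.rd_add PGA_smo[OF assms(1)] PGA_smo[OF assms(2)])
qed

lemma TE_scale_eq: "TE_scale r a = (scE r (fst a), scT r (snd a))"
  by (cases a) (simp add: TE_scale_def scE_def scT_def)

lemma local_scaling:
  "super_scaling (open_domain.mS (Dom c t) :: ('n, 'r) mform set) (open_domain.mOm (Dom c t)) (open_domain.vV (Dom c t))
    (\<lambda>i. {v. open_domain.vf (Dom c t) i v}) mwedge (open_domain.mdl (Dom c t)) (open_domain.mdb (Dom c t)) contr
    (open_domain.vb (Dom c t)) (open_domain.SN (Dom c t)) (W c t) (\<theta> c t)
    (\<lambda>A i j. fm (\<lambda>_. r) (A i j)) (\<lambda>v a. fm (\<lambda>_. r) (v a))"
proof -
  interpret D: open_domain "Dom c t" by (rule ED)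
  interpret H: super_higgs "D.mS :: ('n, 'r) mform set" D.mOm D.vV "\<lambda>i. {v. D.vf i v}" mwedge D.mdl D.mdb contr
    D.vb D.SN "W c t" "\<theta> c t" by (rule local_higgs)
  show ?thesis
  proof
    fix A B :: "('n, 'r) mform" and v :: "'n vform"
    show "(\<lambda>i j. fm (\<lambda>_. r) ((A + B) i j)) = (\<lambda>i j. fm (\<lambda>_. r) (A i j)) + (\<lambda>i j. fm (\<lambda>_. r) (B i j))"
      "(\<lambda>i j. fm (\<lambda>_. r) ((- A) i j)) = - (\<lambda>i j. fm (\<lambda>_. r) (A i j))"
      by (simp_all add: fun_eq_iff fm_def algebra_simps)
    show "mwedge (\<lambda>i j. fm (\<lambda>_. r) (A i j)) B = (\<lambda>i j. fm (\<lambda>_. r) (mwedge A B i j))"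
      "mwedge A (\<lambda>i j. fm (\<lambda>_. r) (B i j)) = (\<lambda>i j. fm (\<lambda>_. r) (mwedge A B i j))"
      by (simp_all add: fun_eq_iff mwedge_def wedge_fm fm_sum)
    show "contr v (\<lambda>i j. fm (\<lambda>_. r) (A i j)) = (\<lambda>i j. fm (\<lambda>_. r) (contr v A i j))"
      "contr (\<lambda>a. fm (\<lambda>_. r) (v a)) A = (\<lambda>i j. fm (\<lambda>_. r) (contr v A i j))"
      by (simp_all add: fun_eq_iff contr_def wedge_fm fm_sum iota_fm)
    assume "A \<in> D.mS"
    then show "D.mdl (\<lambda>i j. fm (\<lambda>_. r) (A i j)) = (\<lambda>i j. fm (\<lambda>_. r) (D.mdl A i j))"
      "D.mdb (\<lambda>i j. fm (\<lambda>_. r) (A i j)) = (\<lambda>i j. fm (\<lambda>_. r) (D.mdb A i j))"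
      by (simp_all add: fun_eq_iff D.mdl_def D.mdb_def D.rd_const_fm D.mS_D)
  qed
qed

lemma scE_local: "scE r A c t = (\<lambda>i j. fm (\<lambda>_. r) (A c t i j))" and scT_local: "scT r \<phi> c = (\<lambda>a. fm (\<lambda>_. r) (\<phi> c a))"
  by (simp_all add: fun_eq_iff scE_def scT_def fm_def)

lemma gbr_scale:
  assumes "a \<in> PGA i" "b \<in> PGA j"
  shows "gbr i j (TE_scale r a) b = TE_scale r (gbr i j a b)" "gbr i j a (TE_scale r b) = TE_scale r (gbr i j a b)"
proof -
  note sc = super_scaling.brE_scale[OF local_scaling PGA_local(4)[OF assms(1)] PGA_local(4)[OF assms(2)] PGA_local(2)[OF assms(1)] PGA_local(2)[OF assms(2)]]
  note sn = open_domain.SN_const_fm[OF VD PGA_smo[OF assms(1)] PGA_smo[OF assms(2)]]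
  show "gbr i j (TE_scale r a) b = TE_scale r (gbr i j a b)"
    by (rule pair_form_eqI; simp only: TE_scale_eq fst_conv snd_conv scE_local scT_local gbr_sel rv_scT sc) (intro ext; simp only: sn)
  show "gbr i j a (TE_scale r b) = TE_scale r (gbr i j a b)"
    by (rule pair_form_eqI; simp only: TE_scale_eq fst_conv snd_conv scE_local scT_local gbr_sel rv_scT sc) (intro ext; simp only: sn)
qed

lemma gd_scale:
  assumes "a \<in> PGA i"
  shows "gd i (TE_scale r a) = TE_scale r (gd i a)"
proof (rule pair_form_eqI)
  fix c t
  show "fst (gd i (TE_scale r a)) c t = fst (TE_scale r (gd i a)) c t"
    by (simp only: TE_scale_eq fst_conv snd_conv scE_local gd_sel rv_scT
        super_scaling.dE_scale[OF local_scaling PGA_local(4)[OF assms] PGA_local(2)[OF assms]])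
next
  fix c
  interpret D: open_domain "vdom M c" by (rule VD)
  show "snd (gd i (TE_scale r a)) c = snd (TE_scale r (gd i a)) c"
    by (intro ext) (simp add: TE_scale_eq scT_local gd_sel D.vb_def D.rd_const_fm PGA_smo[OF assms])
qed

end

section \<open>From homogeneous elements to the direct sum\<close>

lemma TE_scale_sel: "fst (TE_scale r a) c t i j y vs = r * fst a c t i j y vs" "snd (TE_scale r a) c e y vs = r * snd a c e y vs"
  by (cases a; simp add: TE_scale_def)+

lemma vector_space_TE_scale: "vector_space (TE_scale :: complex \<Rightarrow> ('x, 't, 'n::finite, 'r::finite) pair_form \<Rightarrow> _)"
  by unfold_locales (simp_all add: prod_eq_iff fun_eq_iff TE_scale_sel algebra_simps)

lemma TE_scale_power_int: "TE_scale ((- 1) powi int m) x = sg m x"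
  for x :: "('x, 't, 'n::finite, 'r::finite) pair_form"
  by (cases "even m") (simp_all add: sg_def prod_eq_iff fun_eq_iff TE_scale_sel)

lemma degree_part_linear:
  fixes a b :: "('x, 't, 'n::finite, 'r::finite) pair_form"
  shows "degree_part k (a + b) = degree_part k a + degree_part k b"
    "degree_part k (TE_scale r a) = TE_scale r (degree_part k a)"
    "degree_part k (0 :: ('x, 't, 'n, 'r) pair_form) = 0"
  by (simp_all add: prod_eq_iff fun_eq_iff TE_scale_sel degree_part_def case_prod_beta)

lemma degree_part_sum:
  "degree_part k (\<Sum>i\<in>I. f i) = (\<Sum>i\<in>I. degree_part k (f i :: ('x, 't, 'n::finite, 'r::finite) pair_form))"
  using sum_comp_morphism[of "degree_part k" f I, OF degree_part_linear(3,1)] by (simp add: o_def)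

context higgs_bundle
begin

lemma PGA_closed:
  "0 \<in> PGA k" "a \<in> PGA k \<Longrightarrow> b \<in> PGA k \<Longrightarrow> a + b \<in> PGA k" "a \<in> PGA k \<Longrightarrow> TE_scale r a \<in> PGA k"
  by (auto simp: PGA_def TE_scale_eq zero_prod_def GA_0 tan_0 GA_scale tan_scale intro: GA_add tan_add)

lemma TE_space_nat: "TE_space M E (int m) = PGA m"
  unfolding TE_space_def PGA_def GA_def by auto

lemma TE_space_cases:
  assumes "a \<in> TE_space M E i"
  obtains "a = 0" | m where "i = int m" "a \<in> PGA m"
proof (cases "i < 0")
  case True
  then show ?thesis using assms that(1) by (simp add: TE_space_def)
next
  case False
  then have "i = int (nat i)" by simp
  then show ?thesis using assms that(2) TE_space_nat by metis
qed

lemma TE_space_closed: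
  "0 \<in> TE_space M E i" "a \<in> TE_space M E i \<Longrightarrow> b \<in> TE_space M E i \<Longrightarrow> a + b \<in> TE_space M E i"
  "a \<in> TE_space M E i \<Longrightarrow> TE_scale r a \<in> TE_space M E i"
proof -
  interpret V: vector_space "TE_scale :: complex \<Rightarrow> ('x, 't, 'n, 'r) pair_form \<Rightarrow> _" by (rule vector_space_TE_scale)
  have "TE_space M E i = (if i < 0 then {0} else PGA (nat i))"
    by (simp add: TE_space_nat[symmetric]) (simp add: TE_space_def)
  then show "0 \<in> TE_space M E i" "a \<in> TE_space M E i \<Longrightarrow> b \<in> TE_space M E i \<Longrightarrow> a + b \<in> TE_space M E i"
    "a \<in> TE_space M E i \<Longrightarrow> TE_scale r a \<in> TE_space M E i"
    by (auto simp: PGA_closed)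
qed

text \<open>A form of degree \<open>m\<close> vanishes on lists of any other length, so selecting by
  length is the projection onto a homogeneous component.\<close>

lemma degree_part_PGA:
  assumes "a \<in> PGA m"
  shows "degree_part k a = (if k = m then a else 0)"
proof -
  have m: "fst a \<in> GA m" "snd a \<in> tan_forms M m" using assms by (auto simp: PGA_def)
  have "fst a c t i j y vs = 0" if "length vs \<noteq> m" for c t i j y vs
    using GA_local(2)[OF m(1), of c t i j] that by (simp add: deg_def)
  moreover have "snd a c e y vs = 0" if "length vs \<noteq> m" for c e y vs
    using open_domain.pq_smo(2)[OF VD tan_forms_pq(1,2)[OF m(2)], of c e] that by (simp add: deg_def)
  ultimately show ?thesis
    by (auto simp: prod_eq_iff fun_eq_iff degree_part_def case_prod_beta)
qed

lemma PGA_large: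
  assumes "a \<in> PGA m" "m > 2 * CARD('n)"
  shows "a = 0"
proof -
  have m: "fst a \<in> GA m" "snd a \<in> tan_forms M m" using assms by (auto simp: PGA_def)
  have "snd a c e = 0" for c e
    by (rule open_domain.pq_large[OF VD tan_forms_pq(1,2)[OF m(2)]]) (use assms in simp)
  then show ?thesis using GA_local(3)[OF m(1) assms(2)] by (simp add: prod_eq_iff fun_eq_iff)
qed

lemma TE_bracket_0: "TE_bracket M E W 0 b = 0" "TE_bracket M E W a 0 = 0"
  by (simp_all add: TE_bracket_def degree_part_linear TE_bracket_hom_0)

lemma TE_diff_0: "TE_diff M E W \<theta> 0 = 0"
  by (simp add: TE_diff_def degree_part_linear TE_diff_hom_0)

text \<open>Up to degree \<open>2 * CARD('n)\<close> exactly one summand of the double sum survives;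
  beyond it one of the arguments is itself zero by \<open>PGA_large\<close>.\<close>

lemma TE_bracket_eq:
  assumes "a \<in> PGA m" "b \<in> PGA n"
  shows "TE_bracket M E W a b = gbr m n a b"
proof (cases "m \<le> 2 * CARD('n) \<and> n \<le> 2 * CARD('n)")
  case True
  have "TE_bracket_hom M E W i j (degree_part i a) (degree_part j b) = (if j = n then if i = m then gbr m n a b else 0 else 0)" for i j
    by (simp add: degree_part_PGA[OF assms(1)] degree_part_PGA[OF assms(2)] TE_bracket_hom_0 TE_bracket_hom_eq[OF assms])
  then show ?thesis using True by (simp add: TE_bracket_def)
next
  case False
  then have "a = 0 \<or> b = 0" using PGA_large assms by (meson not_le)
  then show ?thesis
    unfolding TE_bracket_hom_eq[OF assms, symmetric] by (auto simp: TE_bracket_0 TE_bracket_hom_0)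
qed

lemma TE_diff_eq:
  assumes "a \<in> PGA m"
  shows "TE_diff M E W \<theta> a = gd m a"
proof (cases "m \<le> 2 * CARD('n)")
  case True
  have "TE_diff_hom M E W \<theta> i (degree_part i a) = (if i = m then gd m a else 0)" for i
    by (simp add: degree_part_PGA[OF assms] TE_diff_hom_0 TE_diff_hom_eq[OF assms])
  then show ?thesis using True by (simp add: TE_diff_def)
next
  case False
  then have "a = 0" using PGA_large[OF assms] by simp
  then show ?thesis
    unfolding TE_diff_hom_eq[OF assms, symmetric] by (simp add: TE_diff_0 TE_diff_hom_0)
qed

text \<open>Bilinearity is required on the span, whose elements are not homogeneous. This subspace
  contains the span and makes every projection available, which spares decomposing an element into a
  finite sum.\<close>

definition GS :: "('x, 't, 'n, 'r) pair_form set" where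
  "GS = {a. \<forall>k. degree_part k a \<in> PGA k}"

lemma span_GS: "module.span TE_scale (\<Union>i. TE_space M E i) \<subseteq> GS"
proof -
  interpret V: vector_space "TE_scale :: complex \<Rightarrow> ('x, 't, 'n, 'r) pair_form \<Rightarrow> _" by (rule vector_space_TE_scale)
  show ?thesis
  proof (rule V.span_minimal)
    show "(\<Union>i. TE_space M E i) \<subseteq> GS"
      by (auto simp: GS_def degree_part_PGA PGA_closed degree_part_linear elim!: TE_space_cases)
    show "V.subspace GS"
      unfolding GS_def by (rule V.subspaceI) (simp_all only: mem_Collect_eq degree_part_linear PGA_closed simp_thms)
  qed
qed

lemma TE_bracket_linear:
  assumes "a \<in> GS" "b \<in> GS" "c \<in> GS"
  shows "TE_bracket M E W (a + b) c = TE_bracket M E W a c + TE_bracket M E W b c"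
    "TE_bracket M E W a (b + c) = TE_bracket M E W a b + TE_bracket M E W a c"
    "TE_bracket M E W (TE_scale r a) b = TE_scale r (TE_bracket M E W a b)"
    "TE_bracket M E W a (TE_scale r b) = TE_scale r (TE_bracket M E W a b)"
proof -
  interpret V: vector_space "TE_scale :: complex \<Rightarrow> ('x, 't, 'n, 'r) pair_form \<Rightarrow> _" by (rule vector_space_TE_scale)
  have dp: "degree_part k a \<in> PGA k" "degree_part k b \<in> PGA k" "degree_part k c \<in> PGA k" for k
    using assms by (auto simp: GS_def)
  show "TE_bracket M E W (a + b) c = TE_bracket M E W a c + TE_bracket M E W b c"
    "TE_bracket M E W a (b + c) = TE_bracket M E W a b + TE_bracket M E W a c"
    "TE_bracket M E W (TE_scale r a) b = TE_scale r (TE_bracket M E W a b)"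
    "TE_bracket M E W a (TE_scale r b) = TE_scale r (TE_bracket M E W a b)"
    by (simp_all add: TE_bracket_def degree_part_linear TE_bracket_hom_eq PGA_closed dp gbr_add gbr_add_right gbr_scale
        sum.distrib V.scale_sum_right)
qed

lemma TE_diff_linear:
  assumes "a \<in> GS" "b \<in> GS"
  shows "TE_diff M E W \<theta> (a + b) = TE_diff M E W \<theta> a + TE_diff M E W \<theta> b"
    "TE_diff M E W \<theta> (TE_scale r a) = TE_scale r (TE_diff M E W \<theta> a)"
proof -
  interpret V: vector_space "TE_scale :: complex \<Rightarrow> ('x, 't, 'n, 'r) pair_form \<Rightarrow> _" by (rule vector_space_TE_scale)
  have dp: "degree_part k a \<in> PGA k" "degree_part k b \<in> PGA k" for k
    using assms by (auto simp: GS_def)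
  show "TE_diff M E W \<theta> (a + b) = TE_diff M E W \<theta> a + TE_diff M E W \<theta> b"
    "TE_diff M E W \<theta> (TE_scale r a) = TE_scale r (TE_diff M E W \<theta> a)"
    by (simp_all add: TE_diff_def degree_part_linear TE_diff_hom_eq PGA_closed dp gd_add gd_scale
        sum.distrib V.scale_sum_right)
qed

lemma dg_lie_algebra_TE: "dg_lie_algebra TE_scale (TE_space M E) (TE_bracket M E W) (TE_diff M E W \<theta>)"
proof -
  interpret V: vector_space "TE_scale :: complex \<Rightarrow> ('x, 't, 'n, 'r) pair_form \<Rightarrow> _" by (rule vector_space_TE_scale)
  note z = TE_bracket_0 TE_diff_0
  note powi = TE_scale_power_int TE_scale_power_int[of "_ * _", unfolded of_nat_mult]
  have br: "TE_bracket M E W a b \<in> TE_space M E (i + j)" if "a \<in> TE_space M E i" "b \<in> TE_space M E j" for a b i j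
    \<comment> \<open>In negative degrees only zero occurs, so either an argument vanishes or the
      degree is a natural number.\<close>
    using that(1)
  proof (cases rule: TE_space_cases)
    case a: (2 m)
    show ?thesis using that(2)
    proof (cases rule: TE_space_cases)
      case b: (2 n)
      show ?thesis
        using PGA_gbr[OF a(2) b(2)] TE_space_nat[of "m + n"] by (simp add: a(1) b(1) TE_bracket_eq[OF a(2) b(2)])
    qed (simp add: z TE_space_closed)
  qed (simp add: z TE_space_closed)
  have d: "TE_diff M E W \<theta> a \<in> TE_space M E (i + 1)" if "a \<in> TE_space M E i" for a i
    using that
  proof (cases rule: TE_space_cases)
    case a: (2 m)
    show ?thesis
      using PGA_gd[OF a(2)] TE_space_nat[of "Suc m"] by (simp add: a(1) TE_diff_eq[OF a(2)] add.commute)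
  qed (simp add: z TE_space_closed)
  show ?thesis
  proof
    show "V.subspace (TE_space M E i)" for i
      by (intro V.subspaceI) (simp_all add: TE_space_closed)
  next
    fix I :: "int set" and x i
    assume h: "finite I" "\<And>i. i \<in> I \<Longrightarrow> x i \<in> TE_space M E i" "(\<Sum>i\<in>I. x i) = 0" "i \<in> I"
    from h(2)[OF h(4)] show "x i = 0"
    proof (cases rule: TE_space_cases)
      case i: (2 m)
      \<comment> \<open>The projection onto degree \<open>m\<close> isolates the summand
        \<open>x i\<close>, which gives directness of the sum.\<close>
      have "degree_part m (x j) = (if j = i then x i else 0)" if "j \<in> I" for j
        using h(2)[OF that]
      proof (cases rule: TE_space_cases)
        case 1
        then show ?thesis using i by (auto simp: degree_part_linear)
      next
        case (2 n)
        then show ?thesis using i by (auto simp: degree_part_PGA)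
      qed
      then have "(\<Sum>j\<in>I. degree_part m (x j)) = (\<Sum>j\<in>I. if j = i then x i else 0)" by (intro sum.cong refl)
      moreover have "(\<Sum>j\<in>I. degree_part m (x j)) = 0"
        using h(3) by (simp add: degree_part_sum[symmetric] degree_part_linear)
      ultimately show ?thesis using h(1,4) by simp
    qed
  next
    fix a b c :: "('x, 't, 'n, 'r) pair_form" and r
    assume "a \<in> V.span (\<Union>i. TE_space M E i)" "b \<in> V.span (\<Union>i. TE_space M E i)"
    then have ab: "a \<in> GS" "b \<in> GS" using span_GS by auto
    show "TE_bracket M E W (TE_scale r a) b = TE_scale r (TE_bracket M E W a b)"
      "TE_bracket M E W a (TE_scale r b) = TE_scale r (TE_bracket M E W a b)"
      "TE_diff M E W \<theta> (a + b) = TE_diff M E W \<theta> a + TE_diff M E W \<theta> b"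
      by (rule TE_bracket_linear[OF ab ab(1)] TE_diff_linear[OF ab])+
    assume "c \<in> V.span (\<Union>i. TE_space M E i)"
    then have c: "c \<in> GS" using span_GS by auto
    show "TE_bracket M E W (a + b) c = TE_bracket M E W a c + TE_bracket M E W b c"
      "TE_bracket M E W a (b + c) = TE_bracket M E W a b + TE_bracket M E W a c"
      by (rule TE_bracket_linear[OF ab c])+
  next
    fix a :: "('x, 't, 'n, 'r) pair_form" and r
    assume "a \<in> V.span (\<Union>i. TE_space M E i)"
    then have "a \<in> GS" using span_GS by auto
    then show "TE_diff M E W \<theta> (TE_scale r a) = TE_scale r (TE_diff M E W \<theta> a)"
      by (intro TE_diff_linear)
  next
    fix a i assume a: "a \<in> TE_space M E i"
    show "TE_diff M E W \<theta> a \<in> TE_space M E (i + 1)" by (rule d[OF a])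
    from a show "TE_diff M E W \<theta> (TE_diff M E W \<theta> a) = 0"
    proof (cases rule: TE_space_cases)
      case (2 m)
      then show ?thesis by (simp add: TE_diff_eq[OF 2(2)] TE_diff_eq[OF PGA_gd[OF 2(2)]] gd_gd)
    qed (simp add: z)
    fix b j assume b: "b \<in> TE_space M E j"
    show "TE_bracket M E W a b \<in> TE_space M E (i + j)" by (rule br[OF a b])
    show "TE_bracket M E W a b + TE_scale ((- 1) powi (i * j)) (TE_bracket M E W b a) = 0"
      using a
    proof (cases rule: TE_space_cases)
      case a: (2 m)
      show ?thesis using b
      proof (cases rule: TE_space_cases)
        case b: (2 n)
        show ?thesis
          unfolding a(1) b(1) powi TE_bracket_eq[OF a(2) b(2)] TE_bracket_eq[OF b(2) a(2)]
          using gbr_antisym[OF a(2) b(2)] by simp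
      qed (simp add: z)
    qed (simp add: z)
    show "TE_diff M E W \<theta> (TE_bracket M E W a b) =
      TE_bracket M E W (TE_diff M E W \<theta> a) b + TE_scale ((- 1) powi i) (TE_bracket M E W a (TE_diff M E W \<theta> b))"
      using a
    proof (cases rule: TE_space_cases)
      case a: (2 m)
      show ?thesis using b
      proof (cases rule: TE_space_cases)
        case b: (2 n)
        show ?thesis
          unfolding a(1) powi TE_bracket_eq[OF a(2) b(2)] TE_diff_eq[OF a(2)] TE_diff_eq[OF b(2)]
            TE_bracket_eq[OF PGA_gd[OF a(2)] b(2)] TE_bracket_eq[OF a(2) PGA_gd[OF b(2)]] TE_diff_eq[OF PGA_gbr[OF a(2) b(2)]]
          by (rule gd_Leibniz[OF a(2) b(2)])
      qed (simp add: z)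
    qed (simp add: z)
    fix c k assume c: "c \<in> TE_space M E k"
    show "TE_bracket M E W a (TE_bracket M E W b c) =
      TE_bracket M E W (TE_bracket M E W a b) c + TE_scale ((- 1) powi (i * j)) (TE_bracket M E W b (TE_bracket M E W a c))"
      using a
    proof (cases rule: TE_space_cases)
      case a: (2 m)
      show ?thesis using b
      proof (cases rule: TE_space_cases)
        case b: (2 n)
        show ?thesis using c
        proof (cases rule: TE_space_cases)
          case c: (2 l)
          show ?thesis
            unfolding a(1) b(1) powi TE_bracket_eq[OF a(2) b(2)] TE_bracket_eq[OF b(2) c(2)] TE_bracket_eq[OF a(2) c(2)]
              TE_bracket_eq[OF a(2) PGA_gbr[OF b(2) c(2)]] TE_bracket_eq[OF b(2) PGA_gbr[OF a(2) c(2)]]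
              TE_bracket_eq[OF PGA_gbr[OF a(2) b(2)] c(2)]
            by (rule gbr_Jacobi[OF a(2) b(2) c(2)])
        qed (simp add: z)
      qed (simp add: z)
    qed (simp add: z)
  qed
qed

end

theorem theorem1p1:
  fixes M :: "('x, 'n::finite) cmanifold"
    and E :: "('x, 't, 'r::finite) vbundle"
    and \<theta> W :: "('x, 't, 'n, 'r) end_form"
    and K :: "'t \<Rightarrow> 'x \<Rightarrow> complex^'r^'r"
  assumes "holomorphic_higgs_pair M E \<theta>"
    and "hermitian_metric M E K"
    and "chern_connection M E K W"
  shows "dg_lie_algebra TE_scale (TE_space M E) (TE_bracket M E W) (TE_diff M E W \<theta>)"
proof -
  interpret higgs_bundle M E \<theta> W K
    using assms by unfold_locales (simp_all add: holomorphic_higgs_pair_def)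
  show ?thesis by (rule dg_lie_algebra_TE)
qed

end
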